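(* Let $\mathcal X\subset\mathbf R^n$ be a basic spectratope, let the unit ball $\mathcal B_*$ of the norm conjugate to $\|\cdot\|$ be a spectratope, and let $\mathcal Q$ be a nonempty convex compact set of positive definite $m\times m$ matrices (data and notation as in the context). Consider the convex optimization problem $$ \mathrm{Opt}=\min_{H,\Lambda,\Upsilon,\Upsilon',\Theta}\Big\{\phi_{\mathcal T}(\lambda[\Lambda])+\phi_{\mathcal R}(\lambda[\Upsilon])+\phi_{\mathcal R}(\lambda[\Upsilon'])+\Gamma(\Theta)\Big\} $$ over $H\in\mathbf R^{m\times\nu}$, $\Lambda=\{\Lambda_k\in\mathbf S^{d_k}_+\}_{k\le K}$, $\Upsilon=\{\Upsilon_\ell\in\mathbf S^{f_\ell}_+\}_{\ell\le L}$, $\Upsilon'=\{\Upsilon'_\ell\in\mathbf S^{f_\ell}_+\}_{\ell\le L}$, $\Theta\in\mathbf S^m$ subject to $$ \begin{bmatrix}\sum_k\mathcal R_k^*[\Lambda_k]&\tfrac12[B^T-A^TH]M\\ \tfrac12M^T[B-H^TA]&\sum_\ell\mathcal S_\ell^*[\Upsilon_\ell]\end{bmatrix}\succeq0,\qquad \begin{bmatrix}\Theta&\tfrac12HM\\ \tfrac12M^TH^T&\sum_\ell\mathcal S_\ell^*[\Upsilon'_\ell]\end{bmatrix}\succeq0 . $$ Let $H_*$ be the $H$-component of an optimal solution to this problem, and let $\widehat x_{H_*}(\omega)=H_*^T\omega$. Then $$ \mathrm{Risk}_{\mathcal Q,\|\cdot\|}[\widehat x_{H_*}|\mathcal X]\le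 \mathrm{Opt}\le 64\sqrt{(2\ln F+10\ln 2)(2\ln D+10\ln 2)}\;\mathrm{RiskOpt}_{\mathcal Q,\|\cdot\|}[\mathcal X], $$ where $D=\sum_{k}d_k$ and $F=\sum_\ell f_\ell$.
   Context: $\mathbf S^k$ is the space of symmetric $k\times k$ matrices, $\mathbf S^k_+$ the cone of positive semidefinite ones; $U\succeq V$ means $U-V$ is positive semidefinite. A monotonic set in $\mathbf R^K$ is a convex compact set $\mathcal T\subset\mathbf R^K_+$ which contains a vector with all entries positive and satisfies: $0\le t'\le t\in\mathcal T$ (entrywise) implies $t'\in\mathcal T$. Signal set: $\mathcal X=\{x\in\mathbf R^n:\exists t\in\mathcal T: R_k^2[x]\preceq t_kI_{d_k},\,1\le k\le K\}$ is a basic spectratope: $R_k[x]=\sum_{i=1}^n x_iR^{ki}$ with $R^{ki}\in\mathbf S^{d_k}$, $\mathcal T\subset\mathbf R^K_+$ is monotonic, and for every $x\ne0$ one has $R_k[x]\neq0$ for some $k$. Norm: $\|\cdot\|$ is a norm on $\mathbf R^\nu$ such that the unit ball $\mathcal B_*$ of the conjugate norm $\|z\|_*=\max\{z^Tu:\|u\|\le1\}$ is a spectratope: $\mathcal B_*=\{z\in\mathbf R^\nu:\exists y\in\mathcal Y: z=My\}$, $\mathcal Y=\{y\in\mathbf R^q:\exists r\in\mathcal R: S_\ell^2[y]\preceq r_\ell I_{f_\ell},1\le\ell\le L\}$, where $M\in\mathbf R^{\nu\times q}$, $S_\ell[y]=\sum_{i=1}^q y_iS^{\ell i}$ with $S^{\ell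 i}\in\mathbf S^{f_\ell}$, $\mathcal R\subset\mathbf R^L_+$ is monotonic, and for every $y\neq0$ one has $S_\ell[y]\ne0$ for some $\ell$. Mappings: $[\mathcal R_k^*[\Lambda_k]]_{ij}=\frac12\mathrm{Tr}(\Lambda_k[R^{ki}R^{kj}+R^{kj}R^{ki}])$, $1\le i,j\le n$; $[\mathcal S_\ell^*[\Upsilon_\ell]]_{ij}=\frac12\mathrm{Tr}(\Upsilon_\ell[S^{\ell i}S^{\ell j}+S^{\ell j}S^{\ell i}])$, $1\le i,j\le q$; $\lambda[\{\Xi_1,\dots,\Xi_N\}]=[\mathrm{Tr}(\Xi_1);\dots;\mathrm{Tr}(\Xi_N)]$; $\phi_{\mathcal T}(g)=\max_{t\in\mathcal T}g^Tt$, $\phi_{\mathcal R}(g)=\max_{r\in\mathcal R}g^Tr$; $\Gamma(\Theta)=\max_{Q\in\mathcal Q}\mathrm{Tr}(Q\Theta)$. Estimation problem: $A\in\mathbf R^{m\times n}$ and $B\in\mathbf R^{\nu\times n}$ are given; the goal is to recover $Bx$, $x\in\mathcal X$, from $\omega=Ax+\xi$. For a Borel probability distribution $P$ on $\mathbf R^m$ put $\mathrm{Cov}[P]=\mathbf E_{\xi\sim P}\{\xi\xi^T\}$ (non-centered), and write $P\preccurlyeq\mathcal Q$ if $\mathrm{Cov}[P]\preceq Q$ for some $Q\in\mathcal Q$. An estimate is a Borel function $\widehat x:\mathbf R^m\to\mathbf R^\nu$, its risk is $$\mathrm{Risk}_{\mathcal Q,\|\cdot\|}[\widehat x|\mathcal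 X]=\sup_{x\in\mathcal X,\,P\preccurlyeq\mathcal Q}\mathbf E_{\xi\sim P}\{\|\widehat x(Ax+\xi)-Bx\|\}.$$ The Gaussian minimax risk is $$\mathrm{RiskOpt}_{\mathcal Q,\|\cdot\|}[\mathcal X]=\sup_{Q\in\mathcal Q}\inf_{\widehat x(\cdot)}\sup_{x\in\mathcal X}\mathbf E_{\xi\sim\mathcal N(0,Q)}\{\|Bx-\widehat x(Ax+\xi)\|\},$$ the infimum being over all estimates. *)

theory Defs
  imports "HOL-Probability.Probability" "Jordan_Normal_Form.Matrix"
begin

no_notation Matrix.scalar_prod (infix \<open>\<bullet>\<close> 70)
no_notation Matrix.vec_index (infixl \<open>$\<close> 100)

text \<open>
  The spaces of fixed dimension (where x, y, u, \<open>\<omega>\<close> and the vectors t, r live) are rendered as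
  \<open>real ^ 'n\<close>, and \<open>real ^ 'c ^ 'r\<close> is the space of matrices with rows indexed by \<open>'r\<close> and
  columns indexed by \<open>'c\<close>. The blocks of a spectratope have sizes \<open>d k\<close>, \<open>f l\<close> that vary
  with the block index, so they are matrices of type \<^typ>\<open>real mat\<close> with explicit carriers.
\<close>

section \<open>Symmetric and positive semidefinite matrices\<close>

definition psd :: "real ^ 'n ^ 'n \<Rightarrow> bool" where
  "psd A \<longleftrightarrow> transpose A = A \<and> (\<forall>x. 0 \<le> x \<bullet> (A *v x))"

definition pos_def :: "real ^ 'n ^ 'n \<Rightarrow> bool" where
  "pos_def A \<longleftrightarrow> transpose A = A \<and> (\<forall>x. x \<noteq> 0 \<longrightarrow> 0 < x \<bullet> (A *v x))"

definition block_matrix ::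
  "real ^ 'a ^ 'a \<Rightarrow> real ^ 'b ^ 'a \<Rightarrow> real ^ 'a ^ 'b \<Rightarrow> real ^ 'b ^ 'b \<Rightarrow>
   real ^ ('a + 'b) ^ ('a + 'b)" where
  "block_matrix P Q R S =
     (\<chi> i j. case i of
        Inl a \<Rightarrow> (case j of Inl a' \<Rightarrow> P $ a $ a' | Inr b \<Rightarrow> Q $ a $ b)
      | Inr b \<Rightarrow> (case j of Inl a \<Rightarrow> R $ b $ a | Inr b' \<Rightarrow> S $ b $ b'))"

definition sym_mat :: "nat \<Rightarrow> real mat \<Rightarrow> bool" where
  "sym_mat d X \<longleftrightarrow> X \<in> carrier_mat d d \<and> transpose_mat X = X"

definition psd_mat :: "nat \<Rightarrow> real mat \<Rightarrow> bool" where
  "psd_mat d X \<longleftrightarrow> sym_mat d X \<and> (\<forall>v \<in> carrier_vec d. 0 \<le> scalar_prod v (X *\<^sub>v v))"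

definition trace_mat :: "real mat \<Rightarrow> real" where
  "trace_mat X = (\<Sum>a < dim_row X. X $$ (a, a))"


section \<open>Spectratopes\<close>

definition monotonic_set :: "(real ^ 'k) set \<Rightarrow> bool" where
  "monotonic_set T \<longleftrightarrow>
     convex T \<and> compact T \<and> (\<forall>t \<in> T. \<forall>k. 0 \<le> t $ k) \<and>
     (\<exists>t \<in> T. \<forall>k. 0 < t $ k) \<and>
     (\<forall>t \<in> T. \<forall>t'. (\<forall>k. 0 \<le> t' $ k \<and> t' $ k \<le> t $ k) \<longrightarrow> t' \<in> T)"

text \<open>\<open>lin_mat d R x\<close> is the d by d matrix \<open>\<Sum>i. x\<^sub>i R\<^sup>i\<close>, written entrywise because
  \<^typ>\<open>real mat\<close> has no global zero matrix.\<close>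

definition lin_mat :: "nat \<Rightarrow> ('n::finite \<Rightarrow> real mat) \<Rightarrow> real ^ 'n \<Rightarrow> real mat" where
  "lin_mat d R x = Matrix.mat d d (\<lambda>(a, b). \<Sum>i \<in> UNIV. x $ i * R i $$ (a, b))"

definition spectratope_data ::
  "('k::finite \<Rightarrow> nat) \<Rightarrow> ('k \<Rightarrow> 'n::finite \<Rightarrow> real mat) \<Rightarrow> (real ^ 'k) set \<Rightarrow> bool" where
  "spectratope_data d R T \<longleftrightarrow>
     (\<forall>k. 1 \<le> d k) \<and> (\<forall>k i. sym_mat (d k) (R k i)) \<and> monotonic_set T \<and>
     (\<forall>x. x \<noteq> 0 \<longrightarrow> (\<exists>k. lin_mat (d k) (R k) x \<noteq> 0\<^sub>m (d k) (d k)))"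

definition basic_spectratope ::
  "('k::finite \<Rightarrow> nat) \<Rightarrow> ('k \<Rightarrow> 'n::finite \<Rightarrow> real mat) \<Rightarrow> (real ^ 'k) set \<Rightarrow> (real ^ 'n) set" where
  "basic_spectratope d R T =
     {x. \<exists>t \<in> T. \<forall>k. psd_mat (d k)
        ((t $ k) \<cdot>\<^sub>m 1\<^sub>m (d k) - lin_mat (d k) (R k) x * lin_mat (d k) (R k) x)}"

definition adj_map :: "('n::finite \<Rightarrow> real mat) \<Rightarrow> real mat \<Rightarrow> real ^ 'n ^ 'n" where
  "adj_map R L = (\<chi> i j. 1/2 * trace_mat (L * (R i * R j + R j * R i)))"

definition trace_vec :: "('k::finite \<Rightarrow> real mat) \<Rightarrow> real ^ 'k" where
  "trace_vec L = (\<chi> k. trace_mat (L k))"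

text \<open>In the following three definitions the supremum is a maximum: the sets T and Q are nonempty
  and compact, and so is the unit ball of a norm.\<close>

definition supp_fun :: "(real ^ 'k) set \<Rightarrow> real ^ 'k \<Rightarrow> real" where
  "supp_fun T g = (SUP t \<in> T. g \<bullet> t)"

definition Gam :: "(real ^ 'm ^ 'm) set \<Rightarrow> real ^ 'm ^ 'm \<Rightarrow> real" where
  "Gam Q Th = (SUP X \<in> Q. trace (X ** Th))"

definition conj_norm :: "(real ^ 'v \<Rightarrow> real) \<Rightarrow> real ^ 'v \<Rightarrow> real" where
  "conj_norm N z = (SUP u \<in> {u. N u \<le> 1}. z \<bullet> u)"

definition is_norm :: "(real ^ 'v \<Rightarrow> real) \<Rightarrow> bool" where
  "is_norm N \<longleftrightarrow>
     (\<forall>u. 0 \<le> N u) \<and> (\<forall>u. N u = 0 \<longleftrightarrow> u = 0) \<and>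
     (\<forall>c u. N (c *\<^sub>R u) = \<bar>c\<bar> * N u) \<and> (\<forall>u w. N (u + w) \<le> N u + N w)"


section \<open>Risks\<close>

definition Cov :: "(real ^ 'm) measure \<Rightarrow> real ^ 'm ^ 'm" where
  "Cov P = (\<integral>\<xi>. (\<chi> i j. \<xi> $ i * \<xi> $ j) \<partial>P)"

text \<open>Integrability is required explicitly: the Bochner integral of a non-integrable function is 0
  by convention, whereas \<open>Cov P\<close> bounded by Q entails that the second moments are finite.\<close>

definition cov_dominated :: "(real ^ 'm) measure \<Rightarrow> (real ^ 'm ^ 'm) set \<Rightarrow> bool" where
  "cov_dominated P Q \<longleftrightarrow>
     prob_space P \<and> sets P = sets borel \<and>
     integrable P (\<lambda>\<xi>. (\<chi> i j. \<xi> $ i * \<xi> $ j) :: real ^ 'm ^ 'm) \<and>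
     (\<exists>X \<in> Q. psd (X - Cov P))"

text \<open>The normal distribution with zero mean and positive definite covariance matrix \<open>Q\<close>.\<close>

definition gaussian :: "real ^ 'm ^ 'm \<Rightarrow> (real ^ 'm) measure" where
  "gaussian Q = density lborel (\<lambda>\<xi>. ennreal
     (exp (- (\<xi> \<bullet> (matrix_inv Q *v \<xi>)) / 2) / sqrt ((2 * pi) ^ CARD('m) * det Q)))"

text \<open>Expectations of the nonnegative loss and the risks take values in \<^typ>\<open>ennreal\<close>, since they
  may be infinite.\<close>

definition Risk ::
  "real ^ 'n ^ 'm \<Rightarrow> real ^ 'n ^ 'v \<Rightarrow> (real ^ 'm ^ 'm) set \<Rightarrow> (real ^ 'v \<Rightarrow> real) \<Rightarrow>
   (real ^ 'n) set \<Rightarrow> (real ^ 'm \<Rightarrow> real ^ 'v) \<Rightarrow> ennreal" where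
  "Risk A B Q N X xhat =
     (SUP x \<in> X. SUP P \<in> {P. cov_dominated P Q}.
        \<integral>\<^sup>+ \<xi>. ennreal (N (xhat (A *v x + \<xi>) - B *v x)) \<partial>P)"

definition RiskOpt ::
  "real ^ 'n ^ 'm \<Rightarrow> real ^ 'n ^ 'v \<Rightarrow> (real ^ 'm ^ 'm) set \<Rightarrow> (real ^ 'v \<Rightarrow> real) \<Rightarrow>
   (real ^ 'n) set \<Rightarrow> ennreal" where
  "RiskOpt A B Q N X =
     (SUP C \<in> Q. INF xhat \<in> borel_measurable borel. SUP x \<in> X.
        \<integral>\<^sup>+ \<xi>. ennreal (N (B *v x - xhat (A *v x + \<xi>))) \<partial>gaussian C)"

definition linear_estimate :: "real ^ 'v ^ 'm \<Rightarrow> real ^ 'm \<Rightarrow> real ^ 'v" where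
  "linear_estimate H \<omega> = transpose H *v \<omega>"


section \<open>The convex optimization problem\<close>

text \<open>A candidate solution is a tuple \<open>(H, \<Lambda>, \<Upsilon>, \<Upsilon>', \<Theta>)\<close>.\<close>

type_synonym ('m, 'v, 'k, 'l) candidate =
  "(real ^ 'v ^ 'm) \<times> ('k \<Rightarrow> real mat) \<times> ('l \<Rightarrow> real mat) \<times> ('l \<Rightarrow> real mat) \<times> (real ^ 'm ^ 'm)"

definition feasible ::
  "real ^ 'n ^ 'm \<Rightarrow> real ^ 'n ^ 'v \<Rightarrow> real ^ 'q ^ 'v \<Rightarrow>
   ('k::finite \<Rightarrow> nat) \<Rightarrow> ('k \<Rightarrow> 'n::finite \<Rightarrow> real mat) \<Rightarrow>
   ('l::finite \<Rightarrow> nat) \<Rightarrow> ('l \<Rightarrow> 'q::finite \<Rightarrow> real mat) \<Rightarrow> ('m::finite, 'v::finite, 'k, 'l) candidate \<Rightarrow> bool" where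
  "feasible A B M d R f S = (\<lambda>(H, \<Lambda>, \<Upsilon>, \<Upsilon>', \<Theta>).
     (\<forall>k. psd_mat (d k) (\<Lambda> k)) \<and> (\<forall>l. psd_mat (f l) (\<Upsilon> l)) \<and> (\<forall>l. psd_mat (f l) (\<Upsilon>' l)) \<and>
     transpose \<Theta> = \<Theta> \<and>
     psd (block_matrix
        (\<Sum>k \<in> UNIV. adj_map (R k) (\<Lambda> k))
        ((1/2) *\<^sub>R ((transpose B - transpose A ** H) ** M))
        ((1/2) *\<^sub>R (transpose M ** (B - transpose H ** A)))
        (\<Sum>l \<in> UNIV. adj_map (S l) (\<Upsilon> l))) \<and>
     psd (block_matrix
        \<Theta>
        ((1/2) *\<^sub>R (H ** M))
        ((1/2) *\<^sub>R (transpose M ** transpose H))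
        (\<Sum>l \<in> UNIV. adj_map (S l) (\<Upsilon>' l))))"

definition objective ::
  "(real ^ 'k::finite) set \<Rightarrow> (real ^ 'l::finite) set \<Rightarrow> (real ^ 'm ^ 'm) set \<Rightarrow>
   ('m::finite, 'v::finite, 'k, 'l) candidate \<Rightarrow> real" where
  "objective T Rs Q = (\<lambda>(H, \<Lambda>, \<Upsilon>, \<Upsilon>', \<Theta>).
     supp_fun T (trace_vec \<Lambda>) + supp_fun Rs (trace_vec \<Upsilon>) + supp_fun Rs (trace_vec \<Upsilon>')
       + Gam Q \<Theta>)"

text \<open>When T and Rs are monotonic and Q is a nonempty compact set of positive definite matrices, the
  objective is nonnegative at every
  feasible point, so the infimum below is a genuine one and \<open>ennreal\<close> does not truncate it.\<close>

definition Opt ::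
  "real ^ 'n ^ 'm \<Rightarrow> real ^ 'n ^ 'v \<Rightarrow> real ^ 'q ^ 'v \<Rightarrow>
   ('k::finite \<Rightarrow> nat) \<Rightarrow> ('k \<Rightarrow> 'n::finite \<Rightarrow> real mat) \<Rightarrow> (real ^ 'k) set \<Rightarrow>
   ('l::finite \<Rightarrow> nat) \<Rightarrow> ('l \<Rightarrow> 'q::finite \<Rightarrow> real mat) \<Rightarrow> (real ^ 'l) set \<Rightarrow>
   (real ^ 'm ^ 'm) set \<Rightarrow> real" where
  "Opt A B M d R T f S Rs Q = (INF s \<in> {s. feasible A B M d R f S s}. objective T Rs Q s)"

definition optimal ::
  "real ^ 'n ^ 'm \<Rightarrow> real ^ 'n ^ 'v \<Rightarrow> real ^ 'q ^ 'v \<Rightarrow>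
   ('k::finite \<Rightarrow> nat) \<Rightarrow> ('k \<Rightarrow> 'n::finite \<Rightarrow> real mat) \<Rightarrow> (real ^ 'k) set \<Rightarrow>
   ('l::finite \<Rightarrow> nat) \<Rightarrow> ('l \<Rightarrow> 'q::finite \<Rightarrow> real mat) \<Rightarrow> (real ^ 'l) set \<Rightarrow>
   (real ^ 'm ^ 'm) set \<Rightarrow> ('m::finite, 'v::finite, 'k, 'l) candidate \<Rightarrow> bool" where
  "optimal A B M d R T f S Rs Q = is_arg_min (objective T Rs Q) (feasible A B M d R f S)"

end

theory Submission
  imports Defs
begin

text \<open>
  The upper bound is the duality \<open>z\<^sup>T u \<le> \<parallel>u\<parallel>\<close> on the spectratope \<open>M \<Y>\<close>, applied to the bias and to the noise of
  a feasible linear estimate.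

  For the lower bound, conic duality turns \<open>Opt\<close> into vectors \<open>X\<^sub>i\<close>, \<open>Y\<^sub>i\<close>, \<open>P\<^sub>j\<close>, \<open>W\<^sub>j\<close> whose Gaussian
  combinations lie, after scaling by \<open>\<alpha>\<close> and \<open>s\<close> of order \<open>sqrt (ln D)\<close> and \<open>sqrt (ln F)\<close>, in the spectratopes with
  high probability (noncommutative Khintchine inequality), with \<open>\<Sum>\<^sub>j P\<^sub>j P\<^sub>j\<^sup>T \<in> Q\<close>. Take the signal
  \<open>x = \<alpha>\<^sup>-\<^sup>1 \<Sum>\<^sub>i \<zeta>\<^sub>i X\<^sub>i\<close> and the noise \<open>\<xi> = \<Sum>\<^sub>j \<eta>\<^sub>j P\<^sub>j\<close> for standard normal \<open>\<zeta>\<close>, \<open>\<eta>\<close>. The entries of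
  \<open>z = M (\<Sum>\<^sub>i \<zeta>\<^sub>i Y\<^sub>i - \<alpha>\<^sup>-\<^sup>1 \<Sum>\<^sub>j \<eta>\<^sub>j W\<^sub>j)\<close> are linear forms that are orthogonal to the observation \<open>A x + \<xi>\<close>. Let \<open>e\<close> be the
  part of \<open>B x\<close> orthogonal to the observation; reflecting it shows that no estimate has a loss
  smaller than \<open>\<parallel>e\<parallel>\<close> on average over a point and its mirror image. As the expectation of \<open>z\<^sup>T e\<close> is at
  least \<open>Opt / \<alpha>\<close>, the norm of \<open>e\<close> is of order \<open>Opt / (\<alpha> s)\<close> with probability bounded below: after a
  rotation of \<open>z\<close>, the random variable \<open>z\<^sup>T e\<close> is a nonnegative quadratic form, to which the Paley-Zygmund
  inequality applies.
\<close>

section \<open>Positive semidefinite kernels and traces\<close>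

text \<open>Everything probabilistic is read off from the multipliers of the two block inequalities.
  H is unconstrained, so stationarity in H is an equality; this equality is what makes z orthogonal
  to the observation. The multiplier of the second inequality contains the covariance used for the
  noise, so no worst member of Q has to be searched for.

  Two obstacles shape the lower bound. A Gaussian prior is not supported in the signal set; hence
  the loss is truncated at a level \<delta>, and leaving the set costs only \<delta> times a small
  probability. Moreover only the mean of the bilinear form in z and e is known, and the second
  moment of an indefinite form is not controlled by its squared mean. Here it helps that z enters
  only through an event of small Gaussian probability, which is rotation invariant, so that z may be
  turned against e until the form is nonnegative.

  The logarithms come from trace moments of Gaussian matrix series and a union bound over the
  blocks. Both exceptional events get probability at most 1/128, which fixes the constants.\<close>

definition psd_on :: "'i set \<Rightarrow> ('i \<Rightarrow> 'i \<Rightarrow> real) \<Rightarrow> bool" where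
  "psd_on I a \<longleftrightarrow> (\<forall>i\<in>I. \<forall>j\<in>I. a i j = a j i) \<and> (\<forall>x. 0 \<le> (\<Sum>i\<in>I. \<Sum>j\<in>I. x i * a i j * x j))"

lemma quadratic_discriminant:
  fixes a l c :: real
  assumes "\<And>t. 0 \<le> c + 2 * t * l + t\<^sup>2 * a"
  shows "l\<^sup>2 \<le> a * c"
proof (cases "a = 0")
  case True
  show ?thesis
  proof (rule ccontr)
    assume "\<not> ?thesis"
    then have "l \<noteq> 0" using True by auto
    then have "2 * (- (\<bar>c\<bar> + 1) / (2 * l)) * l = - (\<bar>c\<bar> + 1)" by simp
    moreover have "0 \<le> c + 2 * t * l" for t using assms[of t] True by simp
    ultimately have "0 \<le> c + - (\<bar>c\<bar> + 1)" by metis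
    then show False by linarith
  qed
next
  case False
  have "0 \<le> a"
  proof (rule ccontr)
    assume "\<not> 0 \<le> a"
    \<comment> \<open>Large enough for the negative term \<open>t\<^sup>2 * a\<close> to outweigh
      \<open>c + 2 * t * l\<close>; the final summand 1 ensures \<open>1 \<le> t\<close>.\<close>
    define t where "t = (\<bar>c\<bar> + 1 + 2 * \<bar>l\<bar>) / (- a) + 1"
    have a: "- a > 0" using \<open>\<not> 0 \<le> a\<close> by simp
    have t: "t \<ge> 1" "t * (- a) \<ge> \<bar>c\<bar> + 1 + 2 * \<bar>l\<bar>"
    proof -
      have "(\<bar>c\<bar> + 1 + 2 * \<bar>l\<bar>) / (- a) \<ge> 0" by (intro divide_nonneg_pos a) simp
      then show "t \<ge> 1" by (simp add: t_def)
      have "t * (- a) = \<bar>c\<bar> + 1 + 2 * \<bar>l\<bar> + (- a)"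
        unfolding t_def distrib_right using a by simp
      then show "t * (- a) \<ge> \<bar>c\<bar> + 1 + 2 * \<bar>l\<bar>" using a by linarith
    qed
    have "t\<^sup>2 * (- a) \<ge> t * (\<bar>c\<bar> + 1 + 2 * \<bar>l\<bar>)"
      using mult_left_mono[OF t(2), of t] t(1) by (simp add: power2_eq_square mult.assoc)
    moreover have "t * (\<bar>c\<bar> + 1) \<ge> \<bar>c\<bar> + 1" using mult_right_mono[OF t(1), of "\<bar>c\<bar> + 1"] by simp
    moreover have "2 * t * l \<le> t * (2 * \<bar>l\<bar>)" using t(1) mult_left_mono[of l "\<bar>l\<bar>" t] by simp
    ultimately show False using assms[of t] by (simp add: algebra_simps)
  qed
  then have "a > 0" using False by simp
  then show ?thesis using assms[of "- l / a"] by (simp add: field_simps power2_eq_square)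
qed

text \<open>One step of a Cholesky decomposition: column \<open>k\<close>, divided by the root of
  its diagonal entry, is split off as a rank-one kernel. The last conclusion says that indices
  already eliminated stay eliminated.\<close>

lemma psd_on_peel:
  assumes fin: "finite I" and psd: "psd_on I a" and k: "k \<in> I"
  obtains w where "psd_on I (\<lambda>i j. a i j - w i * w j)" "\<And>j. j \<in> I \<Longrightarrow> a k j = w k * w j"
    "\<And>i. a i k = 0 \<Longrightarrow> w i = (0::real)"
proof
  \<comment> \<open>If \<open>a k k = 0\<close>, division by zero makes \<open>w\<close> vanish.
    This is the right value, since row \<open>k\<close> is then zero by \<open>ineq\<close>.\<close>
  define w where "w i = a i k / sqrt (a k k)" for i
  have sym: "a i j = a j i" if "i \<in> I" "j \<in> I" for i j using psd that by (auto simp: psd_on_def)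
  \<comment> \<open>Cauchy-Schwarz for the form between the k-th unit vector and \<open>x\<close>,
    obtained from the discriminant in \<open>t\<close> of the form at
    \<open>x + t * e\<close>.\<close>
  have ineq: "(\<Sum>j\<in>I. a k j * x j)\<^sup>2 \<le> a k k * (\<Sum>i\<in>I. \<Sum>j\<in>I. x i * a i j * x j)" for x
  proof (rule quadratic_discriminant)
    fix t
    define e where "e i = (if i = k then 1 else 0::real)" for i
    have "0 \<le> (\<Sum>i\<in>I. \<Sum>j\<in>I. (x i + t * e i) * a i j * (x j + t * e j))"
      using psd by (auto simp: psd_on_def)
    also have "\<dots> = (\<Sum>i\<in>I. \<Sum>j\<in>I. x i * a i j * x j) + t * (\<Sum>i\<in>I. \<Sum>j\<in>I. e i * a i j * x j)
        + t * (\<Sum>i\<in>I. \<Sum>j\<in>I. x i * a i j * e j) + t\<^sup>2 * (\<Sum>i\<in>I. \<Sum>j\<in>I. e i * a i j * e j)"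
      by (simp add: algebra_simps sum.distrib sum_distrib_left power2_eq_square)
    also have "(\<Sum>i\<in>I. \<Sum>j\<in>I. e i * a i j * x j) = (\<Sum>j\<in>I. a k j * x j)"
    proof -
      have "(\<Sum>i\<in>I. \<Sum>j\<in>I. e i * a i j * x j) = (\<Sum>i\<in>I. if i = k then \<Sum>j\<in>I. a k j * x j else 0)"
        by (intro sum.cong) (auto simp: e_def)
      then show ?thesis using fin k by simp
    qed
    also have "(\<Sum>i\<in>I. \<Sum>j\<in>I. x i * a i j * e j) = (\<Sum>j\<in>I. a k j * x j)"
      using fin k sym by (simp add: e_def if_distrib[of "\<lambda>z. _ * z"] cong: if_cong) (simp add: mult.commute)
    also have "(\<Sum>i\<in>I. \<Sum>j\<in>I. e i * a i j * e j) = a k k"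
      using fin k by (simp add: e_def mult.assoc sum_distrib_left[symmetric] if_distrib[of "\<lambda>z. z * _"] if_distrib[of "\<lambda>z. _ * z"] cong: if_cong)
    finally show "0 \<le> (\<Sum>i\<in>I. \<Sum>j\<in>I. x i * a i j * x j) + 2 * t * (\<Sum>j\<in>I. a k j * x j) + t\<^sup>2 * a k k"
      by simp
  qed
  have akk: "0 \<le> a k k"
  proof -
    have "(a k k)\<^sup>2 \<le> a k k * a k k" by (simp add: power2_eq_square)
    have "0 \<le> (\<Sum>i\<in>I. \<Sum>j\<in>I. (if i = k then 1 else 0) * a i j * (if j = k then 1 else 0))"
      using psd unfolding psd_on_def by (elim conjE allE)
    also have "\<dots> = a k k"
      using fin k by (simp add: mult.assoc sum_distrib_left[symmetric] if_distrib[of "\<lambda>z. z * _"] if_distrib[of "\<lambda>z. _ * z"] cong: if_cong)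
    finally show ?thesis .
  qed
  show "w i = 0" if "a i k = 0" for i using that by (simp add: w_def)
  show "a k j = w k * w j" if j: "j \<in> I" for j
  proof (cases "a k k = 0")
    case True
    have "(\<Sum>i\<in>I. a k i * (if i = j then 1 else 0))\<^sup>2 \<le> 0" using ineq[of "\<lambda>i. if i = j then 1 else 0"] True by simp
    then have "a k j = 0" using fin j by (simp add: if_distrib[of "\<lambda>z. _ * z"] cong: if_cong)
    then show ?thesis by (simp add: w_def True)
  next
    case False
    then show ?thesis using akk sym[OF k j] by (simp add: w_def field_simps)
  qed
  show "psd_on I (\<lambda>i j. a i j - w i * w j)"
    unfolding psd_on_def
  proof (intro conjI ballI allI)
    fix i j assume "i \<in> I" "j \<in> I" then show "a i j - w i * w j = a j i - w j * w i" using sym by simp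
  next
    fix x
    have "(\<Sum>i\<in>I. \<Sum>j\<in>I. x i * (a i j - w i * w j) * x j)
        = (\<Sum>i\<in>I. \<Sum>j\<in>I. x i * a i j * x j) - (\<Sum>i\<in>I. w i * x i)\<^sup>2"
      by (simp add: power2_eq_square sum_product algebra_simps sum_subtractf)
    moreover have "(\<Sum>i\<in>I. w i * x i)\<^sup>2 \<le> (\<Sum>i\<in>I. \<Sum>j\<in>I. x i * a i j * x j)"
    proof (cases "a k k = 0")
      case True then show ?thesis using psd by (simp add: w_def psd_on_def)
    next
      case False
      have "(\<Sum>i\<in>I. w i * x i) = (\<Sum>j\<in>I. a k j * x j) / sqrt (a k k)"
        using sym k by (simp add: w_def sum_divide_distrib)
      then have "(\<Sum>i\<in>I. w i * x i)\<^sup>2 = (\<Sum>j\<in>I. a k j * x j)\<^sup>2 / a k k"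
        using akk by (simp add: power_divide)
      then show ?thesis using ineq[of x] False akk by (simp add: pos_divide_le_eq mult.commute)
    qed
    ultimately show "0 \<le> (\<Sum>i\<in>I. \<Sum>j\<in>I. x i * (a i j - w i * w j) * x j)" by simp
  qed
qed

text \<open>The indices of \<open>S\<close> are peeled one at a time. The last conclusion prepares a
  second round on the complement of \<open>S\<close>: rows that are zero by then receive no further
  contribution.\<close>

lemma psd_on_factor_step:
  assumes fin: "finite I" and psd: "psd_on I a" and S: "S \<subseteq> I"
  shows "\<exists>v. psd_on I (\<lambda>i j. a i j - (\<Sum>k\<in>S. v k i * v k j)) \<and>
    (\<forall>i\<in>S. \<forall>j\<in>I. a i j = (\<Sum>k\<in>S. v k i * v k j)) \<and>
    (\<forall>i\<in>I. (\<forall>j\<in>I. a i j = 0) \<longrightarrow> (\<forall>k\<in>S. v k i = (0::real)))"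
  using finite_subset[OF S fin] S
proof (induction S rule: finite_induct)
  case empty
  then show ?case using psd by simp
next
  case (insert s S)
  then obtain v where v: "psd_on I (\<lambda>i j. a i j - (\<Sum>k\<in>S. v k i * v k j))"
    "\<forall>i\<in>S. \<forall>j\<in>I. a i j = (\<Sum>k\<in>S. v k i * v k j)"
    "\<forall>i\<in>I. (\<forall>j\<in>I. a i j = 0) \<longrightarrow> (\<forall>k\<in>S. v k i = 0)" by auto
  have s: "s \<in> I" using insert.prems by simp
  obtain w where w: "psd_on I (\<lambda>i j. a i j - (\<Sum>k\<in>S. v k i * v k j) - w i * w j)"
    "\<And>j. j \<in> I \<Longrightarrow> a s j - (\<Sum>k\<in>S. v k s * v k j) = w s * w j"
    "\<And>i. a i s - (\<Sum>k\<in>S. v k i * v k s) = 0 \<Longrightarrow> w i = 0"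
    using psd_on_peel[OF fin v(1) s] by blast
  define u where "u = v(s := w)"
  have sm: "(\<Sum>k\<in>insert s S. u k i * u k j) = (\<Sum>k\<in>S. v k i * v k j) + w i * w j" for i j
  proof -
    have "(\<Sum>k\<in>S. u k i * u k j) = (\<Sum>k\<in>S. v k i * v k j)"
      using insert.hyps by (intro sum.cong) (auto simp: u_def)
    then show ?thesis using insert.hyps by (simp add: u_def)
  qed
  show ?case
  proof (intro exI[of _ u] conjI)
    show "psd_on I (\<lambda>i j. a i j - (\<Sum>k\<in>insert s S. u k i * u k j))"
      using w(1) unfolding sm by (simp add: algebra_simps)
    show "\<forall>i\<in>insert s S. \<forall>j\<in>I. a i j = (\<Sum>k\<in>insert s S. u k i * u k j)"
    proof (intro ballI)
      fix i j assume i: "i \<in> insert s S" and j: "j \<in> I"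
      show "a i j = (\<Sum>k\<in>insert s S. u k i * u k j)"
      proof (cases "i = s")
        case True then show ?thesis using w(2)[OF j] by (simp add: sm)
      next
        case False
        \<comment> \<open>Row \<open>i\<close> of the remainder is already zero, so the new vector
          vanishes at \<open>i\<close> and the equations of the earlier steps persist.\<close>
        then have iS: "i \<in> S" using i by simp
        then have "w i = 0" using w(3)[of i] v(2) s by simp
        then show ?thesis using v(2) iS j by (simp add: sm)
      qed
    qed
    show "\<forall>i\<in>I. (\<forall>j\<in>I. a i j = 0) \<longrightarrow> (\<forall>k\<in>insert s S. u k i = 0)"
    proof (intro ballI impI)
      fix i k assume i: "i \<in> I" "\<forall>j\<in>I. a i j = 0" and k: "k \<in> insert s S"
      have vz: "\<forall>k\<in>S. v k i = 0" using v(3) i by blast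
      then have "w i = 0" using w(3)[of i] i s by simp
      then show "u k i = 0" using vz k by (auto simp: u_def)
    qed
  qed
qed

text \<open>If \<open>S\<close> is eliminated completely before its complement, the remainder has
  zero rows on \<open>S\<close>, and the vectors of the second round cannot reach
  \<open>S\<close>.\<close>

lemma psd_on_factor_triangular:
  assumes fin: "finite I" and psd: "psd_on I a" and S: "S \<subseteq> I"
  obtains v where "\<And>i j. i \<in> I \<Longrightarrow> j \<in> I \<Longrightarrow> a i j = (\<Sum>k\<in>I. v k i * v k j)"
    "\<And>i k. i \<in> S \<Longrightarrow> k \<in> I - S \<Longrightarrow> v k i = (0::real)"
proof -
  obtain v where v: "psd_on I (\<lambda>i j. a i j - (\<Sum>k\<in>S. v k i * v k j))"
    "\<forall>i\<in>S. \<forall>j\<in>I. a i j = (\<Sum>k\<in>S. v k i * v k j)"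
    using psd_on_factor_step[OF fin psd S] by blast
  let ?b = "\<lambda>i j. a i j - (\<Sum>k\<in>S. v k i * v k j)"
  obtain u where u: "psd_on I (\<lambda>i j. ?b i j - (\<Sum>k\<in>I - S. u k i * u k j))"
    "\<forall>i\<in>I - S. \<forall>j\<in>I. ?b i j = (\<Sum>k\<in>I - S. u k i * u k j)"
    "\<forall>i\<in>I. (\<forall>j\<in>I. ?b i j = 0) \<longrightarrow> (\<forall>k\<in>I - S. u k i = 0)"
    using psd_on_factor_step[OF fin v(1), of "I - S"] by blast
  define w where "w k = (if k \<in> S then v k else u k)" for k
  have z: "u k i = 0" if "i \<in> S" "k \<in> I - S" for i k
    using u(3) v(2) that S by auto
  have "a i j = (\<Sum>k\<in>I. w k i * w k j)" if ij: "i \<in> I" "j \<in> I" for i j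
  proof -
    have "(\<Sum>k\<in>I. w k i * w k j) = (\<Sum>k\<in>S. w k i * w k j) + (\<Sum>k\<in>I - S. w k i * w k j)"
      using S fin by (simp add: sum.subset_diff add.commute)
    also have "(\<Sum>k\<in>S. w k i * w k j) = (\<Sum>k\<in>S. v k i * v k j)" by (intro sum.cong) (auto simp: w_def)
    also have "(\<Sum>k\<in>I - S. w k i * w k j) = (\<Sum>k\<in>I - S. u k i * u k j)" by (intro sum.cong) (auto simp: w_def)
    also have "\<dots> = ?b i j"
    proof (cases "i \<in> S")
      case True then show ?thesis using z v(2) ij by simp
    next
      case False then show ?thesis using u(2) ij by simp
    qed
    finally show ?thesis by simp
  qed
  moreover have "w k i = 0" if "i \<in> S" "k \<in> I - S" for i k using z that by (simp add: w_def)
  ultimately show ?thesis using that by blast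
qed

lemma psd_on_factor:
  assumes "finite I" and "psd_on I a"
  shows "\<exists>v. \<forall>i\<in>I. \<forall>j\<in>I. a i j = (\<Sum>k\<in>I. v k i * v k j :: real)"
proof (rule psd_on_factor_triangular[OF assms empty_subsetI])
  fix v assume "\<And>i j. i \<in> I \<Longrightarrow> j \<in> I \<Longrightarrow> a i j = (\<Sum>k\<in>I. v k i * v k j)"
  then show ?thesis by (intro exI[of _ v]) blast
qed

section \<open>Matrices as kernels on a finite index set: powers and trace inequalities\<close>

definition ker_mult :: "'i set \<Rightarrow> ('i \<Rightarrow> 'i \<Rightarrow> real) \<Rightarrow> ('i \<Rightarrow> 'i \<Rightarrow> real) \<Rightarrow> 'i \<Rightarrow> 'i \<Rightarrow> real" where
  "ker_mult I A B = (\<lambda>i j. \<Sum>k\<in>I. A i k * B k j)"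

definition ker_apply :: "'i set \<Rightarrow> ('i \<Rightarrow> 'i \<Rightarrow> real) \<Rightarrow> ('i \<Rightarrow> real) \<Rightarrow> 'i \<Rightarrow> real" where
  "ker_apply I A v = (\<lambda>i. \<Sum>k\<in>I. A i k * v k)"

text \<open>The zeroth power is the identity cut off outside \<open>I\<close>, because kernels are
  functions on the whole index type.\<close>

primrec ker_power :: "'i set \<Rightarrow> ('i \<Rightarrow> 'i \<Rightarrow> real) \<Rightarrow> nat \<Rightarrow> 'i \<Rightarrow> 'i \<Rightarrow> real" where
  "ker_power I X 0 = (\<lambda>i j. if i = j \<and> i \<in> I then 1 else 0)"
| "ker_power I X (Suc n) = ker_mult I X (ker_power I X n)"

definition ker_trace :: "'i set \<Rightarrow> ('i \<Rightarrow> 'i \<Rightarrow> real) \<Rightarrow> real" where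
  "ker_trace I A = (\<Sum>i\<in>I. A i i)"

text \<open>Vanishing outside \<open>I\<close> is included, so that identities between products hold
  as equalities of functions and the zeroth power is a two-sided unit.\<close>

definition ker_sym :: "'i set \<Rightarrow> ('i \<Rightarrow> 'i \<Rightarrow> real) \<Rightarrow> bool" where
  "ker_sym I A \<longleftrightarrow> (\<forall>i j. A i j = A j i) \<and> (\<forall>i j. i \<notin> I \<longrightarrow> A i j = 0)"

lemma ker_mult_assoc: "ker_mult I (ker_mult I A B) C = ker_mult I A (ker_mult I B C)"
proof (intro ext)
  fix i j
  have "(\<Sum>k\<in>I. (\<Sum>l\<in>I. A i l * B l k) * C k j) = (\<Sum>k\<in>I. \<Sum>l\<in>I. A i l * (B l k * C k j))"
    by (simp add: sum_distrib_right mult.assoc)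
  also have "\<dots> = (\<Sum>l\<in>I. \<Sum>k\<in>I. A i l * (B l k * C k j))" by (rule sum.swap)
  finally show "ker_mult I (ker_mult I A B) C i j = ker_mult I A (ker_mult I B C) i j"
    by (simp add: ker_mult_def sum_distrib_left)
qed

lemma ker_trace_commute: "ker_trace I (ker_mult I A B) = ker_trace I (ker_mult I B A)"
  unfolding ker_trace_def ker_mult_def by (subst sum.swap) (intro sum.cong refl mult.commute)

lemma ker_transpose_mult: "ker_mult I A B i j = ker_mult I (\<lambda>i j. B j i) (\<lambda>i j. A j i) j i"
  unfolding ker_mult_def by (intro sum.cong refl mult.commute)

lemma ker_mult_one:
  assumes "finite I" "ker_sym I X"
  shows "ker_mult I X (ker_power I X' 0) = X" and "ker_mult I (ker_power I X' 0) X = X"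
proof -
  have z: "X i j = 0" if "i \<notin> I \<or> j \<notin> I" for i j using assms that unfolding ker_sym_def by metis
  have "ker_mult I X (ker_power I X' 0) i j = X i j" for i j
  proof -
    have "ker_mult I X (ker_power I X' 0) i j = (\<Sum>k\<in>I. if k = j then X i j else 0)"
      unfolding ker_mult_def by (intro sum.cong) auto
    then show ?thesis using assms z by (simp add: sum.delta)
  qed
  moreover have "ker_mult I (ker_power I X' 0) X i j = X i j" for i j
  proof -
    have "ker_mult I (ker_power I X' 0) X i j = (\<Sum>k\<in>I. if k = i then X i j else 0)"
      unfolding ker_mult_def by (intro sum.cong) auto
    then show ?thesis using assms z by (simp add: sum.delta)
  qed
  ultimately show "ker_mult I X (ker_power I X' 0) = X" "ker_mult I (ker_power I X' 0) X = X" by blast+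
qed

lemma ker_sym_power:
  assumes "finite I" "ker_sym I X"
  shows "ker_power I X n i j = ker_power I X n j i" and "i \<notin> I \<Longrightarrow> ker_power I X n i j = 0"
    and "ker_mult I X (ker_power I X n) = ker_mult I (ker_power I X n) X"
proof -
  have out: "i \<notin> I \<Longrightarrow> ker_power I X n i j = 0" for n i j
    using assms by (cases n) (auto simp: ker_mult_def ker_sym_def)
  have sy: "X i j = X j i" for i j using assms by (auto simp: ker_sym_def)
  have one: "ker_mult I X (ker_power I X 0) = X" "ker_mult I (ker_power I X 0) X = X"
    using ker_mult_one[OF assms] by blast+
  have comm: "ker_mult I X (ker_power I X n) = ker_mult I (ker_power I X n) X" for n
  proof (induction n)
    case 0 show ?case using one by simp
  next
    case (Suc n)
    have "ker_mult I (ker_power I X (Suc n)) X = ker_mult I X (ker_mult I (ker_power I X n) X)"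
      by (simp add: ker_mult_assoc)
    then show ?case using Suc by simp
  qed
  have "ker_power I X n i j = ker_power I X n j i" for n i j
  proof (induction n arbitrary: i j)
    case 0 then show ?case by auto
  next
    case (Suc n)
    have 1: "(\<lambda>i j. ker_power I X n j i) = ker_power I X n" using Suc by auto
    have 2: "(\<lambda>i j. X j i) = X" using sy by auto
    have "ker_power I X (Suc n) i j = ker_mult I (ker_power I X n) X j i"
      unfolding ker_power.simps by (subst ker_transpose_mult) (simp only: 1 2)
    then show ?case by (simp only: ker_power.simps comm)
  qed
  then show "ker_power I X n i j = ker_power I X n j i" .
  show "i \<notin> I \<Longrightarrow> ker_power I X n i j = 0" by (rule out)
  show "ker_mult I X (ker_power I X n) = ker_mult I (ker_power I X n) X" by (rule comm)
qed

lemma ker_power_add: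
  assumes "finite I" "ker_sym I X"
  shows "ker_mult I (ker_power I X m) (ker_power I X n) = ker_power I X (m + n)"
proof (induction m)
  case 0
  have "ker_sym I (ker_power I X n)"
    using ker_sym_power(1,2)[OF assms, where n = n] unfolding ker_sym_def by blast
  then show ?case using ker_mult_one(2)[OF assms(1)] by simp
next
  case (Suc m) then show ?case by (simp add: ker_mult_assoc)
qed

lemma ker_trace_gram:
  "ker_trace I (ker_mult I (\<lambda>i j. U j i) V) = (\<Sum>i\<in>I. \<Sum>j\<in>I. U j i * V j i)"
  by (simp add: ker_trace_def ker_mult_def)

text \<open>A discrete maximum principle: a convex sequence has no strict interior peak.\<close>

lemma midpoint_convex_le_ends:
  fixes b :: "nat \<Rightarrow> real"
  assumes "\<And>i. 0 < i \<Longrightarrow> i < m \<Longrightarrow> 2 * b i \<le> b (i - 1) + b (i + 1)" and "i \<le> m"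
  shows "b i \<le> max (b 0) (b m)"
proof -
  define M where "M = Max (b ` {..m})"
  have le: "b j \<le> M" if "j \<le> m" for j using that by (auto simp: M_def)
  have "M \<in> b ` {..m}" unfolding M_def by (rule Max_in) auto
  then obtain j where j: "j \<le> m" "b j = M" by auto
  \<comment> \<open>At the least maximizer the left neighbour is strictly smaller, which contradicts
    midpoint convexity unless the maximizer is an end.\<close>
  define l where "l = (LEAST j. j \<le> m \<and> b j = M)"
  have l: "l \<le> m" "b l = M" using LeastI[of "\<lambda>j. j \<le> m \<and> b j = M" j] j by (auto simp: l_def)
  have min: "\<not> (j \<le> m \<and> b j = M)" if "j < l" for j
    using that not_less_Least unfolding l_def by blast
  have "l = 0 \<or> l = m"
  proof (rule ccontr)
    assume "\<not> (l = 0 \<or> l = m)"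
    then have h: "0 < l" "l < m" using l by linarith+
    have "b (l - 1) \<noteq> M" using min[of "l - 1"] h by linarith
    moreover have "b (l - 1) \<le> M" by (rule le) (use h in linarith)
    moreover have "b (l + 1) \<le> M" by (rule le) (use h in linarith)
    ultimately show False using assms(1)[OF h] l(2) by linarith
  qed
  then have "b l \<le> max (b 0) (b m)" by (elim disjE) (simp_all only: max.cobounded1 max.cobounded2)
  then show ?thesis using l(2) le[OF assms(2)] by linarith
qed

text \<open>For even \<open>p + q\<close> the numbers \<open>tr (A X\<^sup>2\<^sup>i A X\<^sup>s\<^sup>-\<^sup>2\<^sup>i)\<close> form a convex sequence in \<open>i\<close> by the
  Cauchy-Schwarz inequality for the Frobenius inner product, so they are largest at the ends.\<close>

lemma ker_trace_sandwich_le: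
  assumes fin: "finite I" and A: "ker_sym I A" and X: "ker_sym I X" and q: "q \<le> 2 * m"
  shows "ker_trace I (ker_mult I A (ker_mult I (ker_power I X q) (ker_mult I A (ker_power I X (2 * m - q)))))
    \<le> (\<Sum>i\<in>I. \<Sum>j\<in>I. (ker_mult I A (ker_power I X m) j i)\<^sup>2)"
proof -
  let ?M = "ker_mult I" and ?P = "ker_power I X"
  define a where "a p q = ker_trace I (?M A (?M (?P p) (?M A (?P q))))" for p q
  define G where "G i j = ?M (?P i) (?M A (?P j))" for i j
  have As: "(\<lambda>i j. A j i) = A" using A by (auto simp: ker_sym_def)
  have Ps: "(\<lambda>i j. ?P n j i) = ?P n" for n using ker_sym_power(1)[OF fin X] by blast
  have GT: "(\<lambda>x y. G i j y x) = ?M (?P j) (?M A (?P i))" for i j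
  proof (intro ext)
    fix x y
    have "(\<lambda>x y. ?M A (?P j) y x) = ?M (?P j) A"
      by (intro ext, subst ker_transpose_mult, simp only: As Ps)
    then show "G i j y x = ?M (?P j) (?M A (?P i)) x y"
      unfolding G_def by (subst ker_transpose_mult) (simp only: Ps ker_mult_assoc)
  qed
  \<comment> \<open>Cyclicity of the trace merges neighbouring powers of \<open>X\<close>, so the
    Frobenius product of two sandwiches depends only on the sums of exponents.\<close>
  have gram: "(\<Sum>x\<in>I. \<Sum>y\<in>I. G i j y x * G k l y x) = a (i + k) (j + l)" for i j k l
  proof -
    have "(\<Sum>x\<in>I. \<Sum>y\<in>I. G i j y x * G k l y x) = ker_trace I (?M (\<lambda>x y. G i j y x) (G k l))"
      by (simp add: ker_trace_gram)
    also have "\<dots> = ker_trace I (?M (?P j) (?M A (?M (?P i) (G k l))))" by (simp add: GT ker_mult_assoc)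
    also have "\<dots> = ker_trace I (?M (?M A (?M (?P i) (G k l))) (?P j))" by (rule ker_trace_commute)
    also have "?M (?M A (?M (?P i) (G k l))) (?P j) = ?M A (?M (?M (?P i) (?P k)) (?M A (?M (?P l) (?P j))))"
      by (simp add: G_def ker_mult_assoc)
    finally show ?thesis by (simp add: a_def ker_power_add[OF fin X] add.commute)
  qed
  have cs: "2 * a (i + k) (j + l) \<le> a (i + i) (j + j) + a (k + k) (l + l)" for i j k l
  proof -
    have "2 * (\<Sum>x\<in>I. \<Sum>y\<in>I. G i j y x * G k l y x) \<le> (\<Sum>x\<in>I. \<Sum>y\<in>I. G i j y x * G i j y x) + (\<Sum>x\<in>I. \<Sum>y\<in>I. G k l y x * G k l y x)"
      unfolding sum_distrib_left sum.distrib[symmetric]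
    proof (intro sum_mono)
      fix x y
      show "2 * (G i j y x * G k l y x) \<le> G i j y x * G i j y x + G k l y x * G k l y x"
        using sum_squares_bound[of "G i j y x" "G k l y x"] by (simp add: power2_eq_square)
    qed
    then show ?thesis by (simp only: gram)
  qed
  have acomm: "a p q = a q p" for p q
  proof -
    have "a p q = ker_trace I (?M (?M A (?P p)) (?M A (?P q)))" by (simp add: a_def ker_mult_assoc)
    also have "\<dots> = ker_trace I (?M (?M A (?P q)) (?M A (?P p)))" by (rule ker_trace_commute)
    finally show ?thesis by (simp add: a_def ker_mult_assoc)
  qed
  define b where "b i = a (2 * i) (2 * (m - i))" for i
  have ends: "b i \<le> a 0 (2 * m)" if "i \<le> m" for i
  proof -
    have "b i \<le> max (b 0) (b m)"
    proof (rule midpoint_convex_le_ends[OF _ that])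
      fix i assume i: "0 < i" "i < m"
      have e: "i - 1 + (i + 1) = 2 * i" "m - i + 1 + (m - i - 1) = 2 * (m - i)"
        "i - 1 + (i - 1) = 2 * (i - 1)" "m - i + 1 + (m - i + 1) = 2 * (m - (i - 1))"
        "i + 1 + (i + 1) = 2 * (i + 1)" "m - i - 1 + (m - i - 1) = 2 * (m - (i + 1))" using i by auto
      show "2 * b i \<le> b (i - 1) + b (i + 1)"
        using cs[of "i - 1" "i + 1" "m - i + 1" "m - i - 1"] unfolding b_def e .
    qed
    then show ?thesis using acomm[of 0 "2 * m"] by (simp add: b_def)
  qed
  have "a q (2 * m - q) \<le> a 0 (2 * m)"
  proof (cases "even q")
    case True
    then obtain i where "q = 2 * i" by blast
    then show ?thesis using ends[of i] q by (simp add: b_def diff_mult_distrib2)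
  next
    \<comment> \<open>An odd exponent lies midway between two even ones; pairing the halves
      \<open>i\<close> and \<open>i + 1\<close> crosswise bounds it by their mean.\<close>
    case False
    then obtain i where i: "q = 2 * i + 1" using oddE by blast
    then have e: "i + (i + 1) = q" "m - i + (m - i - 1) = 2 * m - q"
        "i + i = 2 * i" "m - i + (m - i) = 2 * (m - i)"
        "i + 1 + (i + 1) = 2 * (i + 1)" "m - i - 1 + (m - i - 1) = 2 * (m - (i + 1))" using q by auto
    have "2 * a q (2 * m - q) \<le> b i + b (i + 1)"
      using cs[of i "i + 1" "m - i" "m - i - 1"] unfolding b_def e .
    then show ?thesis using ends[of i] ends[of "i + 1"] i q by simp
  qed
  also have "a 0 (2 * m) = (\<Sum>x\<in>I. \<Sum>y\<in>I. G 0 m y x * G 0 m y x)" by (simp add: gram mult_2)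
  also have "G 0 m = ?M A (?P m)"
  proof -
    have "?M (?P 0) A = A" by (rule ker_mult_one(2)[OF fin A])
    then show ?thesis unfolding G_def ker_mult_assoc[symmetric] by simp
  qed
  finally show ?thesis unfolding a_def by (simp add: power2_eq_square)
qed

lemma ker_trace_power_even:
  assumes "finite I" "ker_sym I X"
  shows "ker_trace I (ker_power I X (2 * m)) = (\<Sum>i\<in>I. \<Sum>j\<in>I. (ker_power I X m j i)\<^sup>2)"
proof -
  have "(\<lambda>i j. ker_power I X m j i) = ker_power I X m" using ker_sym_power(1)[OF assms] by blast
  then show ?thesis
    using ker_trace_gram[of I "ker_power I X m" "ker_power I X m"]
    by (simp only: ker_power_add[OF assms] mult_2 power2_eq_square)
qed

text \<open>The squared lengths of the iterates of \<open>v\<close> under \<open>X\<close> are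
  log-convex by Cauchy-Schwarz, so their initial growth factor, which exceeds \<open>c\<close>,
  never drops. The growth over \<open>p\<close> steps is at most the squared Frobenius norm of the
  p-th power, which is the trace. This takes the place of a spectral decomposition.\<close>

lemma ker_trace_power_ge:
  assumes fin: "finite I" and X: "ker_sym I X" and c: "0 \<le> c"
    and v: "c * (\<Sum>i\<in>I. (v i)\<^sup>2) < (\<Sum>i\<in>I. (ker_apply I X v i)\<^sup>2)"
  shows "c ^ p \<le> ker_trace I (ker_power I X (2 * p))"
proof -
  define w where "w k = (ker_apply I X ^^ k) v" for k
  define n where "n k = (\<Sum>i\<in>I. (w k i)\<^sup>2)" for k
  have w0: "w 0 = v" and wS: "w (Suc k) = ker_apply I X (w k)" for k by (auto simp: w_def)
  have sy: "X i j = X j i" for i j using X by (auto simp: ker_sym_def)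
  have adj: "(\<Sum>i\<in>I. ker_apply I X u i * z i) = (\<Sum>i\<in>I. u i * ker_apply I X z i)" for u z
  proof -
    have "(\<Sum>i\<in>I. ker_apply I X u i * z i) = (\<Sum>i\<in>I. \<Sum>j\<in>I. X i j * u j * z i)"
      by (simp add: ker_apply_def sum_distrib_right)
    also have "\<dots> = (\<Sum>j\<in>I. \<Sum>i\<in>I. X i j * u j * z i)" by (rule sum.swap)
    also have "\<dots> = (\<Sum>j\<in>I. u j * ker_apply I X z j)"
      unfolding ker_apply_def sum_distrib_left by (intro sum.cong refl) (simp add: sy mult_ac)
    finally show ?thesis .
  qed
  have cs: "(n (Suc k))\<^sup>2 \<le> n k * n (Suc (Suc k))" for k
  proof -
    have "n (Suc k) = (\<Sum>i\<in>I. w k i * w (Suc (Suc k)) i)"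
      using adj[of "w k" "w (Suc k)"] by (simp add: n_def wS power2_eq_square)
    then show ?thesis using Cauchy_Schwarz_ineq_sum[of "w k" "w (Suc (Suc k))" I] by (simp add: n_def)
  qed
  have nn: "0 \<le> n k" for k by (simp add: n_def sum_nonneg)
  have base: "c * n 0 < n 1" using v by (simp add: n_def w0 wS)
  \<comment> \<open>Positivity of two consecutive lengths is carried along, since they are cancelled
    in the induction.\<close>
  have step: "0 < n k \<and> 0 < n (Suc k) \<and> c * n k \<le> n (Suc k)" for k
  proof (induction k)
    case 0
    have "0 < n 1" using base mult_nonneg_nonneg[OF c nn[of 0]] by linarith
    moreover have "n 0 \<noteq> 0"
      using cs[of 0] \<open>0 < n 1\<close> by (metis One_nat_def mult_zero_left not_le zero_less_power)
    ultimately show ?case using base nn[of 0] by simp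
  next
    case (Suc k)
    then have k: "0 < n k" "0 < n (Suc k)" "c * n k \<le> n (Suc k)" by auto
    have "c * n k * n (Suc k) \<le> n (Suc k) * n (Suc k)" using k by (intro mult_right_mono) auto
    also have "\<dots> \<le> n k * n (Suc (Suc k))" using cs[of k] by (simp add: power2_eq_square)
    finally have "n k * (c * n (Suc k)) \<le> n k * n (Suc (Suc k))" by (simp add: mult_ac)
    then have 1: "c * n (Suc k) \<le> n (Suc (Suc k))" using k(1) by simp
    have "0 < n (Suc k) * n (Suc k)" using k by simp
    also have "\<dots> \<le> n k * n (Suc (Suc k))" using cs[of k] by (simp add: power2_eq_square)
    finally have "0 < n (Suc (Suc k))" using k(1) by (simp add: zero_less_mult_iff)
    then show ?case using k 1 by simp
  qed
  have grow: "c ^ p * n 0 \<le> n p"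
  proof (induction p)
    case (Suc p)
    have "c ^ Suc p * n 0 \<le> c * n p" using mult_left_mono[OF Suc c] by (simp add: mult_ac)
    also have "\<dots> \<le> n (Suc p)" using step by blast
    finally show ?case .
  qed simp
  have wp: "w p i = ker_apply I (ker_power I X p) v i" if "i \<in> I" for i
    using that
  proof (induction p arbitrary: i)
    case 0 then show ?case using fin by (simp add: w0 ker_apply_def if_distrib[of "\<lambda>z. z * _"] cong: if_cong)
  next
    case (Suc p)
    have "w (Suc p) i = (\<Sum>j\<in>I. X i j * ker_apply I (ker_power I X p) v j)" using Suc by (simp add: wS ker_apply_def)
    also have "\<dots> = (\<Sum>j\<in>I. \<Sum>l\<in>I. X i j * ker_power I X p j l * v l)"
      by (simp add: ker_apply_def sum_distrib_left mult.assoc)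
    also have "\<dots> = (\<Sum>l\<in>I. \<Sum>j\<in>I. X i j * ker_power I X p j l * v l)" by (rule sum.swap)
    finally show ?case by (simp add: ker_apply_def ker_mult_def sum_distrib_right)
  qed
  have "n p \<le> (\<Sum>i\<in>I. (\<Sum>j\<in>I. (ker_power I X p i j)\<^sup>2) * n 0)"
    unfolding n_def[of p]
  proof (rule sum_mono)
    fix i assume "i \<in> I"
    then have "(w p i)\<^sup>2 = (\<Sum>j\<in>I. ker_power I X p i j * v j)\<^sup>2" by (simp add: wp ker_apply_def)
    also have "\<dots> \<le> (\<Sum>j\<in>I. (ker_power I X p i j)\<^sup>2) * (\<Sum>j\<in>I. (v j)\<^sup>2)"
      by (rule Cauchy_Schwarz_ineq_sum)
    finally show "(w p i)\<^sup>2 \<le> (\<Sum>j\<in>I. (ker_power I X p i j)\<^sup>2) * n 0" by (simp add: n_def w0)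
  qed
  also have "\<dots> = ker_trace I (ker_power I X (2 * p)) * n 0"
    unfolding ker_trace_power_even[OF fin X] sum_distrib_right[symmetric]
    by (intro arg_cong2[where f = "(*)"] sum.cong refl arg_cong2[where f = power] ker_sym_power(1)[OF fin X])
  finally have "c ^ p * n 0 \<le> ker_trace I (ker_power I X (2 * p)) * n 0" using grow by simp
  then show ?thesis using step[of 0] by simp
qed

section \<open>The standard Gaussian measure\<close>

definition std_gauss_density :: "'a::euclidean_space \<Rightarrow> real" where
  "std_gauss_density x = exp (- (norm x)\<^sup>2 / 2) / sqrt (2 * pi) ^ DIM('a)"

definition std_gauss :: "'a::euclidean_space measure" where
  "std_gauss = density lborel (\<lambda>x. ennreal (std_gauss_density x))"

lemma std_gauss_density_pos: "0 < std_gauss_density x"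
  by (simp add: std_gauss_density_def)

lemma std_gauss_density_measurable[measurable]: "std_gauss_density \<in> borel_measurable borel"
  unfolding std_gauss_density_def by measurable

lemma space_std_gauss[simp]: "space std_gauss = UNIV"
  and sets_std_gauss[simp, measurable_cong]: "sets std_gauss = sets borel"
  by (auto simp: std_gauss_def)

lemma norm_power2_Basis: "(norm (x::'a::euclidean_space))\<^sup>2 = (\<Sum>b\<in>Basis. (x \<bullet> b)\<^sup>2)"
proof -
  have "(norm x)\<^sup>2 = (\<Sum>b\<in>Basis. (x \<bullet> b) * (x \<bullet> b))"
    unfolding power2_norm_eq_inner by (rule euclidean_inner)
  then show ?thesis by (simp only: power2_eq_square)
qed

lemma nn_integral_exp_norm:
  assumes c: "0 < c"
  shows "(\<integral>\<^sup>+x. ennreal (exp (- c * (norm (x::'a::euclidean_space))\<^sup>2)) \<partial>lborel) = ennreal (sqrt (pi / c) ^ DIM('a))"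
proof -
  \<comment> \<open>The standard deviation for which the normal density is proportional to
    \<open>exp (- c * y\<^sup>2)\<close>.\<close>
  define \<sigma> where "\<sigma> = 1 / sqrt (2 * c)"
  have s: "\<sigma> > 0" "\<sigma>\<^sup>2 = 1 / (2 * c)" using c by (auto simp: \<sigma>_def power_divide)
  have one: "(\<integral>\<^sup>+y. ennreal (exp (- c * y\<^sup>2)) \<partial>lborel) = ennreal (sqrt (pi / c))"
  proof -
    have "2 * pi * \<sigma>\<^sup>2 = pi / c" "y\<^sup>2 / (2 * \<sigma>\<^sup>2) = c * y\<^sup>2" for y
      using c by (auto simp: s(2))
    then have e: "exp (- c * y\<^sup>2) = sqrt (pi / c) * normal_density 0 \<sigma> y" for y
      using c by (simp add: normal_density_def)
    have "(\<integral>\<^sup>+y. ennreal (normal_density 0 \<sigma> y) \<partial>lborel) = 1"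
      using s(1) by (simp add: nn_integral_eq_integral)
    then show ?thesis unfolding e using c by (simp add: ennreal_mult nn_integral_cmult)
  qed
  have "(\<integral>\<^sup>+x. ennreal (exp (- c * (norm (x::'a))\<^sup>2)) \<partial>lborel)
      = (\<integral>\<^sup>+x. (\<Prod>b\<in>Basis. ennreal (exp (- c * (x \<bullet> b)\<^sup>2))) \<partial>(lborel::'a measure))"
    by (simp add: norm_power2_Basis exp_sum[symmetric] sum_distrib_left prod_ennreal flip: sum_negf)
  also have "\<dots> = (\<Prod>b\<in>(Basis::'a set). \<integral>\<^sup>+y. ennreal (exp (- c * y\<^sup>2)) \<partial>lborel)"
    by (rule nn_integral_lborel_prod) auto
  also have "\<dots> = ennreal (sqrt (pi / c) ^ DIM('a))"
    unfolding one using c by (simp add: ennreal_power)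
  finally show ?thesis .
qed

lemma prob_space_std_gauss: "prob_space (std_gauss :: 'a::euclidean_space measure)"
proof
  have "(\<integral>\<^sup>+x. ennreal (std_gauss_density (x::'a)) \<partial>lborel)
      = (\<integral>\<^sup>+x. ennreal (1 / sqrt (2 * pi) ^ DIM('a)) * ennreal (exp (- (1/2) * (norm (x::'a))\<^sup>2)) \<partial>lborel)"
    by (intro nn_integral_cong) (simp add: std_gauss_density_def ennreal_mult[symmetric])
  also have "\<dots> = ennreal (1 / sqrt (2 * pi) ^ DIM('a)) * ennreal (sqrt (pi / (1/2)) ^ DIM('a))"
    using nn_integral_exp_norm[where c = "1/2" and 'a = 'a] by (subst nn_integral_cmult) (simp, simp only: half_gt_zero zero_less_one)
  also have "\<dots> = 1" by (subst ennreal_mult[symmetric]) (simp_all add: mult.commute)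
  finally show "emeasure std_gauss (space (std_gauss :: 'a measure)) = 1"
    by (simp add: std_gauss_def emeasure_density)
qed

section \<open>Gaussian integrals of polynomials and integration by parts\<close>

lemma real_polynomial_function_exp_bound:
  fixes f :: "'a::real_normed_vector \<Rightarrow> real"
  assumes "real_polynomial_function f"
  shows "0 < a \<Longrightarrow> \<exists>C. \<forall>x. \<bar>f x\<bar> \<le> C * exp (a * (norm x)\<^sup>2)"
  using assms
proof (induction arbitrary: a rule: real_polynomial_function.induct)
  case (linear f)
  then obtain K where K: "\<And>x. \<bar>f x\<bar> \<le> norm x * K" "0 < K"
    using bounded_linear.pos_bounded[of f] by (auto simp: mult.commute)
  show ?case
  proof (intro exI[of _ "K * (1 + 1 / a)"] allI)
    fix x :: 'a
    have "norm x \<le> 1 + (norm x)\<^sup>2"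
    proof -
      have "2 * norm x \<le> 1 + (norm x)\<^sup>2" using sum_squares_bound[of 1 "norm x"] by simp
      then show ?thesis using norm_ge_zero[of x] by linarith
    qed
    also have "\<dots> \<le> (1 + 1 / a) * (1 + a * (norm x)\<^sup>2)" using linear(2) by (simp add: field_simps)
    also have "\<dots> \<le> (1 + 1 / a) * exp (a * (norm x)\<^sup>2)" using linear(2) by (intro mult_left_mono) auto
    finally have "norm x * K \<le> (1 + 1 / a) * exp (a * (norm x)\<^sup>2) * K" using K by (intro mult_right_mono) auto
    then show "\<bar>f x\<bar> \<le> K * (1 + 1 / a) * exp (a * (norm x)\<^sup>2)" using K(1)[of x] by (simp add: mult_ac)
  qed
next
  case (const c)
  show ?case
  proof (intro exI[of _ "\<bar>c\<bar>"] allI)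
    fix x :: 'a
    have "1 \<le> exp (a * (norm x)\<^sup>2)" using const by simp
    then show "\<bar>c\<bar> \<le> \<bar>c\<bar> * exp (a * (norm x)\<^sup>2)" using mult_left_mono[of 1 _ "\<bar>c\<bar>"] by simp
  qed
next
  case (add f g)
  then obtain C D where "\<forall>x. \<bar>f x\<bar> \<le> C * exp (a * (norm x)\<^sup>2)" "\<forall>x. \<bar>g x\<bar> \<le> D * exp (a * (norm x)\<^sup>2)"
    by meson
  then show ?case
    by (intro exI[of _ "C + D"] allI) (smt (verit, best) distrib_right)
next
  case (mult f g)
  \<comment> \<open>Each factor of a product gets half of the exponential rate; this is why the
    induction is over all rates at once.\<close>
  have "0 < a / 2" using mult by simp
  then obtain C D where C: "\<forall>x. \<bar>f x\<bar> \<le> C * exp (a / 2 * (norm x)\<^sup>2)" and D: "\<forall>x. \<bar>g x\<bar> \<le> D * exp (a / 2 * (norm x)\<^sup>2)"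
    using mult.IH by meson
  show ?case
  proof (intro exI[of _ "C * D"] allI)
    fix x
    have "\<bar>f x * g x\<bar> \<le> (C * exp (a / 2 * (norm x)\<^sup>2)) * (D * exp (a / 2 * (norm x)\<^sup>2))"
      unfolding abs_mult using C D by (intro mult_mono) (auto intro: order_trans[OF abs_ge_zero])
    also have "\<dots> = C * D * exp (a * (norm x)\<^sup>2)" by (simp add: mult_ac flip: exp_add) 
    finally show "\<bar>f x * g x\<bar> \<le> C * D * exp (a * (norm x)\<^sup>2)" .
  qed
qed

lemma real_polynomial_function_borel_measurable:
  assumes "real_polynomial_function (f :: 'a::euclidean_space \<Rightarrow> real)"
  shows "f \<in> borel_measurable borel"
  using assms continuous_on_polymonial_function real_polynomial_function_eq
  by (intro borel_measurable_continuous_onI) (auto simp: continuous_on_eq_continuous_at continuous_real_polymonial_function)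

lemma integrable_polynomial_density:
  assumes f: "real_polynomial_function (f :: 'a::euclidean_space \<Rightarrow> real)"
  shows "integrable lborel (\<lambda>x. std_gauss_density x * f x)"
proof -
  \<comment> \<open>Any rate below the 1/2 of the density would do: what remains is again an
    integrable Gaussian.\<close>
  obtain C where C: "\<And>x. \<bar>f x\<bar> \<le> C * exp (1/4 * (norm x)\<^sup>2)"
    using real_polynomial_function_exp_bound[OF f, of "1/4"] by auto
  have i: "integrable lborel (\<lambda>x::'a. exp (- (1/4) * (norm x)\<^sup>2))"
    by (rule integrableI_nonneg) (simp_all only: nn_integral_exp_norm, simp_all)
  have [measurable]: "f \<in> borel_measurable borel" by (rule real_polynomial_function_borel_measurable[OF f])
  show ?thesis
  proof (rule Bochner_Integration.integrable_bound)
    show "integrable lborel (\<lambda>x::'a. C / sqrt (2 * pi) ^ DIM('a) * exp (- (1/4) * (norm x)\<^sup>2))"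
      by (intro integrable_mult_right i)
    show "AE x in lborel. norm (std_gauss_density x * f x) \<le> norm (C / sqrt (2 * pi) ^ DIM('a) * exp (- (1/4) * (norm (x::'a))\<^sup>2))"
    proof (intro AE_I2)
      fix x :: 'a
      have "std_gauss_density x * \<bar>f x\<bar> \<le> std_gauss_density x * (C * exp (1/4 * (norm x)\<^sup>2))"
        using C[of x] std_gauss_density_pos[of x] by (intro mult_left_mono) auto
      also have "\<dots> = C / sqrt (2 * pi) ^ DIM('a) * (exp (- (norm x)\<^sup>2 / 2) * exp (1/4 * (norm x)\<^sup>2))"
        by (simp add: std_gauss_density_def)
      also have "exp (- (norm x)\<^sup>2 / 2) * exp (1/4 * (norm x)\<^sup>2) = exp (- (1/4) * (norm x)\<^sup>2)"
        by (simp flip: exp_add)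
      finally have "std_gauss_density x * \<bar>f x\<bar> \<le> C / sqrt (2 * pi) ^ DIM('a) * exp (- (1/4) * (norm x)\<^sup>2)" .
      moreover have "norm (std_gauss_density x * f x) = std_gauss_density x * \<bar>f x\<bar>"
        unfolding real_norm_def abs_mult abs_of_pos[OF std_gauss_density_pos] ..
      ultimately show "norm (std_gauss_density x * f x) \<le> norm (C / sqrt (2 * pi) ^ DIM('a) * exp (- (1/4) * (norm x)\<^sup>2))"
        unfolding real_norm_def by linarith
    qed
  qed measurable
qed

lemma integrable_std_gauss:
  assumes f: "real_polynomial_function (f :: 'a::euclidean_space \<Rightarrow> real)"
  shows "integrable std_gauss f"
  unfolding std_gauss_def
  using integrable_polynomial_density[OF f] real_polynomial_function_borel_measurable[OF f]
    less_imp_le[OF std_gauss_density_pos]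
  by (subst integrable_density) auto

lemma integral_std_gauss:
  fixes f :: "'a::euclidean_space \<Rightarrow> real"
  assumes [measurable]: "f \<in> borel_measurable borel"
  shows "(\<integral>x. f x \<partial>std_gauss) = (\<integral>x. std_gauss_density (x::'a::euclidean_space) * f x \<partial>lborel)"
  unfolding std_gauss_def using less_imp_le[OF std_gauss_density_pos]
  by (subst integral_density) auto

lemma integral_lborel_translation:
  fixes h :: "'a::euclidean_space \<Rightarrow> real"
  assumes [measurable]: "h \<in> borel_measurable borel"
  shows "(\<integral>x. h (x + u) \<partial>lborel) = (\<integral>x. h x \<partial>lborel)"
    and "(\<integral>\<^sup>+x. ennreal \<bar>h (x + u)\<bar> \<partial>lborel) = (\<integral>\<^sup>+x. ennreal \<bar>h x\<bar> \<partial>lborel)"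
proof -
  have "(\<integral>x. h (x + u) \<partial>lborel) = (\<integral>x. h x \<partial>distr lborel borel ((+) u))"
    by (subst integral_distr) (auto simp: add.commute)
  then show "(\<integral>x. h (x + u) \<partial>lborel) = (\<integral>x. h x \<partial>lborel)" by (simp only: lborel_distr_plus)
  have "(\<integral>\<^sup>+x. ennreal \<bar>h (x + u)\<bar> \<partial>lborel) = (\<integral>\<^sup>+x. ennreal \<bar>h x\<bar> \<partial>distr lborel borel ((+) u))"
    by (subst nn_integral_distr) (auto simp: add.commute)
  then show "(\<integral>\<^sup>+x. ennreal \<bar>h (x + u)\<bar> \<partial>lborel) = (\<integral>\<^sup>+x. ennreal \<bar>h x\<bar> \<partial>lborel)" by (simp only: lborel_distr_plus)
qed

text \<open>By translation invariance \<open>h (x + u) - h x\<close> has integral zero; as an integral of the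
  derivative along the segment it also has, by Fubini, the integral of \<open>h'\<close>.\<close>

lemma integral_directional_derivative_eq_0:
  fixes h h' :: "'a::euclidean_space \<Rightarrow> real"
  assumes h: "integrable lborel h" and h': "integrable lborel h'" and cont: "continuous_on UNIV h'"
    and der: "\<And>x t. ((\<lambda>t. h (x + t *\<^sub>R u)) has_real_derivative h' (x + t *\<^sub>R u)) (at t)"
  shows "(\<integral>x. h' x \<partial>lborel) = 0"
proof -
  have [measurable]: "h' \<in> borel_measurable borel" using cont by (rule borel_measurable_continuous_onI)
  have [measurable]: "h \<in> borel_measurable borel" using h by simp
  define F where "F = (\<lambda>(t::real, x::'a). indicator {0..1} t * h' (x + t *\<^sub>R u))"
  have Fm[measurable]: "F \<in> borel_measurable (lborel \<Otimes>\<^sub>M lborel)" unfolding F_def by measurable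
  have nF: "(\<integral>\<^sup>+x. ennreal (norm (F (t, x))) \<partial>lborel) = indicator {0..1} t * (\<integral>\<^sup>+x. ennreal \<bar>h' x\<bar> \<partial>lborel)" for t
    using integral_lborel_translation(2)[of h' "t *\<^sub>R u"]
    by (auto simp: F_def indicator_def abs_mult)
  have Fi: "integrable (lborel \<Otimes>\<^sub>M lborel) F"
  proof (rule integrableI_bounded[OF Fm])
    have "(\<integral>\<^sup>+z. ennreal (norm (F z)) \<partial>(lborel \<Otimes>\<^sub>M lborel)) = (\<integral>\<^sup>+t. \<integral>\<^sup>+x. ennreal (norm (F (t, x))) \<partial>lborel \<partial>lborel)"
      by (rule lborel.nn_integral_fst[symmetric]) measurable
    also have "\<dots> = (\<integral>\<^sup>+x. ennreal \<bar>h' x\<bar> \<partial>lborel)"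
      unfolding nF by (subst nn_integral_multc) auto
    also have "\<dots> < \<infinity>" using h' by (simp add: integrable_iff_bounded)
    finally show "(\<integral>\<^sup>+z. ennreal (norm (F z)) \<partial>(lborel \<Otimes>\<^sub>M lborel)) < \<infinity>" .
  qed
  have "(\<integral>t. \<integral>x. F (t, x) \<partial>lborel \<partial>lborel) = (\<integral>x. \<integral>t. F (t, x) \<partial>lborel \<partial>lborel)"
    using lborel_pair.Fubini_integral[of "\<lambda>t x. F (t, x)"] Fi by simp
  moreover have "(\<integral>x. F (t, x) \<partial>lborel) = indicator {0..1} t * (\<integral>x. h' x \<partial>lborel)" for t
    using integral_lborel_translation(1)[of h' "t *\<^sub>R u"] by (simp add: F_def)
  moreover have "(\<integral>t. F (t, x) \<partial>lborel) = h (x + u) - h x" for x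
  proof -
    have "(\<integral>t. F (t, x) \<partial>lborel) = (\<integral>t. h' (x + t *\<^sub>R u) * indicator {0..1} t \<partial>lborel)"
      by (simp add: F_def mult.commute)
    also have "\<dots> = h (x + 1 *\<^sub>R u) - h (x + 0 *\<^sub>R u)"
    proof (rule integral_FTC_Icc_real)
      show "((\<lambda>t. h (x + t *\<^sub>R u)) has_real_derivative h' (x + t *\<^sub>R u)) (at t)" for t by (rule der)
      show "isCont (\<lambda>t. h' (x + t *\<^sub>R u)) t" for t
        using cont by (intro continuous_at_compose[unfolded o_def, of _ "\<lambda>t. x + t *\<^sub>R u" h'] continuous_intros)
          (auto simp: continuous_on_eq_continuous_at)
    qed simp
    finally show ?thesis by simp
  qed
  moreover have "(\<integral>x. h (x + u) - h x \<partial>lborel) = 0"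
  proof -
    have "integrable lborel (\<lambda>x. h (x + u))"
      using h integral_lborel_translation(2)[of h u] by (simp add: integrable_iff_bounded)
    then show ?thesis using h integral_lborel_translation(1)[of h u] by simp
  qed
  ultimately show ?thesis by simp
qed

lemma std_gauss_density_has_derivative:
  "((\<lambda>t. std_gauss_density (x + t *\<^sub>R u)) has_real_derivative
     - (u \<bullet> (x + t *\<^sub>R u)) * std_gauss_density (x + t *\<^sub>R u)) (at t)"
proof -
  have n: "(norm (x + t *\<^sub>R u))\<^sup>2 = (norm x)\<^sup>2 + 2 * t * (u \<bullet> x) + t\<^sup>2 * (norm u)\<^sup>2" for t
    unfolding power2_norm_eq_inner
    by (simp add: inner_add_left inner_add_right inner_commute power2_eq_square algebra_simps)
  show ?thesis unfolding std_gauss_density_def n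
    by (rule derivative_eq_intros refl | simp)+ (simp add: dot_square_norm inner_add_right field_simps)
qed

text \<open>The density times \<open>f\<close> has the directional derivative: density times
  \<open>f' - (u \<bullet> x) * f\<close>, and such a derivative integrates to zero. With
  polynomials integrability is automatic.\<close>

lemma std_gauss_integration_by_parts:
  fixes f f' :: "'a::euclidean_space \<Rightarrow> real"
  assumes f: "real_polynomial_function f" and f': "real_polynomial_function f'"
    and der: "\<And>x t. ((\<lambda>t. f (x + t *\<^sub>R u)) has_real_derivative f' (x + t *\<^sub>R u)) (at t)"
  shows "(\<integral>x. (u \<bullet> x) * f x \<partial>std_gauss) = (\<integral>x. f' x \<partial>std_gauss)"
proof -
  have lin: "real_polynomial_function (\<lambda>x::'a. u \<bullet> x)"
    by (intro real_polynomial_function.intros(1) bounded_linear_inner_right)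
  have uf: "real_polynomial_function (\<lambda>x. (u \<bullet> x) * f x)" by (intro real_polynomial_function.intros(4) lin f)
  have c: "continuous_on UNIV f" if "real_polynomial_function f" for f :: "'a \<Rightarrow> real"
    using that by (auto simp: continuous_on_eq_continuous_at continuous_real_polymonial_function)
  have "(\<integral>x. std_gauss_density x * f' x - std_gauss_density x * ((u \<bullet> x) * f x) \<partial>lborel) = 0"
  proof (rule integral_directional_derivative_eq_0)
    show "integrable lborel (\<lambda>x. std_gauss_density x * f x)" by (rule integrable_polynomial_density[OF f])
    show "integrable lborel (\<lambda>x. std_gauss_density x * f' x - std_gauss_density x * ((u \<bullet> x) * f x))"
      by (intro Bochner_Integration.integrable_diff integrable_polynomial_density f' uf)
    show "continuous_on UNIV (\<lambda>x. std_gauss_density x * f' x - std_gauss_density x * ((u \<bullet> x) * f x))"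
      unfolding std_gauss_density_def by (intro continuous_intros c f' f) auto
    show "((\<lambda>t. std_gauss_density (x + t *\<^sub>R u) * f (x + t *\<^sub>R u)) has_real_derivative
        std_gauss_density (x + t *\<^sub>R u) * f' (x + t *\<^sub>R u) - std_gauss_density (x + t *\<^sub>R u) * ((u \<bullet> (x + t *\<^sub>R u)) * f (x + t *\<^sub>R u))) (at t)" for x t
      by (rule DERIV_cong[OF DERIV_mult[OF std_gauss_density_has_derivative der]]) (simp add: algebra_simps)
  qed
  then have "(\<integral>x. std_gauss_density x * f' x \<partial>lborel) = (\<integral>x. std_gauss_density x * ((u \<bullet> x) * f x) \<partial>lborel)"
    by (simp add: integrable_polynomial_density f' uf)
  then show ?thesis
    by (simp add: integral_std_gauss real_polynomial_function_borel_measurable f' uf)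
qed

lemma real_polynomial_function_inner: "real_polynomial_function (\<lambda>x::'a::real_inner. u \<bullet> x)"
  by (intro real_polynomial_function.intros(1) bounded_linear_inner_right)

lemma measure_std_gauss_UNIV[simp]: "measure (std_gauss :: 'a::euclidean_space measure) UNIV = 1"
  using prob_space.prob_space[OF prob_space_std_gauss] by simp

lemma std_gauss_moment2: "(\<integral>x. (u \<bullet> x) * (w \<bullet> x) \<partial>std_gauss) = u \<bullet> (w::'a::euclidean_space)"
proof -
  have "(\<integral>x. (u \<bullet> x) * (w \<bullet> x) \<partial>std_gauss) = (\<integral>x. w \<bullet> u \<partial>(std_gauss :: 'a measure))"
  proof (rule std_gauss_integration_by_parts)
    show "((\<lambda>t. w \<bullet> (x + t *\<^sub>R u)) has_real_derivative w \<bullet> u) (at t)" for x t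
      unfolding inner_add_right inner_scaleR_right by (auto intro!: derivative_eq_intros)
  qed (auto intro: real_polynomial_function_inner real_polynomial_function.intros(2))
  then show ?thesis by (simp add: inner_commute)
qed

text \<open>Integration by parts with the cube of the linear form reduces the fourth moment to three
  times the second one.\<close>

lemma std_gauss_moment4: "(\<integral>x. (u \<bullet> x) ^ 4 \<partial>std_gauss) = 3 * (norm (u::'a::euclidean_space)) ^ 4"
proof -
  have p: "real_polynomial_function (\<lambda>x::'a. (u \<bullet> x) * (u \<bullet> x))"
    by (intro real_polynomial_function.intros(4) real_polynomial_function_inner)
  have "(\<integral>x. (u \<bullet> x) * ((u \<bullet> x) * ((u \<bullet> x) * (u \<bullet> x))) \<partial>std_gauss)
      = (\<integral>x. 3 * (u \<bullet> u) * ((u \<bullet> x) * (u \<bullet> x)) \<partial>(std_gauss :: 'a measure))"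
  proof (rule std_gauss_integration_by_parts)
    show "((\<lambda>t. (u \<bullet> (x + t *\<^sub>R u)) * ((u \<bullet> (x + t *\<^sub>R u)) * (u \<bullet> (x + t *\<^sub>R u)))) has_real_derivative
       3 * (u \<bullet> u) * ((u \<bullet> (x + t *\<^sub>R u)) * (u \<bullet> (x + t *\<^sub>R u)))) (at t)" for x t
    proof -
      have "((\<lambda>t. u \<bullet> (x + t *\<^sub>R u)) has_real_derivative u \<bullet> u) (at t)"
        unfolding inner_add_right inner_scaleR_right by (auto intro!: derivative_eq_intros)
      note d = this
      show ?thesis by (rule DERIV_cong[OF DERIV_mult[OF d DERIV_mult[OF d d]]]) (simp add: algebra_simps)
    qed
  qed (intro real_polynomial_function.intros p real_polynomial_function_inner)+
  also have "\<dots> = 3 * (u \<bullet> u) * (u \<bullet> u)" by (simp add: std_gauss_moment2)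
  finally show ?thesis by (simp add: power4_eq_xxxx power2_norm_eq_inner[symmetric] power2_eq_square mult.assoc)
qed

section \<open>Lower tail of nonnegative Gaussian quadratic forms\<close>

lemma psd_form_sum_squares:
  fixes a c :: "'i \<Rightarrow> 'a::euclidean_space"
  assumes "finite I" and pos: "\<And>v. 0 \<le> (\<Sum>i\<in>I. (a i \<bullet> v) * (c i \<bullet> v))"
  obtains u :: "'a \<Rightarrow> 'a" where "\<And>v. (\<Sum>i\<in>I. (a i \<bullet> v) * (c i \<bullet> v)) = (\<Sum>k\<in>Basis. (u k \<bullet> v)\<^sup>2)"
proof -
  \<comment> \<open>The symmetrized coefficient matrix in the standard basis. The form depends only
    on it, and a nonnegative form then has a Gram factorization.\<close>
  define m where "m b b' = (\<Sum>i\<in>I. (a i \<bullet> b) * (c i \<bullet> b') + (a i \<bullet> b') * (c i \<bullet> b)) / 2" for b b'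
  have m: "(\<Sum>b\<in>Basis. \<Sum>b'\<in>Basis. x b * m b b' * x b') = (\<Sum>i\<in>I. (a i \<bullet> v) * (c i \<bullet> v))"
    if v: "v = (\<Sum>b\<in>Basis. x b *\<^sub>R b)" for x v
  proof -
    have e: "(\<Sum>b\<in>Basis. x b * (w \<bullet> b)) = w \<bullet> v" for w by (simp add: v inner_sum_right)
    have "(\<Sum>b\<in>Basis. \<Sum>b'\<in>Basis. x b * m b b' * x b')
        = (\<Sum>b\<in>Basis. \<Sum>b'\<in>Basis. \<Sum>i\<in>I. ((x b * (a i \<bullet> b)) * (x b' * (c i \<bullet> b')) + (x b' * (a i \<bullet> b')) * (x b * (c i \<bullet> b))) / 2)"
      unfolding m_def by (simp add: sum_distrib_left sum_distrib_right sum_divide_distrib algebra_simps)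
    also have "\<dots> = (\<Sum>b\<in>Basis. \<Sum>i\<in>I. \<Sum>b'\<in>Basis. ((x b * (a i \<bullet> b)) * (x b' * (c i \<bullet> b')) + (x b' * (a i \<bullet> b')) * (x b * (c i \<bullet> b))) / 2)"
      by (intro sum.cong refl sum.swap)
    also have "\<dots> = (\<Sum>b\<in>Basis. \<Sum>i\<in>I. ((x b * (a i \<bullet> b)) * (c i \<bullet> v) + (a i \<bullet> v) * (x b * (c i \<bullet> b))) / 2)"
      by (simp only: sum_divide_distrib[symmetric] sum.distrib sum_distrib_left[symmetric] sum_distrib_right[symmetric] e)
    also have "\<dots> = (\<Sum>i\<in>I. \<Sum>b\<in>Basis. ((x b * (a i \<bullet> b)) * (c i \<bullet> v) + (a i \<bullet> v) * (x b * (c i \<bullet> b))) / 2)"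
      by (rule sum.swap)
    also have "\<dots> = (\<Sum>i\<in>I. (a i \<bullet> v) * (c i \<bullet> v))"
      by (simp only: sum_divide_distrib[symmetric] sum.distrib sum_distrib_left[symmetric] sum_distrib_right[symmetric] e) simp
    finally show ?thesis .
  qed
  have pm: "psd_on (Basis :: 'a set) m"
    unfolding psd_on_def
  proof (intro conjI ballI allI)
    fix b b' show "m b b' = m b' b" by (simp add: m_def add.commute)
  next
    fix x show "0 \<le> (\<Sum>b\<in>Basis. \<Sum>b'\<in>Basis. x b * m b b' * x b')" unfolding m[OF refl] by (rule pos)
  qed
  obtain w :: "'a \<Rightarrow> 'a \<Rightarrow> real" where w: "\<forall>b\<in>Basis. \<forall>b'\<in>Basis. m b b' = (\<Sum>k\<in>Basis. w k b * w k b')"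
    using psd_on_factor[OF finite_Basis pm] by blast
  define u where "u k = (\<Sum>b\<in>Basis. w k b *\<^sub>R b)" for k :: 'a
  have "(\<Sum>i\<in>I. (a i \<bullet> v) * (c i \<bullet> v)) = (\<Sum>k\<in>Basis. (u k \<bullet> v)\<^sup>2)" for v
  proof -
    have "(\<Sum>i\<in>I. (a i \<bullet> v) * (c i \<bullet> v)) = (\<Sum>b\<in>Basis. \<Sum>b'\<in>Basis. (v \<bullet> b) * m b b' * (v \<bullet> b'))"
      by (rule m[symmetric]) (simp add: euclidean_representation)
    also have "\<dots> = (\<Sum>b\<in>Basis. \<Sum>b'\<in>Basis. \<Sum>k\<in>Basis. (w k b * (v \<bullet> b)) * (w k b' * (v \<bullet> b')))"
      by (intro sum.cong refl) (simp add: w sum_distrib_left sum_distrib_right mult_ac)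
    also have "\<dots> = (\<Sum>b\<in>Basis. \<Sum>k\<in>Basis. \<Sum>b'\<in>Basis. (w k b * (v \<bullet> b)) * (w k b' * (v \<bullet> b')))"
      by (intro sum.cong refl sum.swap)
    also have "\<dots> = (\<Sum>k\<in>Basis. \<Sum>b\<in>Basis. \<Sum>b'\<in>Basis. (w k b * (v \<bullet> b)) * (w k b' * (v \<bullet> b')))"
      by (rule sum.swap)
    also have "\<dots> = (\<Sum>k\<in>Basis. (u k \<bullet> v)\<^sup>2)"
      by (intro sum.cong refl) (simp add: u_def inner_sum_left power2_eq_square sum_product inner_commute[of v])
    finally show ?thesis .
  qed
  then show ?thesis by (rule that)
qed

text \<open>The Paley-Zygmund argument: \<open>q \<le> s/4 + q\<^sup>2/(8 s) + 2 s 1{q \<ge> s/4}\<close> pointwise, where \<open>s\<close> is the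
  mean of \<open>q\<close>, and the second moment of \<open>q\<close> is at most \<open>3 s\<^sup>2\<close>.\<close>

lemma std_gauss_psd_form_lower_tail:
  fixes a c :: "'i \<Rightarrow> 'a::euclidean_space"
  assumes "finite I" and pos: "\<And>v. 0 \<le> (\<Sum>i\<in>I. (a i \<bullet> v) * (c i \<bullet> v))"
    and s: "0 < (\<Sum>i\<in>I. a i \<bullet> c i)"
  shows "3/16 \<le> measure std_gauss {v. (\<Sum>i\<in>I. a i \<bullet> c i) / 4 \<le> (\<Sum>i\<in>I. (a i \<bullet> v) * (c i \<bullet> v))}"
proof -
  interpret prob_space "std_gauss :: 'a measure" by (rule prob_space_std_gauss)
  define q where "q v = (\<Sum>i\<in>I. (a i \<bullet> v) * (c i \<bullet> v))" for v
  define s where "s = (\<Sum>i\<in>I. a i \<bullet> c i)"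
  obtain u :: "'a \<Rightarrow> 'a" where u: "\<And>v. q v = (\<Sum>k\<in>Basis. (u k \<bullet> v)\<^sup>2)"
    using psd_form_sum_squares[OF assms(1,2)] unfolding q_def by metis
  have pq2: "real_polynomial_function (\<lambda>v. (u k \<bullet> v)\<^sup>2)" for k
    unfolding power2_eq_square by (intro real_polynomial_function.intros(4) real_polynomial_function_inner)
  have pq: "real_polynomial_function q"
    unfolding u by (intro real_polynomial_function_sum finite_Basis pq2)
  have pqq: "real_polynomial_function (\<lambda>v. (q v)\<^sup>2)"
    unfolding power2_eq_square by (intro real_polynomial_function.intros(4) pq)
  have qm[measurable]: "q \<in> borel_measurable borel" by (rule real_polynomial_function_borel_measurable[OF pq])
  have "(\<integral>v. q v \<partial>std_gauss) = (\<Sum>i\<in>I. \<integral>v. (a i \<bullet> v) * (c i \<bullet> v) \<partial>std_gauss)"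
    unfolding q_def by (intro Bochner_Integration.integral_sum integrable_std_gauss
        real_polynomial_function.intros(4) real_polynomial_function_inner)
  then have Eq: "(\<integral>v. q v \<partial>std_gauss) = s" by (simp add: std_gauss_moment2 s_def)
  have "(\<integral>v. q v \<partial>std_gauss) = (\<Sum>k\<in>Basis. \<integral>v. (u k \<bullet> v)\<^sup>2 \<partial>std_gauss)"
    unfolding u by (intro Bochner_Integration.integral_sum integrable_std_gauss pq2)
  then have su: "s = (\<Sum>k\<in>Basis. (norm (u k))\<^sup>2)"
    by (simp add: Eq power2_eq_square std_gauss_moment2 power2_norm_eq_inner[symmetric])
  have E4: "(\<integral>v. (u k \<bullet> v)\<^sup>2 * (u l \<bullet> v)\<^sup>2 \<partial>std_gauss) \<le> 3 * ((norm (u k))\<^sup>2 * (norm (u l))\<^sup>2)" for k l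
  proof (cases "u k = 0 \<or> u l = 0")
    case False
    \<comment> \<open>The weight that balances the two lengths in
      \<open>2 * x * y \<le> r * x\<^sup>2 + y\<^sup>2 / r\<close>; mixed moments are thereby
      reduced to fourth moments of single linear forms.\<close>
    define r where "r = (norm (u l))\<^sup>2 / (norm (u k))\<^sup>2"
    have r: "0 < r" using False by (simp add: r_def)
    have p4: "real_polynomial_function (\<lambda>v. (u k \<bullet> v) ^ 4)" for k
      using real_polynomial_function.intros(4)[OF pq2[of k] pq2[of k]] by (simp add: power_add[symmetric])
    have "(\<integral>v. (u k \<bullet> v)\<^sup>2 * (u l \<bullet> v)\<^sup>2 \<partial>std_gauss) \<le> (\<integral>v. r / 2 * (u k \<bullet> v) ^ 4 + 1 / (2 * r) * (u l \<bullet> v) ^ 4 \<partial>std_gauss)"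
    proof (rule integral_mono)
      show "integrable std_gauss (\<lambda>v. (u k \<bullet> v)\<^sup>2 * (u l \<bullet> v)\<^sup>2)"
        by (intro integrable_std_gauss real_polynomial_function.intros(4) pq2)
      show "integrable std_gauss (\<lambda>v. r / 2 * (u k \<bullet> v) ^ 4 + 1 / (2 * r) * (u l \<bullet> v) ^ 4)"
        by (intro integrable_std_gauss real_polynomial_function.intros(2-4) p4)
      fix v
      have "0 \<le> (r * (u k \<bullet> v)\<^sup>2 - (u l \<bullet> v)\<^sup>2)\<^sup>2 / (2 * r)" using r by simp
      also have "\<dots> = r / 2 * (u k \<bullet> v) ^ 4 + 1 / (2 * r) * (u l \<bullet> v) ^ 4 - (u k \<bullet> v)\<^sup>2 * (u l \<bullet> v)\<^sup>2"
        using r by (simp add: field_simps power2_eq_square power4_eq_xxxx)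
      finally show "(u k \<bullet> v)\<^sup>2 * (u l \<bullet> v)\<^sup>2 \<le> r / 2 * (u k \<bullet> v) ^ 4 + 1 / (2 * r) * (u l \<bullet> v) ^ 4" by simp
    qed
    also have "\<dots> = r / 2 * (3 * norm (u k) ^ 4) + 1 / (2 * r) * (3 * norm (u l) ^ 4)"
      using integrable_std_gauss[OF p4] by (simp add: std_gauss_moment4)
    also have "\<dots> = 3 * ((norm (u k))\<^sup>2 * (norm (u l))\<^sup>2)"
      using False by (simp add: r_def field_simps power2_eq_square power4_eq_xxxx)
    finally show ?thesis .
  qed auto
  have "(\<integral>v. (q v)\<^sup>2 \<partial>std_gauss) = (\<Sum>k\<in>Basis. \<Sum>l\<in>Basis. \<integral>v. (u k \<bullet> v)\<^sup>2 * (u l \<bullet> v)\<^sup>2 \<partial>std_gauss)"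
  proof -
    have "(q v)\<^sup>2 = (\<Sum>k\<in>Basis. \<Sum>l\<in>Basis. (u k \<bullet> v)\<^sup>2 * (u l \<bullet> v)\<^sup>2)" for v
      by (subst power2_eq_square) (simp only: u sum_product)
    moreover have "integrable std_gauss (\<lambda>v. (u k \<bullet> v)\<^sup>2 * (u l \<bullet> v)\<^sup>2)" for k l
      by (intro integrable_std_gauss real_polynomial_function.intros(4) pq2)
    ultimately show ?thesis by (simp add: Bochner_Integration.integral_sum)
  qed
  also have "\<dots> \<le> (\<Sum>k\<in>Basis. \<Sum>l\<in>Basis. 3 * ((norm (u k))\<^sup>2 * (norm (u l))\<^sup>2))"
    by (intro sum_mono E4)
  also have "\<dots> = 3 * s\<^sup>2" 
    unfolding su power2_eq_square[of "sum _ _"] sum_product by (simp only: sum_distrib_left)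
  finally have Eqq: "(\<integral>v. (q v)\<^sup>2 \<partial>std_gauss) \<le> 3 * s\<^sup>2" .
  define E where "E = {v. s / 4 \<le> q v}"
  have Em: "E \<in> sets std_gauss" unfolding E_def by simp
  have s0: "0 < s" using s by (simp add: s_def)
  have "s = (\<integral>v. q v \<partial>std_gauss)" by (simp add: Eq)
  also have "\<dots> \<le> (\<integral>v. s / 4 + 1 / (8 * s) * (q v)\<^sup>2 + 2 * s * indicator E v \<partial>std_gauss)"
  proof (rule integral_mono)
    show "integrable std_gauss q" by (rule integrable_std_gauss[OF pq])
    show "integrable std_gauss (\<lambda>v. s / 4 + 1 / (8 * s) * (q v)\<^sup>2 + 2 * s * indicator E v)"
      using Em by (intro Bochner_Integration.integrable_add integrable_mult_right integrable_std_gauss[OF pqq] integrable_real_indicator)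
        (auto simp: emeasure_eq_measure)
    fix v
    show "q v \<le> s / 4 + 1 / (8 * s) * (q v)\<^sup>2 + 2 * s * indicator E v"
    proof (cases "v \<in> E")
      case True
      have "0 \<le> (q v - 4 * s)\<^sup>2 / (8 * s)" using s0 by simp
      also have "\<dots> = 1 / (8 * s) * (q v)\<^sup>2 + 2 * s - q v" using s0 by (simp add: field_simps power2_eq_square)
      finally show ?thesis using True s0 by simp
    next
      case False
      moreover have "0 \<le> 1 / (8 * s) * (q v)\<^sup>2" using s0 by simp
      ultimately show ?thesis by (simp add: E_def del: times_divide_eq_left)
    qed
  qed
  also have "\<dots> = s / 4 + 1 / (8 * s) * (\<integral>v. (q v)\<^sup>2 \<partial>std_gauss) + 2 * s * measure std_gauss E"
    using Em integrable_std_gauss[OF pqq] by (simp add: emeasure_eq_measure)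
  also have "\<dots> \<le> s / 4 + 1 / (8 * s) * (3 * s\<^sup>2) + 2 * s * measure std_gauss E"
    using Eqq s0 by (intro add_mono mult_left_mono) auto
  \<comment> \<open>Here 5/8 is 1/4 + 3/8. The remaining 3/8 must come from the event, which is
    counted twice; hence the probability 3/16.\<close>
  also have "\<dots> = s * (5/8 + 2 * measure std_gauss E)" using s0 by (simp add: field_simps power2_eq_square)
  finally have "1 \<le> 5/8 + 2 * measure std_gauss E" using s0 by simp
  then show ?thesis by (simp add: E_def q_def s_def)
qed

section \<open>Trace moments and the tail of a Gaussian matrix series\<close>

context
  fixes I :: "'i set" and A :: "'a::euclidean_space \<Rightarrow> 'i \<Rightarrow> 'i \<Rightarrow> real" and \<sigma> :: real
  assumes fin: "finite I" and sym: "\<And>b. b \<in> Basis \<Longrightarrow> ker_sym I (A b)"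
    and var: "\<And>v. (\<Sum>b\<in>Basis. \<Sum>i\<in>I. (ker_apply I (A b) v i)\<^sup>2) \<le> \<sigma> * (\<Sum>i\<in>I. (v i)\<^sup>2)"
begin

text \<open>A Gaussian combination of the symmetric matrices \<open>A b\<close>. The hypothesis
  \<open>var\<close> says that the sum of their squares is at most \<sigma> times the identity, so
  \<sigma> is a variance and not a standard deviation.\<close>

private abbreviation "X z \<equiv> (\<lambda>i j. \<Sum>b\<in>Basis. (b \<bullet> z) * A b i j)"

private lemma symX: "ker_sym I (X z)"
  using sym unfolding ker_sym_def by (auto intro!: sum.cong sum.neutral)

private lemma poly_mult:
  assumes "\<And>i j. real_polynomial_function (\<lambda>z. U z i j)" "\<And>i j. real_polynomial_function (\<lambda>z. V z i j)"
  shows "real_polynomial_function (\<lambda>z. ker_mult I (U z) (V z) i j)"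
  unfolding ker_mult_def by (intro real_polynomial_function_sum fin real_polynomial_function.intros(4) assms)

private lemma poly_trace:
  assumes "\<And>i j. real_polynomial_function (\<lambda>z. U z i j)"
  shows "real_polynomial_function (\<lambda>z. ker_trace I (U z))"
  unfolding ker_trace_def by (intro real_polynomial_function_sum fin assms)

private lemma poly_X: "real_polynomial_function (\<lambda>z. X z i j)"
  by (intro real_polynomial_function_sum finite_Basis real_polynomial_function.intros(2,4) real_polynomial_function_inner)

private lemma poly_power: "real_polynomial_function (\<lambda>z. ker_power I (X z) n i j)"
proof (induction n arbitrary: i j)
  case 0 then show ?case by (simp add: real_polynomial_function.intros(2))
next
  case (Suc n) show ?case unfolding ker_power.simps by (intro poly_mult poly_X Suc)
qed

private lemma deriv_mult:
  assumes "\<And>i j. ((\<lambda>t. U t i j) has_real_derivative U' i j) (at t)" "\<And>i j. ((\<lambda>t. V t i j) has_real_derivative V' i j) (at t)"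
  shows "((\<lambda>t. ker_mult I (U t) (V t) i j) has_real_derivative (ker_mult I U' (V t) i j + ker_mult I (U t) V' i j)) (at t)"
proof -
  have "((\<lambda>t. \<Sum>k\<in>I. U t i k * V t k j) has_real_derivative (\<Sum>k\<in>I. U' i k * V t k j + V' k j * U t i k)) (at t)"
    by (intro DERIV_sum DERIV_mult assms)
  then show ?thesis by (simp add: ker_mult_def sum.distrib mult.commute)
qed

private lemma deriv_X:
  assumes "b \<in> Basis"
  shows "((\<lambda>t. X (x + t *\<^sub>R b) i j) has_real_derivative A b i j) (at t)"
proof -
  have "((\<lambda>t. \<Sum>c\<in>Basis. (c \<bullet> (x + t *\<^sub>R b)) * A c i j) has_real_derivative (\<Sum>c\<in>Basis. (c \<bullet> b) * A c i j)) (at t)"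
    unfolding inner_add_right inner_scaleR_right by (intro DERIV_sum) (auto intro!: derivative_eq_intros)
  also have "(\<Sum>c\<in>Basis. (c \<bullet> b) * A c i j) = (\<Sum>c\<in>Basis. if c = b then A b i j else 0)"
    using assms by (intro sum.cong) (auto simp: inner_Basis)
  finally show ?thesis using assms by simp
qed

text \<open>The factors do not commute, so the derivative of a power is the sum over the position
  \<open>q\<close> of the differentiated factor.\<close>

private lemma deriv_power:
  assumes b: "b \<in> Basis"
  shows "((\<lambda>t. ker_power I (X (x + t *\<^sub>R b)) n i j) has_real_derivative
    (\<Sum>q<n. ker_mult I (ker_power I (X (x + t *\<^sub>R b)) q) (ker_mult I (A b) (ker_power I (X (x + t *\<^sub>R b)) (n - Suc q))) i j)) (at t)"
proof (induction n arbitrary: i j)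
  case 0 then show ?case by simp
next
  case (Suc n)
  let ?Y = "X (x + t *\<^sub>R b)"
  let ?M = "ker_mult I"
  have s: "(\<Sum>q<Suc n. ?M (ker_power I ?Y q) (?M (A b) (ker_power I ?Y (Suc n - Suc q))) i j)
    = ?M (A b) (ker_power I ?Y n) i j + ?M ?Y (\<lambda>i j. \<Sum>q<n. ?M (ker_power I ?Y q) (?M (A b) (ker_power I ?Y (n - Suc q))) i j) i j"
  proof -
    have 1: "?M (ker_power I ?Y 0) (?M (A b) (ker_power I ?Y n)) = ?M (A b) (ker_power I ?Y n)"
      unfolding ker_mult_assoc[symmetric] by (simp only: ker_mult_one(2)[OF fin sym[OF b]])
    have 2: "?M ?Y (\<lambda>i j. \<Sum>q<n. F q i j) i j = (\<Sum>q<n. ?M ?Y (F q) i j)" for F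
      unfolding ker_mult_def sum_distrib_left by (rule sum.swap)
    show ?thesis
      unfolding sum.lessThan_Suc_shift 2 by (simp only: 1 diff_Suc_Suc diff_zero ker_power.simps(2) ker_mult_assoc)
  qed
  show ?case unfolding s ker_power.simps by (rule deriv_mult[OF deriv_X[OF b] Suc])
qed

text \<open>One factor \<open>X z\<close> is expanded and integrated by parts coordinate by
  coordinate. This produces, for each \<open>b\<close>, the \<open>2 * m + 1\<close> traces tr(A X^q
  A X^(2m-q)) with \<open>A = A b\<close>; each is at most the squared Frobenius norm of A X^m.
  Summed over \<open>b\<close>, these norms are at most \<sigma> times the trace of X^(2m).\<close>

private lemma trace_step: 
  "(\<integral>z. ker_trace I (ker_power I (X z) (2 * Suc m)) \<partial>std_gauss)
    \<le> (2 * real m + 1) * \<sigma> * (\<integral>z. ker_trace I (ker_power I (X z) (2 * m)) \<partial>std_gauss)"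
proof -
  let ?M = "ker_mult I" and ?P = "\<lambda>z. ker_power I (X z)"
  have pow_split: "ker_trace I (?P z (2 * Suc m)) = (\<Sum>b\<in>Basis. (b \<bullet> z) * ker_trace I (?M (A b) (?P z (2 * m + 1))))" for z
  proof -
    have "ker_trace I (?P z (2 * Suc m)) = (\<Sum>i\<in>I. \<Sum>k\<in>I. \<Sum>b\<in>Basis. (b \<bullet> z) * (A b i k * ?P z (2 * m + 1) k i))"
      by (simp add: ker_trace_def ker_mult_def[of I "X z" "ker_mult I (X z) _"] sum_distrib_right mult.assoc)
    also have "\<dots> = (\<Sum>i\<in>I. \<Sum>b\<in>Basis. \<Sum>k\<in>I. (b \<bullet> z) * (A b i k * ?P z (2 * m + 1) k i))"
      by (intro sum.cong refl sum.swap)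
    also have "\<dots> = (\<Sum>b\<in>Basis. \<Sum>i\<in>I. \<Sum>k\<in>I. (b \<bullet> z) * (A b i k * ?P z (2 * m + 1) k i))" by (rule sum.swap)
    finally show ?thesis by (simp only: ker_trace_def ker_mult_def sum_distrib_left)
  qed
  define f where "f b z = ker_trace I (?M (A b) (?P z (2 * m + 1)))" for b z
  define g where "g b z = (\<Sum>q<2 * m + 1. ker_trace I (?M (A b) (?M (?P z q) (?M (A b) (?P z (2 * m - q))))))" for b z
  define h where "h b z = (\<Sum>i\<in>I. \<Sum>j\<in>I. (?M (A b) (?P z m) j i)\<^sup>2)" for b z
  have pA: "real_polynomial_function (\<lambda>z::'a. A b i j)" for b i j by (rule real_polynomial_function.intros(2))
  have pf: "real_polynomial_function (f b)" for b
    unfolding f_def by (intro poly_trace poly_mult poly_power pA)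
  have pg: "real_polynomial_function (g b)" for b
    unfolding g_def by (intro real_polynomial_function_sum finite_lessThan poly_trace poly_mult poly_power pA)
  have ph: "real_polynomial_function (h b)" for b
    unfolding h_def power2_eq_square by (intro real_polynomial_function_sum fin real_polynomial_function.intros(4) poly_mult poly_power pA)
  have pt: "real_polynomial_function (\<lambda>z. ker_trace I (?P z n))" for n by (intro poly_trace poly_power)
  have ibp: "(\<integral>z. (b \<bullet> z) * f b z \<partial>std_gauss) = (\<integral>z. g b z \<partial>std_gauss)" if b: "b \<in> Basis" for b
  proof (rule std_gauss_integration_by_parts[OF pf pg])
    fix x t
    let ?Y = "X (x + t *\<^sub>R b)"
    have "((\<lambda>t. \<Sum>i\<in>I. ker_mult I (A b) (?P (x + t *\<^sub>R b) (2 * m + 1)) i i) has_real_derivative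
      (\<Sum>i\<in>I. ker_mult I (\<lambda>i j. 0) (ker_power I ?Y (2 * m + 1)) i i + ker_mult I (A b) (\<lambda>i j. \<Sum>q<2 * m + 1.
         ?M (ker_power I ?Y q) (?M (A b) (ker_power I ?Y (2 * m + 1 - Suc q))) i j) i i)) (at t)"
      by (intro DERIV_sum deriv_mult deriv_power[OF b] DERIV_const)
    also have "(\<Sum>i\<in>I. ker_mult I (\<lambda>i j. 0) (ker_power I ?Y (2 * m + 1)) i i + ker_mult I (A b) (\<lambda>i j. \<Sum>q<2 * m + 1.
         ?M (ker_power I ?Y q) (?M (A b) (ker_power I ?Y (2 * m + 1 - Suc q))) i j) i i) = g b (x + t *\<^sub>R b)"
    proof -
      have 2: "?M Y (\<lambda>i j. \<Sum>q<n. F q i j) i j = (\<Sum>q<n. ?M Y (F q) i j)" for F n Y i j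
        unfolding ker_mult_def sum_distrib_left by (rule sum.swap)
      have 0: "?M (\<lambda>i j. 0) Y i j = 0" for Y i j by (simp add: ker_mult_def)
      show ?thesis unfolding 2 0 g_def ker_trace_def add_0 by (subst sum.swap) simp
    qed
    finally show "((\<lambda>t. f b (x + t *\<^sub>R b)) has_real_derivative g b (x + t *\<^sub>R b)) (at t)"
      unfolding f_def ker_trace_def .
  qed
  have gh: "g b z \<le> (2 * m + 1) * h b z" if b: "b \<in> Basis" for b z
  proof -
    have "g b z \<le> (\<Sum>q<2 * m + 1. h b z)"
      unfolding g_def h_def
      by (intro sum_mono ker_trace_sandwich_le[OF fin sym[OF b] symX]) auto
    then show ?thesis by simp
  qed
  have hs: "(\<Sum>b\<in>Basis. h b z) \<le> \<sigma> * ker_trace I (?P z (2 * m))" for z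
  proof -
    \<comment> \<open>The hypothesis \<open>var\<close> is applied to each column of the m-th
      power.\<close>
    have "(\<Sum>b\<in>Basis. h b z) = (\<Sum>i\<in>I. \<Sum>b\<in>Basis. \<Sum>j\<in>I. (ker_apply I (A b) (\<lambda>k. ?P z m k i) j)\<^sup>2)"
      unfolding h_def ker_mult_def ker_apply_def by (rule sum.swap)
    also have "\<dots> \<le> (\<Sum>i\<in>I. \<sigma> * (\<Sum>k\<in>I. (?P z m k i)\<^sup>2))" by (intro sum_mono var)
    also have "\<dots> = \<sigma> * ker_trace I (?P z (2 * m))"
      by (simp only: ker_trace_power_even[OF fin symX] sum_distrib_left)
    finally show ?thesis .
  qed
  have "(\<integral>z. ker_trace I (?P z (2 * Suc m)) \<partial>std_gauss) = (\<Sum>b\<in>Basis. \<integral>z. (b \<bullet> z) * f b z \<partial>std_gauss)"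
    unfolding pow_split f_def[symmetric]
    by (intro Bochner_Integration.integral_sum integrable_std_gauss real_polynomial_function.intros(4) pf real_polynomial_function_inner)
  also have "\<dots> = (\<Sum>b\<in>Basis. \<integral>z. g b z \<partial>std_gauss)" by (intro sum.cong refl ibp)
  also have "\<dots> \<le> (\<Sum>b\<in>Basis. \<integral>z. (2 * m + 1) * h b z \<partial>std_gauss)"
    by (intro sum_mono integral_mono integrable_std_gauss pg gh integrable_mult_right ph)
  also have "\<dots> = (2 * m + 1) * (\<integral>z. (\<Sum>b\<in>Basis. h b z) \<partial>std_gauss)"
    by (subst Bochner_Integration.integral_sum) (auto intro!: integrable_std_gauss ph simp: sum_distrib_left)
  also have "\<dots> \<le> (2 * m + 1) * (\<integral>z. \<sigma> * ker_trace I (?P z (2 * m)) \<partial>std_gauss)"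
    by (intro mult_left_mono integral_mono integrable_std_gauss real_polynomial_function_sum finite_Basis ph hs integrable_mult_right pt) auto
  also have "\<dots> = (2 * real m + 1) * \<sigma> * (\<integral>z. ker_trace I (?P z (2 * m)) \<partial>std_gauss)"
    by (simp only: integral_mult_right_zero mult.assoc of_nat_add of_nat_mult of_nat_numeral of_nat_1)
  finally show ?thesis .
qed

text \<open>The quotient of factorials is the product of the odd numbers below \<open>2 * m\<close>,
  that is, the moment of order \<open>2 * m\<close> of a standard normal variable;
  \<open>trace_step\<close> contributes one odd factor at a time.\<close>

private lemma trace_moment:
  "(\<integral>z. ker_trace I (ker_power I (X z) (2 * m)) \<partial>std_gauss) \<le> card I * \<sigma> ^ m * fact (2 * m) / (2 ^ m * fact m)"
  if "0 \<le> \<sigma>"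
proof (induction m)
  case 0 then show ?case using fin by (simp add: ker_trace_def)
next
  case (Suc m)
  have "(\<integral>z. ker_trace I (ker_power I (X z) (2 * Suc m)) \<partial>std_gauss)
      \<le> (2 * real m + 1) * \<sigma> * (card I * \<sigma> ^ m * fact (2 * m) / (2 ^ m * fact m))"
  proof -
    have "0 \<le> (2 * real m + 1) * \<sigma>" using that by (intro mult_nonneg_nonneg) auto
    from order_trans[OF trace_step mult_left_mono[OF Suc this]] show ?thesis .
  qed
  also have "\<dots> = card I * \<sigma> ^ Suc m * fact (2 * Suc m) / (2 ^ Suc m * fact (Suc m))"
    by (simp add: divide_simps)
  finally show ?case .
qed

text \<open>Summing the moment bounds against \<open>t\<^sup>2\<^sup>p/(2p)!\<close> gives the bound
  \<open>card I exp(t\<^sup>2/2) / cosh(t\<^sup>2)\<close> for the probability.\<close>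

lemma std_gauss_series_tail:
  fixes t :: real
  defines "E \<equiv> {z. \<exists>v. t\<^sup>2 * \<sigma> * (\<Sum>i\<in>I. (v i)\<^sup>2) < (\<Sum>i\<in>I. (ker_apply I (\<lambda>i j. \<Sum>b\<in>Basis. (b \<bullet> z) * A b i j) v i)\<^sup>2)}"
  assumes \<sigma>: "0 \<le> \<sigma>"
  shows "E \<in> sets borel" and "measure std_gauss E \<le> 2 * card I * exp (- t\<^sup>2 / 2)"
proof -
  \<comment> \<open>Measurability in spite of the unrestricted quantifier over \<open>v\<close>: the
    complement is an intersection of closed sets.\<close>
  have "closed {z. \<forall>v. (\<Sum>i\<in>I. (ker_apply I (X z) v i)\<^sup>2) \<le> t\<^sup>2 * \<sigma> * (\<Sum>i\<in>I. (v i)\<^sup>2)}"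
    unfolding ker_apply_def by (intro closed_Collect_all closed_Collect_le continuous_intros)
  also have "{z. \<forall>v. (\<Sum>i\<in>I. (ker_apply I (X z) v i)\<^sup>2) \<le> t\<^sup>2 * \<sigma> * (\<Sum>i\<in>I. (v i)\<^sup>2)} = - E"
    by (simp add: E_def Collect_neg_eq[symmetric] not_less)
  finally show Em: "E \<in> sets borel" by (simp add: borel_open open_closed)
  interpret prob_space "std_gauss :: 'a measure" by (rule prob_space_std_gauss)
  show "measure std_gauss E \<le> 2 * card I * exp (- t\<^sup>2 / 2)"
  \<comment> \<open>The moment bounds will be divided by powers of \<sigma>. For \<sigma> = 0 all
    the matrices vanish on \<open>I\<close>, and the event is empty.\<close>
  proof (cases "\<sigma> = 0")
    case True
    have "A b i j = 0" if "b \<in> Basis" "i \<in> I" "j \<in> I" for b i j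
    proof -
      let ?v = "\<lambda>k. if k = j then 1 else 0::real"
      have "(\<Sum>b\<in>Basis. \<Sum>i\<in>I. (ker_apply I (A b) ?v i)\<^sup>2) \<le> 0" using var[of ?v] True by simp
      then have "(\<Sum>b\<in>Basis. \<Sum>i\<in>I. (ker_apply I (A b) ?v i)\<^sup>2) = 0"
        by (intro order_antisym sum_nonneg) auto
      then have "\<forall>b\<in>Basis. (\<Sum>i\<in>I. (ker_apply I (A b) ?v i)\<^sup>2) = 0"
        by (subst (asm) sum_nonneg_eq_0_iff) (auto intro: sum_nonneg)
      then have "\<forall>i\<in>I. (ker_apply I (A b) ?v i)\<^sup>2 = 0" using that fin
        by (subst (asm) sum_nonneg_eq_0_iff) auto
      then have "ker_apply I (A b) ?v i = 0" using that by auto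
      moreover have "ker_apply I (A b) ?v i = A b i j"
        using fin that by (simp add: ker_apply_def if_distrib[of "\<lambda>z. _ * z"] cong: if_cong)
      ultimately show ?thesis by simp
    qed
    then have "ker_apply I (X z) v i = 0" if "i \<in> I" for z v i
      using that by (simp add: ker_apply_def)
    then have "E = {}" using True by (simp add: E_def)
    then show ?thesis by simp
  next
    case False
    then have s: "0 < \<sigma>" using \<sigma> by simp
    \<comment> \<open>Markov's inequality for the trace of the power \<open>2 * p\<close>, which is
      at least \<open>(t\<^sup>2 * \<sigma>) ^ p\<close> on \<open>E\<close>. Keeping all
      \<open>p\<close> and summing avoids the choice of an optimal one.\<close>
    have bd: "measure std_gauss E * ((t\<^sup>2) ^ (2 * p) / fact (2 * p)) \<le> card I * ((t\<^sup>2 / 2) ^ p / fact p)" for p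
    proof -
      have pt: "real_polynomial_function (\<lambda>z. ker_trace I (ker_power I (X z) n))" for n by (intro poly_trace poly_power)
      have "(\<integral>z. (t\<^sup>2 * \<sigma>) ^ p * indicator E z \<partial>std_gauss) \<le> (\<integral>z. ker_trace I (ker_power I (X z) (2 * p)) \<partial>std_gauss)"
      proof (rule integral_mono)
        show "integrable std_gauss (\<lambda>z. (t\<^sup>2 * \<sigma>) ^ p * indicator E z)" 
          using Em by (intro integrable_mult_right integrable_real_indicator) (auto simp: emeasure_eq_measure)
        show "integrable std_gauss (\<lambda>z. ker_trace I (ker_power I (X z) (2 * p)))" by (rule integrable_std_gauss[OF pt])
        fix z
        show "(t\<^sup>2 * \<sigma>) ^ p * indicator E z \<le> ker_trace I (ker_power I (X z) (2 * p))"
        proof (cases "z \<in> E")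
          case True
          then obtain v where "t\<^sup>2 * \<sigma> * (\<Sum>i\<in>I. (v i)\<^sup>2) < (\<Sum>i\<in>I. (ker_apply I (X z) v i)\<^sup>2)" by (auto simp: E_def)
          then show ?thesis using ker_trace_power_ge[OF fin symX, of "t\<^sup>2 * \<sigma>"] True s by simp
        next
          case False
          then show ?thesis unfolding ker_trace_power_even[OF fin symX] by (simp add: sum_nonneg)
        qed
      qed
      also have "(\<integral>z. (t\<^sup>2 * \<sigma>) ^ p * indicator E z \<partial>std_gauss) = (t\<^sup>2 * \<sigma>) ^ p * measure std_gauss E"
        using Em by (simp add: emeasure_eq_measure)
      finally have "(t\<^sup>2 * \<sigma>) ^ p * measure std_gauss E \<le> card I * \<sigma> ^ p * fact (2 * p) / (2 ^ p * fact p)"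
        using trace_moment[OF \<sigma>, of p] by linarith
      then have "\<sigma> ^ p * ((t\<^sup>2) ^ p * measure std_gauss E) \<le> \<sigma> ^ p * (card I * fact (2 * p) / (2 ^ p * fact p))"
        by (simp add: power_mult_distrib mult_ac)
      then have "(t\<^sup>2) ^ p * measure std_gauss E \<le> card I * fact (2 * p) / (2 ^ p * fact p)"
        by (rule mult_left_le_imp_le) (use s in simp)
      then have "((t\<^sup>2) ^ p / fact (2 * p)) * ((t\<^sup>2) ^ p * measure std_gauss E) \<le> ((t\<^sup>2) ^ p / fact (2 * p)) * (card I * fact (2 * p) / (2 ^ p * fact p))"
        by (intro mult_left_mono) auto
      moreover have "((t\<^sup>2) ^ p / fact (2 * p)) * ((t\<^sup>2) ^ p * measure std_gauss E) = measure std_gauss E * ((t\<^sup>2) ^ (2 * p) / fact (2 * p))"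
        by (simp add: mult_2 power_add)
      moreover have "((t\<^sup>2) ^ p / fact (2 * p)) * (card I * fact (2 * p) / (2 ^ p * fact p)) = card I * ((t\<^sup>2 / 2) ^ p / fact p)"
        by (simp add: power_divide)
      ultimately show ?thesis by linarith
    qed
    have c: "(\<lambda>p. (t\<^sup>2) ^ (2 * p) / fact (2 * p)) sums cosh (t\<^sup>2)"
    proof -
      have "(\<lambda>n. if even n then (t\<^sup>2) ^ n /\<^sub>R fact n else 0) sums cosh (t\<^sup>2)" by (rule cosh_converges)
      then have "(\<lambda>p. if even (2 * p) then (t\<^sup>2) ^ (2 * p) /\<^sub>R fact (2 * p) else 0) sums cosh (t\<^sup>2)"
        by (subst sums_mono_reindex[of "\<lambda>p. 2 * p"]) (auto simp: strict_mono_def)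
      moreover have "(if even (2 * p) then (t\<^sup>2) ^ (2 * p) /\<^sub>R fact (2 * p) else 0) = (t\<^sup>2) ^ (2 * p) / fact (2 * p)" for p
        by (subst if_P) (simp, simp only: real_scaleR_def divide_inverse mult.commute[of "inverse _"])
      ultimately show ?thesis by (simp only:)
    qed
    have e: "(\<lambda>p. (t\<^sup>2 / 2) ^ p / fact p) sums exp (t\<^sup>2 / 2)"
      using exp_converges[of "t\<^sup>2 / 2"] by (simp only: real_scaleR_def divide_inverse[of _ "fact _"] mult.commute[of "inverse _"])
    have "measure std_gauss E * cosh (t\<^sup>2) \<le> card I * exp (t\<^sup>2 / 2)"
      using sums_le[OF bd sums_mult[OF c] sums_mult[OF e]] .
    \<comment> \<open>Replacing the hyperbolic cosine by half an exponential accounts for the factor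
      2 in the final bound.\<close>
    moreover have "measure std_gauss E * (exp (t\<^sup>2) / 2) \<le> measure std_gauss E * cosh (t\<^sup>2)"
      by (intro mult_left_mono) (auto simp: cosh_field_def)
    ultimately have "measure std_gauss E * exp (t\<^sup>2) \<le> 2 * card I * exp (t\<^sup>2 / 2)" by simp
    then have "measure std_gauss E * exp (t\<^sup>2) * exp (- t\<^sup>2) \<le> 2 * card I * exp (t\<^sup>2 / 2) * exp (- t\<^sup>2)"
      by (intro mult_right_mono) auto
    then show ?thesis by (simp add: mult.assoc flip: exp_add)
  qed
qed

end

section \<open>Linear images of Gaussian measures\<close>

lemma matrix_inv_right:
  fixes A :: "real ^ 'n ^ 'n"
  assumes "invertible A"
  shows "A ** matrix_inv A = Finite_Cartesian_Product.mat 1" and "matrix_inv A ** A = Finite_Cartesian_Product.mat 1"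
  using someI_ex[of "\<lambda>A'. A ** A' = Finite_Cartesian_Product.mat 1 \<and> A' ** A = Finite_Cartesian_Product.mat 1"] assms
  unfolding invertible_def matrix_inv_def by auto

lemma matrix_inv_unique:
  fixes A :: "real ^ 'n ^ 'n"
  assumes "A ** B = Finite_Cartesian_Product.mat 1"
  shows "matrix_inv A = B"
proof -
  have "invertible A" using assms invertible_right_inverse by blast
  then have "matrix_inv A = matrix_inv A ** (A ** B)" using assms by simp
  also have "\<dots> = B" by (simp add: matrix_mul_assoc matrix_inv_right[OF \<open>invertible A\<close>])
  finally show ?thesis .
qed

lemma prod_Basis_vec: "(\<Prod>b\<in>(Basis :: (real ^ 'n) set). g b) = (\<Prod>i\<in>UNIV. g (axis i 1))"
proof -
  have 1: "(Basis :: (real ^ 'n) set) = (\<lambda>i. axis i 1) ` UNIV" by (auto simp: Basis_vec_def)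
  have 2: "inj (\<lambda>i. axis i (1::real) :: real ^ 'n)" by (auto simp: inj_on_def axis_eq_axis)
  show ?thesis unfolding 1 prod.reindex[OF 2] o_def ..
qed

lemma borel_measurable_vec_nth[measurable]: "(\<lambda>x :: real ^ 'n. x $ i) \<in> borel_measurable borel"
  by (intro borel_measurable_continuous_onI continuous_intros)

lemma emeasure_lborel_box_vec:
  fixes l u :: "real ^ 'n"
  assumes "\<And>i. l $ i \<le> u $ i"
  shows "emeasure lborel (box l u) = ennreal (\<Prod>i\<in>UNIV. u $ i - l $ i)"
proof -
  have "l \<bullet> b \<le> u \<bullet> b" if "b \<in> Basis" for b
    using axis_inverse[OF that] assms by (auto simp: inner_axis)
  then show ?thesis by (simp add: emeasure_lborel_box prod_Basis_vec inner_axis)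
qed

section \<open>Change of variables under invertible linear maps\<close>

lemma nn_integral_lborel_translation:
  fixes h :: "'a::euclidean_space \<Rightarrow> ennreal"
  assumes [measurable]: "h \<in> borel_measurable borel"
  shows "(\<integral>\<^sup>+x. h (x + u) \<partial>lborel) = (\<integral>\<^sup>+x. h x \<partial>lborel)"
proof -
  have "(\<integral>\<^sup>+x. h (x + u) \<partial>lborel) = (\<integral>\<^sup>+x. h x \<partial>distr lborel borel ((+) u))"
    by (subst nn_integral_distr) (auto simp: add.commute)
  then show ?thesis by (simp only: lborel_distr_plus)
qed

text \<open>Inserting \<open>1 = \<integral> k (s - x\<^sub>m) ds\<close> for a probability density \<open>k\<close> on the line reduces the shear to
  translations.\<close>

lemma nn_integral_lborel_shear:
  fixes h :: "real ^ 'n \<Rightarrow> ennreal"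
  assumes mn: "m \<noteq> n" and [measurable]: "h \<in> borel_measurable borel"
  shows "(\<integral>\<^sup>+x. h (x + (x $ n) *\<^sub>R axis m 1) \<partial>lborel) = (\<integral>\<^sup>+x. h x \<partial>lborel)"
proof -
  define k where "k s = (indicator {0..1} s :: ennreal)" for s :: real
  have [measurable]: "k \<in> borel_measurable borel" unfolding k_def by measurable
  have k1: "(\<integral>\<^sup>+s. k (s + c) \<partial>lborel) = 1" for c
    using nn_integral_lborel_translation[of k c] by (simp add: k_def)
  have key: "(\<integral>\<^sup>+x. g x \<partial>lborel) = (\<integral>\<^sup>+x. k (- (x $ m)) * (\<integral>\<^sup>+s. g (x + s *\<^sub>R axis m 1) \<partial>lborel) \<partial>lborel)"
    if [measurable]: "g \<in> borel_measurable borel" for g :: "real ^ 'n \<Rightarrow> ennreal"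
  proof -
    have "(\<integral>\<^sup>+x. g x \<partial>lborel) = (\<integral>\<^sup>+x. \<integral>\<^sup>+s. g x * k (s + - (x $ m)) \<partial>lborel \<partial>lborel)"
      by (subst nn_integral_cmult) (simp_all only: k1 mult_1_right, simp)
    also have "\<dots> = (\<integral>\<^sup>+s. \<integral>\<^sup>+x. g x * k (s + - (x $ m)) \<partial>lborel \<partial>lborel)"
      by (rule lborel_pair.Fubini') measurable
    also have "\<dots> = (\<integral>\<^sup>+s. \<integral>\<^sup>+x. g (x + s *\<^sub>R axis m 1) * k (- (x $ m)) \<partial>lborel \<partial>lborel)"
    proof (rule nn_integral_cong)
      fix s
      show "(\<integral>\<^sup>+x. g x * k (s + - (x $ m)) \<partial>lborel) = (\<integral>\<^sup>+x. g (x + s *\<^sub>R axis m 1) * k (- (x $ m)) \<partial>lborel)"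
        using nn_integral_lborel_translation[of "\<lambda>x. g x * k (s + - (x $ m))" "s *\<^sub>R axis m 1"] by simp
    qed
    also have "\<dots> = (\<integral>\<^sup>+x. \<integral>\<^sup>+s. g (x + s *\<^sub>R axis m 1) * k (- (x $ m)) \<partial>lborel \<partial>lborel)"
      by (rule lborel_pair.Fubini') measurable
    also have "\<dots> = (\<integral>\<^sup>+x. k (- (x $ m)) * (\<integral>\<^sup>+s. g (x + s *\<^sub>R axis m 1) \<partial>lborel) \<partial>lborel)"
      by (rule nn_integral_cong, subst nn_integral_multc) (measurable, simp add: mult.commute)
    finally show ?thesis .
  qed
  \<comment> \<open>As \<open>m\<close> differs from \<open>n\<close>, the coordinate
    \<open>x $ n\<close> is constant along the line, and there the shear is the translation by
    it.\<close>
  have t: "(\<integral>\<^sup>+s. h (x + s *\<^sub>R axis m 1 + ((x + s *\<^sub>R axis m 1) $ n) *\<^sub>R axis m 1) \<partial>lborel)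
      = (\<integral>\<^sup>+s. h (x + s *\<^sub>R axis m 1) \<partial>lborel)" for x
  proof -
    have e: "x + s *\<^sub>R axis m 1 + ((x + s *\<^sub>R axis m 1) $ n) *\<^sub>R axis m 1 = x + (s + x $ n) *\<^sub>R axis m 1" for s
      using mn by (simp add: axis_def algebra_simps)
    show ?thesis unfolding e
      by (rule nn_integral_lborel_translation[of "\<lambda>s. h (x + s *\<^sub>R axis m 1)" "x $ n"]) measurable
  qed
  show ?thesis
    by (subst (1 2) key) (simp_all only: t, measurable)
qed

lemma nn_integral_lborel_permute:
  fixes h :: "real ^ 'n \<Rightarrow> ennreal"
  assumes [measurable]: "h \<in> borel_measurable borel" and p: "bij (p :: 'n \<Rightarrow> 'n)"
  shows "(\<integral>\<^sup>+x. h (\<chi> i. x $ p i) \<partial>lborel) = (\<integral>\<^sup>+x. h x \<partial>lborel)"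
proof -
  define \<sigma> where "\<sigma> x = (\<chi> i. x $ p i)" for x :: "real ^ 'n"
  have [measurable]: "\<sigma> \<in> borel_measurable borel"
    unfolding \<sigma>_def by (intro borel_measurable_continuous_onI continuous_on_vec_lambda continuous_intros)
  have "lborel = distr lborel borel \<sigma>"
  proof (rule lborel_eqI)
    fix l u :: "real ^ 'n" assume lu: "\<And>b. b \<in> Basis \<Longrightarrow> l \<bullet> b \<le> u \<bullet> b"
    have le: "l $ i \<le> u $ i" for i using lu[of "axis i 1"] by (simp add: inner_axis)
    define l' u' where "l' = (\<chi> i. l $ inv_into UNIV p i)" and "u' = (\<chi> i. u $ inv_into UNIV p i)"
    have "\<sigma> -` box l u = box l' u'"
    proof (rule Set.set_eqI)
      fix x
      have "(\<forall>i. l $ i < x $ p i \<and> x $ p i < u $ i) \<longleftrightarrow> (\<forall>i. l $ inv_into UNIV p i < x $ i \<and> x $ i < u $ inv_into UNIV p i)"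
        using p by (metis bij_inv_eq_iff)
      then show "x \<in> \<sigma> -` box l u \<longleftrightarrow> x \<in> box l' u'"
        by (simp add: mem_box_cart \<sigma>_def l'_def u'_def)
    qed
    then have "emeasure (distr lborel borel \<sigma>) (box l u) = emeasure lborel (box l' u')"
      by (simp add: emeasure_distr)
    also have "\<dots> = ennreal (\<Prod>i\<in>UNIV. u $ inv_into UNIV p i - l $ inv_into UNIV p i)"
      using le by (subst emeasure_lborel_box_vec) (simp_all add: l'_def u'_def)
    also have "(\<Prod>i\<in>UNIV. u $ inv_into UNIV p i - l $ inv_into UNIV p i) = (\<Prod>i\<in>UNIV. u $ i - l $ i)"
      by (rule prod.reindex_bij_betw[OF bij_imp_bij_inv[OF p]])
    finally show "emeasure (distr lborel borel \<sigma>) (box l u) = ennreal (prod ((\<bullet>) (u - l)) Basis)"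
      by (simp add: prod_Basis_vec inner_axis)
  qed simp
  then have "(\<integral>\<^sup>+x. h x \<partial>lborel) = (\<integral>\<^sup>+x. h x \<partial>distr lborel borel \<sigma>)" by simp
  then show ?thesis by (simp add: nn_integral_distr \<sigma>_def)
qed

lemma nn_integral_lborel_stretch:
  fixes h :: "real ^ 'n \<Rightarrow> ennreal"
  assumes [measurable]: "h \<in> borel_measurable borel" and c: "\<And>i. c i \<noteq> 0"
  shows "(\<integral>\<^sup>+x. h x \<partial>lborel) = ennreal \<bar>prod c UNIV\<bar> * (\<integral>\<^sup>+x. h (\<chi> i. c i * x $ i) \<partial>lborel)"
proof -
  define c' where "c' j = c (axis_index j)" for j :: "real ^ 'n"
  have c0: "c' j \<noteq> 0" for j using c by (simp add: c'_def)
  have "(\<Sum>j\<in>Basis. (c' j * (x \<bullet> j)) *\<^sub>R j) = (\<chi> i. c i * x $ i)" for x :: "real ^ 'n"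
  proof (rule euclidean_eqI)
    fix b :: "real ^ 'n" assume b: "b \<in> Basis"
    then obtain i where i: "b = axis i 1" using axis_inverse by blast
    have "(\<Sum>j\<in>Basis. (c' j * (x \<bullet> j)) *\<^sub>R j) \<bullet> b = c' b * (x \<bullet> b)"
      using b by (simp add: inner_sum_left inner_Basis if_distrib cong: if_cong)
    also have "\<dots> = (\<chi> i. c i * x $ i) \<bullet> b" by (simp add: i inner_axis c'_def axis_index_axis)
    finally show "(\<Sum>j\<in>Basis. (c' j * (x \<bullet> j)) *\<^sub>R j) \<bullet> b = (\<chi> i. c i * x $ i) \<bullet> b" .
  qed
  then have eq: "lborel = density (distr lborel borel (\<lambda>x :: real ^ 'n. \<chi> i. c i * x $ i)) (\<lambda>_. ennreal \<bar>prod c UNIV\<bar>)"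
    using lborel_affine_euclidean[of c' 0] c0
    by (simp add: prod_Basis_vec c'_def axis_index_axis abs_prod[symmetric])
  have [measurable]: "(\<lambda>x :: real ^ 'n. \<chi> i. c i * x $ i) \<in> borel_measurable borel"
    by (intro borel_measurable_continuous_onI continuous_on_vec_lambda continuous_intros)
  have "(\<integral>\<^sup>+x. h x \<partial>lborel) = (\<integral>\<^sup>+x. h x \<partial>density (distr lborel borel (\<lambda>x :: real ^ 'n. \<chi> i. c i * x $ i)) (\<lambda>_. ennreal \<bar>prod c UNIV\<bar>))"
    using eq by simp
  then show ?thesis by (simp add: nn_integral_density nn_integral_distr nn_integral_cmult)
qed

text \<open>The induction over elementary maps also meets singular ones. The implication makes the
  case of a zero row vacuous and passes from a composition to both of its factors, since the
  determinant is multiplicative.\<close>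

lemma nn_integral_lborel_linear:
  fixes f :: "real ^ 'n \<Rightarrow> real ^ 'n"
  assumes "linear f"
  shows "det (matrix f) \<noteq> 0 \<longrightarrow> (\<forall>h\<in>borel_measurable borel.
    (\<integral>\<^sup>+x. h x \<partial>lborel) = ennreal \<bar>det (matrix f)\<bar> * (\<integral>\<^sup>+x. h (f x) \<partial>lborel))"
proof (rule induct_linear_elementary[OF assms]; intro impI ballI)
  fix f g :: "real ^ 'n \<Rightarrow> real ^ 'n" and h :: "real ^ 'n \<Rightarrow> ennreal"
  assume lin: "linear f" "linear g"
    and f: "det (matrix f) \<noteq> 0 \<longrightarrow> (\<forall>h\<in>borel_measurable borel.
      (\<integral>\<^sup>+x. h x \<partial>lborel) = ennreal \<bar>det (matrix f)\<bar> * (\<integral>\<^sup>+x. h (f x) \<partial>lborel))"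
    and g: "det (matrix g) \<noteq> 0 \<longrightarrow> (\<forall>h\<in>borel_measurable borel.
      (\<integral>\<^sup>+x. h x \<partial>lborel) = ennreal \<bar>det (matrix g)\<bar> * (\<integral>\<^sup>+x. h (g x) \<partial>lborel))"
    and d: "det (matrix (f \<circ> g)) \<noteq> 0" and h[measurable]: "h \<in> borel_measurable borel"
  have [measurable]: "f \<in> borel_measurable borel"
    using lin by (intro borel_measurable_continuous_onI linear_continuous_on linear_conv_bounded_linear[THEN iffD1])
  have dd: "det (matrix (f \<circ> g)) = det (matrix f) * det (matrix g)"
    using lin by (simp add: matrix_compose det_mul)
  have "(\<integral>\<^sup>+x. h x \<partial>lborel) = ennreal \<bar>det (matrix f)\<bar> * (\<integral>\<^sup>+x. h (f x) \<partial>lborel)" 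
    by (rule f[THEN mp, THEN bspec, OF _ h]) (use d in \<open>simp add: dd\<close>)
  also have "(\<integral>\<^sup>+x. h (f x) \<partial>lborel) = ennreal \<bar>det (matrix g)\<bar> * (\<integral>\<^sup>+x. h (f (g x)) \<partial>lborel)" 
    by (rule g[THEN mp, THEN bspec]) (use d in \<open>simp add: dd\<close>, measurable)
  finally show "(\<integral>\<^sup>+x. h x \<partial>lborel) = ennreal \<bar>det (matrix (f \<circ> g))\<bar> * (\<integral>\<^sup>+x. h ((f \<circ> g) x) \<partial>lborel)"
    by (simp add: dd abs_mult ennreal_mult mult.assoc)
next
  fix f :: "real ^ 'n \<Rightarrow> real ^ 'n" and i and h :: "real ^ 'n \<Rightarrow> ennreal"
  assume "\<And>x. f x $ i = 0" and d: "det (matrix f) \<noteq> 0"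
  then have "Finite_Cartesian_Product.row i (matrix f) = 0" by (subst Finite_Cartesian_Product.vec_eq_iff) (simp add: Finite_Cartesian_Product.row_def matrix_def)
  then have "det (matrix f) = 0" by (rule det_zero_row)
  then show "(\<integral>\<^sup>+x. h x \<partial>lborel) = ennreal \<bar>det (matrix f)\<bar> * (\<integral>\<^sup>+x. h (f x) \<partial>lborel)" using d by simp
next
  fix c :: "'n \<Rightarrow> real" and h :: "real ^ 'n \<Rightarrow> ennreal"
  assume d: "det (matrix (\<lambda>x::real ^ 'n. \<chi> i. c i * x $ i)) \<noteq> 0" and h: "h \<in> borel_measurable borel"
  have dd: "det (matrix (\<lambda>x::real ^ 'n. \<chi> i. c i * x $ i)) = prod c UNIV"
    by (subst det_diagonal) (auto simp: matrix_def axis_def)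
  have "c i \<noteq> 0" for i using d unfolding dd by simp
  then show "(\<integral>\<^sup>+x. h x \<partial>lborel) = ennreal \<bar>det (matrix (\<lambda>x::real ^ 'n. \<chi> i. c i * x $ i))\<bar> * (\<integral>\<^sup>+x. h (\<chi> i. c i * x $ i) \<partial>lborel)"
    unfolding dd by (rule nn_integral_lborel_stretch[OF h])
next
  fix m n :: 'n and h :: "real ^ 'n \<Rightarrow> ennreal"
  let ?f = "\<lambda>x::real ^ 'n. \<chi> i. x $ Transposition.transpose m n i"
  assume h: "h \<in> borel_measurable borel"
  have lin: "linear ?f" by (rule linearI) (auto simp: Finite_Cartesian_Product.vec_eq_iff)
  have "?f \<circ> ?f = id" by (auto simp: fun_eq_iff Finite_Cartesian_Product.vec_eq_iff)
  then have "matrix ?f ** matrix ?f = Finite_Cartesian_Product.mat 1"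
    using matrix_compose[OF lin lin] by (simp add: matrix_id_mat_1)
  then have "det (matrix ?f) * det (matrix ?f) = 1" by (metis det_I det_mul)
  then have dd: "\<bar>det (matrix ?f)\<bar> = 1" unfolding power2_eq_square[symmetric] abs_square_eq_1 .
  show "(\<integral>\<^sup>+x. h x \<partial>lborel) = ennreal \<bar>det (matrix ?f)\<bar> * (\<integral>\<^sup>+x. h (?f x) \<partial>lborel)"
    unfolding dd using nn_integral_lborel_permute[OF h, of "Transposition.transpose m n"] by (simp add: bij_transpose)
next
  fix m n :: 'n and h :: "real ^ 'n \<Rightarrow> ennreal"
  let ?f = "\<lambda>x::real ^ 'n. \<chi> i. if i = m then x $ m + x $ n else x $ i"
  assume mn: "m \<noteq> n" and h: "h \<in> borel_measurable borel"
  have e: "matrix ?f = (\<chi> k. if k = m then Finite_Cartesian_Product.row m (Finite_Cartesian_Product.mat 1) + 1 *s Finite_Cartesian_Product.row n (Finite_Cartesian_Product.mat 1) else Finite_Cartesian_Product.row k (Finite_Cartesian_Product.mat 1))"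
    by (auto simp: matrix_def Finite_Cartesian_Product.vec_eq_iff Finite_Cartesian_Product.row_def Finite_Cartesian_Product.mat_def axis_def)
  have dd: "det (matrix ?f) = 1" unfolding e by (subst det_row_operation[OF mn]) (rule det_I)
  have "?f x = x + (x $ n) *\<^sub>R axis m 1" for x :: "real ^ 'n" by (auto simp: Finite_Cartesian_Product.vec_eq_iff axis_def)
  then show "(\<integral>\<^sup>+x. h x \<partial>lborel) = ennreal \<bar>det (matrix ?f)\<bar> * (\<integral>\<^sup>+x. h (?f x) \<partial>lborel)"
    unfolding dd using nn_integral_lborel_shear[OF mn h] by simp
qed

lemma nn_integral_lborel_matrix:
  fixes J :: "real ^ 'n ^ 'n" and h :: "real ^ 'n \<Rightarrow> ennreal"
  assumes "invertible J" and "h \<in> borel_measurable borel"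
  shows "(\<integral>\<^sup>+x. h x \<partial>lborel) = ennreal \<bar>det J\<bar> * (\<integral>\<^sup>+x. h (J *v x) \<partial>lborel)"
  using nn_integral_lborel_linear[of "(*v) J"] assms by (simp add: invertible_det_nz)

section \<open>Rotation invariance, covariance square roots and splitting of the Gaussian
  measure\<close>

lemma nn_integral_std_gauss:
  fixes f :: "'a::euclidean_space \<Rightarrow> ennreal"
  assumes [measurable]: "f \<in> borel_measurable borel"
  shows "(\<integral>\<^sup>+x. f x \<partial>std_gauss) = (\<integral>\<^sup>+x. ennreal (std_gauss_density x) * f x \<partial>lborel)"
  unfolding std_gauss_def by (rule nn_integral_density) auto

lemma nn_integral_std_gauss_orthogonal:
  fixes f :: "real ^ 'n \<Rightarrow> ennreal" and \<sigma> :: "real ^ 'n \<Rightarrow> real ^ 'n"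
  assumes \<sigma>: "orthogonal_transformation \<sigma>" and f[measurable]: "f \<in> borel_measurable borel"
  shows "(\<integral>\<^sup>+x. f (\<sigma> x) \<partial>std_gauss) = (\<integral>\<^sup>+x. f x \<partial>std_gauss)"
proof -
  have lin: "linear \<sigma>" and nrm: "norm (\<sigma> x) = norm x" for x
    using \<sigma> by (auto simp: orthogonal_transformation)
  have s: "\<sigma> = (*v) (matrix \<sigma>)" using lin by auto
  have d: "\<bar>det (matrix \<sigma>)\<bar> = 1" by (rule orthogonal_transformation_det[OF \<sigma>])
  have [measurable]: "\<sigma> \<in> borel_measurable borel"
    using lin by (intro borel_measurable_continuous_onI linear_continuous_on linear_conv_bounded_linear[THEN iffD1])
  have "(\<integral>\<^sup>+x. f x \<partial>std_gauss) = ennreal \<bar>det (matrix \<sigma>)\<bar> * (\<integral>\<^sup>+x. ennreal (std_gauss_density (matrix \<sigma> *v x)) * f (matrix \<sigma> *v x) \<partial>lborel)"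
    unfolding nn_integral_std_gauss[OF f]
    by (rule nn_integral_lborel_matrix) (use d in \<open>auto simp: invertible_det_nz\<close>)
  also have "\<dots> = (\<integral>\<^sup>+x. ennreal (std_gauss_density x) * f (\<sigma> x) \<partial>lborel)"
    unfolding s[symmetric] d by (simp add: std_gauss_density_def nrm)
  also have "\<dots> = (\<integral>\<^sup>+x. f (\<sigma> x) \<partial>std_gauss)" by (subst nn_integral_std_gauss) auto
  finally show ?thesis ..
qed

text \<open>The noise becomes a linear image of a standard Gaussian vector, so that signal and noise
  can be treated as one such vector. The inverse covariance is the Gram matrix of the inverse of
  \<open>J\<close>, and \<bar>det J\<bar> cancels against the normalizing constant.\<close>

lemma nn_integral_gaussian:
  fixes J :: "real ^ 'm ^ 'm" and f :: "real ^ 'm \<Rightarrow> ennreal"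
  assumes J: "invertible J" and f[measurable]: "f \<in> borel_measurable borel"
  shows "(\<integral>\<^sup>+x. f x \<partial>gaussian (J ** transpose J)) = (\<integral>\<^sup>+x. f (J *v x) \<partial>std_gauss)"
proof -
  let ?C = "J ** transpose J" and ?K = "matrix_inv J"
  have KJ: "?K *v (J *v x) = x" for x by (simp add: matrix_vector_mul_assoc matrix_inv_right[OF J])
  have inv: "matrix_inv ?C = transpose ?K ** ?K"
  proof (rule matrix_inv_unique)
    have "?C ** (transpose ?K ** ?K) = J ** (transpose (?K ** J)) ** ?K"
      by (simp add: matrix_transpose_mul matrix_mul_assoc)
    then show "?C ** (transpose ?K ** ?K) = Finite_Cartesian_Product.mat 1"
      by (simp add: matrix_inv_right[OF J] transpose_mat)
  qed
  have dJ: "det J \<noteq> 0" using J by (simp add: invertible_det_nz)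
  have dens: "exp (- ((J *v x) \<bullet> (matrix_inv ?C *v (J *v x))) / 2) / sqrt ((2 * pi) ^ CARD('m) * det ?C)
      = std_gauss_density x / \<bar>det J\<bar>" for x :: "real ^ 'm"
  proof -
    have "(J *v x) \<bullet> (matrix_inv ?C *v (J *v x)) = (?K *v (J *v x)) \<bullet> (?K *v (J *v x))"
      unfolding inv matrix_vector_mul_assoc[symmetric]
      by (simp only: transpose_matrix_vector inner_commute[of "J *v x"] dot_lmul_matrix)
    then have "(J *v x) \<bullet> (matrix_inv ?C *v (J *v x)) = (norm x)\<^sup>2" by (simp add: KJ power2_norm_eq_inner)
    moreover have "sqrt ((2 * pi) ^ CARD('m) * det ?C) = sqrt (2 * pi) ^ CARD('m) * \<bar>det J\<bar>"
    proof -
      have "det ?C = (det J)\<^sup>2" by (simp add: det_mul det_transpose power2_eq_square)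
      then show ?thesis
        unfolding real_sqrt_mult[of "(2 * pi) ^ CARD('m)"] by (simp only: real_sqrt_abs) (simp only: real_sqrt_power)
    qed
    ultimately show ?thesis by (simp add: std_gauss_density_def)
  qed
  have [measurable]: "(*v) J \<in> borel_measurable borel" for J :: "real ^ 'm ^ 'm"
    by (intro borel_measurable_continuous_onI linear_continuous_on matrix_vector_mul_bounded_linear)
  have "(\<integral>\<^sup>+x. f x \<partial>gaussian ?C) = (\<integral>\<^sup>+x. ennreal (exp (- (x \<bullet> (matrix_inv ?C *v x)) / 2) / sqrt ((2 * pi) ^ CARD('m) * det ?C)) * f x \<partial>lborel)"
    unfolding gaussian_def by (subst nn_integral_density) auto
  also have "\<dots> = ennreal \<bar>det J\<bar> * (\<integral>\<^sup>+x. ennreal (std_gauss_density x / \<bar>det J\<bar>) * f (J *v x) \<partial>lborel)"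
    by (subst nn_integral_lborel_matrix[OF J]) (simp_all only: dens, simp)
  also have "\<dots> = (\<integral>\<^sup>+x. ennreal \<bar>det J\<bar> * (ennreal (std_gauss_density x / \<bar>det J\<bar>) * f (J *v x)) \<partial>lborel)"
    by (subst nn_integral_cmult) auto
  also have "\<dots> = (\<integral>\<^sup>+x. ennreal (std_gauss_density x) * f (J *v x) \<partial>lborel)"
  proof (intro nn_integral_cong)
    fix x :: "real ^ 'm"
    have "ennreal \<bar>det J\<bar> * ennreal (std_gauss_density x / \<bar>det J\<bar>) = ennreal (std_gauss_density x)"
      using dJ less_imp_le[OF std_gauss_density_pos[of x]] by (subst ennreal_mult[symmetric]) auto
    then show "ennreal \<bar>det J\<bar> * (ennreal (std_gauss_density x / \<bar>det J\<bar>) * f (J *v x)) = ennreal (std_gauss_density x) * f (J *v x)"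
      by (simp add: mult.assoc[symmetric])
  qed
  also have "\<dots> = (\<integral>\<^sup>+x. f (J *v x) \<partial>std_gauss)" by (subst nn_integral_std_gauss) auto
  finally show ?thesis .
qed

text \<open>Pairs become vectors over a sum type, the index type of \<open>block_matrix\<close>. A
  single Gaussian vector can then hold the coordinates of the signal and of the noise.\<close>

definition vec_join :: "(real ^ 'a) \<times> (real ^ 'b) \<Rightarrow> real ^ ('a + 'b)" where
  "vec_join z = (\<chi> i. case i of Inl a \<Rightarrow> fst z $ a | Inr b \<Rightarrow> snd z $ b)"

lemma vec_join_nth[simp]: "vec_join z $ Inl a = fst z $ a" "vec_join z $ Inr b = snd z $ b"
  by (simp_all add: vec_join_def)

lemma sum_UNIV_Plus: "(\<Sum>i\<in>(UNIV :: ('a::finite + 'b::finite) set). f i) = (\<Sum>a\<in>UNIV. f (Inl a)) + (\<Sum>b\<in>UNIV. f (Inr b))"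
  using sum.Plus[of UNIV UNIV f] by simp

lemma prod_UNIV_Plus: "(\<Prod>i\<in>(UNIV :: ('a::finite + 'b::finite) set). f i) = (\<Prod>a\<in>UNIV. f (Inl a)) * (\<Prod>b\<in>UNIV. f (Inr b) :: 'c::comm_monoid_mult)"
  using prod.Plus[of UNIV UNIV f] by simp

lemma vec_join_measurable[measurable]: "vec_join \<in> borel_measurable borel"
  unfolding vec_join_def
proof (intro borel_measurable_continuous_onI continuous_on_vec_lambda)
  fix i :: "'a + 'b"
  show "continuous_on UNIV (\<lambda>z :: (real ^ 'a) \<times> (real ^ 'b). case i of Inl a \<Rightarrow> fst z $ a | Inr b \<Rightarrow> snd z $ b)"
    by (cases i) (auto intro!: continuous_intros)
qed

lemma lborel_vec_join: "lborel = distr lborel borel (vec_join :: (real ^ 'a) \<times> (real ^ 'b) \<Rightarrow> _)"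
proof (rule lborel_eqI)
  fix l u :: "real ^ ('a + 'b)" assume lu: "\<And>b. b \<in> Basis \<Longrightarrow> l \<bullet> b \<le> u \<bullet> b"
  have le: "l $ i \<le> u $ i" for i using lu[of "axis i 1"] by (simp add: inner_axis)
  define l1 u1 where "l1 = (\<chi> a. l $ Inl a)" and "u1 = (\<chi> a. u $ Inl a)"
  define l2 u2 where "l2 = (\<chi> a. l $ Inr a)" and "u2 = (\<chi> a. u $ Inr a)"
  have pre: "vec_join -` box l u = box l1 u1 \<times> box l2 u2"
  proof (rule Set.set_eqI)
    fix z :: "(real ^ 'a) \<times> (real ^ 'b)"
    have "(\<forall>i :: 'a + 'b. P i) \<longleftrightarrow> (\<forall>a. P (Inl a)) \<and> (\<forall>b. P (Inr b))" for P
      by (metis sum.exhaust)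
    then show "z \<in> vec_join -` box l u \<longleftrightarrow> z \<in> box l1 u1 \<times> box l2 u2"
      by (cases z) (simp add: mem_box_cart l1_def u1_def l2_def u2_def)
  qed
  have "emeasure (distr lborel borel vec_join) (box l u) = emeasure (lborel \<Otimes>\<^sub>M lborel) (box l1 u1 \<times> box l2 u2)"
    by (simp add: emeasure_distr pre lborel_prod)
  also have "\<dots> = emeasure lborel (box l1 u1) * emeasure lborel (box l2 u2)"
    by (rule lborel.emeasure_pair_measure_Times) auto
  also have "emeasure lborel (box l1 u1) = ennreal (\<Prod>a\<in>UNIV. u $ Inl a - l $ Inl a)"
    using le by (subst emeasure_lborel_box_vec) (simp_all add: l1_def u1_def)
  also have "emeasure lborel (box l2 u2) = ennreal (\<Prod>a\<in>UNIV. u $ Inr a - l $ Inr a)"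
    using le by (subst emeasure_lborel_box_vec) (simp_all add: l2_def u2_def)
  also have "ennreal (\<Prod>a\<in>UNIV. u $ Inl a - l $ Inl a) * ennreal (\<Prod>a\<in>UNIV. u $ Inr a - l $ Inr a)
      = ennreal (prod ((\<bullet>) (u - l)) Basis)"
    using le by (subst ennreal_mult[symmetric]) (auto intro!: prod_nonneg simp: prod_Basis_vec inner_axis prod_UNIV_Plus)
  finally show "emeasure (distr lborel borel vec_join) (box l u) = ennreal (prod ((\<bullet>) (u - l)) Basis)" .
qed simp

lemma norm_vec_join: "(norm (vec_join z))\<^sup>2 = (norm (fst z))\<^sup>2 + (norm (snd z))\<^sup>2"
  by (simp add: power2_norm_eq_inner inner_vec_def sum_UNIV_Plus)

lemma nn_integral_std_gauss_split:
  fixes f :: "real ^ ('a::finite + 'b::finite) \<Rightarrow> ennreal"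
  assumes f[measurable]: "f \<in> borel_measurable borel"
  shows "(\<integral>\<^sup>+x. f x \<partial>std_gauss) = (\<integral>\<^sup>+x. \<integral>\<^sup>+y. f (vec_join (x, y)) \<partial>std_gauss \<partial>std_gauss)"
proof -
  have d: "std_gauss_density (vec_join (x, y) :: real ^ ('a + 'b)) = std_gauss_density x * std_gauss_density y" for x y
  proof -
    have "- ((norm x)\<^sup>2 + (norm y)\<^sup>2) / 2 = - (norm x)\<^sup>2 / 2 + - (norm y)\<^sup>2 / 2" by simp
    then show ?thesis unfolding std_gauss_density_def norm_vec_join fst_conv snd_conv
      by (simp only: exp_add) (simp add: power_add)
  qed
  have [measurable]: "vec_join \<in> borel_measurable ((lborel :: (real ^ 'a) measure) \<Otimes>\<^sub>M (lborel :: (real ^ 'b) measure))"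
    using vec_join_measurable by (simp add: lborel_prod)
  have "(\<integral>\<^sup>+x. f x \<partial>std_gauss) = (\<integral>\<^sup>+x. ennreal (std_gauss_density x) * f x \<partial>lborel)" by (rule nn_integral_std_gauss[OF f])
  also have "\<dots> = (\<integral>\<^sup>+z. ennreal (std_gauss_density (vec_join z)) * f (vec_join z) \<partial>(lborel :: ((real ^ 'a) \<times> (real ^ 'b)) measure))"
    by (subst lborel_vec_join) (simp add: nn_integral_distr)
  also have "\<dots> = (\<integral>\<^sup>+x. \<integral>\<^sup>+y. ennreal (std_gauss_density (vec_join (x, y))) * f (vec_join (x, y)) \<partial>lborel \<partial>lborel)"
    unfolding lborel_prod[symmetric] by (rule lborel.nn_integral_fst[symmetric]) measurable
  also have "\<dots> = (\<integral>\<^sup>+x. ennreal (std_gauss_density x) * (\<integral>\<^sup>+y. ennreal (std_gauss_density y) * f (vec_join (x, y)) \<partial>lborel) \<partial>lborel)"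
    by (intro nn_integral_cong, subst nn_integral_cmult[symmetric])
      (auto simp: d ennreal_mult less_imp_le[OF std_gauss_density_pos] mult.assoc)
  also have "\<dots> = (\<integral>\<^sup>+x. \<integral>\<^sup>+y. f (vec_join (x, y)) \<partial>std_gauss \<partial>std_gauss)"
    by (subst nn_integral_std_gauss[symmetric], measurable)+
  finally show ?thesis .
qed

section \<open>Spectratopes and norms\<close>

text \<open>The kernel of \<open>lin_mat\<close>, extended by zero so that it satisfies
  \<open>ker_sym\<close>.\<close>

definition lin_ker :: "nat \<Rightarrow> ('n::finite \<Rightarrow> real mat) \<Rightarrow> real ^ 'n \<Rightarrow> nat \<Rightarrow> nat \<Rightarrow> real" where
  "lin_ker d R x a b = (if a < d \<and> b < d then \<Sum>i\<in>UNIV. x $ i * R i $$ (a, b) else 0)"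

text \<open>The squared length of the vector R[x] v. The matrix inequality between the square of
  R[x] and a multiple of the identity becomes a family of scalar inequalities in it, without carrier
  conditions.\<close>

definition lin_sqnorm :: "nat \<Rightarrow> ('n::finite \<Rightarrow> real mat) \<Rightarrow> real ^ 'n \<Rightarrow> (nat \<Rightarrow> real) \<Rightarrow> real" where
  "lin_sqnorm d R x v = (\<Sum>a<d. (ker_apply {..<d} (lin_ker d R x) v a)\<^sup>2)"

lemma scalar_prod_mult_mat_vec:
  assumes "A \<in> carrier_mat d d" "v \<in> carrier_vec d"
  shows "scalar_prod v (A *\<^sub>v v) = (\<Sum>a<d. \<Sum>b<d. vec_index v a * A $$ (a, b) * vec_index v b :: real)"
  using assms
  by (auto simp: scalar_prod_def mult_mat_vec_def lessThan_atLeast0 sum_distrib_left mult.assoc intro!: sum.cong)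

lemma psd_mat_iff: "psd_mat d A \<longleftrightarrow> A \<in> carrier_mat d d \<and> psd_on {..<d} (\<lambda>a b. A $$ (a, b))"
proof (cases "A \<in> carrier_mat d d")
  case True
  have s: "transpose_mat A = A \<longleftrightarrow> (\<forall>a\<in>{..<d}. \<forall>b\<in>{..<d}. A $$ (a, b) = A $$ (b, a))"
  proof
    assume "transpose_mat A = A"
    then show "\<forall>a\<in>{..<d}. \<forall>b\<in>{..<d}. A $$ (a, b) = A $$ (b, a)"
      using True by (metis carrier_matD index_transpose_mat(1) lessThan_iff)
  next
    assume "\<forall>a\<in>{..<d}. \<forall>b\<in>{..<d}. A $$ (a, b) = A $$ (b, a)"
    then show "transpose_mat A = A" using True by (intro eq_matI) auto
  qed
  have q: "(\<forall>v\<in>carrier_vec d. 0 \<le> scalar_prod v (A *\<^sub>v v)) \<longleftrightarrow> (\<forall>x. 0 \<le> (\<Sum>a<d. \<Sum>b<d. x a * A $$ (a, b) * x b))"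
  proof (intro iffI ballI allI)
    fix x :: "nat \<Rightarrow> real" assume "\<forall>v\<in>carrier_vec d. 0 \<le> scalar_prod v (A *\<^sub>v v)"
    then have "0 \<le> scalar_prod (Matrix.vec d x) (A *\<^sub>v Matrix.vec d x)" by simp
    then show "0 \<le> (\<Sum>a<d. \<Sum>b<d. x a * A $$ (a, b) * x b)"
      by (subst (asm) scalar_prod_mult_mat_vec[OF True]) auto
  next
    fix v :: "real Matrix.vec" assume "\<forall>x. 0 \<le> (\<Sum>a<d. \<Sum>b<d. x a * A $$ (a, b) * x b)" "v \<in> carrier_vec d"
    then show "0 \<le> scalar_prod v (A *\<^sub>v v)" by (simp add: scalar_prod_mult_mat_vec[OF True])
  qed
  show ?thesis using True by (simp add: psd_mat_def sym_mat_def psd_on_def s q)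
qed (simp add: psd_mat_def sym_mat_def)

lemma sym_mat_nth: "sym_mat d X \<Longrightarrow> a < d \<Longrightarrow> b < d \<Longrightarrow> X $$ (a, b) = X $$ (b, a)"
  unfolding sym_mat_def by (metis carrier_matD index_transpose_mat(1))

lemma lin_ker_sym:
  assumes "\<And>i. sym_mat d (R i)"
  shows "ker_sym {..<d} (lin_ker d R x)"
  using sym_mat_nth[OF assms] by (auto simp: ker_sym_def lin_ker_def intro!: sum.cong)

lemma psd_mat_spectratope_iff:
  assumes R: "\<And>i. sym_mat d (R i)"
  shows "psd_mat d (t \<cdot>\<^sub>m 1\<^sub>m d - lin_mat d R x * lin_mat d R x)
    \<longleftrightarrow> (\<forall>v. lin_sqnorm d R x v \<le> t * (\<Sum>a<d. (v a)\<^sup>2))"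
proof -
  let ?A = "t \<cdot>\<^sub>m 1\<^sub>m d - lin_mat d R x * lin_mat d R x"
  have Ls: "lin_ker d R x a b = lin_ker d R x b a" for a b
    using lin_ker_sym[OF R, where x = x] by (auto simp: ker_sym_def)
  have c: "?A \<in> carrier_mat d d" by (auto simp: lin_mat_def)
  have e: "?A $$ (a, b) = (if a = b then t else 0) - (\<Sum>c<d. lin_ker d R x c a * lin_ker d R x c b)"
    if "a < d" "b < d" for a b
  proof -
    have "(lin_mat d R x * lin_mat d R x) $$ (a, b) = (\<Sum>c<d. lin_ker d R x a c * lin_ker d R x c b)"
      using that by (auto simp: lin_mat_def lin_ker_def scalar_prod_def lessThan_atLeast0 intro!: sum.cong)
    then show ?thesis using that Ls[of a] by (simp add: lin_mat_def)
  qed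
  have f: "(\<Sum>a<d. \<Sum>b<d. v a * ?A $$ (a, b) * v b) = t * (\<Sum>a<d. (v a)\<^sup>2) - lin_sqnorm d R x v" for v
  proof -
    have "(\<Sum>a<d. \<Sum>b<d. v a * ?A $$ (a, b) * v b)
      = (\<Sum>a<d. \<Sum>b<d. (if a = b then t * (v a * v b) else 0)) - (\<Sum>a<d. \<Sum>b<d. \<Sum>c<d. (lin_ker d R x c a * v a) * (lin_ker d R x c b * v b))"
      unfolding sum_subtractf[symmetric]
      by (intro sum.cong refl) (auto simp: e algebra_simps sum_distrib_left sum_distrib_right intro!: sum.cong)
    also have "(\<Sum>a<d. \<Sum>b<d. \<Sum>c<d. (lin_ker d R x c a * v a) * (lin_ker d R x c b * v b))
      = (\<Sum>a<d. \<Sum>c<d. \<Sum>b<d. (lin_ker d R x c a * v a) * (lin_ker d R x c b * v b))"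
      by (intro sum.cong refl sum.swap)
    also have "\<dots> = (\<Sum>c<d. \<Sum>a<d. \<Sum>b<d. (lin_ker d R x c a * v a) * (lin_ker d R x c b * v b))" by (rule sum.swap)
    also have "\<dots> = lin_sqnorm d R x v"
      by (simp add: lin_sqnorm_def ker_apply_def power2_eq_square sum_product)
    also have "(\<Sum>a<d. \<Sum>b<d. (if a = b then t * (v a * v b) else 0)) = t * (\<Sum>a<d. (v a)\<^sup>2)"
      by (simp add: sum_distrib_left power2_eq_square)
    finally show ?thesis .
  qed
  have s: "?A $$ (a, b) = ?A $$ (b, a)" if "a < d" "b < d" for a b
    unfolding e[OF that] e[OF that(2,1)] by (auto intro!: sum.cong)
  show ?thesis unfolding psd_mat_iff psd_on_def f using c s by (auto simp: algebra_simps)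
qed

lemma basic_spectratope_altdef:
  assumes "\<And>k i. sym_mat (d k) (R k i)"
  shows "basic_spectratope d R T = {x. \<exists>t\<in>T. \<forall>k v. lin_sqnorm (d k) (R k) x v \<le> t $ k * (\<Sum>a<d k. (v a)\<^sup>2)}"
  unfolding basic_spectratope_def psd_mat_spectratope_iff[OF assms] ..

lemma trace_mat_mult3:
  assumes "L \<in> carrier_mat d d" "P \<in> carrier_mat d d" "Q \<in> carrier_mat d d"
  shows "trace_mat (L * (P * Q + Q * P)) =
    (\<Sum>a<d. \<Sum>b<d. \<Sum>c<d. L $$ (a, b) * (P $$ (b, c) * Q $$ (c, a))) + (\<Sum>a<d. \<Sum>b<d. \<Sum>c<d. L $$ (a, b) * (Q $$ (b, c) * P $$ (c, a)))"
proof -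
  have "(L * (P * Q + Q * P)) $$ (a, a) = (\<Sum>b<d. L $$ (a, b) * (\<Sum>c<d. P $$ (b, c) * Q $$ (c, a))) + (\<Sum>b<d. L $$ (a, b) * (\<Sum>c<d. Q $$ (b, c) * P $$ (c, a)))"
    if "a < d" for a
  proof -
    have pq: "(P * Q + Q * P) $$ (b, a) = (\<Sum>c<d. P $$ (b, c) * Q $$ (c, a)) + (\<Sum>c<d. Q $$ (b, c) * P $$ (c, a))" if "b < d" for b
      using assms that \<open>a < d\<close> by (auto simp: scalar_prod_def lessThan_atLeast0)
    have "(L * (P * Q + Q * P)) $$ (a, a) = (\<Sum>b<d. L $$ (a, b) * (P * Q + Q * P) $$ (b, a))"
      using assms that by (auto simp: scalar_prod_def lessThan_atLeast0 intro!: sum.cong)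
    also have "\<dots> = (\<Sum>b<d. L $$ (a, b) * ((\<Sum>c<d. P $$ (b, c) * Q $$ (c, a)) + (\<Sum>c<d. Q $$ (b, c) * P $$ (c, a))))"
      by (intro sum.cong refl) (simp add: pq)
    finally show ?thesis by (simp add: distrib_left sum.distrib)
  qed
  then show ?thesis using assms by (simp add: trace_mat_def sum.distrib sum_distrib_left)
qed

lemma adj_map_transpose:
  assumes "L \<in> carrier_mat d d" "\<And>i. R i \<in> carrier_mat d d"
  shows "Finite_Cartesian_Product.transpose (adj_map R L) = adj_map R L"
  using assms by (simp add: adj_map_def Finite_Cartesian_Product.transpose_def Finite_Cartesian_Product.vec_eq_iff trace_mat_mult3 add.commute)

text \<open>The right side is the trace of L times the square of R[x]: this is the duality between
  \<open>adj_map\<close> and the quadratic map that defines a spectratope.\<close>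

lemma adj_map_form:
  assumes L: "L \<in> carrier_mat d d" and R: "\<And>i. sym_mat d (R i)"
  shows "x \<bullet> (adj_map R L *v x) = (\<Sum>a<d. \<Sum>b<d. L $$ (a, b) * (\<Sum>c<d. lin_ker d R x c a * lin_ker d R x c b))"
proof -
  have Rc: "R i \<in> carrier_mat d d" for i using R by (auto simp: sym_mat_def)
  define F where "F i j = (\<Sum>a<d. \<Sum>b<d. \<Sum>c<d. L $$ (a, b) * (R i $$ (b, c) * R j $$ (c, a)))" for i j
  have "x \<bullet> (adj_map R L *v x) = (\<Sum>i\<in>UNIV. \<Sum>j\<in>UNIV. x $ i * (1/2 * (F i j + F j i)) * x $ j)"
    by (simp add: inner_vec_def matrix_vector_mult_def adj_map_def trace_mat_mult3[OF L Rc Rc] F_def sum_distrib_left mult.assoc)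
  also have "\<dots> = (\<Sum>i\<in>UNIV. \<Sum>j\<in>UNIV. x $ i * F i j * x $ j) / 2 + (\<Sum>i\<in>UNIV. \<Sum>j\<in>UNIV. x $ i * F j i * x $ j) / 2"
    by (simp add: sum_divide_distrib sum.distrib[symmetric] algebra_simps add_divide_distrib)
  also have "(\<Sum>i\<in>UNIV. \<Sum>j\<in>UNIV. x $ i * F j i * x $ j) = (\<Sum>j\<in>UNIV. \<Sum>i\<in>UNIV. x $ i * F j i * x $ j)" by (rule sum.swap)
  also have "\<dots> = (\<Sum>i\<in>UNIV. \<Sum>j\<in>UNIV. x $ i * F i j * x $ j)" by (intro sum.cong refl) (simp add: mult_ac)
  finally have "x \<bullet> (adj_map R L *v x) = (\<Sum>i\<in>UNIV. \<Sum>j\<in>UNIV. x $ i * F i j * x $ j)" by simp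
  also have "\<dots> = (\<Sum>i\<in>UNIV. \<Sum>j\<in>UNIV. \<Sum>a<d. \<Sum>b<d. \<Sum>c<d. L $$ (a, b) * ((x $ i * R i $$ (b, c)) * (x $ j * R j $$ (c, a))))"
    by (simp add: F_def sum_distrib_left sum_distrib_right mult_ac)
  also have "\<dots> = (\<Sum>a<d. \<Sum>b<d. \<Sum>c<d. \<Sum>i\<in>UNIV. \<Sum>j\<in>UNIV. L $$ (a, b) * ((x $ i * R i $$ (b, c)) * (x $ j * R j $$ (c, a))))"
  proof -
    have s: "(\<Sum>i\<in>UNIV. \<Sum>j\<in>UNIV. \<Sum>a<d. g i j a) = (\<Sum>a<d. \<Sum>i\<in>UNIV. \<Sum>j\<in>UNIV. g i j a)" for g :: "'a \<Rightarrow> 'a \<Rightarrow> nat \<Rightarrow> real"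
    proof -
      have "(\<Sum>i\<in>UNIV. \<Sum>j\<in>UNIV. \<Sum>a<d. g i j a) = (\<Sum>i\<in>UNIV. \<Sum>a<d. \<Sum>j\<in>UNIV. g i j a)" by (intro sum.cong refl sum.swap)
      also have "\<dots> = (\<Sum>a<d. \<Sum>i\<in>UNIV. \<Sum>j\<in>UNIV. g i j a)" by (rule sum.swap)
      finally show ?thesis .
    qed
    show ?thesis by (simp only: s)
  qed
  also have "\<dots> = (\<Sum>a<d. \<Sum>b<d. L $$ (a, b) * (\<Sum>c<d. lin_ker d R x c a * lin_ker d R x c b))"
  proof -
    have "(\<Sum>i\<in>UNIV. \<Sum>j\<in>UNIV. L $$ (a, b) * ((x $ i * R i $$ (b, c)) * (x $ j * R j $$ (c, a)))) = L $$ (a, b) * (lin_ker d R x c a * lin_ker d R x c b)"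
      if "a < d" "b < d" "c < d" for a b c
    proof -
      have "(\<Sum>i\<in>UNIV. x $ i * R i $$ (b, c)) = (\<Sum>i\<in>UNIV. x $ i * R i $$ (c, b))"
        using sym_mat_nth[OF R that(2,3)] by simp
      moreover have "(\<Sum>i\<in>UNIV. \<Sum>j\<in>UNIV. L $$ (a, b) * ((x $ i * R i $$ (b, c)) * (x $ j * R j $$ (c, a))))
          = L $$ (a, b) * ((\<Sum>i\<in>UNIV. x $ i * R i $$ (b, c)) * (\<Sum>j\<in>UNIV. x $ j * R j $$ (c, a)))"
        unfolding sum_product by (simp only: sum_distrib_left)
      ultimately show ?thesis using that by (simp add: lin_ker_def mult.commute)
    qed
    then show ?thesis by (simp add: sum_distrib_left)
  qed
  finally show ?thesis .
qed

lemma adj_map_form_gram: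
  assumes L: "L \<in> carrier_mat d d" and R: "\<And>i. sym_mat d (R i)"
    and w: "\<And>a b. a < d \<Longrightarrow> b < d \<Longrightarrow> L $$ (a, b) = (\<Sum>e\<in>E. w e a * w e b)"
  shows "x \<bullet> (adj_map R L *v x) = (\<Sum>e\<in>E. lin_sqnorm d R x (w e))"
proof -
  have "x \<bullet> (adj_map R L *v x) = (\<Sum>a<d. \<Sum>b<d. \<Sum>e\<in>E. \<Sum>c<d. (lin_ker d R x c a * w e a) * (lin_ker d R x c b * w e b))"
    unfolding adj_map_form[OF L R]
    by (intro sum.cong refl) (simp add: w sum_distrib_left sum_distrib_right mult_ac, rule sum.swap)
  also have "\<dots> = (\<Sum>e\<in>E. \<Sum>a<d. \<Sum>b<d. \<Sum>c<d. (lin_ker d R x c a * w e a) * (lin_ker d R x c b * w e b))"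
    by (simp only: sum.swap[of _ E "{..<d}"])
  also have "\<dots> = (\<Sum>e\<in>E. \<Sum>c<d. \<Sum>a<d. \<Sum>b<d. (lin_ker d R x c a * w e a) * (lin_ker d R x c b * w e b))"
  proof (rule sum.cong[OF refl])
    fix e
    have "(\<Sum>a<d. \<Sum>b<d. \<Sum>c<d. (lin_ker d R x c a * w e a) * (lin_ker d R x c b * w e b))
        = (\<Sum>a<d. \<Sum>c<d. \<Sum>b<d. (lin_ker d R x c a * w e a) * (lin_ker d R x c b * w e b))"
      by (intro sum.cong refl sum.swap)
    also have "\<dots> = (\<Sum>c<d. \<Sum>a<d. \<Sum>b<d. (lin_ker d R x c a * w e a) * (lin_ker d R x c b * w e b))" by (rule sum.swap)
    finally show "(\<Sum>a<d. \<Sum>b<d. \<Sum>c<d. (lin_ker d R x c a * w e a) * (lin_ker d R x c b * w e b))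
      = (\<Sum>c<d. \<Sum>a<d. \<Sum>b<d. (lin_ker d R x c a * w e a) * (lin_ker d R x c b * w e b))" .
  qed
  also have "\<dots> = (\<Sum>e\<in>E. lin_sqnorm d R x (w e))"
    by (simp add: lin_sqnorm_def ker_apply_def power2_eq_square sum_product)
  finally show ?thesis .
qed

lemma psd_mat_gram:
  assumes "psd_mat d L"
  obtains w :: "nat \<Rightarrow> nat \<Rightarrow> real" where "\<And>a b. a < d \<Longrightarrow> b < d \<Longrightarrow> L $$ (a, b) = (\<Sum>e<d. w e a * w e b)"
    and "trace_mat L = (\<Sum>e<d. \<Sum>a<d. (w e a)\<^sup>2)"
proof -
  have c: "L \<in> carrier_mat d d" and p: "psd_on {..<d} (\<lambda>a b. L $$ (a, b))" using assms by (auto simp: psd_mat_iff)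
  obtain w :: "nat \<Rightarrow> nat \<Rightarrow> real" where w: "\<forall>a\<in>{..<d}. \<forall>b\<in>{..<d}. L $$ (a, b) = (\<Sum>e<d. w e a * w e b)"
    using psd_on_factor[OF finite_lessThan p] by blast
  have "trace_mat L = (\<Sum>a<d. \<Sum>e<d. (w e a)\<^sup>2)"
    using c w by (simp add: trace_mat_def power2_eq_square)
  also have "\<dots> = (\<Sum>e<d. \<Sum>a<d. (w e a)\<^sup>2)" by (rule sum.swap)
  finally show ?thesis using that w by auto
qed

lemma trace_mat_psd_nonneg: "psd_mat d L \<Longrightarrow> 0 \<le> trace_mat L"
  by (erule psd_mat_gram) (simp add: sum_nonneg)

text \<open>Rank-one multipliers probe R[x] in a single direction; they are the test matrices of
  \<open>spectratope_dual\<close>.\<close>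

lemma psd_mat_rank_one:
  fixes v :: "nat \<Rightarrow> real" and d :: nat
  assumes "0 \<le> \<mu>"
  defines "L \<equiv> Matrix.mat d d (\<lambda>(a, b). \<mu> * (v a * v b))"
  shows "psd_mat d L" and "trace_mat L = \<mu> * (\<Sum>a<d. (v a)\<^sup>2)"
    and "(\<And>i. sym_mat d (R i)) \<Longrightarrow> x \<bullet> (adj_map R L *v x) = \<mu> * lin_sqnorm d R x v"
proof -
  have c: "L \<in> carrier_mat d d" by (simp add: L_def)
  have g: "L $$ (a, b) = (\<Sum>e\<in>{0::nat}. (sqrt \<mu> * v a) * (sqrt \<mu> * v b))" if "a < d" "b < d" for a b
    using assms(1) that by (simp add: L_def)
  have "psd_on {..<d} (\<lambda>a b. L $$ (a, b))"
    unfolding psd_on_def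
  proof (intro conjI ballI allI)
    fix a b assume "a \<in> {..<d}" "b \<in> {..<d}" then show "L $$ (a, b) = L $$ (b, a)" by (simp add: L_def)
  next
    fix x
    have "(\<Sum>i<d. \<Sum>j<d. x i * L $$ (i, j) * x j) = \<mu> * (\<Sum>i<d. x i * v i)\<^sup>2"
      by (simp add: L_def power2_eq_square sum_product sum_distrib_left mult_ac)
    then show "0 \<le> (\<Sum>i<d. \<Sum>j<d. x i * L $$ (i, j) * x j)" using assms(1) by simp
  qed
  then show "psd_mat d L" using c by (simp add: psd_mat_iff)
  show "trace_mat L = \<mu> * (\<Sum>a<d. (v a)\<^sup>2)"
    by (simp add: L_def trace_mat_def sum_distrib_left power2_eq_square)
  assume R: "\<And>i. sym_mat d (R i)"
  have "x \<bullet> (adj_map R L *v x) = (\<Sum>e\<in>{0::nat}. lin_sqnorm d R x (\<lambda>a. sqrt \<mu> * v a))"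
    by (rule adj_map_form_gram[OF c R]) (use g in auto)
  also have "\<dots> = \<mu> * lin_sqnorm d R x v"
  proof -
    have "ker_apply I X (\<lambda>a. sqrt \<mu> * v a) i = sqrt \<mu> * ker_apply I X v i" for I X and i :: nat
      by (simp add: ker_apply_def sum_distrib_left mult_ac)
    then show ?thesis using assms(1) by (simp add: lin_sqnorm_def power_mult_distrib sum_distrib_left)
  qed
  finally show "x \<bullet> (adj_map R L *v x) = \<mu> * lin_sqnorm d R x v" .
qed

lemma psd_mat_add:
  assumes "psd_mat d L" "psd_mat d L'"
  shows "psd_mat d (L + L')" and "trace_mat (L + L') = trace_mat L + trace_mat L'"
proof -
  have c: "L \<in> carrier_mat d d" "L' \<in> carrier_mat d d" using assms by (auto simp: psd_mat_iff)
  show "trace_mat (L + L') = trace_mat L + trace_mat L'" using c by (simp add: trace_mat_def sum.distrib)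
  have "(\<Sum>i<d. \<Sum>j<d. x i * (L + L') $$ (i, j) * x j) = (\<Sum>i<d. \<Sum>j<d. x i * L $$ (i, j) * x j) + (\<Sum>i<d. \<Sum>j<d. x i * L' $$ (i, j) * x j)" for x
    using c by (simp add: sum.distrib[symmetric] algebra_simps)
  then show "psd_mat d (L + L')" using assms c by (auto simp: psd_mat_iff psd_on_def)
qed

lemma psd_mat_smult:
  assumes "psd_mat d L" "0 \<le> \<mu>"
  shows "psd_mat d (\<mu> \<cdot>\<^sub>m L)" and "trace_mat (\<mu> \<cdot>\<^sub>m L) = \<mu> * trace_mat L"
proof -
  have c: "L \<in> carrier_mat d d" using assms by (auto simp: psd_mat_iff)
  show "trace_mat (\<mu> \<cdot>\<^sub>m L) = \<mu> * trace_mat L" using c by (simp add: trace_mat_def sum_distrib_left)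
  have "(\<Sum>i<d. \<Sum>j<d. x i * (\<mu> \<cdot>\<^sub>m L) $$ (i, j) * x j) = \<mu> * (\<Sum>i<d. \<Sum>j<d. x i * L $$ (i, j) * x j)" for x
    using c by (simp add: sum_distrib_left mult_ac)
  then show "psd_mat d (\<mu> \<cdot>\<^sub>m L)" using assms c by (auto simp: psd_mat_iff psd_on_def)
qed

lemma adj_map_add:
  assumes "L \<in> carrier_mat d d" "L' \<in> carrier_mat d d" "\<And>i. R i \<in> carrier_mat d d"
  shows "adj_map R (L + L') = adj_map R L + adj_map R L'"
  using assms
  by (simp add: adj_map_def Finite_Cartesian_Product.vec_eq_iff trace_mat_mult3[of _ d] sum.distrib algebra_simps)

lemma adj_map_smult:
  assumes "L \<in> carrier_mat d d" "\<And>i. R i \<in> carrier_mat d d"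
  shows "adj_map R (\<mu> \<cdot>\<^sub>m L) = \<mu> *\<^sub>R adj_map R L"
  using assms
  by (simp add: adj_map_def Finite_Cartesian_Product.vec_eq_iff trace_mat_mult3[of _ d] sum_distrib_left algebra_simps)

section \<open>Norms and their conjugates\<close>

lemma is_normD:
  assumes "is_norm N"
  shows "0 \<le> N u" "N u = 0 \<longleftrightarrow> u = 0" "N (c *\<^sub>R u) = \<bar>c\<bar> * N u" "N (u + w) \<le> N u + N w"
  using assms by (simp_all add: is_norm_def)

lemma is_norm_zero: "is_norm N \<Longrightarrow> N 0 = 0"
  using is_normD(2)[of N 0] by blast

lemma is_norm_minus: "is_norm N \<Longrightarrow> N (- u) = N u"
  using is_normD(3)[of N "-1" u] by simp

lemma is_norm_continuous:
  fixes N :: "real ^ 'v \<Rightarrow> real"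
  assumes N: "is_norm N"
  shows "continuous_on UNIV N"
proof -
  have "convex_on UNIV N"
  proof (rule convex_onI)
    fix t :: real and x y :: "real ^ 'v" assume "0 < t" "t < 1"
    then show "N ((1 - t) *\<^sub>R x + t *\<^sub>R y) \<le> (1 - t) * N x + t * N y"
      using is_normD(4)[OF N, of "(1 - t) *\<^sub>R x" "t *\<^sub>R y"] by (simp add: is_normD(3)[OF N])
  qed simp
  then show ?thesis by (rule convex_on_continuous[OF open_UNIV])
qed

lemma is_norm_lower_bound:
  fixes N :: "real ^ 'v \<Rightarrow> real"
  assumes N: "is_norm N"
  obtains c where "0 < c" "\<And>u. c * norm u \<le> N u"
proof -
  have "compact (sphere (0 :: real ^ 'v) 1)" by simp
  moreover have "sphere (0 :: real ^ 'v) 1 \<noteq> {}" by (simp add: sphere_eq_empty)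
  ultimately obtain x where x: "x \<in> sphere 0 1" "\<And>y. y \<in> sphere 0 1 \<Longrightarrow> N x \<le> N y"
    using continuous_attains_inf[of "sphere 0 1" N] continuous_on_subset[OF is_norm_continuous[OF N]] by blast
  show ?thesis
  proof
    have "x \<noteq> 0" using x(1) by auto
    then show "0 < N x" using is_normD(1,2)[OF N, of x] by simp
    fix u :: "real ^ 'v"
    show "N x * norm u \<le> N u"
    proof (cases "u = 0")
      case False
      then have "N x \<le> N ((1 / norm u) *\<^sub>R u)" by (intro x(2)) simp
      also have "\<dots> = N u / norm u" using False by (simp add: is_normD(3)[OF N])
      finally show ?thesis using False by (simp add: field_simps)
    qed (simp add: is_norm_zero[OF N])
  qed
qed

lemma conj_norm_bdd_above:
  assumes "is_norm N"
  shows "bdd_above ((\<lambda>u. z \<bullet> u) ` {u. N u \<le> 1})"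
proof -
  obtain c where c: "0 < c" "\<And>u. c * norm u \<le> N u" using is_norm_lower_bound[OF assms] by blast
  show ?thesis
  proof (rule bdd_aboveI2)
    fix u assume "u \<in> {u. N u \<le> 1}"
    then have "c * norm u \<le> 1" using c(2)[of u] by simp
    then have "norm u \<le> 1 / c" using c(1) by (simp add: field_simps)
    then show "z \<bullet> u \<le> norm z * (1 / c)"
      using norm_cauchy_schwarz[of z u] mult_left_mono[of "norm u" "1 / c" "norm z"] by simp
  qed
qed

lemma inner_le_norm_if_conj_norm_le_1:
  assumes N: "is_norm N" and z: "conj_norm N z \<le> 1"
  shows "z \<bullet> u \<le> N u"
proof (cases "u = 0")
  case False
  then have p: "0 < N u" using is_normD(1,2)[OF N, of u] by simp
  have "z \<bullet> ((1 / N u) *\<^sub>R u) \<le> conj_norm N z"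
    unfolding conj_norm_def using p
    by (intro cSUP_upper conj_norm_bdd_above N) (simp add: is_normD(3)[OF N])
  then have "z \<bullet> u / N u \<le> 1" using z by simp
  then show ?thesis using p by (simp add: field_simps)
qed (simp add: is_norm_zero[OF N])

text \<open>The nontrivial half of the duality of norms. If \<open>N u\<close> exceeded
  \<open>c\<close>, a hyperplane would separate a multiple of \<open>u\<close> from the unit ball,
  and its normalized normal vector would be a point of the conjugate ball that violates the
  hypothesis.\<close>

lemma norm_le_if_conj_norm_bound:
  assumes N: "is_norm N" and c: "\<And>z. conj_norm N z \<le> 1 \<Longrightarrow> z \<bullet> u \<le> c"
  shows "N u \<le> c"
proof (rule ccontr)
  assume "\<not> N u \<le> c"
  then have cu: "c < N u" by simp
  have ne: "{u. N u \<le> 1} \<noteq> {}" using is_norm_zero[OF N] by (intro ex_in_conv[THEN iffD1] exI[of _ 0]) simp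
  have conj_le: "conj_norm N z \<le> b" if "\<And>w. N w \<le> 1 \<Longrightarrow> z \<bullet> w \<le> b" for z b
    unfolding conj_norm_def using that by (intro cSUP_least ne) simp
  have c0: "0 \<le> c" using c[of 0] conj_le[of 0 1] by simp
  \<comment> \<open>Strictly between \<open>c\<close> and \<open>N u\<close>: the point
    \<open>u / c'\<close> is outside the unit ball, and yet the separation gives more than
    \<open>c\<close>.\<close>
  define c' where "c' = (c + N u) / 2"
  have c': "c < c'" "c' < N u" "0 < c'" using cu c0 by (auto simp: c'_def)
  have "convex {u. N u \<le> 1}"
  proof (rule convexI)
    fix x y s t assume h: "x \<in> {u. N u \<le> 1}" "y \<in> {u. N u \<le> 1}" "0 \<le> s" "0 \<le> t" "s + t = (1::real)"
    have "N (s *\<^sub>R x + t *\<^sub>R y) \<le> s * N x + t * N y"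
      using is_normD(4)[OF N, of "s *\<^sub>R x" "t *\<^sub>R y"] h by (simp add: is_normD(3)[OF N])
    also have "\<dots> \<le> s * 1 + t * 1" using h by (intro add_mono mult_left_mono) auto
    finally show "s *\<^sub>R x + t *\<^sub>R y \<in> {u. N u \<le> 1}" using h by simp
  qed
  moreover have "closed {u. N u \<le> 1}"
    by (intro closed_Collect_le is_norm_continuous[OF N] continuous_on_const)
  moreover have "(1 / c') *\<^sub>R u \<notin> {u. N u \<le> 1}" using c' by (simp add: is_normD(3)[OF N])
  ultimately obtain a b where ab: "a \<bullet> ((1 / c') *\<^sub>R u) < b" "\<And>w. N w \<le> 1 \<Longrightarrow> b < a \<bullet> w"
    using separating_hyperplane_closed_point[of "{u. N u \<le> 1}" "(1 / c') *\<^sub>R u"] by auto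
  \<comment> \<open>The ball lies on the upper side of the hyperplane and contains 0, so
    \<open>b\<close> is negative and division by it reverses the inequalities.\<close>
  have b0: "b < 0" using ab(2)[of 0] is_norm_zero[OF N] by simp
  define z where "z = (1 / b) *\<^sub>R a"
  have "conj_norm N z \<le> 1"
  proof (rule conj_le)
    fix w assume "N w \<le> 1"
    then have "b < a \<bullet> w" by (rule ab(2))
    then show "z \<bullet> w \<le> 1" using b0 by (simp add: z_def divide_le_eq)
  qed
  then have "z \<bullet> u \<le> c" by (rule c)
  moreover have "c' < z \<bullet> u"
    using ab(1) b0 c' by (simp add: z_def field_simps)
  ultimately show False using c' by simp
qed

section \<open>Forms on spectratopes, positive semidefinite blocks and their traces\<close>

lemma spectratope_dataD:
  assumes "spectratope_data d R T"
  shows "1 \<le> d k" "sym_mat (d k) (R k i)" "monotonic_set T" "R k i \<in> carrier_mat (d k) (d k)"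
    "x \<noteq> 0 \<Longrightarrow> \<exists>k. lin_mat (d k) (R k) x \<noteq> 0\<^sub>m (d k) (d k)"
proof -
  note a = assms[unfolded spectratope_data_def]
  show "1 \<le> d k" using a by simp
  show "sym_mat (d k) (R k i)" using a by simp
  then show "R k i \<in> carrier_mat (d k) (d k)" by (simp add: sym_mat_def)
  show "monotonic_set T" using a by simp
  show "\<exists>k. lin_mat (d k) (R k) x \<noteq> 0\<^sub>m (d k) (d k)" if "x \<noteq> 0" using a that by simp
qed

lemma supp_fun_upper:
  assumes "monotonic_set T" "t \<in> T"
  shows "g \<bullet> t \<le> supp_fun T g"
  unfolding supp_fun_def
proof (rule cSUP_upper[OF assms(2)])
  have "compact T" using assms by (simp add: monotonic_set_def)
  then have "compact ((\<bullet>) g ` T)" by (intro compact_continuous_image continuous_intros)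
  then show "bdd_above ((\<bullet>) g ` T)" by (intro bounded_imp_bdd_above compact_imp_bounded)
qed

lemma supp_fun_least:
  assumes "monotonic_set T" "\<And>t. t \<in> T \<Longrightarrow> g \<bullet> t \<le> c"
  shows "supp_fun T g \<le> c"
  unfolding supp_fun_def
proof (rule cSUP_least)
  show "T \<noteq> {}" using assms(1) unfolding monotonic_set_def by blast
qed (rule assms(2))

lemma sum_matrix_vector_mult: "(\<Sum>k\<in>K. P k) *v x = (\<Sum>k\<in>K. P k *v (x :: real ^ 'n))"
  by (induction K rule: infinite_finite_induct) (simp_all add: matrix_vector_mult_add_rdistrib)

text \<open>The form is the sum over \<open>k\<close> of the traces of \<open>L k\<close> times the
  square of R_k[x], and one vector of \<open>T\<close> dominates all these squares.\<close>

lemma spectratope_form_le: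
  assumes sd: "spectratope_data d R T" and x: "x \<in> basic_spectratope d R T" and L: "\<And>k. psd_mat (d k) (L k)"
  shows "x \<bullet> ((\<Sum>k\<in>UNIV. adj_map (R k) (L k)) *v x) \<le> supp_fun T (trace_vec L)"
proof -
  note sym = spectratope_dataD(2)[OF sd]
  obtain t where t: "t \<in> T" "\<And>k v. lin_sqnorm (d k) (R k) x v \<le> t $ k * (\<Sum>a<d k. (v a)\<^sup>2)"
    using x unfolding basic_spectratope_altdef[of d R, OF sym] by blast
  have "x \<bullet> (adj_map (R k) (L k) *v x) \<le> t $ k * trace_mat (L k)" for k
  proof (rule psd_mat_gram[OF L[of k]])
    fix w :: "nat \<Rightarrow> nat \<Rightarrow> real"
    assume w: "\<And>a b. a < d k \<Longrightarrow> b < d k \<Longrightarrow> L k $$ (a, b) = (\<Sum>e<d k. w e a * w e b)"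
      and tr: "trace_mat (L k) = (\<Sum>e<d k. \<Sum>a<d k. (w e a)\<^sup>2)"
    have "x \<bullet> (adj_map (R k) (L k) *v x) = (\<Sum>e<d k. lin_sqnorm (d k) (R k) x (w e))"
      using L[of k] by (intro adj_map_form_gram sym w) (auto simp: psd_mat_iff)
    also have "\<dots> \<le> (\<Sum>e<d k. t $ k * (\<Sum>a<d k. (w e a)\<^sup>2))" by (intro sum_mono t)
    finally show ?thesis by (simp add: tr sum_distrib_left)
  qed
  then have "x \<bullet> ((\<Sum>k\<in>UNIV. adj_map (R k) (L k)) *v x) \<le> (\<Sum>k\<in>UNIV. t $ k * trace_mat (L k))"
    by (simp add: sum_matrix_vector_mult inner_sum_right sum_mono)
  also have "\<dots> = trace_vec L \<bullet> t" by (simp add: inner_vec_def trace_vec_def mult.commute)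
  also have "\<dots> \<le> supp_fun T (trace_vec L)" by (rule supp_fun_upper[OF spectratope_dataD(3)[OF sd] t(1)])
  finally show ?thesis .
qed

lemma matrix_vector_mult_minus: "A *v (- x) = - (A *v (x :: real ^ 'n))"
  by (simp add: matrix_vector_mult_def Finite_Cartesian_Product.vec_eq_iff sum_negf)

lemma block_matrix_form:
  "vec_join (x, y) \<bullet> (block_matrix P Q R S *v vec_join (x, y))
    = x \<bullet> (P *v x) + x \<bullet> (Q *v y) + y \<bullet> (R *v x) + y \<bullet> (S *v y)"
proof -
  have "(block_matrix P Q R S *v vec_join (x, y)) $ Inl i = (P *v x) $ i + (Q *v y) $ i" for i
    by (simp add: matrix_vector_mult_def block_matrix_def sum_UNIV_Plus)
  moreover have "(block_matrix P Q R S *v vec_join (x, y)) $ Inr i = (R *v x) $ i + (S *v y) $ i" for i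
    by (simp add: matrix_vector_mult_def block_matrix_def sum_UNIV_Plus)
  ultimately show ?thesis
    by (simp add: inner_vec_def[of "vec_join _"] sum_UNIV_Plus distrib_left sum.distrib) (simp add: inner_vec_def)
qed

lemma psd_iff_psd_on: "psd A \<longleftrightarrow> psd_on UNIV (\<lambda>i j. A $ i $ j)"
proof -
  have "(\<forall>x. 0 \<le> x \<bullet> (A *v x)) \<longleftrightarrow> (\<forall>x. 0 \<le> (\<Sum>i\<in>UNIV. \<Sum>j\<in>UNIV. x i * A $ i $ j * x j))"
  proof (intro iffI allI)
    fix x assume "\<forall>x. 0 \<le> x \<bullet> (A *v x)"
    then have "0 \<le> (\<chi> i. x i) \<bullet> (A *v (\<chi> i. x i))" by blast
    then show "0 \<le> (\<Sum>i\<in>UNIV. \<Sum>j\<in>UNIV. x i * A $ i $ j * x j)"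
      by (simp add: inner_vec_def matrix_vector_mult_def sum_distrib_left mult.assoc)
  next
    fix x assume "\<forall>x. 0 \<le> (\<Sum>i\<in>UNIV. \<Sum>j\<in>UNIV. x i * A $ i $ j * x j)"
    then have "0 \<le> (\<Sum>i\<in>UNIV. \<Sum>j\<in>UNIV. x $ i * A $ i $ j * x $ j)" by blast
    then show "0 \<le> x \<bullet> (A *v x)"
      by (simp add: inner_vec_def matrix_vector_mult_def sum_distrib_left mult.assoc)
  qed
  moreover have "Finite_Cartesian_Product.transpose A = A \<longleftrightarrow> (\<forall>i\<in>UNIV. \<forall>j\<in>UNIV. A $ i $ j = A $ j $ i)"
    by (auto simp: Finite_Cartesian_Product.transpose_def Finite_Cartesian_Product.vec_eq_iff)
  ultimately show ?thesis by (simp add: psd_def psd_on_def)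
qed

lemma psd_gram:
  fixes A :: "real ^ 'n ^ 'n"
  assumes "psd A"
  obtains w :: "'n \<Rightarrow> real ^ 'n" where "\<And>i j. A $ i $ j = (\<Sum>k\<in>UNIV. w k $ i * w k $ j)"
proof -
  obtain v :: "'n \<Rightarrow> 'n \<Rightarrow> real" where "\<forall>i\<in>UNIV. \<forall>j\<in>UNIV. A $ i $ j = (\<Sum>k\<in>UNIV. v k i * v k j)"
    using psd_on_factor[OF finite_class.finite_UNIV] assms unfolding psd_iff_psd_on by blast
  then show ?thesis using that[of "\<lambda>k. \<chi> i. v k i"] by simp
qed

text \<open>With \<open>A\<close> a sum of rank-one matrices, the pairing is the sum of the values
  of the form of \<open>P\<close> at the Gram vectors of \<open>A\<close>.\<close>

lemma psd_trace_mult_nonneg: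
  assumes "psd (A :: real ^ 'n ^ 'n)" "\<And>x. 0 \<le> x \<bullet> (P *v x)"
  shows "0 \<le> (\<Sum>i\<in>UNIV. \<Sum>j\<in>UNIV. A $ i $ j * P $ i $ j)"
proof -
  obtain w :: "'n \<Rightarrow> real ^ 'n" where w: "\<And>i j. A $ i $ j = (\<Sum>k\<in>UNIV. w k $ i * w k $ j)"
    using psd_gram[OF assms(1)] by blast
  have "(\<Sum>i\<in>UNIV. \<Sum>j\<in>UNIV. A $ i $ j * P $ i $ j) = (\<Sum>i\<in>UNIV. \<Sum>j\<in>UNIV. \<Sum>k\<in>UNIV. w k $ i * P $ i $ j * w k $ j)"
    by (intro sum.cong refl) (simp add: w sum_distrib_right sum_distrib_left mult_ac)
  also have "\<dots> = (\<Sum>i\<in>UNIV. \<Sum>k\<in>UNIV. \<Sum>j\<in>UNIV. w k $ i * P $ i $ j * w k $ j)" by (intro sum.cong refl sum.swap)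
  also have "\<dots> = (\<Sum>k\<in>UNIV. \<Sum>i\<in>UNIV. \<Sum>j\<in>UNIV. w k $ i * P $ i $ j * w k $ j)" by (rule sum.swap)
  also have "\<dots> = (\<Sum>k\<in>UNIV. w k \<bullet> (P *v w k))"
    by (simp add: inner_vec_def matrix_vector_mult_def sum_distrib_left mult.assoc)
  finally show ?thesis by (simp add: sum_nonneg assms(2))
qed

lemma trace_matrix_mult: "trace (X ** Th) = (\<Sum>i\<in>UNIV. \<Sum>j\<in>UNIV. X $ i $ j * Th $ j $ i)"
  by (simp add: trace_def matrix_matrix_mult_def)

lemma Gam_upper:
  fixes Q :: "(real ^ 'm ^ 'm) set"
  assumes "compact Q" "X \<in> Q"
  shows "trace (X ** Th) \<le> Gam Q Th"
  unfolding Gam_def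
proof (rule cSUP_upper[OF assms(2)])
  have "compact ((\<lambda>X. trace (X ** Th)) ` Q)"
    using assms(1) unfolding trace_matrix_mult by (intro compact_continuous_image continuous_intros)
  then show "bdd_above ((\<lambda>X. trace (X ** Th)) ` Q)" by (intro bounded_imp_bdd_above compact_imp_bounded)
qed

lemma psd_block_matrix_fst: "psd (block_matrix P U V W) \<Longrightarrow> psd P"
proof -
  assume p: "psd (block_matrix P U V W)"
  have "0 \<le> x \<bullet> (P *v x)" for x
    using p block_matrix_form[of x 0 P U V W] unfolding psd_def by (metis add.right_neutral inner_zero_left inner_zero_right matrix_vector_mult_0_right)
  moreover have "P $ i $ j = P $ j $ i" for i j
  proof -
    have "block_matrix P U V W $ Inl i $ Inl j = block_matrix P U V W $ Inl j $ Inl i"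
      using p by (simp add: psd_iff_psd_on psd_on_def)
    then show ?thesis by (simp add: block_matrix_def)
  qed
  ultimately show ?thesis
    by (simp add: psd_def Finite_Cartesian_Product.transpose_def Finite_Cartesian_Product.vec_eq_iff)
qed

section \<open>The risk of a feasible linear estimate\<close>

context
  fixes A :: "real ^ 'n::finite ^ 'm::finite" and B :: "real ^ 'n ^ 'v::finite"
    and M :: "real ^ 'q::finite ^ 'v"
    and d :: "'k::finite \<Rightarrow> nat" and R :: "'k \<Rightarrow> 'n \<Rightarrow> real mat" and T :: "(real ^ 'k) set"
    and f :: "'l::finite \<Rightarrow> nat" and S :: "'l \<Rightarrow> 'q \<Rightarrow> real mat" and Rs :: "(real ^ 'l) set"
    and N :: "real ^ 'v \<Rightarrow> real" and Q :: "(real ^ 'm ^ 'm) set"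
  assumes sdR: "spectratope_data d R T" and N: "is_norm N" and sdS: "spectratope_data f S Rs"
    and ball: "{z. conj_norm N z \<le> 1} = (\<lambda>y. M *v y) ` basic_spectratope f S Rs"
    and Q: "Q \<noteq> {}" "compact Q" "\<forall>C \<in> Q. pos_def C"
begin

lemma norm_le_if_spectratope_bound:
  assumes "\<And>y. y \<in> basic_spectratope f S Rs \<Longrightarrow> (M *v y) \<bullet> u \<le> c"
  shows "N u \<le> c"
proof (rule norm_le_if_conj_norm_bound[OF N])
  fix z assume "conj_norm N z \<le> 1"
  then have "z \<in> (\<lambda>y. M *v y) ` basic_spectratope f S Rs" unfolding ball[symmetric] by simp
  then obtain y where "y \<in> basic_spectratope f S Rs" "z = M *v y" by (elim imageE)
  then show "z \<bullet> u \<le> c" using assms by simp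
qed

lemma spectratope_inner_le:
  assumes "y \<in> basic_spectratope f S Rs"
  shows "(M *v y) \<bullet> u \<le> N u"
proof -
  have "M *v y \<in> {z. conj_norm N z \<le> 1}" unfolding ball using assms by (rule imageI)
  then show ?thesis by (intro inner_le_norm_if_conj_norm_le_1[OF N]) simp
qed

text \<open>The second block form at the pair of \<xi> and \<open>- y\<close> is nonnegative; the
  minus sign moves the pairing of \<open>M *v y\<close> with the noise to the smaller side. For
  \<open>y\<close> in the spectratope the remaining form in \<open>y\<close> is bounded by
  \<open>spectratope_form_le\<close>.\<close>

lemma feasible_noise_bound:
  assumes "feasible A B M d R f S (H, \<Lambda>, \<Upsilon>, \<Upsilon>', \<Theta>)"
  shows "N (Finite_Cartesian_Product.transpose H *v \<xi>) \<le> \<xi> \<bullet> (\<Theta> *v \<xi>) + supp_fun Rs (trace_vec \<Upsilon>')"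
proof (rule norm_le_if_spectratope_bound)
  fix y assume y: "y \<in> basic_spectratope f S Rs"
  let ?P = "\<Sum>l\<in>UNIV. adj_map (S l) (\<Upsilon>' l)"
  have p: "\<And>l. psd_mat (f l) (\<Upsilon>' l)" and b: "psd (block_matrix \<Theta> ((1/2) *\<^sub>R (H ** M)) ((1/2) *\<^sub>R (Finite_Cartesian_Product.transpose M ** Finite_Cartesian_Product.transpose H)) ?P)"
    using assms by (auto simp: feasible_def)
  have "0 \<le> \<xi> \<bullet> (\<Theta> *v \<xi>) + \<xi> \<bullet> ((1/2) *\<^sub>R (H ** M) *v (- y)) + (- y) \<bullet> ((1/2) *\<^sub>R (Finite_Cartesian_Product.transpose M ** Finite_Cartesian_Product.transpose H) *v \<xi>) + (- y) \<bullet> (?P *v (- y))"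
    using b unfolding psd_def block_matrix_form[symmetric] by blast
  also have "\<xi> \<bullet> ((1/2) *\<^sub>R (H ** M) *v (- y)) = - (1/2) * ((M *v y) \<bullet> (Finite_Cartesian_Product.transpose H *v \<xi>))"
    by (simp add: matrix_vector_mult_scaleR scaleR_matrix_vector_assoc[symmetric] matrix_vector_mul_assoc[symmetric] matrix_vector_mult_minus transpose_matrix_vector dot_lmul_matrix[symmetric] inner_commute)
  also have "(- y) \<bullet> ((1/2) *\<^sub>R (Finite_Cartesian_Product.transpose M ** Finite_Cartesian_Product.transpose H) *v \<xi>) = - (1/2) * ((M *v y) \<bullet> (Finite_Cartesian_Product.transpose H *v \<xi>))"
    by (simp add: scaleR_matrix_vector_assoc[symmetric] matrix_vector_mul_assoc[symmetric] transpose_matrix_vector[of M] dot_lmul_matrix inner_commute[of y] inner_commute[of "M *v y"])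
  also have "(- y) \<bullet> (?P *v (- y)) = y \<bullet> (?P *v y)" by (simp add: matrix_vector_mult_minus)
  finally have "(M *v y) \<bullet> (Finite_Cartesian_Product.transpose H *v \<xi>) \<le> \<xi> \<bullet> (\<Theta> *v \<xi>) + y \<bullet> (?P *v y)" by simp
  also have "y \<bullet> (?P *v y) \<le> supp_fun Rs (trace_vec \<Upsilon>')" by (rule spectratope_form_le[OF sdS y p])
  finally show "(M *v y) \<bullet> (Finite_Cartesian_Product.transpose H *v \<xi>) \<le> \<xi> \<bullet> (\<Theta> *v \<xi>) + supp_fun Rs (trace_vec \<Upsilon>')" by simp
qed

text \<open>The same argument with the first block; here both vectors range over spectratopes, so
  both diagonal forms are bounded by support functions.\<close>

lemma feasible_bias_bound:
  assumes "feasible A B M d R f S (H, \<Lambda>, \<Upsilon>, \<Upsilon>', \<Theta>)" and x: "x \<in> basic_spectratope d R T"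
  shows "N ((B - Finite_Cartesian_Product.transpose H ** A) *v x) \<le> supp_fun T (trace_vec \<Lambda>) + supp_fun Rs (trace_vec \<Upsilon>)"
proof (rule norm_le_if_spectratope_bound)
  fix y assume y: "y \<in> basic_spectratope f S Rs"
  let ?P = "\<Sum>k\<in>UNIV. adj_map (R k) (\<Lambda> k)" and ?P' = "\<Sum>l\<in>UNIV. adj_map (S l) (\<Upsilon> l)"
  let ?D = "B - Finite_Cartesian_Product.transpose H ** A"
  have p: "\<And>k. psd_mat (d k) (\<Lambda> k)" "\<And>l. psd_mat (f l) (\<Upsilon> l)"
    and b: "psd (block_matrix ?P ((1/2) *\<^sub>R ((Finite_Cartesian_Product.transpose B - Finite_Cartesian_Product.transpose A ** H) ** M)) ((1/2) *\<^sub>R (Finite_Cartesian_Product.transpose M ** ?D)) ?P')"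
    using assms by (auto simp: feasible_def)
  have tD: "Finite_Cartesian_Product.transpose B - Finite_Cartesian_Product.transpose A ** H = Finite_Cartesian_Product.transpose ?D"
    by (simp add: Finite_Cartesian_Product.vec_eq_iff Finite_Cartesian_Product.transpose_def matrix_matrix_mult_def mult.commute)
  have "0 \<le> x \<bullet> (?P *v x) + x \<bullet> ((1/2) *\<^sub>R (Finite_Cartesian_Product.transpose ?D ** M) *v (- y)) + (- y) \<bullet> ((1/2) *\<^sub>R (Finite_Cartesian_Product.transpose M ** ?D) *v x) + (- y) \<bullet> (?P' *v (- y))"
    using b unfolding tD psd_def block_matrix_form[symmetric] by blast
  also have "x \<bullet> ((1/2) *\<^sub>R (Finite_Cartesian_Product.transpose ?D ** M) *v (- y)) = - (1/2) * ((M *v y) \<bullet> (?D *v x))"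
    by (simp add: scaleR_matrix_vector_assoc[symmetric] matrix_vector_mul_assoc[symmetric] matrix_vector_mult_minus transpose_matrix_vector dot_lmul_matrix inner_commute[of x])
  also have "(- y) \<bullet> ((1/2) *\<^sub>R (Finite_Cartesian_Product.transpose M ** ?D) *v x) = - (1/2) * ((M *v y) \<bullet> (?D *v x))"
    by (simp add: scaleR_matrix_vector_assoc[symmetric] matrix_vector_mul_assoc[symmetric] transpose_matrix_vector[of M] dot_lmul_matrix inner_commute[of y] inner_commute[of "M *v y"])
  also have "(- y) \<bullet> (?P' *v (- y)) = y \<bullet> (?P' *v y)" by (simp add: matrix_vector_mult_minus)
  finally have "(M *v y) \<bullet> (?D *v x) \<le> x \<bullet> (?P *v x) + y \<bullet> (?P' *v y)" by simp
  then show "(M *v y) \<bullet> (?D *v x) \<le> supp_fun T (trace_vec \<Lambda>) + supp_fun Rs (trace_vec \<Upsilon>)"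
    using spectratope_form_le[OF sdS y p(2)] spectratope_form_le[OF sdR x p(1)] by linarith
qed

text \<open>The expectation is the pairing of \<Theta> with the second moment matrix, and the gap to
  a dominating member of \<open>Q\<close> pairs nonnegatively with \<Theta>.\<close>

lemma expectation_form_le_Gam:
  assumes P: "cov_dominated P Q" and Th: "psd \<Theta>"
  shows "integrable P (\<lambda>\<xi>. \<xi> \<bullet> (\<Theta> *v \<xi>))" and "(\<integral>\<xi>. \<xi> \<bullet> (\<Theta> *v \<xi>) \<partial>P) \<le> Gam Q \<Theta>"
proof -
  have i: "integrable P (\<lambda>\<xi>. (\<chi> i j. \<xi> $ i * \<xi> $ j) :: real ^ 'm ^ 'm)" using P by (simp add: cov_dominated_def)
  obtain X where X: "X \<in> Q" "psd (X - Cov P)" using P by (auto simp: cov_dominated_def)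
  have bl: "bounded_linear (\<lambda>A :: real ^ 'm ^ 'm. A $ i $ j)" for i j :: 'm
    by (rule bounded_linear_compose[of "\<lambda>v. v $ j" "\<lambda>A. A $ i"]) (rule bounded_linear_vec_nth)+
  have ij: "integrable P (\<lambda>\<xi>. \<xi> $ i * \<xi> $ j)" for i j :: 'm
    using integrable_bounded_linear[OF bl[of i j] i] by simp
  have Cij: "Cov P $ i $ j = (\<integral>\<xi>. \<xi> $ i * \<xi> $ j \<partial>P)" for i j :: 'm
    using integral_bounded_linear[OF bl[of i j] i] by (simp add: Cov_def)
  have e: "\<xi> \<bullet> (\<Theta> *v \<xi>) = (\<Sum>i\<in>UNIV. \<Sum>j\<in>UNIV. \<Theta> $ i $ j * (\<xi> $ i * \<xi> $ j))" for \<xi>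
    by (simp add: inner_vec_def matrix_vector_mult_def sum_distrib_left mult_ac)
  show "integrable P (\<lambda>\<xi>. \<xi> \<bullet> (\<Theta> *v \<xi>))"
    unfolding e by (intro Bochner_Integration.integrable_sum integrable_mult_right ij)
  have "(\<integral>\<xi>. \<xi> \<bullet> (\<Theta> *v \<xi>) \<partial>P) = (\<Sum>i\<in>UNIV. \<Sum>j\<in>UNIV. \<Theta> $ i $ j * Cov P $ i $ j)"
    unfolding e Cij by (simp add: Bochner_Integration.integral_sum Bochner_Integration.integrable_sum ij)
  also have "\<dots> \<le> (\<Sum>i\<in>UNIV. \<Sum>j\<in>UNIV. \<Theta> $ i $ j * X $ i $ j)"
    using psd_trace_mult_nonneg[OF Th, of "X - Cov P"] X(2)
    by (simp add: psd_def right_diff_distrib sum_subtractf)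
  also have "\<dots> = trace (X ** \<Theta>)"
  proof -
    have "\<Theta> $ i $ j = \<Theta> $ j $ i" for i j using Th by (auto simp: psd_iff_psd_on psd_on_def)
    then show ?thesis unfolding trace_matrix_mult by (intro sum.cong refl) (metis mult.commute)
  qed
  also have "\<dots> \<le> Gam Q \<Theta>" by (rule Gam_upper[OF Q(2) X(1)])
  finally show "(\<integral>\<xi>. \<xi> \<bullet> (\<Theta> *v \<xi>) \<partial>P) \<le> Gam Q \<Theta>" .
qed

lemma risk_le_objective:
  assumes fe: "feasible A B M d R f S (H, \<Lambda>, \<Upsilon>, \<Upsilon>', \<Theta>)"
  shows "Risk A B Q N (basic_spectratope d R T) (linear_estimate H) \<le> ennreal (objective T Rs Q (H, \<Lambda>, \<Upsilon>, \<Upsilon>', \<Theta>))"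
  unfolding Risk_def
proof (intro SUP_least)
  fix x P assume x: "x \<in> basic_spectratope d R T" and P: "P \<in> {P. cov_dominated P Q}"
  have th: "psd \<Theta>" using fe psd_block_matrix_fst by (auto simp: feasible_def)
  let ?a = "supp_fun T (trace_vec \<Lambda>) + supp_fun Rs (trace_vec \<Upsilon>)" and ?b = "supp_fun Rs (trace_vec \<Upsilon>')"
  interpret prob_space P using P by (simp add: cov_dominated_def)
  have pt: "N (linear_estimate H (A *v x + \<xi>) - B *v x) \<le> ?a + ?b + \<xi> \<bullet> (\<Theta> *v \<xi>)" for \<xi>
  proof -
    have "linear_estimate H (A *v x + \<xi>) - B *v x = - ((B - Finite_Cartesian_Product.transpose H ** A) *v x) + Finite_Cartesian_Product.transpose H *v \<xi>"
      by (simp add: linear_estimate_def matrix_vector_right_distrib matrix_vector_mul_assoc matrix_vector_mult_diff_rdistrib)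
    then have "N (linear_estimate H (A *v x + \<xi>) - B *v x) \<le> N ((B - Finite_Cartesian_Product.transpose H ** A) *v x) + N (Finite_Cartesian_Product.transpose H *v \<xi>)"
      using is_normD(4)[OF N] is_norm_minus[OF N] by metis
    then show ?thesis using feasible_noise_bound[OF fe, of \<xi>] feasible_bias_bound[OF fe x] by linarith
  qed
  have i: "integrable P (\<lambda>\<xi>. ?a + ?b + \<xi> \<bullet> (\<Theta> *v \<xi>))"
    using P by (intro Bochner_Integration.integrable_add expectation_form_le_Gam(1)[OF _ th]) auto
  have "(\<integral>\<^sup>+\<xi>. ennreal (N (linear_estimate H (A *v x + \<xi>) - B *v x)) \<partial>P) \<le> (\<integral>\<^sup>+\<xi>. ennreal (?a + ?b + \<xi> \<bullet> (\<Theta> *v \<xi>)) \<partial>P)"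
    by (intro nn_integral_mono ennreal_leI pt)
  also have "\<dots> = ennreal (\<integral>\<xi>. ?a + ?b + \<xi> \<bullet> (\<Theta> *v \<xi>) \<partial>P)"
    by (rule nn_integral_eq_integral[OF i]) (intro AE_I2 order_trans[OF is_normD(1)[OF N] pt])
  also have "(\<integral>\<xi>. ?a + ?b + \<xi> \<bullet> (\<Theta> *v \<xi>) \<partial>P) = ?a + ?b + (\<integral>\<xi>. \<xi> \<bullet> (\<Theta> *v \<xi>) \<partial>P)"
    using P expectation_form_le_Gam(1)[OF _ th] prob_space by simp
  also have "ennreal \<dots> \<le> ennreal (objective T Rs Q (H, \<Lambda>, \<Upsilon>, \<Upsilon>', \<Theta>))"
    using expectation_form_le_Gam(2)[OF _ th, of P] P by (intro ennreal_leI) (simp add: objective_def)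
  finally show "(\<integral>\<^sup>+\<xi>. ennreal (N (linear_estimate H (A *v x + \<xi>) - B *v x)) \<partial>P) \<le> ennreal (objective T Rs Q (H, \<Lambda>, \<Upsilon>, \<Upsilon>', \<Theta>))" .
qed

end

section \<open>Existence of an optimal solution\<close>

lemma pos_form_lower_bound:
  fixes P :: "real ^ 'n ^ 'n"
  assumes "\<And>x. x \<noteq> 0 \<Longrightarrow> 0 < x \<bullet> (P *v x)"
  obtains c where "0 < c" "\<And>x. c * (norm x)\<^sup>2 \<le> x \<bullet> (P *v x)"
proof -
  have "continuous_on (sphere 0 1) (\<lambda>x. x \<bullet> (P *v x))"
    by (intro continuous_intros linear_continuous_on matrix_vector_mul_bounded_linear)
  moreover have "sphere (0 :: real ^ 'n) 1 \<noteq> {}" by (simp add: sphere_eq_empty)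
  ultimately obtain x where x: "x \<in> sphere 0 1" "\<And>y. y \<in> sphere 0 1 \<Longrightarrow> x \<bullet> (P *v x) \<le> y \<bullet> (P *v y)"
    using continuous_attains_inf[OF compact_sphere, of 0 1 "\<lambda>x. x \<bullet> (P *v x)"] by blast
  show ?thesis
  proof
    have "x \<noteq> 0" using x(1) by auto
    then show "0 < x \<bullet> (P *v x)" by (rule assms)
    fix y :: "real ^ 'n"
    show "x \<bullet> (P *v x) * (norm y)\<^sup>2 \<le> y \<bullet> (P *v y)"
    proof (cases "y = 0")
      case False
      then have "x \<bullet> (P *v x) \<le> ((1 / norm y) *\<^sub>R y) \<bullet> (P *v ((1 / norm y) *\<^sub>R y))" by (intro x(2)) simp
      also have "\<dots> = (y \<bullet> (P *v y)) / (norm y)\<^sup>2"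
        by (simp add: matrix_vector_mult_scaleR power2_eq_square)
      finally show ?thesis using False by (simp add: pos_le_divide_eq)
    qed simp
  qed
qed

lemma psd_mat_one:
  shows "psd_mat d (1\<^sub>m d)" and "(\<And>i. sym_mat d (R i)) \<Longrightarrow> x \<bullet> (adj_map R (1\<^sub>m d) *v x) = (\<Sum>e<d. lin_sqnorm d R x (\<lambda>a. if a = e then 1 else 0))"
proof -
  have c: "(1\<^sub>m d :: real mat) \<in> carrier_mat d d" by simp
  have "(\<Sum>i<d. \<Sum>j<d. x i * (1\<^sub>m d) $$ (i, j) * x j) = (\<Sum>i<d. (x i)\<^sup>2)" for x :: "nat \<Rightarrow> real"
  proof (intro sum.cong refl)
    fix i assume "i \<in> {..<d}"
    then have "(\<Sum>j<d. x i * (1\<^sub>m d) $$ (i, j) * x j) = (\<Sum>j<d. if j = i then x i * x i else 0)"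
      by (intro sum.cong) auto
    then show "(\<Sum>j<d. x i * (1\<^sub>m d) $$ (i, j) * x j) = (x i)\<^sup>2" using \<open>i \<in> {..<d}\<close> by (simp add: power2_eq_square)
  qed
  then show "psd_mat d (1\<^sub>m d)" by (simp add: psd_mat_iff psd_on_def sum_nonneg)
  assume R: "\<And>i. sym_mat d (R i)"
  show "x \<bullet> (adj_map R (1\<^sub>m d) *v x) = (\<Sum>e<d. lin_sqnorm d R x (\<lambda>a. if a = e then 1 else 0))"
  proof (rule adj_map_form_gram[OF c R])
    fix a b assume "a < d" "b < d"
    have "(\<Sum>e<d. (if a = e then 1 else 0) * (if b = e then 1 else 0)) = (\<Sum>e<d. if e = a then (if a = b then 1 else 0::real) else 0)"
      by (intro sum.cong) auto
    then show "(1\<^sub>m d) $$ (a, b) = (\<Sum>e<d. (if a = e then 1 else 0) * (if b = e then 1 else 0) :: real)"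
      using \<open>a < d\<close> \<open>b < d\<close> by simp
  qed
qed

lemma lin_sqnorm_nonneg: "0 \<le> lin_sqnorm d R x v"
  by (simp add: lin_sqnorm_def sum_nonneg)

text \<open>The form is the sum of the traces of the squares of all R_k[x], which vanishes only at 0
  by nondegeneracy. Identity blocks thus give a strictly feasible direction, used for feasibility
  and for excluding a zero multiplier.\<close>

lemma spectratope_sum_form_pos:
  assumes sd: "spectratope_data d R T" and x: "x \<noteq> 0"
  shows "0 < x \<bullet> ((\<Sum>k\<in>UNIV. adj_map (R k) (1\<^sub>m (d k))) *v x)"
proof -
  note sym = spectratope_dataD(2)[OF sd]
  have f: "x \<bullet> (adj_map (R k) (1\<^sub>m (d k)) *v x) = (\<Sum>e<d k. lin_sqnorm (d k) (R k) x (\<lambda>a. if a = e then 1 else 0))" for k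
    by (rule psd_mat_one(2)[OF sym])
  obtain k where k: "lin_mat (d k) (R k) x \<noteq> 0\<^sub>m (d k) (d k)" using spectratope_dataD(5)[OF sd x] by blast
  have "\<exists>a<d k. \<exists>b<d k. lin_mat (d k) (R k) x $$ (a, b) \<noteq> 0"
  proof (rule ccontr)
    assume "\<not> ?thesis"
    then have "lin_mat (d k) (R k) x = 0\<^sub>m (d k) (d k)" by (intro eq_matI) (auto simp: lin_mat_def)
    then show False using k by simp
  qed
  then obtain a b where ab: "a < d k" "b < d k" "lin_mat (d k) (R k) x $$ (a, b) \<noteq> 0" by blast
  then have l: "lin_ker (d k) (R k) x a b \<noteq> 0" by (simp add: lin_mat_def lin_ker_def)
  have "ker_apply {..<d k} (lin_ker (d k) (R k) x) (\<lambda>a. if a = b then 1 else 0) a = lin_ker (d k) (R k) x a b"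
  proof -
    have "ker_apply {..<d k} (lin_ker (d k) (R k) x) (\<lambda>a. if a = b then 1 else 0) a = (\<Sum>j<d k. if j = b then lin_ker (d k) (R k) x a b else 0)"
      unfolding ker_apply_def by (intro sum.cong) auto
    then show ?thesis using ab by simp
  qed
  then have "0 < (ker_apply {..<d k} (lin_ker (d k) (R k) x) (\<lambda>a. if a = b then 1 else 0) a)\<^sup>2" using l by simp
  also have "\<dots> \<le> lin_sqnorm (d k) (R k) x (\<lambda>a. if a = b then 1 else 0)"
    unfolding lin_sqnorm_def using ab by (intro member_le_sum) auto
  also have "\<dots> \<le> x \<bullet> (adj_map (R k) (1\<^sub>m (d k)) *v x)"
    unfolding f using ab by (intro member_le_sum[of b _ "\<lambda>e. lin_sqnorm (d k) (R k) x (\<lambda>a. if a = e then 1 else 0)"] lin_sqnorm_nonneg) auto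
  also have "\<dots> \<le> (\<Sum>k\<in>UNIV. x \<bullet> (adj_map (R k) (1\<^sub>m (d k)) *v x))"
  proof (rule member_le_sum)
    show "0 \<le> x \<bullet> (adj_map (R k) (1\<^sub>m (d k)) *v x)" for k unfolding f by (intro sum_nonneg lin_sqnorm_nonneg)
  qed auto
  finally show ?thesis by (simp add: sum_matrix_vector_mult inner_sum_right)
qed

lemma psd_block_matrixI:
  assumes "Finite_Cartesian_Product.transpose P = P" "Finite_Cartesian_Product.transpose W = W" "V = Finite_Cartesian_Product.transpose U"
    and "\<And>x y. 0 \<le> x \<bullet> (P *v x) + x \<bullet> (U *v y) + y \<bullet> (V *v x) + y \<bullet> (W *v y)"
  shows "psd (block_matrix P U V W)"
  unfolding psd_def
proof (intro conjI allI)
  have "P $ i $ j = P $ j $ i" for i j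
    using arg_cong[OF assms(1), of "\<lambda>X. X $ j $ i"] by (simp add: Finite_Cartesian_Product.transpose_def)
  moreover have "W $ i $ j = W $ j $ i" for i j
    using arg_cong[OF assms(2), of "\<lambda>X. X $ j $ i"] by (simp add: Finite_Cartesian_Product.transpose_def)
  ultimately show "Finite_Cartesian_Product.transpose (block_matrix P U V W) = block_matrix P U V W"
    using assms(3)
    by (auto simp: block_matrix_def Finite_Cartesian_Product.transpose_def Finite_Cartesian_Product.vec_eq_iff split: sum.splits)
  fix z :: "real ^ ('a + 'b)"
  have "z = vec_join (\<chi> a. z $ Inl a, \<chi> b. z $ Inr b)"
    by (simp add: Finite_Cartesian_Product.vec_eq_iff vec_join_def split: sum.splits)
  then obtain x y where z: "z = vec_join (x, y)" by blast
  show "0 \<le> z \<bullet> (block_matrix P U V W *v z)" unfolding z block_matrix_form by (rule assms(4))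
qed

lemma transpose_sum_matrix: "Finite_Cartesian_Product.transpose (\<Sum>k\<in>K. P k) = (\<Sum>k\<in>K. Finite_Cartesian_Product.transpose (P k :: real ^ 'n ^ 'm))"
  by (simp add: Finite_Cartesian_Product.vec_eq_iff Finite_Cartesian_Product.transpose_def)

lemma transpose_sum_adj_map:
  assumes "spectratope_data d R T" "\<And>k. psd_mat (d k) (L k)"
  shows "Finite_Cartesian_Product.transpose (\<Sum>k\<in>UNIV. adj_map (R k) (L k)) = (\<Sum>k\<in>UNIV. adj_map (R k) (L k))"
  unfolding transpose_sum_matrix
proof (intro sum.cong refl)
  fix k
  show "Finite_Cartesian_Product.transpose (adj_map (R k) (L k)) = adj_map (R k) (L k)"
    using assms(2)[of k] spectratope_dataD(4)[OF assms(1)] by (intro adj_map_transpose[of _ "d k"]) (auto simp: psd_mat_iff)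
qed

text \<open>Convexity is wanted for continuity: a finite convex function on a Euclidean space is
  continuous.\<close>

lemma convex_on_SUP_inner:
  fixes S :: "'b set" and g :: "'b \<Rightarrow> 'a::real_vector \<Rightarrow> real"
  assumes "S \<noteq> {}" "\<And>x. bdd_above ((\<lambda>s. g s x) ` S)" "\<And>s. linear (g s)"
  shows "convex_on UNIV (\<lambda>x. SUP s\<in>S. g s x)"
proof (rule convex_onI)
  fix t :: real and x y :: 'a assume t: "0 < t" "t < 1"
  show "(SUP s\<in>S. g s ((1 - t) *\<^sub>R x + t *\<^sub>R y)) \<le> (1 - t) * (SUP s\<in>S. g s x) + t * (SUP s\<in>S. g s y)"
  proof (rule cSUP_least[OF assms(1)])
    fix s assume s: "s \<in> S"
    have "g s ((1 - t) *\<^sub>R x + t *\<^sub>R y) = (1 - t) * g s x + t * g s y"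
      using assms(3)[of s] by (simp add: linear_add linear_scale)
    also have "\<dots> \<le> (1 - t) * (SUP s\<in>S. g s x) + t * (SUP s\<in>S. g s y)"
      using t s by (intro add_mono mult_left_mono cSUP_upper assms(2)) auto
    finally show "g s ((1 - t) *\<^sub>R x + t *\<^sub>R y) \<le> (1 - t) * (SUP s\<in>S. g s x) + t * (SUP s\<in>S. g s y)" .
  qed
qed simp

lemma convex_on_supp_fun:
  assumes "monotonic_set T"
  shows "convex_on UNIV (supp_fun T)"
  unfolding supp_fun_def
proof (rule convex_on_SUP_inner)
  show "T \<noteq> {}" using assms unfolding monotonic_set_def by blast
  have "compact T" using assms by (simp add: monotonic_set_def)
  then show "bdd_above ((\<lambda>t. x \<bullet> t) ` T)" for x
    by (intro bounded_imp_bdd_above compact_imp_bounded compact_continuous_image continuous_intros)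
  show "linear (\<lambda>x. x \<bullet> t)" for t :: "real ^ 'a" by (rule bounded_linear.linear[OF bounded_linear_inner_left])
qed

lemma convex_on_Gam:
  fixes Q :: "(real ^ 'm ^ 'm) set"
  assumes "compact Q" "Q \<noteq> {}"
  shows "convex_on UNIV (Gam Q)"
  unfolding Gam_def
proof (rule convex_on_SUP_inner[OF assms(2)])
  show "bdd_above ((\<lambda>X. trace (X ** Th)) ` Q)" for Th :: "real ^ 'm ^ 'm"
    using assms(1) unfolding trace_matrix_mult
    by (intro bounded_imp_bdd_above compact_imp_bounded compact_continuous_image continuous_intros)
  show "linear (\<lambda>Th. trace (X ** Th))" for X :: "real ^ 'm ^ 'm"
    unfolding trace_matrix_mult by (rule linearI) (simp_all add: algebra_simps sum.distrib sum_distrib_left)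
qed

lemma supp_fun_ge_trace:
  assumes mono: "monotonic_set T"
  obtains \<tau> where "0 < \<tau>" "\<And>g k. (\<And>k. 0 \<le> g $ k) \<Longrightarrow> \<tau> * g $ k \<le> supp_fun T g"
proof -
  obtain t where t: "t \<in> T" "\<And>k. 0 < t $ k" using mono unfolding monotonic_set_def by blast
  define \<tau> where "\<tau> = Min (range (\<lambda>k. t $ k))"
  have "\<tau> \<in> range (\<lambda>k. t $ k)" unfolding \<tau>_def by (intro Min_in) auto
  then have 1: "0 < \<tau>" using t(2) by auto
  have 2: "\<tau> \<le> t $ k" for k unfolding \<tau>_def by (intro Min_le) auto
  have "\<tau> * g $ k \<le> supp_fun T g" if g: "\<And>k. 0 \<le> g $ k" for g k
  proof -
    have "\<tau> * g $ k \<le> t $ k * g $ k" by (intro mult_right_mono 2 g)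
    also have "\<dots> \<le> (\<Sum>k\<in>UNIV. t $ k * g $ k)"
      using g less_imp_le[OF t(2)] by (intro member_le_sum[of k _ "\<lambda>k. t $ k * g $ k"]) auto
    also have "\<dots> = g \<bullet> t" by (simp add: inner_vec_def mult.commute)
    also have "\<dots> \<le> supp_fun T g" by (rule supp_fun_upper[OF mono t(1)])
    finally show ?thesis .
  qed
  then show ?thesis using that 1 by blast
qed

lemma sum_mult_le_sum_squares:
  fixes u w :: "'e \<Rightarrow> real"
  assumes "(\<Sum>e\<in>E. (u e)\<^sup>2) \<le> c" "(\<Sum>e\<in>E. (w e)\<^sup>2) \<le> c"
  shows "\<bar>\<Sum>e\<in>E. u e * w e\<bar> \<le> c"
proof -
  have "\<bar>\<Sum>e\<in>E. u e * w e\<bar> \<le> (\<Sum>e\<in>E. \<bar>u e * w e\<bar>)" by (rule sum_abs)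
  also have "\<dots> \<le> (\<Sum>e\<in>E. ((u e)\<^sup>2 + (w e)\<^sup>2) / 2)"
  proof (rule sum_mono)
    fix e
    show "\<bar>u e * w e\<bar> \<le> ((u e)\<^sup>2 + (w e)\<^sup>2) / 2"
      using sum_squares_bound[of "\<bar>u e\<bar>" "\<bar>w e\<bar>"] by (simp add: abs_mult)
  qed
  also have "\<dots> = ((\<Sum>e\<in>E. (u e)\<^sup>2) + (\<Sum>e\<in>E. (w e)\<^sup>2)) / 2" by (simp add: sum_divide_distrib[symmetric] sum.distrib)
  finally show ?thesis using assms by simp
qed

lemma psd_mat_entry_le_trace:
  assumes L: "psd_mat d L" and ab: "a < d" "b < d"
  shows "\<bar>L $$ (a, b)\<bar> \<le> trace_mat L"
proof (rule psd_mat_gram[OF L])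
  fix w :: "nat \<Rightarrow> nat \<Rightarrow> real"
  assume w: "\<And>a b. a < d \<Longrightarrow> b < d \<Longrightarrow> L $$ (a, b) = (\<Sum>e<d. w e a * w e b)"
    and tr: "trace_mat L = (\<Sum>e<d. \<Sum>a<d. (w e a)\<^sup>2)"
  have "(\<Sum>e<d. (w e a)\<^sup>2) \<le> trace_mat L" if "a < d" for a
    unfolding tr using that by (intro sum_mono member_le_sum[of a _ "\<lambda>a. (w _ a)\<^sup>2"]) auto
  then show "\<bar>L $$ (a, b)\<bar> \<le> trace_mat L" unfolding w[OF ab] using ab by (intro sum_mult_le_sum_squares) auto
qed

lemma psd_entry_le_trace:
  fixes A :: "real ^ 'n ^ 'n"
  assumes A: "psd A"
  shows "\<bar>A $ i $ j\<bar> \<le> trace A"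
proof -
  obtain w :: "'n \<Rightarrow> real ^ 'n" where w: "\<And>i j. A $ i $ j = (\<Sum>k\<in>UNIV. w k $ i * w k $ j)" using psd_gram[OF A] by blast
  have "trace A = (\<Sum>i\<in>UNIV. \<Sum>k\<in>UNIV. (w k $ i)\<^sup>2)" by (simp add: trace_def w power2_eq_square)
  moreover have "(\<Sum>k\<in>UNIV. (w k $ i)\<^sup>2) \<le> (\<Sum>i\<in>UNIV. \<Sum>k\<in>UNIV. (w k $ i)\<^sup>2)" for i
    by (intro member_le_sum[of i _ "\<lambda>i. \<Sum>k\<in>UNIV. (w k $ i)\<^sup>2"] sum_nonneg) auto
  ultimately have "(\<Sum>k\<in>UNIV. (w k $ i)\<^sup>2) \<le> trace A" for i by simp
  then show ?thesis unfolding w by (intro sum_mult_le_sum_squares)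
qed

text \<open>A member of \<open>Q\<close> dominates a positive multiple of the identity, so \<Gamma>
  controls the trace on positive semidefinite arguments.\<close>

lemma Gam_ge_trace:
  fixes Q :: "(real ^ 'm ^ 'm) set"
  assumes "Q \<noteq> {}" "compact Q" "\<forall>C\<in>Q. pos_def C"
  obtains c where "0 < c" "\<And>\<Theta>. psd \<Theta> \<Longrightarrow> c * trace \<Theta> \<le> Gam Q \<Theta>"
proof -
  obtain X where X: "X \<in> Q" using assms(1) by blast
  then have "pos_def X" using assms(3) by blast
  then obtain c where c: "0 < c" "\<And>x. c * (norm x)\<^sup>2 \<le> x \<bullet> (X *v x)"
    using pos_form_lower_bound[of X] unfolding pos_def_def by blast
  have "c * trace \<Theta> \<le> Gam Q \<Theta>" if Th: "psd \<Theta>" for \<Theta>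
  proof -
    have "x \<bullet> ((X - c *\<^sub>R Finite_Cartesian_Product.mat 1) *v x) = x \<bullet> (X *v x) - c * (norm x)\<^sup>2" for x
      by (simp add: matrix_vector_mult_diff_rdistrib scaleR_matrix_vector_assoc[symmetric] inner_diff_right power2_norm_eq_inner)
    then have "0 \<le> x \<bullet> ((X - c *\<^sub>R Finite_Cartesian_Product.mat 1) *v x)" for x using c(2)[of x] by simp
    then have "0 \<le> (\<Sum>i\<in>UNIV. \<Sum>j\<in>UNIV. \<Theta> $ i $ j * (X - c *\<^sub>R Finite_Cartesian_Product.mat 1) $ i $ j)"
      by (rule psd_trace_mult_nonneg[OF Th])
    also have "\<dots> = (\<Sum>i\<in>UNIV. \<Sum>j\<in>UNIV. X $ i $ j * \<Theta> $ j $ i) - c * trace \<Theta>"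
    proof -
      have s: "\<Theta> $ i $ j = \<Theta> $ j $ i" for i j using Th by (auto simp: psd_iff_psd_on psd_on_def)
      have "(\<Sum>i\<in>UNIV. \<Sum>j\<in>UNIV. \<Theta> $ i $ j * (c *\<^sub>R Finite_Cartesian_Product.mat 1 :: real ^ 'm ^ 'm) $ i $ j) = c * trace \<Theta>"
      proof -
        have "(\<Sum>j\<in>UNIV. \<Theta> $ i $ j * (c *\<^sub>R Finite_Cartesian_Product.mat 1 :: real ^ 'm ^ 'm) $ i $ j) = (\<Sum>j\<in>UNIV. if j = i then c * \<Theta> $ i $ i else 0)" for i
          by (intro sum.cong) (auto simp: Finite_Cartesian_Product.mat_def)
        then show ?thesis by (simp add: trace_def sum_distrib_left)
      qed
      moreover have "(\<Sum>i\<in>UNIV. \<Sum>j\<in>UNIV. \<Theta> $ i $ j * X $ i $ j) = (\<Sum>i\<in>UNIV. \<Sum>j\<in>UNIV. X $ i $ j * \<Theta> $ j $ i)"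
        using s by (intro sum.cong refl) (metis mult.commute)
      ultimately show ?thesis by (simp add: right_diff_distrib sum_subtractf)
    qed
    also have "\<dots> \<le> Gam Q \<Theta> - c * trace \<Theta>" using Gam_upper[OF assms(2) X, of \<Theta>] by (simp add: trace_matrix_mult)
    finally show ?thesis by simp
  qed
  then show ?thesis using that c(1) by blast
qed

text \<open>Candidates are coded by real functions on a type of coordinates, where the bounded functions form
  a compact set by Tychonoff's theorem.\<close>

datatype ('m, 'v, 'k, 'l) coord = CH 'm 'v | CL 'k nat nat | CU 'l nat nat | CV 'l nat nat | CT 'm 'm

definition decode :: "('k \<Rightarrow> nat) \<Rightarrow> ('l \<Rightarrow> nat) \<Rightarrow> (('m::finite, 'v::finite, 'k, 'l) coord \<Rightarrow> real) \<Rightarrow> ('m, 'v, 'k, 'l) candidate" where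
  "decode d f c = (\<chi> i j. c (CH i j), \<lambda>k. Matrix.mat (d k) (d k) (\<lambda>(a, b). c (CL k a b)),
     \<lambda>l. Matrix.mat (f l) (f l) (\<lambda>(a, b). c (CU l a b)), \<lambda>l. Matrix.mat (f l) (f l) (\<lambda>(a, b). c (CV l a b)),
     \<chi> i j. c (CT i j))"

text \<open>Entries outside a block are coded by 0, which keeps codes bounded; \<open>decode\<close>
  never looks at them.\<close>

definition encode :: "('k \<Rightarrow> nat) \<Rightarrow> ('l \<Rightarrow> nat) \<Rightarrow> ('m::finite, 'v::finite, 'k, 'l) candidate \<Rightarrow> (('m, 'v, 'k, 'l) coord \<Rightarrow> real)" where
  "encode d f = (\<lambda>(H, \<Lambda>, \<Upsilon>, \<Upsilon>', \<Theta>) z. case z of CH i j \<Rightarrow> H $ i $ j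
     | CL k a b \<Rightarrow> if a < d k \<and> b < d k then \<Lambda> k $$ (a, b) else 0
     | CU l a b \<Rightarrow> if a < f l \<and> b < f l then \<Upsilon> l $$ (a, b) else 0
     | CV l a b \<Rightarrow> if a < f l \<and> b < f l then \<Upsilon>' l $$ (a, b) else 0
     | CT i j \<Rightarrow> \<Theta> $ i $ j)"

lemma decode_encode:
  assumes "\<And>k. \<Lambda> k \<in> carrier_mat (d k) (d k)" "\<And>l. \<Upsilon> l \<in> carrier_mat (f l) (f l)" "\<And>l. \<Upsilon>' l \<in> carrier_mat (f l) (f l)"
  shows "decode d f (encode d f (H, \<Lambda>, \<Upsilon>, \<Upsilon>', \<Theta>)) = (H, \<Lambda>, \<Upsilon>, \<Upsilon>', \<Theta>)"
proof -
  have "Matrix.mat n n (\<lambda>(a, b). if a < n \<and> b < n then X $$ (a, b) else 0) = X" if "X \<in> carrier_mat n n" for n and X :: "real mat"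
    using that by (intro eq_matI) auto
  then show ?thesis using assms by (simp add: decode_def encode_def)
qed

lemma compact_bounded_functions: "compact {c :: 'i \<Rightarrow> real. \<forall>z. c z \<in> {- C..C}}"
proof -
  have "compactin (product_topology (\<lambda>_ :: 'i. euclidean) UNIV) (Pi\<^sub>E UNIV (\<lambda>_. {- C..C}))"
    unfolding compactin_PiE by simp
  then show ?thesis unfolding euclidean_product_topology compactin_euclidean_iff by (simp add: PiE_UNIV_domain Pi_def)
qed

lemma continuous_on_coordinate[continuous_intros]: "continuous_on S (\<lambda>c :: 'i \<Rightarrow> real. c z)"
  by (rule continuous_on_subset[OF continuous_on_product_coordinates]) simp

lemma closed_psd:
  fixes F :: "'c::topological_space \<Rightarrow> real ^ 'n ^ 'n"
  assumes "\<And>i j. continuous_on UNIV (\<lambda>c. F c $ i $ j)"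
  shows "closed {c. psd (F c)}"
  unfolding psd_iff_psd_on psd_on_def
  by (intro closed_Collect_conj closed_Collect_all closed_Collect_eq closed_Collect_le closed_Collect_imp continuous_intros assms)
    (simp_all add: closed_Collect_all closed_Collect_eq assms)

lemma continuous_on_block_matrix_entry:
  assumes "\<And>i j. continuous_on UNIV (\<lambda>c. P c $ i $ j)" "\<And>i j. continuous_on UNIV (\<lambda>c. U c $ i $ j)"
    "\<And>i j. continuous_on UNIV (\<lambda>c. V c $ i $ j)" "\<And>i j. continuous_on UNIV (\<lambda>c. W c $ i $ j)"
  shows "continuous_on UNIV (\<lambda>c. block_matrix (P c) (U c) (V c) (W c) $ i $ j)"
  by (cases i; cases j) (simp_all add: block_matrix_def assms)

lemma continuous_on_adj_map_entry:
  assumes "\<And>i. R i \<in> carrier_mat d d"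
  shows "continuous_on UNIV (\<lambda>c :: 'i \<Rightarrow> real. adj_map R (Matrix.mat d d (\<lambda>(a, b). c (g a b))) $ i $ j)"
proof -
  have e: "adj_map R (Matrix.mat d d (\<lambda>(a, b). c (g a b))) $ i $ j =
    1/2 * ((\<Sum>a<d. \<Sum>b<d. \<Sum>e<d. c (g a b) * (R i $$ (b, e) * R j $$ (e, a))) + (\<Sum>a<d. \<Sum>b<d. \<Sum>e<d. c (g a b) * (R j $$ (b, e) * R i $$ (e, a))))" for c :: "'i \<Rightarrow> real"
    using assms by (simp add: adj_map_def trace_mat_mult3[of _ d])
  show ?thesis unfolding e by (intro continuous_intros)
qed

lemma closed_psd_mat: "closed {c :: 'i \<Rightarrow> real. psd_mat d (Matrix.mat d d (\<lambda>(a, b). c (g a b)))}"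
proof -
  have "{c :: 'i \<Rightarrow> real. psd_mat d (Matrix.mat d d (\<lambda>(a, b). c (g a b)))} =
    (\<Inter>a\<in>{..<d}. \<Inter>b\<in>{..<d}. {c. c (g a b) = c (g b a)}) \<inter> {c. \<forall>x. 0 \<le> (\<Sum>a<d. \<Sum>b<d. x a * c (g a b) * x b)}"
    by (auto simp: psd_mat_iff psd_on_def)
  then show ?thesis
    by (auto intro!: closed_Int closed_INT closed_Collect_eq closed_Collect_all closed_Collect_le continuous_intros)
qed

lemma matrix_mult_zero:
  "A ** (0 :: real ^ 'b ^ 'c) = 0" "(0 :: real ^ 'c ^ 'b) ** A' = 0"
  unfolding Finite_Cartesian_Product.vec_eq_iff by (simp_all add: matrix_matrix_mult_def)

lemma transpose_zero: "Finite_Cartesian_Product.transpose (0 :: real ^ 'b ^ 'c) = 0"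
  by (simp add: Finite_Cartesian_Product.transpose_def Finite_Cartesian_Product.vec_eq_iff)

lemma transpose_scaleR: "Finite_Cartesian_Product.transpose (c *\<^sub>R A) = c *\<^sub>R Finite_Cartesian_Product.transpose (A :: real ^ 'b ^ 'c)"
  by (simp add: Finite_Cartesian_Product.transpose_def Finite_Cartesian_Product.vec_eq_iff)

lemma inner_transpose_mult: "x \<bullet> (Finite_Cartesian_Product.transpose A *v y) = (A *v x) \<bullet> (y :: real ^ 'b)"
proof -
  have "x \<bullet> (Finite_Cartesian_Product.transpose A *v y) = (y v* A) \<bullet> x"
    unfolding transpose_matrix_vector by (rule inner_commute)
  also have "\<dots> = y \<bullet> (A *v x)" by (rule dot_lmul_matrix)
  finally show ?thesis by (simp only: inner_commute)
qed

section \<open>Feasibility, closedness and compact level sets\<close>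

context
  fixes A :: "real ^ 'n::finite ^ 'm::finite" and B :: "real ^ 'n ^ 'v::finite"
    and M :: "real ^ 'q::finite ^ 'v"
    and d :: "'k::finite \<Rightarrow> nat" and R :: "'k \<Rightarrow> 'n \<Rightarrow> real mat" and T :: "(real ^ 'k) set"
    and f :: "'l::finite \<Rightarrow> nat" and S :: "'l \<Rightarrow> 'q \<Rightarrow> real mat" and Rs :: "(real ^ 'l) set"
    and N :: "real ^ 'v \<Rightarrow> real" and Q :: "(real ^ 'm ^ 'm) set"
  assumes sdR: "spectratope_data d R T" and N: "is_norm N" and sdS: "spectratope_data f S Rs"
    and ball: "{z. conj_norm N z \<le> 1} = (\<lambda>y. M *v y) ` basic_spectratope f S Rs"
    and Q: "Q \<noteq> {}" "compact Q" "\<forall>C \<in> Q. pos_def C"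
begin

text \<open>With H and \<Theta> equal to 0 the second block has no cross terms, and large multiples
  of the identity in \<Lambda> and \<Upsilon> dominate the cross terms of the first.\<close>

lemma feasible_exists: "\<exists>s. feasible A B M d R f S s"
proof -
  define PR where "PR = (\<Sum>k\<in>UNIV. adj_map (R k) (1\<^sub>m (d k)))"
  define PS where "PS = (\<Sum>l\<in>UNIV. adj_map (S l) (1\<^sub>m (f l)))"
  obtain c1 where c1: "0 < c1" "\<And>x. c1 * (norm x)\<^sup>2 \<le> x \<bullet> (PR *v x)"
    using pos_form_lower_bound[of PR] spectratope_sum_form_pos[OF sdR] unfolding PR_def by blast
  obtain c2 where c2: "0 < c2" "\<And>y. c2 * (norm y)\<^sup>2 \<le> y \<bullet> (PS *v y)"
    using pos_form_lower_bound[of PS] spectratope_sum_form_pos[OF sdS] unfolding PS_def by blast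
  obtain KM where KM: "\<And>y. norm (M *v y) \<le> norm y * KM" "0 < KM"
    using bounded_linear.pos_bounded[OF matrix_vector_mul_bounded_linear[of M]] by blast
  obtain KB where KB: "\<And>x. norm (B *v x) \<le> norm x * KB" "0 < KB"
    using bounded_linear.pos_bounded[OF matrix_vector_mul_bounded_linear[of B]] by blast
  \<comment> \<open>The bounds of \<open>M\<close> and \<open>B\<close> measured against the smaller
    of the lower bounds of the two diagonal forms.\<close>
  define \<mu> where "\<mu> = KM * KB / min c1 c2"
  have m0: "0 < min c1 c2" using c1 c2 by simp
  have \<mu>: "0 \<le> \<mu>" "\<mu> * min c1 c2 = KM * KB" using KM(2) KB(2) m0 by (auto simp: \<mu>_def)
  have cross: "\<bar>(M *v y) \<bullet> (B *v x)\<bar> \<le> \<mu> * (x \<bullet> (PR *v x)) + \<mu> * (y \<bullet> (PS *v y))" for x y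
  proof -
    have "\<bar>(M *v y) \<bullet> (B *v x)\<bar> \<le> norm (M *v y) * norm (B *v x)" by (rule Cauchy_Schwarz_ineq2)
    also have "\<dots> \<le> (norm y * KM) * (norm x * KB)" using KM KB by (intro mult_mono) auto
    also have "\<dots> = \<mu> * min c1 c2 * (norm x * norm y)" unfolding \<mu>(2) by simp
    also have "\<dots> \<le> \<mu> * min c1 c2 * ((norm x)\<^sup>2 + (norm y)\<^sup>2)"
    proof (rule mult_left_mono)
      have "2 * (norm x * norm y) \<le> (norm x)\<^sup>2 + (norm y)\<^sup>2" using sum_squares_bound[of "norm x" "norm y"] by simp
      moreover have "0 \<le> norm x * norm y" by simp
      ultimately show "norm x * norm y \<le> (norm x)\<^sup>2 + (norm y)\<^sup>2" by linarith
      show "0 \<le> \<mu> * min c1 c2" using \<mu>(1) m0 by (intro mult_nonneg_nonneg) auto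
    qed
    also have "\<dots> = \<mu> * (min c1 c2 * (norm x)\<^sup>2) + \<mu> * (min c1 c2 * (norm y)\<^sup>2)" by (simp add: algebra_simps)
    also have "\<dots> \<le> \<mu> * (x \<bullet> (PR *v x)) + \<mu> * (y \<bullet> (PS *v y))"
    proof (intro add_mono mult_left_mono \<mu>(1))
      show "min c1 c2 * (norm x)\<^sup>2 \<le> x \<bullet> (PR *v x)"
        by (rule order_trans[OF mult_right_mono c1(2)]) auto
      show "min c1 c2 * (norm y)\<^sup>2 \<le> y \<bullet> (PS *v y)"
        by (rule order_trans[OF mult_right_mono c2(2)]) auto
    qed
    finally show ?thesis .
  qed
  have pR: "psd_mat (d k) (\<mu> \<cdot>\<^sub>m 1\<^sub>m (d k))" for k by (intro psd_mat_smult psd_mat_one \<mu>)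
  have pS: "psd_mat (f l) (\<mu> \<cdot>\<^sub>m 1\<^sub>m (f l))" for l by (intro psd_mat_smult psd_mat_one \<mu>)
  have sR: "(\<Sum>k\<in>UNIV. adj_map (R k) (\<mu> \<cdot>\<^sub>m 1\<^sub>m (d k))) = \<mu> *\<^sub>R PR"
    unfolding PR_def scaleR_sum_right
    by (intro sum.cong refl adj_map_smult[OF one_carrier_mat spectratope_dataD(4)[OF sdR]])
  have sS: "(\<Sum>l\<in>UNIV. adj_map (S l) (\<mu> \<cdot>\<^sub>m 1\<^sub>m (f l))) = \<mu> *\<^sub>R PS"
    unfolding PS_def scaleR_sum_right
    by (intro sum.cong refl adj_map_smult[OF one_carrier_mat spectratope_dataD(4)[OF sdS]])
  have tR: "Finite_Cartesian_Product.transpose PR = PR" and tS: "Finite_Cartesian_Product.transpose PS = PS"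
    unfolding PR_def PS_def by (intro transpose_sum_adj_map[OF sdR] transpose_sum_adj_map[OF sdS] psd_mat_one)+
  have "psd (block_matrix (\<mu> *\<^sub>R PR) ((1/2) *\<^sub>R (Finite_Cartesian_Product.transpose B ** M))
      ((1/2) *\<^sub>R (Finite_Cartesian_Product.transpose M ** B)) (\<mu> *\<^sub>R PS))"
  proof (rule psd_block_matrixI)
    show "(1/2) *\<^sub>R (Finite_Cartesian_Product.transpose M ** B) = Finite_Cartesian_Product.transpose ((1/2) *\<^sub>R (Finite_Cartesian_Product.transpose B ** M))"
      by (simp add: transpose_scaleR matrix_transpose_mul)
    fix x y
    have "x \<bullet> ((1/2) *\<^sub>R (Finite_Cartesian_Product.transpose B ** M) *v y) = (1/2) * ((M *v y) \<bullet> (B *v x))"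
      by (simp only: scaleR_matrix_vector_assoc[symmetric] matrix_vector_mul_assoc[symmetric] inner_scaleR_right inner_transpose_mult inner_commute[of "B *v x"])
    moreover have "y \<bullet> ((1/2) *\<^sub>R (Finite_Cartesian_Product.transpose M ** B) *v x) = (1/2) * ((M *v y) \<bullet> (B *v x))"
      by (simp only: scaleR_matrix_vector_assoc[symmetric] matrix_vector_mul_assoc[symmetric] inner_scaleR_right inner_transpose_mult)
    ultimately show "0 \<le> x \<bullet> (\<mu> *\<^sub>R PR *v x) + x \<bullet> ((1/2) *\<^sub>R (Finite_Cartesian_Product.transpose B ** M) *v y)
      + y \<bullet> ((1/2) *\<^sub>R (Finite_Cartesian_Product.transpose M ** B) *v x) + y \<bullet> (\<mu> *\<^sub>R PS *v y)"
      using cross[of y x] by (simp add: scaleR_matrix_vector_assoc[symmetric])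
  qed (simp_all add: transpose_scaleR tR tS)
  moreover have "psd (block_matrix 0 ((1/2) *\<^sub>R ((0 :: real ^ 'v ^ 'm) ** M)) ((1/2) *\<^sub>R (Finite_Cartesian_Product.transpose M ** 0)) PS)"
  proof (rule psd_block_matrixI)
    fix x :: "real ^ 'm" and y
    have "0 \<le> y \<bullet> (PS *v y)" by (rule order_trans[OF _ c2(2)]) (use c2(1) in simp)
    then show "0 \<le> x \<bullet> (0 *v x) + x \<bullet> ((1/2) *\<^sub>R ((0 :: real ^ 'v ^ 'm) ** M) *v y)
      + y \<bullet> ((1/2) *\<^sub>R (Finite_Cartesian_Product.transpose M ** 0) *v x) + y \<bullet> (PS *v y)"
      by (simp add: matrix_mult_zero)
  qed (simp_all add: tS matrix_mult_zero transpose_zero)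
  ultimately have "feasible A B M d R f S (0, \<lambda>k. \<mu> \<cdot>\<^sub>m 1\<^sub>m (d k), \<lambda>l. \<mu> \<cdot>\<^sub>m 1\<^sub>m (f l), \<lambda>l. 1\<^sub>m (f l), 0)"
    using pR pS psd_mat_one(1) by (simp add: feasible_def sR sS PS_def[symmetric] matrix_mult_zero transpose_zero)
  then show ?thesis by blast
qed

lemma closed_feasible: "closed {c. feasible A B M d R f S (decode d f c)}"
proof -
  have R: "R k i \<in> carrier_mat (d k) (d k)" for k i by (rule spectratope_dataD(4)[OF sdR])
  have S: "S l i \<in> carrier_mat (f l) (f l)" for l i by (rule spectratope_dataD(4)[OF sdS])
  have aR: "continuous_on UNIV (\<lambda>c :: ('m, 'v, 'k, 'l) coord \<Rightarrow> real. (\<Sum>k\<in>UNIV. adj_map (R k) (Matrix.mat (d k) (d k) (\<lambda>(a, b). c (g k a b)))) $ i $ j)" for g i j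
    unfolding sum_component by (intro continuous_on_sum continuous_on_adj_map_entry[OF R])
  have aS: "continuous_on UNIV (\<lambda>c :: ('m, 'v, 'k, 'l) coord \<Rightarrow> real. (\<Sum>l\<in>UNIV. adj_map (S l) (Matrix.mat (f l) (f l) (\<lambda>(a, b). c (g l a b)))) $ i $ j)" for g i j
    unfolding sum_component by (intro continuous_on_sum continuous_on_adj_map_entry[OF S])
  have h1: "continuous_on UNIV (\<lambda>c :: ('m, 'v, 'k, 'l) coord \<Rightarrow> real.
    ((1/2) *\<^sub>R ((Finite_Cartesian_Product.transpose B - Finite_Cartesian_Product.transpose A ** (\<chi> i j. c (CH i j))) ** M)) $ i $ j)" for i j
    by (simp add: matrix_matrix_mult_def Finite_Cartesian_Product.transpose_def, intro continuous_intros) simp_all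
  have h2: "continuous_on UNIV (\<lambda>c :: ('m, 'v, 'k, 'l) coord \<Rightarrow> real.
    ((1/2) *\<^sub>R (Finite_Cartesian_Product.transpose M ** (B - Finite_Cartesian_Product.transpose (\<chi> i j. c (CH i j)) ** A))) $ i $ j)" for i j
    by (simp add: matrix_matrix_mult_def Finite_Cartesian_Product.transpose_def, intro continuous_intros) simp_all
  have h3: "continuous_on UNIV (\<lambda>c :: ('m, 'v, 'k, 'l) coord \<Rightarrow> real. ((1/2) *\<^sub>R ((\<chi> i j. c (CH i j)) ** M)) $ i $ j)" for i j
    by (simp add: matrix_matrix_mult_def, intro continuous_intros) simp_all
  have h4: "continuous_on UNIV (\<lambda>c :: ('m, 'v, 'k, 'l) coord \<Rightarrow> real. ((1/2) *\<^sub>R (Finite_Cartesian_Product.transpose M ** Finite_Cartesian_Product.transpose (\<chi> i j. c (CH i j)))) $ i $ j)" for i j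
    by (simp add: matrix_matrix_mult_def Finite_Cartesian_Product.transpose_def, intro continuous_intros) simp_all
  have h5: "continuous_on UNIV (\<lambda>c :: ('m, 'v, 'k, 'l) coord \<Rightarrow> real. ((\<chi> i j. c (CT i j)) :: real ^ 'm ^ 'm) $ i $ j)" for i j
    by (simp only: vec_lambda_beta continuous_on_coordinate)
  have t: "closed {c :: ('m, 'v, 'k, 'l) coord \<Rightarrow> real. Finite_Cartesian_Product.transpose (\<chi> i j. c (CT i j)) = ((\<chi> i j. c (CT i j)) :: real ^ 'm ^ 'm)}"
    by (simp add: Finite_Cartesian_Product.transpose_def Finite_Cartesian_Product.vec_eq_iff)
      (intro closed_Collect_all closed_Collect_eq continuous_intros)
  show ?thesis
    unfolding feasible_def decode_def prod.case
    by (intro closed_Collect_conj t closed_psd[OF continuous_on_block_matrix_entry[OF aR h1 h2 aS]]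
        closed_psd[OF continuous_on_block_matrix_entry[OF h5 h3 h4 aS]])
      (intro closed_Collect_all closed_psd_mat)+
qed

lemma continuous_objective: "continuous_on UNIV (\<lambda>c :: ('m, 'v, 'k, 'l) coord \<Rightarrow> real. objective T Rs Q (decode d f c))"
proof -
  have s: "continuous_on UNIV (supp_fun T)" "continuous_on UNIV (supp_fun Rs)" "continuous_on UNIV (Gam Q)"
    using convex_on_supp_fun[OF spectratope_dataD(3)[OF sdR]] convex_on_supp_fun[OF spectratope_dataD(3)[OF sdS]]
      convex_on_Gam[OF Q(2,1)] by (auto intro: convex_on_continuous)
  have tk: "continuous_on UNIV (\<lambda>c :: ('m, 'v, 'k, 'l) coord \<Rightarrow> real. trace_vec (\<lambda>k. Matrix.mat (e k) (e k) (\<lambda>(a, b). c (g k a b))))"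
    for e and g :: "'k \<Rightarrow> nat \<Rightarrow> nat \<Rightarrow> ('m, 'v, 'k, 'l) coord"
    unfolding trace_vec_def trace_mat_def by (intro continuous_on_vec_lambda) (auto intro!: continuous_intros)
  have tl: "continuous_on UNIV (\<lambda>c :: ('m, 'v, 'k, 'l) coord \<Rightarrow> real. trace_vec (\<lambda>k. Matrix.mat (e k) (e k) (\<lambda>(a, b). c (g k a b))))"
    for e and g :: "'l \<Rightarrow> nat \<Rightarrow> nat \<Rightarrow> ('m, 'v, 'k, 'l) coord"
    unfolding trace_vec_def trace_mat_def by (intro continuous_on_vec_lambda) (auto intro!: continuous_intros)
  have th: "continuous_on UNIV (\<lambda>c :: ('m, 'v, 'k, 'l) coord \<Rightarrow> real. (\<chi> i j. c (CT i j)) :: real ^ 'm ^ 'm)"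
    by (intro continuous_on_vec_lambda continuous_intros)
  have "continuous_on UNIV (\<lambda>c :: ('m, 'v, 'k, 'l) coord \<Rightarrow> real. supp_fun T (trace_vec (\<lambda>k. Matrix.mat (d k) (d k) (\<lambda>(a, b). c (CL k a b)))))"
    by (rule continuous_on_compose2[OF s(1) tk]) simp
  moreover have "continuous_on UNIV (\<lambda>c :: ('m, 'v, 'k, 'l) coord \<Rightarrow> real. supp_fun Rs (trace_vec (\<lambda>l. Matrix.mat (f l) (f l) (\<lambda>(a, b). c (CU l a b)))))"
    by (rule continuous_on_compose2[OF s(2) tl]) simp
  moreover have "continuous_on UNIV (\<lambda>c :: ('m, 'v, 'k, 'l) coord \<Rightarrow> real. supp_fun Rs (trace_vec (\<lambda>l. Matrix.mat (f l) (f l) (\<lambda>(a, b). c (CV l a b)))))"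
    by (rule continuous_on_compose2[OF s(2) tl]) simp
  moreover have "continuous_on UNIV (\<lambda>c :: ('m, 'v, 'k, 'l) coord \<Rightarrow> real. Gam Q (\<chi> i j. c (CT i j)))"
    by (rule continuous_on_compose2[OF s(3) th]) simp
  ultimately show ?thesis
    unfolding objective_def decode_def prod.case by (intro continuous_on_add)
qed

text \<open>The objective bounds all traces, and the trace of a positive semidefinite matrix bounds
  its entries. H does not occur in the objective; its rows are images of unit vectors, and the noise
  bound controls them through \<Theta> and \<Upsilon>'.\<close>

lemma feasible_level_bounded:
  obtains C where "\<And>s z. feasible A B M d R f S s \<Longrightarrow> objective T Rs Q s \<le> v \<Longrightarrow> encode d f s z \<in> {- C..C}"
proof -
  obtain \<tau> where \<tau>: "0 < \<tau>" "\<And>g k. (\<And>k. 0 \<le> g $ k) \<Longrightarrow> \<tau> * g $ k \<le> supp_fun T g"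
    using supp_fun_ge_trace[OF spectratope_dataD(3)[OF sdR]] by blast
  obtain \<rho> where \<rho>: "0 < \<rho>" "\<And>g k. (\<And>k. 0 \<le> g $ k) \<Longrightarrow> \<rho> * g $ k \<le> supp_fun Rs g"
    using supp_fun_ge_trace[OF spectratope_dataD(3)[OF sdS]] by blast
  obtain \<gamma> where \<gamma>: "0 < \<gamma>" "\<And>\<Theta>. psd \<Theta> \<Longrightarrow> \<gamma> * trace \<Theta> \<le> Gam Q \<Theta>"
    using Gam_ge_trace[OF Q] by blast
  obtain \<nu> where \<nu>: "0 < \<nu>" "\<And>u. \<nu> * norm u \<le> N u" using is_norm_lower_bound[OF N] by blast
  \<comment> \<open>The sum of the separate bounds: each summand is nonnegative, so \<open>C\<close>
    dominates every one of them.\<close>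
  define C where "C = v / \<tau> + v / \<rho> + v / \<gamma> + (v / \<gamma> + v) / \<nu>"
  have "encode d f s z \<in> {- C..C}" if fe: "feasible A B M d R f S s" and ob: "objective T Rs Q s \<le> v" for s z
  proof -
    obtain H \<Lambda> \<Upsilon> \<Upsilon>' \<Theta> where s: "s = (H, \<Lambda>, \<Upsilon>, \<Upsilon>', \<Theta>)" by (cases s) auto
    have p: "\<And>k. psd_mat (d k) (\<Lambda> k)" "\<And>l. psd_mat (f l) (\<Upsilon> l)" "\<And>l. psd_mat (f l) (\<Upsilon>' l)" and th: "psd \<Theta>"
      using fe psd_block_matrix_fst unfolding s feasible_def by auto
    have t1: "\<tau> * trace_mat (\<Lambda> k) \<le> supp_fun T (trace_vec \<Lambda>)" for k
      using \<tau>(2)[of "trace_vec \<Lambda>" k] trace_mat_psd_nonneg[OF p(1)] by (simp add: trace_vec_def)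
    have t2: "\<rho> * trace_mat (\<Upsilon> l) \<le> supp_fun Rs (trace_vec \<Upsilon>)" for l
      using \<rho>(2)[of "trace_vec \<Upsilon>" l] trace_mat_psd_nonneg[OF p(2)] by (simp add: trace_vec_def)
    have t3: "\<rho> * trace_mat (\<Upsilon>' l) \<le> supp_fun Rs (trace_vec \<Upsilon>')" for l
      using \<rho>(2)[of "trace_vec \<Upsilon>'" l] trace_mat_psd_nonneg[OF p(3)] by (simp add: trace_vec_def)
    \<comment> \<open>Index types are nonempty; \<open>undefined\<close> stands for an arbitrary
      index.\<close>
    have trth: "0 \<le> trace \<Theta>" using psd_entry_le_trace[OF th, of undefined undefined] by linarith
    have n1: "0 \<le> supp_fun T (trace_vec \<Lambda>)" using t1[of undefined] trace_mat_psd_nonneg[OF p(1)] \<tau>(1) by (meson mult_nonneg_nonneg less_imp_le order_trans)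
    have n2: "0 \<le> supp_fun Rs (trace_vec \<Upsilon>)" using t2[of undefined] trace_mat_psd_nonneg[OF p(2)] \<rho>(1) by (meson mult_nonneg_nonneg less_imp_le order_trans)
    have n3: "0 \<le> supp_fun Rs (trace_vec \<Upsilon>')" using t3[of undefined] trace_mat_psd_nonneg[OF p(3)] \<rho>(1) by (meson mult_nonneg_nonneg less_imp_le order_trans)
    have n4: "0 \<le> Gam Q \<Theta>" using \<gamma>(2)[OF th] trth \<gamma>(1) by (meson mult_nonneg_nonneg less_imp_le order_trans)
    have tot: "supp_fun T (trace_vec \<Lambda>) + supp_fun Rs (trace_vec \<Upsilon>) + supp_fun Rs (trace_vec \<Upsilon>') + Gam Q \<Theta> \<le> v"
      using ob by (simp add: s objective_def)
    have v0: "0 \<le> v" using n1 n2 n3 n4 tot by linarith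
    have b1: "trace_mat (\<Lambda> k) \<le> v / \<tau>" for k
    proof -
      have "\<tau> * trace_mat (\<Lambda> k) \<le> v" using t1[of k] n1 n2 n3 n4 tot by linarith
      then show ?thesis using \<tau>(1) by (simp add: pos_le_divide_eq mult.commute)
    qed
    have b2: "trace_mat (\<Upsilon> l) \<le> v / \<rho>" for l
    proof -
      have "\<rho> * trace_mat (\<Upsilon> l) \<le> v" using t2[of l] n1 n2 n3 n4 tot by linarith
      then show ?thesis using \<rho>(1) by (simp add: pos_le_divide_eq mult.commute)
    qed
    have b3: "trace_mat (\<Upsilon>' l) \<le> v / \<rho>" for l
    proof -
      have "\<rho> * trace_mat (\<Upsilon>' l) \<le> v" using t3[of l] n1 n2 n3 n4 tot by linarith
      then show ?thesis using \<rho>(1) by (simp add: pos_le_divide_eq mult.commute)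
    qed
    have b4: "trace \<Theta> \<le> v / \<gamma>"
    proof -
      have "\<gamma> * trace \<Theta> \<le> v" using \<gamma>(2)[OF th] n1 n2 n3 n4 tot by linarith
      then show ?thesis using \<gamma>(1) by (simp add: pos_le_divide_eq mult.commute)
    qed
    have b5: "\<bar>H $ i $ j\<bar> \<le> (v / \<gamma> + v) / \<nu>" for i j
    proof -
      have r: "(Finite_Cartesian_Product.transpose H *v axis i 1) $ j = H $ i $ j"
        by (simp add: matrix_vector_mult_basis Finite_Cartesian_Product.column_def Finite_Cartesian_Product.transpose_def)
      have "axis i 1 \<bullet> (\<Theta> *v axis i 1) = \<Theta> $ i $ i"
        by (simp add: matrix_vector_mult_basis Finite_Cartesian_Product.column_def inner_axis')
      then have "N (Finite_Cartesian_Product.transpose H *v axis i 1) \<le> \<Theta> $ i $ i + supp_fun Rs (trace_vec \<Upsilon>')"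
        using feasible_noise_bound[OF sdR N sdS ball Q fe[unfolded s], of "axis i 1"] by simp
      moreover have "\<Theta> $ i $ i \<le> v / \<gamma>" using psd_entry_le_trace[OF th, of i i] b4 by linarith
      moreover have "supp_fun Rs (trace_vec \<Upsilon>') \<le> v" using n1 n2 n4 tot by linarith
      moreover have "\<nu> * \<bar>H $ i $ j\<bar> \<le> N (Finite_Cartesian_Product.transpose H *v axis i 1)"
        using \<nu>(2)[of "Finite_Cartesian_Product.transpose H *v axis i 1"]
          mult_left_mono[OF component_le_norm_cart[of "Finite_Cartesian_Product.transpose H *v axis i 1" j], of \<nu>] \<nu>(1)
        unfolding r by linarith
      ultimately have "\<nu> * \<bar>H $ i $ j\<bar> \<le> v / \<gamma> + v" by linarith
      then show ?thesis using \<nu>(1) by (simp add: pos_le_divide_eq mult.commute)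
    qed
    have pos: "0 \<le> v / \<tau>" "0 \<le> v / \<rho>" "0 \<le> v / \<gamma>" "0 \<le> (v / \<gamma> + v) / \<nu>"
      using v0 \<tau>(1) \<rho>(1) \<gamma>(1) \<nu>(1) by simp_all
    have "\<bar>encode d f s z\<bar> \<le> C"
    proof (cases z)
      case (CH i j) then show ?thesis using b5[of i j] pos by (simp add: s encode_def C_def)
    next
      case (CL k a b)
      then show ?thesis using psd_mat_entry_le_trace[OF p(1), of a k b] b1[of k] pos by (auto simp: s encode_def C_def)
    next
      case (CU l a b)
      then show ?thesis using psd_mat_entry_le_trace[OF p(2), of a l b] b2[of l] pos by (auto simp: s encode_def C_def)
    next
      case (CV l a b)
      then show ?thesis using psd_mat_entry_le_trace[OF p(3), of a l b] b3[of l] pos by (auto simp: s encode_def C_def)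
    next
      case (CT i j) then show ?thesis using psd_entry_le_trace[OF th, of i j] b4 pos by (simp add: s encode_def C_def)
    qed
    then show ?thesis by (simp add: abs_le_iff)
  qed
  then show ?thesis using that by blast
qed

lemma optimal_exists: "\<exists>s. optimal A B M d R T f S Rs Q s"
proof -
  let ?F = "feasible A B M d R f S" and ?O = "objective T Rs Q"
  have de: "decode d f (encode d f s) = s" if "?F s" for s
    using that by (cases s) (auto simp: feasible_def psd_mat_iff intro!: decode_encode)
  obtain s0 where s0: "?F s0" using feasible_exists by blast
  obtain C where C: "\<And>s z. ?F s \<Longrightarrow> ?O s \<le> ?O s0 \<Longrightarrow> encode d f s z \<in> {- C..C}"
    using feasible_level_bounded[of "?O s0"] by blast
  \<comment> \<open>Compact, and large enough to contain the codes of all feasible candidates at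
    least as good as \<open>s0\<close>. It may contain codes of worse ones as well, but all of them
    are feasible.\<close>
  define K where "K = {c. \<forall>z. c z \<in> {- C..C}} \<inter> {c. ?F (decode d f c)}"
  have cK: "compact K" unfolding K_def by (intro compact_Int_closed compact_bounded_functions closed_feasible)
  have in_K: "encode d f s \<in> K" if "?F s" "?O s \<le> ?O s0" for s
    using that C[OF that] de[OF that(1)] by (simp add: K_def)
  have ne: "K \<noteq> {}" using in_K[OF s0] by blast
  have "continuous_on K (\<lambda>c. ?O (decode d f c))"
    by (rule continuous_on_subset[OF continuous_objective]) simp
  from continuous_attains_inf[OF cK ne this] obtain c where c: "c \<in> K" "\<And>c'. c' \<in> K \<Longrightarrow> ?O (decode d f c) \<le> ?O (decode d f c')"
    by blast
  have le: "?O (decode d f c) \<le> ?O s" if "?F s" for s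
  proof (cases "?O s \<le> ?O s0")
    case True
    then show ?thesis using c(2)[OF in_K[OF that True]] de[OF that] by simp
  next
    case False
    then show ?thesis using c(2)[OF in_K[OF s0 order_refl]] de[OF s0] by simp
  qed
  have "optimal A B M d R T f S Rs Q (decode d f c)"
    unfolding optimal_def is_arg_min_def
  proof (intro conjI notI)
    show "?F (decode d f c)" using c(1) by (simp add: K_def)
    assume "\<exists>y. ?F y \<and> ?O y < ?O (decode d f c)"
    then obtain y where "?F y" "?O y < ?O (decode d f c)" by blast
    then show False using le[of y] by simp
  qed
  then show ?thesis by blast
qed

lemma optimal_objective:
  assumes "optimal A B M d R T f S Rs Q s"
  shows "feasible A B M d R f S s" and "objective T Rs Q s = Opt A B M d R T f S Rs Q"
    and "feasible A B M d R f S s' \<Longrightarrow> Opt A B M d R T f S Rs Q \<le> objective T Rs Q s'"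
proof -
  show fe: "feasible A B M d R f S s" using assms by (simp add: optimal_def is_arg_min_def)
  have le: "objective T Rs Q s \<le> objective T Rs Q s'" if "feasible A B M d R f S s'" for s'
    using assms that unfolding optimal_def is_arg_min_def by (meson not_less)
  have "Opt A B M d R T f S Rs Q = objective T Rs Q s"
    unfolding Opt_def using fe le by (intro cInf_eq_minimum) auto
  then show "objective T Rs Q s = Opt A B M d R T f S Rs Q"
    and "feasible A B M d R f S s' \<Longrightarrow> Opt A B M d R T f S Rs Q \<le> objective T Rs Q s'" using le by auto
qed

end

section \<open>Conic duality\<close>

lemma lin_sqnorm_scale: "lin_sqnorm d R x (\<lambda>a. c * v a) = c\<^sup>2 * lin_sqnorm d R x v"
proof -
  have "ker_apply {..<d} X (\<lambda>a. c * v a) i = c * ker_apply {..<d} X v i" for X i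
    by (simp add: ker_apply_def sum_distrib_left mult_ac)
  then show ?thesis by (simp add: lin_sqnorm_def power_mult_distrib sum_distrib_left)
qed

lemma lin_sqnorm_scaleR: "lin_sqnorm d R (c *\<^sub>R x) v = c\<^sup>2 * lin_sqnorm d R x v"
proof -
  have "lin_ker d R (c *\<^sub>R x) i j = c * lin_ker d R x i j" for i j
    by (simp add: lin_ker_def sum_distrib_left mult_ac)
  then have "ker_apply {..<d} (lin_ker d R (c *\<^sub>R x)) v i = c * ker_apply {..<d} (lin_ker d R x) v i" for i
    by (simp add: ker_apply_def sum_distrib_left mult_ac)
  then show ?thesis by (simp add: lin_sqnorm_def power_mult_distrib sum_distrib_left)
qed

lemma lin_sqnorm_bound: "\<exists>C\<ge>0. \<forall>v. lin_sqnorm d R x v \<le> C * (\<Sum>a<d. (v a)\<^sup>2)"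
proof (intro exI[of _ "\<Sum>a<d. \<Sum>b<d. (lin_ker d R x a b)\<^sup>2"] conjI allI)
  show "0 \<le> (\<Sum>a<d. \<Sum>b<d. (lin_ker d R x a b)\<^sup>2)" by (simp add: sum_nonneg)
  show "lin_sqnorm d R x v \<le> (\<Sum>a<d. \<Sum>b<d. (lin_ker d R x a b)\<^sup>2) * (\<Sum>a<d. (v a)\<^sup>2)" for v
    unfolding lin_sqnorm_def ker_apply_def sum_distrib_right by (intro sum_mono Cauchy_Schwarz_ineq_sum[unfolded sum_distrib_right])
qed

text \<open>The largest eigenvalues of \<open>\<Sum>\<^sub>\<kappa> R\<^sub>k[x\<^sub>\<kappa>]\<^sup>2\<close> form the vector \<open>t\<close>. Were it outside \<open>T\<close>, a separating
  nonnegative \<open>g\<close> and \<open>\<Lambda>\<^sub>k = g\<^sub>k v\<^sub>k v\<^sub>k\<^sup>T\<close> with almost maximal unit vectors \<open>v\<^sub>k\<close> would violate the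
  hypothesis.\<close>

lemma spectratope_dual:
  fixes X :: "'i::finite \<Rightarrow> real ^ 'n::finite" and d :: "'k::finite \<Rightarrow> nat"
  assumes sd: "spectratope_data d R T"
    and le: "\<And>L. (\<And>k. psd_mat (d k) (L k)) \<Longrightarrow>
      (\<Sum>i\<in>UNIV. X i \<bullet> ((\<Sum>k\<in>UNIV. adj_map (R k) (L k)) *v X i)) \<le> supp_fun T (trace_vec L)"
  obtains t where "t \<in> T" "\<And>k v. (\<Sum>i\<in>UNIV. lin_sqnorm (d k) (R k) (X i) v) \<le> t $ k * (\<Sum>a<d k. (v a)\<^sup>2)"
proof -
  note sym = spectratope_dataD(2)[OF sd] and mono = spectratope_dataD(3)[OF sd]
  define q where "q k v = (\<Sum>i\<in>UNIV. lin_sqnorm (d k) (R k) (X i) v)" for k v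
  define U where "U k = {v :: nat \<Rightarrow> real. (\<Sum>a<d k. (v a)\<^sup>2) \<le> 1}" for k
  have q0: "0 \<le> q k v" for k v unfolding q_def by (intro sum_nonneg lin_sqnorm_nonneg)
  have qb: "\<exists>C\<ge>0. \<forall>v. q k v \<le> C * (\<Sum>a<d k. (v a)\<^sup>2)" for k
  proof -
    have "\<forall>i. \<exists>C\<ge>0. \<forall>v. lin_sqnorm (d k) (R k) (X i) v \<le> C * (\<Sum>a<d k. (v a)\<^sup>2)" using lin_sqnorm_bound by blast
    then obtain C where C: "\<And>i. 0 \<le> C i" "\<And>i v. lin_sqnorm (d k) (R k) (X i) v \<le> C i * (\<Sum>a<d k. (v a)\<^sup>2)" by metis
    show ?thesis
    proof (intro exI[of _ "\<Sum>i\<in>UNIV. C i"] conjI allI)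
      show "0 \<le> (\<Sum>i\<in>UNIV. C i)" by (intro sum_nonneg C)
      show "q k v \<le> (\<Sum>i\<in>UNIV. C i) * (\<Sum>a<d k. (v a)\<^sup>2)" for v unfolding q_def sum_distrib_right by (intro sum_mono C)
    qed
  qed
  have bdd: "bdd_above (q k ` U k)" for k
  proof -
    obtain C where C: "0 \<le> C" "\<And>v. q k v \<le> C * (\<Sum>a<d k. (v a)\<^sup>2)" using qb by blast
    show ?thesis
    proof (rule bdd_aboveI2)
      fix v assume "v \<in> U k"
      then have "C * (\<Sum>a<d k. (v a)\<^sup>2) \<le> C * 1" using C(1) by (intro mult_left_mono) (auto simp: U_def)
      then show "q k v \<le> C" using C(2)[of v] by simp
    qed
  qed
  have U0: "(\<lambda>_. 0) \<in> U k" for k by (simp add: U_def)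
  define l where "l = (\<chi> k. SUP v\<in>U k. q k v)"
  have ql: "q k v \<le> l $ k" if "v \<in> U k" for k v unfolding l_def using that bdd by (simp add: cSUP_upper)
  have l0: "0 \<le> l $ k" for k using ql[OF U0] q0 by (rule order_trans[rotated])
  have "l \<in> T"
  proof (rule ccontr)
    assume "l \<notin> T"
    moreover have "convex T" "closed T" using mono by (auto simp: monotonic_set_def compact_imp_closed)
    ultimately obtain a b where ab: "a \<bullet> l < b" "\<And>t. t \<in> T \<Longrightarrow> b < a \<bullet> t"
      using separating_hyperplane_closed_point[of T l] by blast
    define g where "g k = max (- a $ k) 0" for k
    have g0: "0 \<le> g k" for k by (simp add: g_def)
    have gT: "(\<Sum>k\<in>UNIV. g k * t $ k) \<le> - b" if t: "t \<in> T" for t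
    proof -
      \<comment> \<open>Monotonicity of \<open>T\<close> lets the coordinates with the wrong sign of
        the normal be set to 0; so the truncated, nonnegative normal \<open>g\<close> obeys the same
        bound on \<open>T\<close>.\<close>
      define t' where "t' = (\<chi> k. if a $ k < 0 then t $ k else 0)"
      have t0: "\<And>k. 0 \<le> t $ k" using mono t unfolding monotonic_set_def by blast
      have "\<forall>k. 0 \<le> t' $ k \<and> t' $ k \<le> t $ k" using t0 by (simp add: t'_def)
      then have "t' \<in> T" using mono t unfolding monotonic_set_def by blast
      then have "b < a \<bullet> t'" by (rule ab(2))
      also have "a \<bullet> t' = - (\<Sum>k\<in>UNIV. g k * t $ k)"
        unfolding inner_vec_def sum_negf[symmetric] by (intro sum.cong) (auto simp: t'_def g_def)
      finally show ?thesis by simp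
    qed
    have "(\<Sum>k\<in>UNIV. g k * l $ k) \<le> - b"
    proof (rule field_le_epsilon)
      fix e :: real assume e: "0 < e"
      \<comment> \<open>The suprema in \<open>l\<close> are only approached; the weights in
        \<open>g\<close> add these errors up to at most \<open>e\<close>.\<close>
      define \<epsilon> where "\<epsilon> = e / (1 + (\<Sum>k\<in>UNIV. g k))"
      have G: "0 \<le> (\<Sum>k\<in>UNIV. g k)" by (intro sum_nonneg g0)
      then have \<epsilon>: "0 < \<epsilon>" using e by (simp add: \<epsilon>_def)
      have "\<exists>v\<in>U k. l $ k - \<epsilon> < q k v" for k
      proof -
        have "l $ k - \<epsilon> < (SUP v\<in>U k. q k v)" using \<epsilon> by (simp add: l_def)
        then show ?thesis using less_cSUP_iff[OF _ bdd, of k] U0[of k] by blast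
      qed
      then obtain v where v: "\<And>k. v k \<in> U k" "\<And>k. l $ k - \<epsilon> < q k (v k)" by metis
      define L where "L k = Matrix.mat (d k) (d k) (\<lambda>(a, b). g k * (v k a * v k b))" for k
      have L: "psd_mat (d k) (L k)" for k unfolding L_def by (rule psd_mat_rank_one(1)[OF g0])
      have LX: "x \<bullet> (adj_map (R k) (L k) *v x) = g k * lin_sqnorm (d k) (R k) x (v k)" for k x
        unfolding L_def by (rule psd_mat_rank_one(3)[OF g0 sym])
      have Lt: "trace_mat (L k) \<le> g k" for k
      proof -
        have "trace_mat (L k) = g k * (\<Sum>a<d k. (v k a)\<^sup>2)" unfolding L_def by (rule psd_mat_rank_one(2)[OF g0])
        also have "\<dots> \<le> g k * 1" using v(1)[of k] by (intro mult_left_mono g0) (simp add: U_def)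
        finally show ?thesis by simp
      qed
      have "(\<Sum>k\<in>UNIV. g k * (l $ k - \<epsilon>)) \<le> (\<Sum>k\<in>UNIV. g k * q k (v k))"
        by (intro sum_mono mult_left_mono g0 less_imp_le v(2))
      also have "\<dots> = (\<Sum>k\<in>UNIV. \<Sum>i\<in>UNIV. X i \<bullet> (adj_map (R k) (L k) *v X i))"
        by (simp add: LX q_def sum_distrib_left)
      also have "\<dots> = (\<Sum>i\<in>UNIV. X i \<bullet> ((\<Sum>k\<in>UNIV. adj_map (R k) (L k)) *v X i))"
        by (subst sum.swap) (simp add: sum_matrix_vector_mult inner_sum_right)
      also have "\<dots> \<le> supp_fun T (trace_vec L)" by (rule le[OF L])
      also have "\<dots> \<le> - b"
      proof (rule supp_fun_least[OF mono])
        fix t assume t: "t \<in> T"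
        have t0: "\<And>k. 0 \<le> t $ k" using mono t unfolding monotonic_set_def by blast
        have "trace_vec L \<bullet> t \<le> (\<Sum>k\<in>UNIV. g k * t $ k)"
          unfolding inner_vec_def trace_vec_def by (auto intro!: sum_mono mult_right_mono Lt t0)
        then show "trace_vec L \<bullet> t \<le> - b" using gT[OF t] by linarith
      qed
      finally have "(\<Sum>k\<in>UNIV. g k * l $ k) \<le> - b + \<epsilon> * (\<Sum>k\<in>UNIV. g k)"
        by (simp add: right_diff_distrib sum_subtractf sum_distrib_left mult.commute)
      moreover have "\<epsilon> * (\<Sum>k\<in>UNIV. g k) \<le> e"
        using e G by (simp add: \<epsilon>_def field_simps)
      ultimately show "(\<Sum>k\<in>UNIV. g k * l $ k) \<le> - b + e" by linarith
    qed
    moreover have "- (a \<bullet> l) \<le> (\<Sum>k\<in>UNIV. g k * l $ k)"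
      unfolding inner_vec_def sum_negf[symmetric]
    proof (rule sum_mono)
      fix k
      have "(- a $ k) * l $ k \<le> g k * l $ k" by (intro mult_right_mono l0) (simp add: g_def)
      then show "- (a $ k \<bullet> l $ k) \<le> g k * l $ k" by simp
    qed
    ultimately show False using ab(1) by linarith
  qed
  moreover have "q k v \<le> l $ k * (\<Sum>a<d k. (v a)\<^sup>2)" for k v
  proof (cases "(\<Sum>a<d k. (v a)\<^sup>2) = 0")
    case True
    obtain C where "0 \<le> C" "\<And>v. q k v \<le> C * (\<Sum>a<d k. (v a)\<^sup>2)" using qb by blast
    from this(2)[of v] show ?thesis using True by simp
  next
    case False
    define s where "s = (\<Sum>a<d k. (v a)\<^sup>2)"
    have s: "0 < s" using False sum_nonneg[of "{..<d k}" "\<lambda>a. (v a)\<^sup>2"] unfolding s_def by simp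
    have "(\<lambda>a. 1 / sqrt s * v a) \<in> U k"
      using s by (simp add: U_def power_mult_distrib power_divide sum_divide_distrib[symmetric] s_def[symmetric])
    then have "q k (\<lambda>a. 1 / sqrt s * v a) \<le> l $ k" by (rule ql)
    moreover have "q k (\<lambda>a. 1 / sqrt s * v a) = q k v / s"
      using s unfolding q_def lin_sqnorm_scale by (simp add: power_divide sum_divide_distrib)
    ultimately show ?thesis using s unfolding s_def[symmetric] by (simp add: pos_divide_le_eq)
  qed
  ultimately show ?thesis using that[of l] unfolding q_def by blast
qed

lemma inner_gram:
  fixes D :: "real ^ 'a ^ 'a" and w :: "'k \<Rightarrow> real ^ 'a"
  assumes "\<And>i j. D $ i $ j = (\<Sum>k\<in>K. w k $ i * w k $ j)"
  shows "D \<bullet> X = (\<Sum>k\<in>K. w k \<bullet> (X *v w k))"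
proof -
  have "D \<bullet> X = (\<Sum>i\<in>UNIV. \<Sum>j\<in>UNIV. \<Sum>k\<in>K. w k $ i * (X $ i $ j * w k $ j))"
    unfolding inner_vec_def by (intro sum.cong refl) (simp add: assms sum_distrib_right sum_distrib_left mult_ac)
  also have "\<dots> = (\<Sum>i\<in>UNIV. \<Sum>k\<in>K. \<Sum>j\<in>UNIV. w k $ i * (X $ i $ j * w k $ j))" by (intro sum.cong refl sum.swap)
  also have "\<dots> = (\<Sum>k\<in>K. \<Sum>i\<in>UNIV. \<Sum>j\<in>UNIV. w k $ i * (X $ i $ j * w k $ j))" by (rule sum.swap)
  finally show ?thesis by (simp add: inner_vec_def matrix_vector_mult_def sum_distrib_left)
qed

text \<open>Used to read off signs of a separating functional along rays.\<close>

lemma affine_bounded_below_slope: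
  fixes a c k :: real
  assumes "\<And>t. 0 \<le> t \<Longrightarrow> c \<le> k + t * a"
  shows "0 \<le> a"
proof (rule ccontr)
  assume "\<not> 0 \<le> a"
  then have a: "a < 0" by simp
  define t where "t = (\<bar>k\<bar> + \<bar>c\<bar> + 1) / (- a)"
  have "0 \<le> t" using a unfolding t_def by (intro divide_nonneg_pos) auto
  moreover have "t * a = - (\<bar>k\<bar> + \<bar>c\<bar> + 1)" using a by (simp add: t_def)
  ultimately show False using assms[of t] by linarith
qed

lemma compact_convex_mem_if_Gam:
  fixes Q :: "(real ^ 'm ^ 'm) set"
  assumes Q: "Q \<noteq> {}" "convex Q" "compact Q" "\<And>X. X \<in> Q \<Longrightarrow> Finite_Cartesian_Product.transpose X = X"
    and C: "Finite_Cartesian_Product.transpose C = C"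
    and le: "\<And>Th. Finite_Cartesian_Product.transpose Th = Th \<Longrightarrow> trace (C ** Th) \<le> Gam Q Th"
  shows "C \<in> Q"
proof (rule ccontr)
  assume "C \<notin> Q"
  then obtain a b where ab: "a \<bullet> C < b" "\<And>X. X \<in> Q \<Longrightarrow> b < a \<bullet> X"
    using separating_hyperplane_closed_point[OF Q(2) compact_imp_closed[OF Q(3)], of C] by blast
  \<comment> \<open>Only symmetric matrices may be tested, and the pairing with symmetric matrices
    does not see the antisymmetric part of the normal. The sign turns the separation into an upper
    bound on \<open>Q\<close>.\<close>
  define Th where "Th = (- 1/2) *\<^sub>R (a + Finite_Cartesian_Product.transpose a)"
  have tTh: "Finite_Cartesian_Product.transpose Th = Th"
    by (simp add: Th_def Finite_Cartesian_Product.vec_eq_iff Finite_Cartesian_Product.transpose_def)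
  have tr: "trace (X ** Th) = - (a \<bullet> X)" if "Finite_Cartesian_Product.transpose X = X" for X
  proof -
    have s: "X $ i $ j = X $ j $ i" for i j
      using arg_cong[OF that, of "\<lambda>X. X $ j $ i"] by (simp add: Finite_Cartesian_Product.transpose_def)
    have "trace (X ** Th) = (- 1/2) * ((\<Sum>i\<in>UNIV. \<Sum>j\<in>UNIV. X $ i $ j * a $ j $ i) + (\<Sum>i\<in>UNIV. \<Sum>j\<in>UNIV. X $ i $ j * a $ i $ j))"
      unfolding trace_matrix_mult sum.distrib[symmetric] sum_distrib_left
      by (intro sum.cong refl) (simp add: Th_def Finite_Cartesian_Product.transpose_def algebra_simps)
    also have "(\<Sum>i\<in>UNIV. \<Sum>j\<in>UNIV. X $ i $ j * a $ j $ i) = (\<Sum>j\<in>UNIV. \<Sum>i\<in>UNIV. X $ i $ j * a $ j $ i)" by (rule sum.swap)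
    also have "\<dots> = (\<Sum>i\<in>UNIV. \<Sum>j\<in>UNIV. X $ i $ j * a $ i $ j)" by (intro sum.cong refl arg_cong2[where f = "(*)"] s)
    finally show ?thesis by (simp add: inner_vec_def mult.commute)
  qed
  have "Gam Q Th \<le> - b"
    unfolding Gam_def
  proof (rule cSUP_least[OF Q(1)])
    fix X assume "X \<in> Q"
    then show "trace (X ** Th) \<le> - b" using ab(2)[of X] tr[OF Q(4)] by simp
  qed
  then show False using le[OF tTh] tr[OF C] ab(1) by simp
qed

text \<open>Duality of the cone of nonnegative forms. Antisymmetric matrices with two nonzero
  entries, of either sign, have zero form and force symmetry of \<open>D\<close>; matrices of rank
  one force nonnegativity.\<close>

lemma psd_if_gram_bound:
  fixes D :: "real ^ 'a ^ 'a"
  assumes "\<And>X. (\<And>v. 0 \<le> v \<bullet> (X *v v)) \<Longrightarrow> 0 \<le> D \<bullet> X"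
  shows "psd D"
proof -
  have dd: "(\<Sum>k\<in>UNIV. \<Sum>l\<in>UNIV. (if k = i then if l = j then c else 0 else 0)) = c" for i j :: 'a and c :: real
  proof -
    have "(\<Sum>l\<in>UNIV. (if k = i then if l = j then c else 0 else 0)) = (if k = i then c else 0)" for k by simp
    then show ?thesis by simp
  qed
  have "D $ i $ j = D $ j $ i" for i j
  proof -
    define X :: "real ^ 'a ^ 'a" where "X = (\<chi> k l. (if k = i \<and> l = j then 1 else 0) - (if k = j \<and> l = i then 1 else 0))"
    have f: "v \<bullet> (X *v v) = 0" for v
    proof -
      have "v \<bullet> (X *v v) = (\<Sum>k\<in>UNIV. \<Sum>l\<in>UNIV. (if k = i then if l = j then v $ i * v $ j else 0 else 0)) - (\<Sum>k\<in>UNIV. \<Sum>l\<in>UNIV. (if k = j then if l = i then v $ j * v $ i else 0 else 0))"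
        unfolding sum_subtractf[symmetric] inner_vec_def matrix_vector_mult_def
        by (auto simp: X_def sum_distrib_left intro!: sum.cong)
      then show ?thesis unfolding dd by simp
    qed
    have g: "D \<bullet> X = D $ i $ j - D $ j $ i"
    proof -
      have "D \<bullet> X = (\<Sum>k\<in>UNIV. \<Sum>l\<in>UNIV. (if k = i then if l = j then D $ i $ j else 0 else 0)) - (\<Sum>k\<in>UNIV. \<Sum>l\<in>UNIV. (if k = j then if l = i then D $ j $ i else 0 else 0))"
        unfolding sum_subtractf[symmetric] inner_vec_def
        by (auto simp: X_def intro!: sum.cong)
      then show ?thesis unfolding dd .
    qed
    have "0 \<le> D \<bullet> X" by (rule assms) (simp add: f)
    moreover have "0 \<le> D \<bullet> (- X)"
    proof (rule assms)
      fix v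
      have "(- X) *v v = - (X *v v)" by (simp add: matrix_vector_mult_def Finite_Cartesian_Product.vec_eq_iff sum_negf)
      then show "0 \<le> v \<bullet> ((- X) *v v)" by (simp add: f)
    qed
    ultimately show ?thesis using g by simp
  qed
  moreover have "0 \<le> x \<bullet> (D *v x)" for x
  proof -
    define X :: "real ^ 'a ^ 'a" where "X = (\<chi> k l. x $ k * x $ l)"
    have "v \<bullet> (X *v v) = (x \<bullet> v)\<^sup>2" for v
      by (simp add: X_def inner_vec_def matrix_vector_mult_def power2_eq_square sum_product sum_distrib_left mult_ac)
    then have "0 \<le> D \<bullet> X" by (intro assms) simp
    also have "D \<bullet> X = x \<bullet> (D *v x)"
      by (simp add: X_def inner_vec_def matrix_vector_mult_def sum_distrib_left mult_ac)
    finally show ?thesis .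
  qed
  ultimately show ?thesis
    by (simp add: psd_def Finite_Cartesian_Product.transpose_def Finite_Cartesian_Product.vec_eq_iff)
qed

lemma matrix_add_rdistrib: "(X + Y) ** Z = X ** Z + Y ** (Z :: real ^ 'b ^ 'c)"
  unfolding Finite_Cartesian_Product.vec_eq_iff
  by (simp add: matrix_matrix_mult_def distrib_right sum.distrib)

lemma supp_fun_combine:
  assumes "monotonic_set T" "0 \<le> u" "0 \<le> w"
  shows "supp_fun T (u *\<^sub>R g + w *\<^sub>R h) \<le> u * supp_fun T g + w * supp_fun T h"
proof (rule supp_fun_least[OF assms(1)])
  fix t assume "t \<in> T"
  then show "(u *\<^sub>R g + w *\<^sub>R h) \<bullet> t \<le> u * supp_fun T g + w * supp_fun T h"
    unfolding inner_add_left inner_scaleR_left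
    by (intro add_mono mult_left_mono supp_fun_upper assms)
qed

lemma Gam_combine:
  fixes Q :: "(real ^ 'm ^ 'm) set"
  assumes "Q \<noteq> {}" "compact Q" "0 \<le> u" "0 \<le> w"
  shows "Gam Q (u *\<^sub>R Th + w *\<^sub>R Th') \<le> u * Gam Q Th + w * Gam Q Th'"
  unfolding Gam_def[of Q "u *\<^sub>R Th + w *\<^sub>R Th'"]
proof (rule cSUP_least[OF assms(1)])
  fix X assume X: "X \<in> Q"
  have "trace (X ** (u *\<^sub>R Th + w *\<^sub>R Th')) = u * trace (X ** Th) + w * trace (X ** Th')"
    by (simp add: trace_matrix_mult sum_distrib_left sum.distrib[symmetric] algebra_simps)
  also have "\<dots> \<le> u * Gam Q Th + w * Gam Q Th'"
    using assms X by (intro add_mono mult_left_mono Gam_upper) auto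
  finally show "trace (X ** (u *\<^sub>R Th + w *\<^sub>R Th')) \<le> u * Gam Q Th + w * Gam Q Th'" .
qed

lemma block_matrix_combine:
  "block_matrix (u *\<^sub>R P + w *\<^sub>R P') (u *\<^sub>R U + w *\<^sub>R U') (u *\<^sub>R V + w *\<^sub>R V') (u *\<^sub>R W + w *\<^sub>R W')
    = u *\<^sub>R block_matrix P U V W + w *\<^sub>R block_matrix P' U' V' W'"
  unfolding Finite_Cartesian_Product.vec_eq_iff
  by (auto simp: block_matrix_def split: sum.splits)

lemma trace_vec_combine:
  assumes "\<And>k. psd_mat (d k) (L k)" "\<And>k. psd_mat (d k) (L' k)" "0 \<le> u" "0 \<le> w"
  shows "\<And>k. psd_mat (d k) (u \<cdot>\<^sub>m L k + w \<cdot>\<^sub>m L' k)"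
    and "trace_vec (\<lambda>k. u \<cdot>\<^sub>m L k + w \<cdot>\<^sub>m L' k) = u *\<^sub>R trace_vec L + w *\<^sub>R trace_vec L'"
proof -
  have p: "psd_mat (d k) (u \<cdot>\<^sub>m L k)" "psd_mat (d k) (w \<cdot>\<^sub>m L' k)" for k
    using psd_mat_smult assms by blast+
  show "\<And>k. psd_mat (d k) (u \<cdot>\<^sub>m L k + w \<cdot>\<^sub>m L' k)" by (rule psd_mat_add(1)[OF p])
  show "trace_vec (\<lambda>k. u \<cdot>\<^sub>m L k + w \<cdot>\<^sub>m L' k) = u *\<^sub>R trace_vec L + w *\<^sub>R trace_vec L'"
    unfolding Finite_Cartesian_Product.vec_eq_iff
    by (simp add: trace_vec_def psd_mat_add(2)[OF p] psd_mat_smult(2)[OF assms(1,3)] psd_mat_smult(2)[OF assms(2,4)])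
qed

lemma sum_adj_map_combine:
  assumes sd: "spectratope_data d R T" and L: "\<And>k. psd_mat (d k) (L k)" "\<And>k. psd_mat (d k) (L' k)"
  shows "(\<Sum>k\<in>UNIV. adj_map (R k) (u \<cdot>\<^sub>m L k + w \<cdot>\<^sub>m L' k))
    = u *\<^sub>R (\<Sum>k\<in>UNIV. adj_map (R k) (L k)) + w *\<^sub>R (\<Sum>k\<in>UNIV. adj_map (R k) (L' k))"
proof -
  have c: "L k \<in> carrier_mat (d k) (d k)" "L' k \<in> carrier_mat (d k) (d k)" for k using L by (auto simp: psd_mat_iff)
  have "adj_map (R k) (u \<cdot>\<^sub>m L k + w \<cdot>\<^sub>m L' k) = u *\<^sub>R adj_map (R k) (L k) + w *\<^sub>R adj_map (R k) (L' k)" for k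
    using c[of k] spectratope_dataD(4)[OF sd]
    by (subst adj_map_add[of _ "d k"]) (auto simp: adj_map_smult[of _ "d k"])
  then show ?thesis by (simp add: sum.distrib scaleR_sum_right)
qed

lemma open_half_combine:
  assumes "\<And>v. v \<noteq> 0 \<Longrightarrow> 0 < v \<bullet> (X *v v)" "\<And>v. v \<noteq> 0 \<Longrightarrow> 0 < v \<bullet> (Y *v v)" "0 \<le> u" "0 \<le> w" "u + w = (1::real)" "v \<noteq> 0"
  shows "0 < v \<bullet> ((u *\<^sub>R X + w *\<^sub>R Y) *v (v :: real ^ 'a))"
proof -
  have "v \<bullet> ((u *\<^sub>R X + w *\<^sub>R Y) *v v) = u * (v \<bullet> (X *v v)) + w * (v \<bullet> (Y *v v))"
    by (simp add: matrix_vector_mult_add_rdistrib scaleR_matrix_vector_assoc[symmetric] inner_add_right)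
  moreover have "0 < u \<or> 0 < w" using assms by linarith
  ultimately show ?thesis using assms(1,2)[OF assms(6)] assms(3,4)
    by (auto intro: add_pos_nonneg add_nonneg_pos)
qed

section \<open>Separation and the dual solution\<close>

context
  fixes A :: "real ^ 'n::finite ^ 'm::finite" and B :: "real ^ 'n ^ 'v::finite"
    and M :: "real ^ 'q::finite ^ 'v"
    and d :: "'k::finite \<Rightarrow> nat" and R :: "'k \<Rightarrow> 'n \<Rightarrow> real mat" and T :: "(real ^ 'k) set"
    and f :: "'l::finite \<Rightarrow> nat" and S :: "'l \<Rightarrow> 'q \<Rightarrow> real mat" and Rs :: "(real ^ 'l) set"
    and N :: "real ^ 'v \<Rightarrow> real" and Q :: "(real ^ 'm ^ 'm) set"
  assumes sdR: "spectratope_data d R T" and N: "is_norm N" and sdS: "spectratope_data f S Rs"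
    and ball: "{z. conj_norm N z \<le> 1} = (\<lambda>y. M *v y) ` basic_spectratope f S Rs"
    and Q: "Q \<noteq> {}" "convex Q" "compact Q" "\<forall>C \<in> Q. pos_def C"
begin

private abbreviation tr where "tr \<equiv> Finite_Cartesian_Product.transpose"

private definition blk1 :: "real ^ 'v ^ 'm \<Rightarrow> ('k \<Rightarrow> real mat) \<Rightarrow> ('l \<Rightarrow> real mat) \<Rightarrow> real ^ ('n + 'q) ^ ('n + 'q)" where
  "blk1 H \<Lambda> \<Upsilon> = block_matrix (\<Sum>k\<in>UNIV. adj_map (R k) (\<Lambda> k)) ((1/2) *\<^sub>R ((tr B - tr A ** H) ** M))
     ((1/2) *\<^sub>R (tr M ** (B - tr H ** A))) (\<Sum>l\<in>UNIV. adj_map (S l) (\<Upsilon> l))"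

private definition blk2 :: "real ^ 'v ^ 'm \<Rightarrow> real ^ 'm ^ 'm \<Rightarrow> ('l \<Rightarrow> real mat) \<Rightarrow> real ^ ('m + 'q) ^ ('m + 'q)" where
  "blk2 H \<Theta> \<Upsilon>' = block_matrix \<Theta> ((1/2) *\<^sub>R (H ** M)) ((1/2) *\<^sub>R (tr M ** tr H)) (\<Sum>l\<in>UNIV. adj_map (S l) (\<Upsilon>' l))"

text \<open>The constraints that stay explicit; the two block inequalities are the ones to be
  dualized.\<close>

private definition psds where
  "psds \<Lambda> \<Upsilon> \<Upsilon>' \<Theta> \<longleftrightarrow> (\<forall>k. psd_mat (d k) (\<Lambda> k)) \<and> (\<forall>l. psd_mat (f l) (\<Upsilon> l)) \<and> (\<forall>l. psd_mat (f l) (\<Upsilon>' l)) \<and> tr \<Theta> = (\<Theta> :: real ^ 'm ^ 'm)"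

private lemma feasible_iff: "feasible A B M d R f S (H, \<Lambda>, \<Upsilon>, \<Upsilon>', \<Theta>) \<longleftrightarrow> psds \<Lambda> \<Upsilon> \<Upsilon>' \<Theta> \<and> psd (blk1 H \<Lambda> \<Upsilon>) \<and> psd (blk2 H \<Theta> \<Upsilon>')"
  by (simp add: feasible_def psds_def blk1_def blk2_def)

private lemma tr_diff: "tr B - tr A ** H = tr (B - tr H ** A)"
  unfolding Finite_Cartesian_Product.vec_eq_iff
  by (simp add: Finite_Cartesian_Product.transpose_def matrix_matrix_mult_def mult.commute)

private lemma blk1_form:
  "vec_join (x, y) \<bullet> (blk1 H \<Lambda> \<Upsilon> *v vec_join (x, y))
    = x \<bullet> ((\<Sum>k\<in>UNIV. adj_map (R k) (\<Lambda> k)) *v x) + (M *v y) \<bullet> ((B - tr H ** A) *v x) + y \<bullet> ((\<Sum>l\<in>UNIV. adj_map (S l) (\<Upsilon> l)) *v y)"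
proof -
  have 1: "x \<bullet> ((1/2) *\<^sub>R (tr (B - tr H ** A) ** M) *v y) = (1/2) * ((M *v y) \<bullet> ((B - tr H ** A) *v x))"
    by (simp only: scaleR_matrix_vector_assoc[symmetric] matrix_vector_mul_assoc[symmetric] inner_scaleR_right inner_transpose_mult inner_commute[of "(B - tr H ** A) *v x"])
  have 2: "y \<bullet> ((1/2) *\<^sub>R (tr M ** (B - tr H ** A)) *v x) = (1/2) * ((M *v y) \<bullet> ((B - tr H ** A) *v x))"
    by (simp only: scaleR_matrix_vector_assoc[symmetric] matrix_vector_mul_assoc[symmetric, of "tr M"] inner_scaleR_right inner_transpose_mult)
  show ?thesis unfolding blk1_def tr_diff block_matrix_form 1 2 by simp
qed

private lemma blk2_form:
  "vec_join (x, y) \<bullet> (blk2 H \<Theta> \<Upsilon>' *v vec_join (x, y))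
    = x \<bullet> (\<Theta> *v x) + (M *v y) \<bullet> (tr H *v x) + y \<bullet> ((\<Sum>l\<in>UNIV. adj_map (S l) (\<Upsilon>' l)) *v y)"
proof -
  have 1: "x \<bullet> ((1/2) *\<^sub>R (H ** M) *v y) = (1/2) * ((M *v y) \<bullet> (tr H *v x))"
    by (simp only: scaleR_matrix_vector_assoc[symmetric] matrix_vector_mul_assoc[symmetric] inner_scaleR_right inner_transpose_mult inner_commute[of x])
  have 2: "y \<bullet> ((1/2) *\<^sub>R (tr M ** tr H) *v x) = (1/2) * ((M *v y) \<bullet> (tr H *v x))"
    by (simp only: scaleR_matrix_vector_assoc[symmetric] matrix_vector_mul_assoc[symmetric] inner_scaleR_right inner_transpose_mult)
  show ?thesis unfolding blk2_def block_matrix_form 1 2 by simp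
qed

text \<open>The blocks are symmetric by construction, so only the sign of their forms is at
  stake.\<close>

private lemma psd_blk:
  assumes "psds \<Lambda> \<Upsilon> \<Upsilon>' \<Theta>" "\<And>v. 0 \<le> v \<bullet> (blk1 H \<Lambda> \<Upsilon> *v v)" "\<And>v. 0 \<le> v \<bullet> (blk2 H \<Theta> \<Upsilon>' *v v)"
  shows "psd (blk1 H \<Lambda> \<Upsilon>)" "psd (blk2 H \<Theta> \<Upsilon>')"
proof -
  have p: "\<And>k. psd_mat (d k) (\<Lambda> k)" "\<And>l. psd_mat (f l) (\<Upsilon> l)" "\<And>l. psd_mat (f l) (\<Upsilon>' l)" "tr \<Theta> = \<Theta>"
    using assms(1) by (auto simp: psds_def)
  show "psd (blk1 H \<Lambda> \<Upsilon>)" unfolding blk1_def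
  proof (rule psd_block_matrixI[OF transpose_sum_adj_map[OF sdR p(1)] transpose_sum_adj_map[OF sdS p(2)]])
    show "(1/2) *\<^sub>R (tr M ** (B - tr H ** A)) = tr ((1/2) *\<^sub>R ((tr B - tr A ** H) ** M))"
      unfolding tr_diff by (simp add: transpose_scaleR matrix_transpose_mul)
  qed (use assms(2) in \<open>simp only: blk1_def block_matrix_form[symmetric]\<close>)
  show "psd (blk2 H \<Theta> \<Upsilon>')" unfolding blk2_def
  proof (rule psd_block_matrixI[OF p(4) transpose_sum_adj_map[OF sdS p(3)]])
    show "(1/2) *\<^sub>R (tr M ** tr H) = tr ((1/2) *\<^sub>R (H ** M))" by (simp add: transpose_scaleR matrix_transpose_mul)
  qed (use assms(3) in \<open>simp only: blk2_def block_matrix_form[symmetric]\<close>)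
qed

text \<open>Attainable values of the two blocks, of whatever sign, together with the levels above
  the objective.\<close>

private definition upper_set :: "((real ^ ('n + 'q) ^ ('n + 'q)) \<times> (real ^ ('m + 'q) ^ ('m + 'q)) \<times> real) set" where
  "upper_set = {(X, Y, c). \<exists>H \<Lambda> \<Upsilon> \<Upsilon>' \<Theta>. psds \<Lambda> \<Upsilon> \<Upsilon>' \<Theta> \<and> X = blk1 H \<Lambda> \<Upsilon> \<and> Y = blk2 H \<Theta> \<Upsilon>' \<and> objective T Rs Q (H, \<Lambda>, \<Upsilon>, \<Upsilon>', \<Theta>) \<le> c}"

private lemma convex_upper_set: "convex upper_set"
proof (rule convexI)
  fix P1 P2 u w assume h: "P1 \<in> upper_set" "P2 \<in> upper_set" "0 \<le> u" "0 \<le> w" "u + w = (1::real)"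
  from h(1) obtain H \<Lambda> \<Upsilon> \<Upsilon>' \<Theta> c where 1: "psds \<Lambda> \<Upsilon> \<Upsilon>' \<Theta>" "P1 = (blk1 H \<Lambda> \<Upsilon>, blk2 H \<Theta> \<Upsilon>', c)" "objective T Rs Q (H, \<Lambda>, \<Upsilon>, \<Upsilon>', \<Theta>) \<le> c"
    unfolding upper_set_def by blast
  from h(2) obtain H2 \<Lambda>2 \<Upsilon>2 \<Upsilon>2' \<Theta>2 c2 where 2: "psds \<Lambda>2 \<Upsilon>2 \<Upsilon>2' \<Theta>2" "P2 = (blk1 H2 \<Lambda>2 \<Upsilon>2, blk2 H2 \<Theta>2 \<Upsilon>2', c2)" "objective T Rs Q (H2, \<Lambda>2, \<Upsilon>2, \<Upsilon>2', \<Theta>2) \<le> c2"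
    unfolding upper_set_def by blast
  note p1 = 1(1)[unfolded psds_def] and p2 = 2(1)[unfolded psds_def]
  let ?H = "u *\<^sub>R H + w *\<^sub>R H2" and ?L = "\<lambda>k. u \<cdot>\<^sub>m \<Lambda> k + w \<cdot>\<^sub>m \<Lambda>2 k" and ?U = "\<lambda>k. u \<cdot>\<^sub>m \<Upsilon> k + w \<cdot>\<^sub>m \<Upsilon>2 k"
    and ?V = "\<lambda>k. u \<cdot>\<^sub>m \<Upsilon>' k + w \<cdot>\<^sub>m \<Upsilon>2' k" and ?Th = "u *\<^sub>R \<Theta> + w *\<^sub>R \<Theta>2"
  have L: "\<And>k. psd_mat (d k) (\<Lambda> k)" "\<And>k. psd_mat (d k) (\<Lambda>2 k)" and U: "\<And>k. psd_mat (f k) (\<Upsilon> k)" "\<And>k. psd_mat (f k) (\<Upsilon>2 k)"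
    and V: "\<And>k. psd_mat (f k) (\<Upsilon>' k)" "\<And>k. psd_mat (f k) (\<Upsilon>2' k)" and Th: "tr \<Theta> = \<Theta>" "tr \<Theta>2 = \<Theta>2" using p1 p2 by auto
  have tradd: "tr (X + Y) = tr X + tr Y" for X Y :: "real ^ 'aa ^ 'bb"
    unfolding Finite_Cartesian_Product.vec_eq_iff by (simp add: Finite_Cartesian_Product.transpose_def)
  have ps: "psds ?L ?U ?V ?Th"
    unfolding psds_def
    using trace_vec_combine(1)[where d = d and L = \<Lambda> and L' = \<Lambda>2, OF L h(3,4)]
      trace_vec_combine(1)[where d = f and L = \<Upsilon> and L' = \<Upsilon>2, OF U h(3,4)]
      trace_vec_combine(1)[where d = f and L = \<Upsilon>' and L' = \<Upsilon>2', OF V h(3,4)] Th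
    by (simp add: tradd transpose_scaleR)
  have Hu: "(tr B - tr A ** ?H) ** M = u *\<^sub>R ((tr B - tr A ** H) ** M) + w *\<^sub>R ((tr B - tr A ** H2) ** M)"
  proof -
    \<comment> \<open>The first block is affine and not linear in the candidate; the constant
      \<open>B\<close> is split by means of \<open>u + w = 1\<close>.\<close>
    have "tr B = u *\<^sub>R tr B + w *\<^sub>R tr B" using h(5) by (simp add: scaleR_add_left[symmetric])
    then have "tr B - tr A ** ?H = u *\<^sub>R (tr B - tr A ** H) + w *\<^sub>R (tr B - tr A ** H2)"
      by (simp add: matrix_add_ldistrib scaleR_right_diff_distrib matrix_scalar_ac scalar_matrix_assoc)
    then show ?thesis by (simp add: matrix_add_rdistrib scalar_matrix_assoc)
  qed
  have Hv: "tr M ** (B - tr ?H ** A) = u *\<^sub>R (tr M ** (B - tr H ** A)) + w *\<^sub>R (tr M ** (B - tr H2 ** A))"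
  proof -
    have "tr (tr (B - tr ?H ** A) ** M) = tr (u *\<^sub>R (tr (B - tr H ** A) ** M) + w *\<^sub>R (tr (B - tr H2 ** A) ** M))"
      using Hu[unfolded tr_diff] by (rule arg_cong)
    then show ?thesis by (simp only: matrix_transpose_mul Finite_Cartesian_Product.transpose_transpose tradd transpose_scaleR)
  qed
  have b1: "blk1 ?H ?L ?U = u *\<^sub>R blk1 H \<Lambda> \<Upsilon> + w *\<^sub>R blk1 H2 \<Lambda>2 \<Upsilon>2"
    unfolding blk1_def block_matrix_combine[symmetric] sum_adj_map_combine[OF sdR L] sum_adj_map_combine[OF sdS U] Hu Hv
    by (simp add: scaleR_add_right mult.commute)
  have HM: "?H ** M = u *\<^sub>R (H ** M) + w *\<^sub>R (H2 ** M)" by (simp add: matrix_add_rdistrib scalar_matrix_assoc)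
  have MH: "tr M ** tr ?H = u *\<^sub>R (tr M ** tr H) + w *\<^sub>R (tr M ** tr H2)"
    using arg_cong[OF HM, of tr] by (simp only: matrix_transpose_mul tradd transpose_scaleR)
  have b2: "blk2 ?H ?Th ?V = u *\<^sub>R blk2 H \<Theta> \<Upsilon>' + w *\<^sub>R blk2 H2 \<Theta>2 \<Upsilon>2'"
    unfolding blk2_def block_matrix_combine[symmetric] sum_adj_map_combine[OF sdS V] HM MH
    by (simp add: scaleR_add_right mult.commute)
  have "objective T Rs Q (?H, ?L, ?U, ?V, ?Th) \<le> u * objective T Rs Q (H, \<Lambda>, \<Upsilon>, \<Upsilon>', \<Theta>) + w * objective T Rs Q (H2, \<Lambda>2, \<Upsilon>2, \<Upsilon>2', \<Theta>2)"
    unfolding objective_def prod.case trace_vec_combine(2)[where d = d and L = \<Lambda> and L' = \<Lambda>2, OF L h(3,4)]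
      trace_vec_combine(2)[where d = f and L = \<Upsilon> and L' = \<Upsilon>2, OF U h(3,4)]
      trace_vec_combine(2)[where d = f and L = \<Upsilon>' and L' = \<Upsilon>2', OF V h(3,4)]
    using supp_fun_combine[OF spectratope_dataD(3)[OF sdR] h(3,4), of "trace_vec \<Lambda>" "trace_vec \<Lambda>2"]
      supp_fun_combine[OF spectratope_dataD(3)[OF sdS] h(3,4), of "trace_vec \<Upsilon>" "trace_vec \<Upsilon>2"]
      supp_fun_combine[OF spectratope_dataD(3)[OF sdS] h(3,4), of "trace_vec \<Upsilon>'" "trace_vec \<Upsilon>2'"]
      Gam_combine[OF Q(1,3) h(3,4), of \<Theta> \<Theta>2]
    by (simp add: distrib_left)
  also have "\<dots> \<le> u * c + w * c2" using 1(3) 2(3) h(3,4) by (intro add_mono mult_left_mono)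
  finally have ob: "objective T Rs Q (?H, ?L, ?U, ?V, ?Th) \<le> u * c + w * c2" .
  show "u *\<^sub>R P1 + w *\<^sub>R P2 \<in> upper_set"
    unfolding upper_set_def 1(2) 2(2) scaleR_Pair add_Pair real_scaleR_def mem_Collect_eq prod.case
    by (intro exI[of _ ?H] exI[of _ ?L] exI[of _ ?U] exI[of _ ?V] exI[of _ ?Th] conjI ps ob b1[symmetric] b2[symmetric])
qed

text \<open>A common point with \<open>upper_set\<close> would be feasible with objective below the
  optimum. Positivity is imposed on the forms without symmetry, so that the separating functional is
  tested on all matrices required by \<open>psd_if_gram_bound\<close>.\<close>

private definition lower_set :: "((real ^ ('n + 'q) ^ ('n + 'q)) \<times> (real ^ ('m + 'q) ^ ('m + 'q)) \<times> real) set" where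
  "lower_set = {(X, Y, c). (\<forall>v. v \<noteq> 0 \<longrightarrow> 0 < v \<bullet> (X *v v)) \<and> (\<forall>v. v \<noteq> 0 \<longrightarrow> 0 < v \<bullet> (Y *v v)) \<and> c < Opt A B M d R T f S Rs Q}"

private lemma convex_lower_set: "convex lower_set"
proof (rule convexI)
  fix P1 P2 u w assume h: "P1 \<in> lower_set" "P2 \<in> lower_set" "0 \<le> u" "0 \<le> w" "u + w = (1::real)"
  obtain X Y c X' Y' c' where P: "P1 = (X, Y, c)" "P2 = (X', Y', c')" by (metis prod_cases3)
  let ?o = "Opt A B M d R T f S Rs Q"
  have c: "c < ?o" "c' < ?o" using h(1,2) unfolding P lower_set_def by simp_all
  have "u * c + w * c' < ?o"
  proof -
    have "u * c \<le> u * ?o" "w * c' \<le> w * ?o" using c h(3,4) by (auto intro: mult_left_mono)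
    moreover have "u * c < u * ?o \<or> w * c' < w * ?o"
    proof (cases "0 < u")
      case True then show ?thesis using c by simp
    next
      case False then show ?thesis using c h(3,5) by simp
    qed
    moreover have "u * ?o + w * ?o = ?o" using h(5) by (simp add: distrib_right[symmetric])
    ultimately show ?thesis by linarith
  qed
  then show "u *\<^sub>R P1 + w *\<^sub>R P2 \<in> lower_set"
    using h(1,2) unfolding P lower_set_def by (auto intro!: open_half_combine h(3-5))
qed

private lemma mat_1_form: "v \<bullet> ((c *\<^sub>R Finite_Cartesian_Product.mat 1 + X) *v v) = c * (norm v)\<^sup>2 + v \<bullet> (X *v (v :: real ^ 'a))"
  by (simp add: matrix_vector_mult_add_rdistrib scaleR_matrix_vector_assoc[symmetric] inner_add_right power2_norm_eq_inner)

text \<open>Lagrange multipliers from a separating hyperplane. The multiplier \<gamma> of the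
  objective may still be zero here; this is excluded in \<open>dual_vectors\<close>.\<close>

private lemma separation:
  obtains D1 :: "real ^ ('n + 'q) ^ ('n + 'q)" and D2 :: "real ^ ('m + 'q) ^ ('m + 'q)" and \<gamma> :: real
  where "psd D1" "psd D2" "0 \<le> \<gamma>" "\<not> (D1 = 0 \<and> D2 = 0 \<and> \<gamma> = 0)"
    "\<And>H \<Lambda> \<Upsilon> \<Upsilon>' \<Theta>. psds \<Lambda> \<Upsilon> \<Upsilon>' \<Theta> \<Longrightarrow> \<gamma> * Opt A B M d R T f S Rs Q
      \<le> \<gamma> * objective T Rs Q (H, \<Lambda>, \<Upsilon>, \<Upsilon>', \<Theta>) - D1 \<bullet> blk1 H \<Lambda> \<Upsilon> - D2 \<bullet> blk2 H \<Theta> \<Upsilon>'"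
proof -
  let ?o = "Opt A B M d R T f S Rs Q"
  let ?I1 = "Finite_Cartesian_Product.mat 1 :: real ^ ('n + 'q) ^ ('n + 'q)" and ?I2 = "Finite_Cartesian_Product.mat 1 :: real ^ ('m + 'q) ^ ('m + 'q)"
  obtain s where s: "optimal A B M d R T f S Rs Q s" using optimal_exists[OF sdR N sdS ball Q(1,3,4)] by blast
  have le: "?o \<le> objective T Rs Q s'" if "feasible A B M d R f S s'" for s'
    by (rule optimal_objective(3)[OF sdR N sdS ball Q(1,3,4) s that])
  have in_lower: "(e *\<^sub>R ?I1 + X, e *\<^sub>R ?I2 + Y, c) \<in> lower_set"
    if "0 < e" "\<And>v. 0 \<le> v \<bullet> (X *v v)" "\<And>v. 0 \<le> v \<bullet> (Y *v v)" "c < ?o" for e X Y c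
    unfolding lower_set_def mem_Collect_eq prod.case mat_1_form using that
    by (auto intro!: add_pos_nonneg)
  have ne1: "lower_set \<noteq> {}" using in_lower[of 1 0 0 "?o - 1"] by (auto simp del: mat_1_form)
  obtain H0 \<Lambda>0 \<Upsilon>0 \<Upsilon>0' \<Theta>0 where s0: "s = (H0, \<Lambda>0, \<Upsilon>0, \<Upsilon>0', \<Theta>0)" by (cases s) auto
  have "feasible A B M d R f S s" by (rule optimal_objective(1)[OF sdR N sdS ball Q(1,3,4) s])
  then have "(blk1 H0 \<Lambda>0 \<Upsilon>0, blk2 H0 \<Theta>0 \<Upsilon>0', objective T Rs Q s) \<in> upper_set"
    unfolding s0 feasible_iff upper_set_def by blast
  then have ne2: "upper_set \<noteq> {}" by blast
  have disj: "lower_set \<inter> upper_set = {}"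
  proof (rule ccontr)
    assume "lower_set \<inter> upper_set \<noteq> {}"
    then obtain P where P: "P \<in> lower_set" "P \<in> upper_set" by blast
    from P(2) obtain H \<Lambda> \<Upsilon> \<Upsilon>' \<Theta> c where u: "psds \<Lambda> \<Upsilon> \<Upsilon>' \<Theta>" "P = (blk1 H \<Lambda> \<Upsilon>, blk2 H \<Theta> \<Upsilon>', c)" "objective T Rs Q (H, \<Lambda>, \<Upsilon>, \<Upsilon>', \<Theta>) \<le> c"
      unfolding upper_set_def by blast
    have l: "\<And>v. v \<noteq> 0 \<Longrightarrow> 0 < v \<bullet> (blk1 H \<Lambda> \<Upsilon> *v v)" "\<And>v. v \<noteq> 0 \<Longrightarrow> 0 < v \<bullet> (blk2 H \<Theta> \<Upsilon>' *v v)" "c < ?o"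
      using P(1) unfolding u(2) lower_set_def by auto
    have "0 \<le> v \<bullet> (blk1 H \<Lambda> \<Upsilon> *v v)" for v using l(1)[of v] by (cases "v = 0") auto
    moreover have "0 \<le> v \<bullet> (blk2 H \<Theta> \<Upsilon>' *v v)" for v using l(2)[of v] by (cases "v = 0") auto
    ultimately have "feasible A B M d R f S (H, \<Lambda>, \<Upsilon>, \<Upsilon>', \<Theta>)" unfolding feasible_iff using u(1) psd_blk[OF u(1)] by blast
    from le[OF this] u(3) l(3) show False by linarith
  qed
  obtain a b where ab: "a \<noteq> 0" "\<And>P. P \<in> lower_set \<Longrightarrow> a \<bullet> P \<le> b" "\<And>P. P \<in> upper_set \<Longrightarrow> b \<le> a \<bullet> P"
    using separating_hyperplane_sets[OF convex_lower_set convex_upper_set ne1 ne2 disj] by blast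
  obtain a1 a2 \<gamma> where a: "a = (a1, a2, \<gamma>)" by (metis prod_cases3)
  have lo: "e * (a1 \<bullet> ?I1 + a2 \<bullet> ?I2) + a1 \<bullet> X + a2 \<bullet> Y + \<gamma> * c \<le> b"
    if "0 < e" "\<And>v. 0 \<le> v \<bullet> (X *v v)" "\<And>v. 0 \<le> v \<bullet> (Y *v v)" "c < ?o" for e X Y c
    using ab(2)[OF in_lower[OF that]] by (simp add: a inner_add_right distrib_left)
  let ?k = "a1 \<bullet> ?I1 + a2 \<bullet> ?I2"
  \<comment> \<open>The set \<open>lower_set\<close> contains rays towards lower levels and along
    every nonnegative form; boundedness of the functional on these rays gives its signs, here and in
    \<open>D1\<close> and \<open>D2\<close>.\<close>
  have \<gamma>: "0 \<le> \<gamma>"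
  proof (rule affine_bounded_below_slope)
    fix t :: real assume t: "0 \<le> t"
    show "1 * ?k + \<gamma> * (?o - 1) - b \<le> 0 + t * \<gamma>"
      using lo[of 1 0 0 "?o - 1 - t"] t by (simp add: right_diff_distrib mult.commute)
  qed
  have D1: "psd (- a1)"
  proof (rule psd_if_gram_bound)
    fix X :: "real ^ ('n + 'q) ^ ('n + 'q)" assume X: "\<And>v. 0 \<le> v \<bullet> (X *v v)"
    show "0 \<le> - a1 \<bullet> X"
    proof (rule affine_bounded_below_slope)
      fix t :: real assume t: "0 \<le> t"
      have "0 \<le> v \<bullet> ((t *\<^sub>R X) *v v)" for v using X[of v] t by (simp add: scaleR_matrix_vector_assoc[symmetric])
      then show "1 * ?k + \<gamma> * (?o - 1) - b \<le> 0 + t * (- a1 \<bullet> X)"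
        using lo[of 1 "t *\<^sub>R X" 0 "?o - 1"] by simp
    qed
  qed
  have D2: "psd (- a2)"
  proof (rule psd_if_gram_bound)
    fix X :: "real ^ ('m + 'q) ^ ('m + 'q)" assume X: "\<And>v. 0 \<le> v \<bullet> (X *v v)"
    show "0 \<le> - a2 \<bullet> X"
    proof (rule affine_bounded_below_slope)
      fix t :: real assume t: "0 \<le> t"
      have "0 \<le> v \<bullet> ((t *\<^sub>R X) *v v)" for v using X[of v] t by (simp add: scaleR_matrix_vector_assoc[symmetric])
      then show "1 * ?k + \<gamma> * (?o - 1) - b \<le> 0 + t * (- a2 \<bullet> X)"
        using lo[of 1 0 "t *\<^sub>R X" "?o - 1"] by simp
    qed
  qed
  \<comment> \<open>Points with both blocks \<epsilon> times the identity and level \<epsilon> below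
    the optimum lie in \<open>lower_set\<close> and tend to the corner with zero blocks and optimal
    level.\<close>
  have go: "\<gamma> * ?o \<le> b"
  proof (rule field_le_epsilon)
    fix e :: real assume e: "0 < e"
    define \<epsilon> where "\<epsilon> = e / (1 + \<bar>?k\<bar> + \<bar>\<gamma>\<bar>)"
    have p: "0 < 1 + \<bar>?k\<bar> + \<bar>\<gamma>\<bar>" by linarith
    have \<epsilon>: "0 < \<epsilon>" using e p by (simp add: \<epsilon>_def)
    have "\<epsilon> * ?k + \<gamma> * (?o - \<epsilon>) \<le> b" using lo[of \<epsilon> 0 0 "?o - \<epsilon>"] \<epsilon> by simp
    moreover have "\<epsilon> * (\<gamma> - ?k) \<le> \<epsilon> * (1 + \<bar>?k\<bar> + \<bar>\<gamma>\<bar>)" using \<epsilon> by (intro mult_left_mono) auto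
    moreover have "\<epsilon> * (1 + \<bar>?k\<bar> + \<bar>\<gamma>\<bar>) = e" using p by (simp add: \<epsilon>_def)
    ultimately show "\<gamma> * ?o \<le> b + e" by (simp add: algebra_simps)
  qed
  have gb: "b \<le> \<gamma> * objective T Rs Q (H, \<Lambda>, \<Upsilon>, \<Upsilon>', \<Theta>) + a1 \<bullet> blk1 H \<Lambda> \<Upsilon> + a2 \<bullet> blk2 H \<Theta> \<Upsilon>'"
    if "psds \<Lambda> \<Upsilon> \<Upsilon>' \<Theta>" for H \<Lambda> \<Upsilon> \<Upsilon>' \<Theta>
  proof -
    have "(blk1 H \<Lambda> \<Upsilon>, blk2 H \<Theta> \<Upsilon>', objective T Rs Q (H, \<Lambda>, \<Upsilon>, \<Upsilon>', \<Theta>)) \<in> upper_set"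
      unfolding upper_set_def using that by blast
    from ab(3)[OF this] show ?thesis by (simp add: a)
  qed
  have fin: "\<gamma> * ?o \<le> \<gamma> * objective T Rs Q (H, \<Lambda>, \<Upsilon>, \<Upsilon>', \<Theta>) - (- a1) \<bullet> blk1 H \<Lambda> \<Upsilon> - (- a2) \<bullet> blk2 H \<Theta> \<Upsilon>'"
    if "psds \<Lambda> \<Upsilon> \<Upsilon>' \<Theta>" for H \<Lambda> \<Upsilon> \<Upsilon>' \<Theta> using go gb[OF that, of H] by simp
  have "\<not> (- a1 = 0 \<and> - a2 = 0 \<and> \<gamma> = 0)" using ab(1) by (simp add: a zero_prod_def)
  from that[OF D1 D2 \<gamma> this fin] show ?thesis .
qed

private lemma psd_mat_scaled:
  assumes "\<And>k. psd_mat (e k) (L k)" "0 \<le> t"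
  shows "\<And>k. psd_mat (e k) (t \<cdot>\<^sub>m L k)" and "trace_vec (\<lambda>k. t \<cdot>\<^sub>m L k) = t *\<^sub>R trace_vec L"
  using psd_mat_smult[OF assms(1) assms(2)]
  by (simp_all add: trace_vec_def Finite_Cartesian_Product.vec_eq_iff)

private lemma sum_adj_map_scaled:
  assumes "spectratope_data e U Z" "\<And>k. psd_mat (e k) (L k)"
  shows "(\<Sum>k\<in>UNIV. adj_map (U k) (t \<cdot>\<^sub>m L k)) = t *\<^sub>R (\<Sum>k\<in>UNIV. adj_map (U k) (L k))"
proof -
  have "adj_map (U k) (t \<cdot>\<^sub>m L k) = t *\<^sub>R adj_map (U k) (L k)" for k
    using assms(2)[of k] by (intro adj_map_smult[of _ "e k"] spectratope_dataD(4)[OF assms(1)]) (auto simp: psd_mat_iff)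
  then show ?thesis by (simp add: scaleR_sum_right)
qed

private lemma adj_form_nonneg:
  assumes sd: "spectratope_data e U Z" and L: "\<And>k. psd_mat (e k) (L k)"
  shows "0 \<le> x \<bullet> ((\<Sum>k\<in>UNIV. adj_map (U k) (L k)) *v x)"
proof -
  have "0 \<le> x \<bullet> (adj_map (U k) (L k) *v x)" for k
  proof (rule psd_mat_gram[OF L[of k]])
    fix w :: "nat \<Rightarrow> nat \<Rightarrow> real"
    assume w: "\<And>a b. a < e k \<Longrightarrow> b < e k \<Longrightarrow> L k $$ (a, b) = (\<Sum>c<e k. w c a * w c b)"
    have "x \<bullet> (adj_map (U k) (L k) *v x) = (\<Sum>c<e k. lin_sqnorm (e k) (U k) x (w c))"
      using L[of k] by (intro adj_map_form_gram spectratope_dataD(2)[OF sd] w) (auto simp: psd_mat_iff)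
    then show ?thesis by (simp add: sum_nonneg lin_sqnorm_nonneg)
  qed
  then show ?thesis by (simp add: sum_matrix_vector_mult inner_sum_right sum_nonneg)
qed

text \<open>The upper bound obtained from \<open>separation\<close> can be scaled independently in
  H, \<Lambda>, \<Upsilon>, \<Upsilon>' and \<Theta>, hence each coefficient has a sign. H may be
  scaled by either sign, so its coefficient vanishes; this is the coupling equation.\<close>

private lemma dual_vectors:
  obtains \<gamma> :: real and X :: "'n + 'q \<Rightarrow> real ^ 'n" and Y :: "'n + 'q \<Rightarrow> real ^ 'q"
    and P :: "'m + 'q \<Rightarrow> real ^ 'm" and W :: "'m + 'q \<Rightarrow> real ^ 'q"
  where "0 < \<gamma>" "\<And>b. P (Inr b) = 0"
    "\<And>L. (\<And>k. psd_mat (d k) (L k)) \<Longrightarrow> (\<Sum>i\<in>UNIV. X i \<bullet> ((\<Sum>k\<in>UNIV. adj_map (R k) (L k)) *v X i)) \<le> \<gamma> * supp_fun T (trace_vec L)"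
    "\<And>L. (\<And>k. psd_mat (f k) (L k)) \<Longrightarrow> (\<Sum>i\<in>UNIV. Y i \<bullet> ((\<Sum>k\<in>UNIV. adj_map (S k) (L k)) *v Y i)) \<le> \<gamma> * supp_fun Rs (trace_vec L)"
    "\<And>L. (\<And>k. psd_mat (f k) (L k)) \<Longrightarrow> (\<Sum>i\<in>UNIV. W i \<bullet> ((\<Sum>k\<in>UNIV. adj_map (S k) (L k)) *v W i)) \<le> \<gamma> * supp_fun Rs (trace_vec L)"
    "\<And>Th. tr Th = Th \<Longrightarrow> (\<Sum>i\<in>UNIV. P i \<bullet> (Th *v P i)) \<le> \<gamma> * Gam Q Th"
    "\<And>H. (\<Sum>i\<in>UNIV. (M *v Y i) \<bullet> (tr H *v (A *v X i))) = (\<Sum>i\<in>UNIV. (M *v W i) \<bullet> (tr H *v P i))"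
    "\<gamma> * Opt A B M d R T f S Rs Q \<le> (\<Sum>i\<in>UNIV. (M *v Y i) \<bullet> (B *v X i))"
proof -
  let ?o = "Opt A B M d R T f S Rs Q"
  obtain D1 :: "real ^ ('n + 'q) ^ ('n + 'q)" and D2 :: "real ^ ('m + 'q) ^ ('m + 'q)" and \<gamma> :: real
    where D: "psd D1" "psd D2" "0 \<le> \<gamma>" "\<not> (D1 = 0 \<and> D2 = 0 \<and> \<gamma> = 0)"
    and sep: "\<And>H \<Lambda> \<Upsilon> \<Upsilon>' \<Theta>. psds \<Lambda> \<Upsilon> \<Upsilon>' \<Theta> \<Longrightarrow> \<gamma> * ?o
      \<le> \<gamma> * objective T Rs Q (H, \<Lambda>, \<Upsilon>, \<Upsilon>', \<Theta>) - D1 \<bullet> blk1 H \<Lambda> \<Upsilon> - D2 \<bullet> blk2 H \<Theta> \<Upsilon>'"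
    by (rule separation) blast
  obtain v :: "'n + 'q \<Rightarrow> real ^ ('n + 'q)" where v: "\<And>i j. D1 $ i $ j = (\<Sum>k\<in>UNIV. v k $ i * v k $ j)"
    using psd_gram[OF D(1)] by blast
  \<comment> \<open>A triangular factor confines \<open>P\<close> to the indices in \<open>'m\<close>, so that it becomes a square root of a covariance matrix.\<close>
  have "psd_on UNIV (\<lambda>i j. D2 $ i $ j)" using D(2) by (simp add: psd_iff_psd_on)
  then obtain w' :: "'m + 'q \<Rightarrow> 'm + 'q \<Rightarrow> real" where w': "\<And>i j. D2 $ i $ j = (\<Sum>k\<in>UNIV. w' k i * w' k j)"
    and tri: "\<And>i k. i \<in> range Inl \<Longrightarrow> k \<in> UNIV - range Inl \<Longrightarrow> w' k i = 0"
    by (rule psd_on_factor_triangular[OF finite_class.finite_UNIV _ subset_UNIV, where S = "range Inl"]) auto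
  define w where "w k = (\<chi> i. w' k i)" for k
  have w: "D2 $ i $ j = (\<Sum>k\<in>UNIV. w k $ i * w k $ j)" for i j by (simp add: w_def w')
  define X where "X k = (\<chi> a. v k $ Inl a)" for k
  \<comment> \<open>The sign makes the cross term of the first block enter with a minus, so that the
    pairing with \<open>B\<close> ends up as a gain \<open>K\<close>. The sign of \<open>W\<close>
    below matches it.\<close>
  define Y where "Y k = (\<chi> a. - v k $ Inr a)" for k
  define P where "P k = (\<chi> a. w k $ Inl a)" for k
  define W where "W k = (\<chi> a. - w k $ Inr a)" for k
  have vj: "v k = vec_join (X k, - Y k)" for k
    by (simp add: Finite_Cartesian_Product.vec_eq_iff vec_join_def X_def Y_def split: sum.splits)
  have wj: "w k = vec_join (P k, - W k)" for k
    by (simp add: Finite_Cartesian_Product.vec_eq_iff vec_join_def P_def W_def split: sum.splits)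
  have P0: "P (Inr b) = 0" for b
    unfolding P_def Finite_Cartesian_Product.vec_eq_iff using tri by (simp add: w_def image_iff)
  define F1 where "F1 L = (\<Sum>i\<in>UNIV. X i \<bullet> ((\<Sum>k\<in>UNIV. adj_map (R k) (L k)) *v X i))" for L
  define F2 where "F2 L = (\<Sum>i\<in>UNIV. Y i \<bullet> ((\<Sum>k\<in>UNIV. adj_map (S k) (L k)) *v Y i))" for L
  define F3 where "F3 L = (\<Sum>i\<in>UNIV. W i \<bullet> ((\<Sum>k\<in>UNIV. adj_map (S k) (L k)) *v W i))" for L
  define F4 where "F4 Th = (\<Sum>i\<in>UNIV. P i \<bullet> (Th *v P i))" for Th
  define K where "K = (\<Sum>i\<in>UNIV. (M *v Y i) \<bullet> (B *v X i))"
  define G where "G H = (\<Sum>i\<in>UNIV. (M *v W i) \<bullet> (tr H *v P i)) - (\<Sum>i\<in>UNIV. (M *v Y i) \<bullet> (tr H *v (A *v X i)))" for H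
  have d1: "D1 \<bullet> blk1 H \<Lambda> \<Upsilon> = F1 \<Lambda> - K + (\<Sum>i\<in>UNIV. (M *v Y i) \<bullet> (tr H *v (A *v X i))) + F2 \<Upsilon>" for H \<Lambda> \<Upsilon>
    unfolding inner_gram[OF v] vj blk1_form
    by (simp add: F1_def F2_def K_def matrix_vector_mult_minus sum.distrib sum_subtractf sum_negf
        matrix_vector_mult_diff_rdistrib inner_diff_right matrix_vector_mul_assoc)
  have d2: "D2 \<bullet> blk2 H \<Theta> \<Upsilon>' = F4 \<Theta> - (\<Sum>i\<in>UNIV. (M *v W i) \<bullet> (tr H *v P i)) + F3 \<Upsilon>'" for H \<Theta> \<Upsilon>'
    unfolding inner_gram[OF w] wj blk2_form
    by (simp add: F3_def F4_def matrix_vector_mult_minus sum.distrib sum_subtractf sum_negf)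
  \<comment> \<open>Support functions and \<Gamma> are positively homogeneous, so the Lagrangian
    bound becomes affine in each of the scalings.\<close>
  have key: "\<gamma> * ?o \<le> K + h * G H + t1 * (\<gamma> * supp_fun T (trace_vec \<Lambda>) - F1 \<Lambda>) + t2 * (\<gamma> * supp_fun Rs (trace_vec \<Upsilon>) - F2 \<Upsilon>)
      + t3 * (\<gamma> * supp_fun Rs (trace_vec \<Upsilon>') - F3 \<Upsilon>') + t4 * (\<gamma> * Gam Q \<Theta> - F4 \<Theta>)"
    if p: "psds \<Lambda> \<Upsilon> \<Upsilon>' \<Theta>" and t: "0 \<le> t1" "0 \<le> t2" "0 \<le> t3" "0 \<le> t4" for H \<Lambda> \<Upsilon> \<Upsilon>' \<Theta> h t1 t2 t3 t4
  proof -
    have q: "\<And>k. psd_mat (d k) (\<Lambda> k)" "\<And>l. psd_mat (f l) (\<Upsilon> l)" "\<And>l. psd_mat (f l) (\<Upsilon>' l)" "tr \<Theta> = \<Theta>"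
      using p unfolding psds_def by auto
    let ?L = "\<lambda>k. t1 \<cdot>\<^sub>m \<Lambda> k" and ?U = "\<lambda>k. t2 \<cdot>\<^sub>m \<Upsilon> k" and ?V = "\<lambda>k. t3 \<cdot>\<^sub>m \<Upsilon>' k" and ?Th = "t4 *\<^sub>R \<Theta>" and ?H = "h *\<^sub>R H"
    have ps: "psds ?L ?U ?V ?Th" unfolding psds_def
      using psd_mat_smult(1)[OF q(1) t(1)] psd_mat_smult(1)[OF q(2) t(2)] psd_mat_smult(1)[OF q(3) t(3)] q(4) by (simp add: transpose_scaleR)
    have ob: "objective T Rs Q (?H, ?L, ?U, ?V, ?Th) \<le> t1 * supp_fun T (trace_vec \<Lambda>) + t2 * supp_fun Rs (trace_vec \<Upsilon>) + t3 * supp_fun Rs (trace_vec \<Upsilon>') + t4 * Gam Q \<Theta>"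
      unfolding objective_def prod.case psd_mat_scaled(2)[where e = d and L = \<Lambda>, OF q(1) t(1)] psd_mat_scaled(2)[where e = f and L = \<Upsilon>, OF q(2) t(2)] psd_mat_scaled(2)[where e = f and L = \<Upsilon>', OF q(3) t(3)]
      using supp_fun_combine[OF spectratope_dataD(3)[OF sdR] t(1) order_refl, of "trace_vec \<Lambda>" 0]
        supp_fun_combine[OF spectratope_dataD(3)[OF sdS] t(2) order_refl, of "trace_vec \<Upsilon>" 0]
        supp_fun_combine[OF spectratope_dataD(3)[OF sdS] t(3) order_refl, of "trace_vec \<Upsilon>'" 0]
        Gam_combine[OF Q(1,3) t(4) order_refl, of \<Theta> 0]
      by simp
    have s1: "F1 ?L = t1 * F1 \<Lambda>" unfolding F1_def sum_adj_map_scaled[OF sdR q(1)] by (simp add: scaleR_matrix_vector_assoc[symmetric] sum_distrib_left)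
    have s2: "F2 ?U = t2 * F2 \<Upsilon>" unfolding F2_def sum_adj_map_scaled[OF sdS q(2)] by (simp add: scaleR_matrix_vector_assoc[symmetric] sum_distrib_left)
    have s3: "F3 ?V = t3 * F3 \<Upsilon>'" unfolding F3_def sum_adj_map_scaled[OF sdS q(3)] by (simp add: scaleR_matrix_vector_assoc[symmetric] sum_distrib_left)
    have s4: "F4 ?Th = t4 * F4 \<Theta>" unfolding F4_def by (simp add: scaleR_matrix_vector_assoc[symmetric] sum_distrib_left)
    have s5: "G ?H = h * G H" unfolding G_def transpose_scaleR
      by (simp add: scaleR_matrix_vector_assoc[symmetric] sum_distrib_left[symmetric] right_diff_distrib)
    have "\<gamma> * ?o \<le> \<gamma> * objective T Rs Q (?H, ?L, ?U, ?V, ?Th) + K + G ?H - F1 ?L - F2 ?U - F3 ?V - F4 ?Th"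
      using sep[OF ps, of ?H] unfolding d1 d2 G_def by linarith
    moreover have "\<gamma> * objective T Rs Q (?H, ?L, ?U, ?V, ?Th) \<le> \<gamma> * (t1 * supp_fun T (trace_vec \<Lambda>) + t2 * supp_fun Rs (trace_vec \<Upsilon>) + t3 * supp_fun Rs (trace_vec \<Upsilon>') + t4 * Gam Q \<Theta>)"
      by (intro mult_left_mono ob D(3))
    ultimately show ?thesis unfolding s1 s2 s3 s4 s5 by (simp add: algebra_simps)
  qed
  define L1 where "L1 k = (1\<^sub>m (d k) :: real mat)" for k
  define U1 where "U1 l = (1\<^sub>m (f l) :: real mat)" for l
  have L1: "psd_mat (d k) (L1 k)" for k unfolding L1_def by (rule psd_mat_one)
  have U1: "psd_mat (f l) (U1 l)" for l unfolding U1_def by (rule psd_mat_one)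
  have tr1: "tr (Finite_Cartesian_Product.mat 1) = (Finite_Cartesian_Product.mat 1 :: real ^ 'm ^ 'm)" by (rule transpose_mat)
  have psI: "psds L U V Th" if "\<And>k. psd_mat (d k) (L k)" "\<And>l. psd_mat (f l) (U l)" "\<And>l. psd_mat (f l) (V l)" "tr Th = Th" for L U V Th
    using that by (simp add: psds_def)
  have K: "\<gamma> * ?o \<le> K" using key[OF psI[OF L1 U1 U1 tr1], of 0 0 0 0 0] by simp
  have G0: "G H = 0" for H
  proof -
    have "0 \<le> G H" by (rule affine_bounded_below_slope[of "\<gamma> * ?o" K]) (use key[OF psI[OF L1 U1 U1 tr1], of 0 0 0 0 _ H] in simp)
    moreover have "0 \<le> - G H"
      by (rule affine_bounded_below_slope[of "\<gamma> * ?o" K]) (use key[OF psI[OF L1 U1 U1 tr1], of 0 0 0 0 "- _" H] in simp)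
    ultimately show ?thesis by linarith
  qed
  have b1: "F1 L \<le> \<gamma> * supp_fun T (trace_vec L)" if L: "\<And>k. psd_mat (d k) (L k)" for L
  proof -
    have "0 \<le> \<gamma> * supp_fun T (trace_vec L) - F1 L"
      by (rule affine_bounded_below_slope[of "\<gamma> * ?o" K]) (use key[OF psI[OF L U1 U1 tr1], of _ 0 0 0 0] in simp)
    then show ?thesis by simp
  qed
  have b2: "F2 L \<le> \<gamma> * supp_fun Rs (trace_vec L)" if L: "\<And>k. psd_mat (f k) (L k)" for L
  proof -
    have "0 \<le> \<gamma> * supp_fun Rs (trace_vec L) - F2 L"
      by (rule affine_bounded_below_slope[of "\<gamma> * ?o" K]) (use key[OF psI[OF L1 L U1 tr1], of 0 _ 0 0 0] in simp)
    then show ?thesis by simp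
  qed
  have b3: "F3 L \<le> \<gamma> * supp_fun Rs (trace_vec L)" if L: "\<And>k. psd_mat (f k) (L k)" for L
  proof -
    have "0 \<le> \<gamma> * supp_fun Rs (trace_vec L) - F3 L"
      by (rule affine_bounded_below_slope[of "\<gamma> * ?o" K]) (use key[OF psI[OF L1 U1 L tr1], of 0 0 _ 0 0] in simp)
    then show ?thesis by simp
  qed
  have b4: "F4 Th \<le> \<gamma> * Gam Q Th" if Th: "tr Th = Th" for Th
  proof -
    have "0 \<le> \<gamma> * Gam Q Th - F4 Th"
      by (rule affine_bounded_below_slope[of "\<gamma> * ?o" K]) (use key[OF psI[OF L1 U1 U1 Th], of 0 0 0 _ 0] in simp)
    then show ?thesis by simp
  qed
  \<comment> \<open>With \<gamma> = 0 the bounds at identity blocks, whose forms are positive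
    definite, would make all vectors zero, hence both multipliers as well, contrary to a nonzero
    functional.\<close>
  have "0 < \<gamma>"
  proof (rule ccontr)
    assume "\<not> 0 < \<gamma>"
    then have g: "\<gamma> = 0" using D(3) by simp
    have X0: "X i = 0" for i
    proof (rule ccontr)
      assume "X i \<noteq> 0"
      then have "0 < X i \<bullet> ((\<Sum>k\<in>UNIV. adj_map (R k) (L1 k)) *v X i)" unfolding L1_def by (rule spectratope_sum_form_pos[OF sdR])
      also have "\<dots> \<le> F1 L1" unfolding F1_def
        by (rule member_le_sum[of i UNIV "\<lambda>i. X i \<bullet> ((\<Sum>k\<in>UNIV. adj_map (R k) (L1 k)) *v X i)"]) (auto intro!: adj_form_nonneg[OF sdR L1])
      finally show False using b1[OF L1] g by simp
    qed
    have Y0: "Y i = 0" for i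
    proof (rule ccontr)
      assume "Y i \<noteq> 0"
      then have "0 < Y i \<bullet> ((\<Sum>k\<in>UNIV. adj_map (S k) (U1 k)) *v Y i)" unfolding U1_def by (rule spectratope_sum_form_pos[OF sdS])
      also have "\<dots> \<le> F2 U1" unfolding F2_def
        by (rule member_le_sum[of i UNIV "\<lambda>i. Y i \<bullet> ((\<Sum>k\<in>UNIV. adj_map (S k) (U1 k)) *v Y i)"]) (auto intro!: adj_form_nonneg[OF sdS U1])
      finally show False using b2[OF U1] g by simp
    qed
    have W0: "W i = 0" for i
    proof (rule ccontr)
      assume "W i \<noteq> 0"
      then have "0 < W i \<bullet> ((\<Sum>k\<in>UNIV. adj_map (S k) (U1 k)) *v W i)" unfolding U1_def by (rule spectratope_sum_form_pos[OF sdS])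
      also have "\<dots> \<le> F3 U1" unfolding F3_def
        by (rule member_le_sum[of i UNIV "\<lambda>i. W i \<bullet> ((\<Sum>k\<in>UNIV. adj_map (S k) (U1 k)) *v W i)"]) (auto intro!: adj_form_nonneg[OF sdS U1])
      finally show False using b3[OF U1] g by simp
    qed
    have Pz: "P i = 0" for i
    proof (rule ccontr)
      assume "P i \<noteq> 0"
      then have "0 < P i \<bullet> P i" by simp
      also have "\<dots> \<le> F4 (Finite_Cartesian_Product.mat 1)" unfolding F4_def matrix_vector_mul_lid
        by (rule member_le_sum[of i UNIV "\<lambda>i. P i \<bullet> P i"]) auto
      finally show False using b4[OF tr1] g by simp
    qed
    have vz: "vec_join (0, 0) = 0" unfolding Finite_Cartesian_Product.vec_eq_iff by (simp add: vec_join_def split: sum.splits)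
    have "D1 = 0" unfolding Finite_Cartesian_Product.vec_eq_iff by (simp add: v vj X0 Y0 vz vec_join_def split: sum.splits)
    moreover have "D2 = 0" unfolding Finite_Cartesian_Product.vec_eq_iff by (simp add: w wj Pz W0 vz vec_join_def split: sum.splits)
    ultimately show False using D(4) g by simp
  qed
  moreover have "(\<Sum>i\<in>UNIV. (M *v Y i) \<bullet> (tr H *v (A *v X i))) = (\<Sum>i\<in>UNIV. (M *v W i) \<bullet> (tr H *v P i))" for H
    using G0[of H] unfolding G_def by simp
  ultimately show ?thesis
    using that[of \<gamma> P X Y W] P0 b1 b2 b3 b4 K unfolding F1_def F2_def F3_def F4_def K_def by blast
qed

text \<open>Dividing the multipliers by \<gamma>, that is the vectors by its square root, turns the
  bounds by support functions into membership in \<open>T\<close>, \<open>Rs\<close> and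
  \<open>Q\<close>, by separation.\<close>

lemma dual_certificate:
  obtains X :: "'n + 'q \<Rightarrow> real ^ 'n" and Y :: "'n + 'q \<Rightarrow> real ^ 'q" and P :: "'m \<Rightarrow> real ^ 'm" and W :: "'m \<Rightarrow> real ^ 'q"
    and t r r'
  where "t \<in> T" "\<And>k v. (\<Sum>i\<in>UNIV. lin_sqnorm (d k) (R k) (X i) v) \<le> t $ k * (\<Sum>a<d k. (v a)\<^sup>2)"
    "r \<in> Rs" "\<And>l v. (\<Sum>i\<in>UNIV. lin_sqnorm (f l) (S l) (Y i) v) \<le> r $ l * (\<Sum>a<f l. (v a)\<^sup>2)"
    "r' \<in> Rs" "\<And>l v. (\<Sum>i\<in>UNIV. lin_sqnorm (f l) (S l) (W i) v) \<le> r' $ l * (\<Sum>a<f l. (v a)\<^sup>2)"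
    "(\<chi> a b. \<Sum>i\<in>UNIV. P i $ a * P i $ b) \<in> Q"
    "\<And>b. (\<Sum>i\<in>UNIV. (M *v Y i) $ b *\<^sub>R (A *v X i)) = (\<Sum>i\<in>UNIV. (M *v W i) $ b *\<^sub>R P i)"
    "Opt A B M d R T f S Rs Q \<le> (\<Sum>i\<in>UNIV. (M *v Y i) \<bullet> (B *v X i))"
proof -
  obtain \<gamma> :: real and X :: "'n + 'q \<Rightarrow> real ^ 'n" and Y :: "'n + 'q \<Rightarrow> real ^ 'q"
    and P :: "'m + 'q \<Rightarrow> real ^ 'm" and W :: "'m + 'q \<Rightarrow> real ^ 'q"
  where \<gamma>: "0 < \<gamma>" and P0: "\<And>b. P (Inr b) = 0"
    and X: "\<And>L. (\<And>k. psd_mat (d k) (L k)) \<Longrightarrow> (\<Sum>i\<in>UNIV. X i \<bullet> ((\<Sum>k\<in>UNIV. adj_map (R k) (L k)) *v X i)) \<le> \<gamma> * supp_fun T (trace_vec L)"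
    and Y: "\<And>L. (\<And>k. psd_mat (f k) (L k)) \<Longrightarrow> (\<Sum>i\<in>UNIV. Y i \<bullet> ((\<Sum>k\<in>UNIV. adj_map (S k) (L k)) *v Y i)) \<le> \<gamma> * supp_fun Rs (trace_vec L)"
    and W: "\<And>L. (\<And>k. psd_mat (f k) (L k)) \<Longrightarrow> (\<Sum>i\<in>UNIV. W i \<bullet> ((\<Sum>k\<in>UNIV. adj_map (S k) (L k)) *v W i)) \<le> \<gamma> * supp_fun Rs (trace_vec L)"
    and P: "\<And>Th. tr Th = Th \<Longrightarrow> (\<Sum>i\<in>UNIV. P i \<bullet> (Th *v P i)) \<le> \<gamma> * Gam Q Th"
    and H: "\<And>H. (\<Sum>i\<in>UNIV. (M *v Y i) \<bullet> (tr H *v (A *v X i))) = (\<Sum>i\<in>UNIV. (M *v W i) \<bullet> (tr H *v P i))"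
    and O: "\<gamma> * Opt A B M d R T f S Rs Q \<le> (\<Sum>i\<in>UNIV. (M *v Y i) \<bullet> (B *v X i))"
    by (rule dual_vectors) blast
  define c where "c = 1 / sqrt \<gamma>"
  have cc: "c * (c * z) = z / \<gamma>" for z using \<gamma> by (simp add: c_def field_simps)
  have cg: "c * (c * (\<gamma> * z)) = z" for z using \<gamma> by (simp add: cc)
  have c0: "0 < c" using \<gamma> by (simp add: c_def)
  obtain t where t: "t \<in> T" "\<And>k v. (\<Sum>i\<in>UNIV. lin_sqnorm (d k) (R k) (c *\<^sub>R X i) v) \<le> t $ k * (\<Sum>a<d k. (v a)\<^sup>2)"
  proof (rule spectratope_dual[OF sdR, where X = "\<lambda>i. c *\<^sub>R X i"])
    fix L :: "'k \<Rightarrow> real mat" assume L: "\<And>k. psd_mat (d k) (L k)"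
    have "(\<Sum>i\<in>UNIV. (c *\<^sub>R X i) \<bullet> ((\<Sum>k\<in>UNIV. adj_map (R k) (L k)) *v (c *\<^sub>R X i)))
      = c * (c * (\<Sum>i\<in>UNIV. X i \<bullet> ((\<Sum>k\<in>UNIV. adj_map (R k) (L k)) *v X i)))"
      by (simp add: matrix_vector_mult_scaleR sum_distrib_left)
    also have "\<dots> \<le> c * (c * (\<gamma> * supp_fun T (trace_vec L)))" using X[OF L] c0 by simp
    finally show "(\<Sum>i\<in>UNIV. (c *\<^sub>R X i) \<bullet> ((\<Sum>k\<in>UNIV. adj_map (R k) (L k)) *v (c *\<^sub>R X i))) \<le> supp_fun T (trace_vec L)"
      by (simp only: cg)
  qed blast
  obtain r where r: "r \<in> Rs" "\<And>k v. (\<Sum>i\<in>UNIV. lin_sqnorm (f k) (S k) (c *\<^sub>R Y i) v) \<le> r $ k * (\<Sum>a<f k. (v a)\<^sup>2)"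
  proof (rule spectratope_dual[OF sdS, where X = "\<lambda>i. c *\<^sub>R Y i"])
    fix L :: "'l \<Rightarrow> real mat" assume L: "\<And>k. psd_mat (f k) (L k)"
    have "(\<Sum>i\<in>UNIV. (c *\<^sub>R Y i) \<bullet> ((\<Sum>k\<in>UNIV. adj_map (S k) (L k)) *v (c *\<^sub>R Y i)))
      = c * (c * (\<Sum>i\<in>UNIV. Y i \<bullet> ((\<Sum>k\<in>UNIV. adj_map (S k) (L k)) *v Y i)))"
      by (simp add: matrix_vector_mult_scaleR sum_distrib_left)
    also have "\<dots> \<le> c * (c * (\<gamma> * supp_fun Rs (trace_vec L)))" using Y[OF L] c0 by simp
    finally show "(\<Sum>i\<in>UNIV. (c *\<^sub>R Y i) \<bullet> ((\<Sum>k\<in>UNIV. adj_map (S k) (L k)) *v (c *\<^sub>R Y i))) \<le> supp_fun Rs (trace_vec L)"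
      by (simp only: cg)
  qed blast
  obtain r' where r': "r' \<in> Rs" "\<And>k v. (\<Sum>i\<in>UNIV. lin_sqnorm (f k) (S k) (c *\<^sub>R W i) v) \<le> r' $ k * (\<Sum>a<f k. (v a)\<^sup>2)"
  proof (rule spectratope_dual[OF sdS, where X = "\<lambda>i. c *\<^sub>R W i"])
    fix L :: "'l \<Rightarrow> real mat" assume L: "\<And>k. psd_mat (f k) (L k)"
    have "(\<Sum>i\<in>UNIV. (c *\<^sub>R W i) \<bullet> ((\<Sum>k\<in>UNIV. adj_map (S k) (L k)) *v (c *\<^sub>R W i)))
      = c * (c * (\<Sum>i\<in>UNIV. W i \<bullet> ((\<Sum>k\<in>UNIV. adj_map (S k) (L k)) *v W i)))"
      by (simp add: matrix_vector_mult_scaleR sum_distrib_left)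
    also have "\<dots> \<le> c * (c * (\<gamma> * supp_fun Rs (trace_vec L)))" using W[OF L] c0 by simp
    finally show "(\<Sum>i\<in>UNIV. (c *\<^sub>R W i) \<bullet> ((\<Sum>k\<in>UNIV. adj_map (S k) (L k)) *v (c *\<^sub>R W i))) \<le> supp_fun Rs (trace_vec L)"
      by (simp only: cg)
  qed blast
  define P' where "P' i = c *\<^sub>R P (Inl i)" for i
  define W' where "W' i = c *\<^sub>R W (Inl i)" for i
  \<comment> \<open>Dropping the vectors \<open>W\<close> with index outside \<open>'m\<close> only
    lowers the left side; it leaves the coupling equation intact, since \<open>P\<close> vanishes at
    these indices.\<close>
  have W'le: "(\<Sum>i\<in>UNIV. lin_sqnorm (f l) (S l) (W' i) v) \<le> r' $ l * (\<Sum>a<f l. (v a)\<^sup>2)" for l v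
    using r'(2)[of l v] sum_nonneg[of UNIV "\<lambda>b. lin_sqnorm (f l) (S l) (c *\<^sub>R W (Inr b)) v"]
    unfolding sum_UNIV_Plus W'_def by (simp add: lin_sqnorm_nonneg)
  have CQ: "(\<chi> a b. \<Sum>i\<in>UNIV. P' i $ a * P' i $ b) \<in> Q"
  proof (rule compact_convex_mem_if_Gam[OF Q(1-3)])
    show "tr Z = Z" if "Z \<in> Q" for Z using Q(4) that by (auto simp: pos_def_def)
    show "tr (\<chi> a b. \<Sum>i\<in>UNIV. P' i $ a * P' i $ b) = (\<chi> a b. \<Sum>i\<in>UNIV. P' i $ a * P' i $ b)"
      unfolding Finite_Cartesian_Product.vec_eq_iff by (simp add: Finite_Cartesian_Product.transpose_def mult.commute)
    fix Th :: "real ^ 'm ^ 'm" assume Th: "tr Th = Th"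
    have "trace ((\<chi> a b. \<Sum>i\<in>UNIV. P' i $ a * P' i $ b) ** Th) = (\<Sum>a\<in>UNIV. \<Sum>b\<in>UNIV. (\<Sum>i\<in>UNIV. P' i $ a * P' i $ b) * Th $ b $ a)"
      by (simp add: trace_def matrix_matrix_mult_def)
    also have "\<dots> = (\<Sum>a\<in>UNIV. \<Sum>b\<in>UNIV. \<Sum>i\<in>UNIV. P' i $ b * (Th $ b $ a * P' i $ a))"
      unfolding sum_distrib_right by (intro sum.cong refl) (simp add: mult_ac)
    also have "\<dots> = (\<Sum>a\<in>UNIV. \<Sum>i\<in>UNIV. \<Sum>b\<in>UNIV. P' i $ b * (Th $ b $ a * P' i $ a))"
      by (intro sum.cong refl sum.swap)
    also have "\<dots> = (\<Sum>i\<in>UNIV. \<Sum>a\<in>UNIV. \<Sum>b\<in>UNIV. P' i $ b * (Th $ b $ a * P' i $ a))" by (rule sum.swap)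
    also have "\<dots> = (\<Sum>i\<in>UNIV. \<Sum>b\<in>UNIV. \<Sum>a\<in>UNIV. P' i $ b * (Th $ b $ a * P' i $ a))"
      by (intro sum.cong refl sum.swap)
    also have "\<dots> = (\<Sum>i\<in>UNIV. P' i \<bullet> (Th *v P' i))"
      by (simp add: inner_vec_def matrix_vector_mult_def sum_distrib_left)
    also have "\<dots> = c * (c * (\<Sum>i\<in>UNIV. P i \<bullet> (Th *v P i)))"
      unfolding P'_def sum_UNIV_Plus by (simp add: P0 matrix_vector_mult_scaleR sum_distrib_left)
    also have "\<dots> \<le> c * (c * (\<gamma> * Gam Q Th))" using P[OF Th] c0 by simp
    finally show "trace ((\<chi> a b. \<Sum>i\<in>UNIV. P' i $ a * P' i $ b) ** Th) \<le> Gam Q Th" by (simp only: cg)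
  qed
  have id: "(\<Sum>i\<in>UNIV. (M *v (c *\<^sub>R Y i)) $ b *\<^sub>R (A *v (c *\<^sub>R X i))) = (\<Sum>i\<in>UNIV. (M *v W' i) $ b *\<^sub>R P' i)" for b
  proof (unfold Finite_Cartesian_Product.vec_eq_iff, rule allI)
    fix a
    \<comment> \<open>A matrix unit: the coupling equation for all H is an equation of
      entries.\<close>
    define U :: "real ^ 'v ^ 'm" where "U = (\<chi> i j. if i = a \<and> j = b then (1::real) else 0)"
    have U: "y \<bullet> (tr U *v x) = y $ b * x $ a" for x :: "real ^ 'm" and y :: "real ^ 'v"
    proof -
      have j: "(tr U *v x) $ j = (if j = b then x $ a else 0)" for j
        by (cases "j = b") (simp_all add: U_def Finite_Cartesian_Product.transpose_def matrix_vector_mult_def if_distrib if_distribR cong: if_cong)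
      show ?thesis by (simp only: inner_vec_def j) (simp add: if_distrib cong: if_cong)
    qed
    have "(\<Sum>i\<in>UNIV. (M *v Y i) $ b * (A *v X i) $ a) = (\<Sum>i\<in>UNIV. (M *v W (Inl i)) $ b * P (Inl i) $ a)"
      using H[of U] unfolding U sum_UNIV_Plus[of "\<lambda>i. (M *v W i) $ b * P i $ a"] by (simp add: P0)
    then have "c * (c * (\<Sum>i\<in>UNIV. (M *v Y i) $ b * (A *v X i) $ a)) = c * (c * (\<Sum>i\<in>UNIV. (M *v W (Inl i)) $ b * P (Inl i) $ a))" by simp
    then show "(\<Sum>i\<in>UNIV. (M *v (c *\<^sub>R Y i)) $ b *\<^sub>R (A *v (c *\<^sub>R X i))) $ a = (\<Sum>i\<in>UNIV. (M *v W' i) $ b *\<^sub>R P' i) $ a"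
      unfolding W'_def P'_def by (simp add: matrix_vector_mult_scaleR sum_distrib_left mult_ac)
  qed
  have "Opt A B M d R T f S Rs Q = c * (c * (\<gamma> * Opt A B M d R T f S Rs Q))" by (simp only: cg)
  also have "\<dots> \<le> c * (c * (\<Sum>i\<in>UNIV. (M *v Y i) \<bullet> (B *v X i)))" using O c0 by simp
  also have "\<dots> = (\<Sum>i\<in>UNIV. (M *v (c *\<^sub>R Y i)) \<bullet> (B *v (c *\<^sub>R X i)))"
    by (simp add: matrix_vector_mult_scaleR sum_distrib_left)
  finally have "Opt A B M d R T f S Rs Q \<le> (\<Sum>i\<in>UNIV. (M *v (c *\<^sub>R Y i)) \<bullet> (B *v (c *\<^sub>R X i)))" .
  from t r r'(1) W'le CQ id this show ?thesis by (rule that)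
qed

end

section \<open>The minimax lower bound\<close>

lemma orthogonal_projection_exists:
  fixes U :: "'a::euclidean_space set"
  assumes U: "subspace U"
  obtains P :: "'a \<Rightarrow> 'a" where "linear P" "\<And>v. P v \<in> U" "\<And>v. v \<in> U \<Longrightarrow> P v = v" "\<And>v w. P v \<bullet> w = v \<bullet> P w"
proof -
  obtain B where B: "B \<subseteq> U" "pairwise real_inner_class.orthogonal B" "\<And>x. x \<in> B \<Longrightarrow> norm x = 1" "independent B" "span B = U"
    using orthonormal_basis_subspace[OF U] by metis
  have fin: "finite B" by (rule independent_imp_finite[OF B(4)])
  define P where "P v = (\<Sum>b\<in>B. (b \<bullet> v) *\<^sub>R b)" for v :: 'a
  have lin: "linear P"
    unfolding P_def by (intro linear_compose_sum ballI linearI) (simp_all add: inner_add_right scaleR_add_left)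
  have Pb: "P c = c" if c: "c \<in> B" for c
  proof -
    have "(b \<bullet> c) *\<^sub>R b = (if b = c then c else 0)" if "b \<in> B" for b
      using B(2) B(3)[OF c] that c by (auto simp: pairwise_def real_inner_class.orthogonal_def norm_eq_1)
    then have "P c = (\<Sum>b\<in>B. if b = c then c else 0)" unfolding P_def by (intro sum.cong) auto
    also have "\<dots> = c" using fin c by simp
    finally show ?thesis .
  qed
  show ?thesis
  proof (rule that[OF lin])
    show "P v \<in> U" for v unfolding P_def using B(1) by (intro subspace_sum[OF U] subspace_scale[OF U]) auto
    have "subspace {v. P v = v}"
      using lin by (auto simp: subspace_def linear_0 linear_add linear_scale)
    then have "span B \<subseteq> {v. P v = v}" using Pb by (intro span_minimal) auto
    then show "P v = v" if "v \<in> U" for v using that B(5) by auto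
    show "P v \<bullet> w = v \<bullet> P w" for v w
      unfolding P_def by (simp add: inner_sum_left inner_sum_right inner_commute mult.commute)
  qed
qed

text \<open>A maximizer of the linear functional on the orthogonal group is no worse than its products
  with reflections; this forces the bilinear form to be nonnegative.\<close>

lemma orthogonal_alignment:
  fixes a c :: "'i::finite \<Rightarrow> real ^ 'n::finite"
  obtains \<phi> :: "real ^ 'n \<Rightarrow> real ^ 'n" where "orthogonal_transformation \<phi>"
    "(\<Sum>i\<in>UNIV. a i \<bullet> c i) \<le> (\<Sum>i\<in>UNIV. \<phi> (a i) \<bullet> c i)"
    "\<And>v. 0 \<le> (\<Sum>i\<in>UNIV. (\<phi> (a i) \<bullet> v) * (c i \<bullet> v))"
proof -
  define K where "K = {Z :: real ^ 'n ^ 'n. Finite_Cartesian_Product.transpose Z ** Z = Finite_Cartesian_Product.mat 1}"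
  define h where "h Z = (\<Sum>i\<in>UNIV. (Z *v a i) \<bullet> c i)" for Z :: "real ^ 'n ^ 'n"
  have cont: "continuous_on UNIV h"
    unfolding h_def matrix_vector_mult_def inner_vec_def by (simp, intro continuous_intros)
  have "closed K"
    unfolding K_def matrix_matrix_mult_def Finite_Cartesian_Product.transpose_def Finite_Cartesian_Product.vec_eq_iff
    by (simp, intro closed_Collect_all closed_Collect_eq continuous_intros)
  moreover have "bounded K"
  proof (rule boundedI[of _ "sqrt (real CARD('n))"])
    fix Z assume Z: "Z \<in> K"
    have "Z \<bullet> Z = (\<Sum>i\<in>UNIV. \<Sum>j\<in>UNIV. Z $ i $ j * Z $ i $ j)" by (simp add: inner_vec_def)
    also have "\<dots> = (\<Sum>j\<in>UNIV. \<Sum>i\<in>UNIV. Z $ i $ j * Z $ i $ j)" by (rule sum.swap)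
    also have "\<dots> = (\<Sum>j\<in>UNIV. (Finite_Cartesian_Product.transpose Z ** Z) $ j $ j)"
      by (simp add: matrix_matrix_mult_def Finite_Cartesian_Product.transpose_def)
    also have "\<dots> = real CARD('n)" using Z unfolding K_def by (simp add: Finite_Cartesian_Product.mat_def)
    finally show "norm Z \<le> sqrt (real CARD('n))" by (simp add: norm_eq_sqrt_inner)
  qed
  ultimately have "compact K" by (simp add: compact_eq_bounded_closed)
  moreover have one: "Finite_Cartesian_Product.mat 1 \<in> K" unfolding K_def by simp
  moreover have "continuous_on K h" by (rule continuous_on_subset[OF cont subset_UNIV])
  ultimately obtain Z where Z: "Z \<in> K" and max: "\<And>Z'. Z' \<in> K \<Longrightarrow> h Z' \<le> h Z"
    using continuous_attains_sup[of K h] by auto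
  show ?thesis
  proof (rule that[of "(*v) Z"])
    show "orthogonal_transformation ((*v) Z)"
      using Z unfolding K_def by (simp add: orthogonal_transformation_matrix orthogonal_matrix)
    show "(\<Sum>i\<in>UNIV. a i \<bullet> c i) \<le> (\<Sum>i\<in>UNIV. (Z *v a i) \<bullet> c i)"
      using max[OF one] by (simp add: h_def)
    fix v :: "real ^ 'n"
    show "0 \<le> (\<Sum>i\<in>UNIV. ((Z *v a i) \<bullet> v) * (c i \<bullet> v))"
    proof (cases "v = 0")
      case False
      define \<rho> where "\<rho> x = x - (2 * (v \<bullet> x) / (v \<bullet> v)) *\<^sub>R v" for x
      have vv: "0 < v \<bullet> v" using False by simp
      have lin: "linear \<rho>"
        unfolding \<rho>_def by (intro linearI) (simp_all add: algebra_simps inner_add_right add_divide_distrib)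
      have nrm: "norm (\<rho> x) = norm x" for x
        unfolding norm_eq_sqrt_inner \<rho>_def using vv
        by (simp add: inner_diff_left inner_diff_right inner_commute field_simps)
      have \<rho>: "orthogonal_transformation \<rho>" unfolding orthogonal_transformation using lin nrm by blast
      define Z' where "Z' = matrix \<rho> ** Z"
      have Z'v: "Z' *v x = \<rho> (Z *v x)" for x
        unfolding Z'_def matrix_vector_mul_assoc[symmetric] using lin by (simp add: matrix_works)
      have "orthogonal_matrix (matrix \<rho>)" using \<rho> by (simp add: orthogonal_transformation_matrix)
      moreover have "orthogonal_matrix Z" using Z unfolding K_def by (simp add: orthogonal_matrix)
      ultimately have "Z' \<in> K" unfolding Z'_def K_def using orthogonal_matrix_mul by (simp add: orthogonal_matrix[symmetric])
      then have "h Z' \<le> h Z" by (rule max)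
      also have "h Z' = h Z - 2 / (v \<bullet> v) * (\<Sum>i\<in>UNIV. ((Z *v a i) \<bullet> v) * (c i \<bullet> v))"
        unfolding h_def Z'v \<rho>_def sum_distrib_left sum_subtractf[symmetric]
        by (intro sum.cong refl) (simp only: inner_diff_left inner_scaleR_left, simp add: inner_commute)
      finally have "0 \<le> 2 / (v \<bullet> v) * (\<Sum>i\<in>UNIV. ((Z *v a i) \<bullet> v) * (c i \<bullet> v))" by simp
      moreover have "0 < 2 / (v \<bullet> v)" using vv by simp
      ultimately show ?thesis by (simp only: zero_le_mult_iff) linarith
    qed simp
  qed
qed

lemma lin_ker_linear:
  fixes g :: "'a::euclidean_space \<Rightarrow> real ^ 'n::finite"
  assumes "linear g"
  shows "lin_ker e U (g z) = (\<lambda>i j. \<Sum>b\<in>Basis. (b \<bullet> z) * lin_ker e U (g b) i j)"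
proof (intro ext)
  fix i j
  have "g z = g (\<Sum>b\<in>Basis. (b \<bullet> z) *\<^sub>R b)" by (subst inner_commute) (simp only: euclidean_representation)
  also have "\<dots> = (\<Sum>b\<in>Basis. (b \<bullet> z) *\<^sub>R g b)" by (simp add: linear_sum[OF assms] linear_scale[OF assms])
  finally have g: "g z $ k = (\<Sum>b\<in>Basis. (b \<bullet> z) * g b $ k)" for k by (simp add: sum_component)
  show "lin_ker e U (g z) i j = (\<Sum>b\<in>Basis. (b \<bullet> z) * lin_ker e U (g b) i j)"
  proof (cases "i < e \<and> j < e")
    case True
    then have "lin_ker e U (g z) i j = (\<Sum>k\<in>UNIV. \<Sum>b\<in>Basis. (b \<bullet> z) * (g b $ k * U k $$ (i, j)))"
      unfolding lin_ker_def g by (simp add: sum_distrib_right mult.assoc)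
    also have "\<dots> = (\<Sum>b\<in>Basis. \<Sum>k\<in>UNIV. (b \<bullet> z) * (g b $ k * U k $$ (i, j)))" by (rule sum.swap)
    finally show ?thesis using True by (simp add: lin_ker_def sum_distrib_left)
  qed (auto simp: lin_ker_def)
qed

text \<open>A union bound over the blocks, each of which is a Gaussian matrix series of its own; the
  block sizes add up to the dimension under the logarithm.\<close>

lemma spectratope_gauss_tail:
  fixes g :: "'a::euclidean_space \<Rightarrow> real ^ 'n::finite" and d :: "'k::finite \<Rightarrow> nat"
  assumes sd: "spectratope_data d R T" and g: "linear g" and t: "t \<in> T"
    and var: "\<And>k v. (\<Sum>b\<in>Basis. lin_sqnorm (d k) (R k) (g b) v) \<le> t $ k * (\<Sum>a<d k. (v a)\<^sup>2)"
    and s: "0 < s"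
  obtains Z where "Z \<in> sets borel" "measure std_gauss Z \<le> 2 * real (\<Sum>k\<in>UNIV. d k) * exp (- s\<^sup>2 / 2)"
    "\<And>z. z \<notin> Z \<Longrightarrow> (1 / s) *\<^sub>R g z \<in> basic_spectratope d R T"
proof -
  interpret prob_space "std_gauss :: 'a measure" by (rule prob_space_std_gauss)
  define E where "E k = {z. \<exists>v. s\<^sup>2 * t $ k * (\<Sum>i<d k. (v i)\<^sup>2) < lin_sqnorm (d k) (R k) (g z) v}" for k
  have t0: "0 \<le> t $ k" for k
    using spectratope_dataD(3)[OF sd] t unfolding monotonic_set_def by blast
  have ks: "ker_sym {..<d k} (lin_ker (d k) (R k) x)" for k x
    by (rule lin_ker_sym[OF spectratope_dataD(2)[OF sd]])
  \<comment> \<open>In the tail bound \<open>s\<close> plays the role of the deviation and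
    \<open>t $ k\<close> that of the variance.\<close>
  have E: "E k \<in> sets borel \<and> prob (E k) \<le> 2 * real (d k) * exp (- s\<^sup>2 / 2)" for k
    using std_gauss_series_tail[OF finite_lessThan[of "d k"] ks[of k] var[of k, unfolded lin_sqnorm_def] t0[of k], of s]
    unfolding E_def lin_sqnorm_def lin_ker_linear[OF g, symmetric] by simp
  show ?thesis
  proof (rule that[of "\<Union>k. E k"])
    show "(\<Union>k. E k) \<in> sets borel" using E by auto
    have "prob (\<Union>k. E k) \<le> (\<Sum>k\<in>UNIV. prob (E k))"
      using E by (intro finite_measure_subadditive_finite) auto
    also have "\<dots> \<le> (\<Sum>k\<in>UNIV. 2 * real (d k) * exp (- s\<^sup>2 / 2))" using E by (intro sum_mono) auto
    also have "\<dots> = 2 * real (\<Sum>k\<in>UNIV. d k) * exp (- s\<^sup>2 / 2)" by (simp add: sum_distrib_right sum_distrib_left)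
    finally show "prob (\<Union>k. E k) \<le> 2 * real (\<Sum>k\<in>UNIV. d k) * exp (- s\<^sup>2 / 2)" .
    fix z assume z: "z \<notin> (\<Union>k. E k)"
    have "lin_sqnorm (d k) (R k) ((1 / s) *\<^sub>R g z) v \<le> t $ k * (\<Sum>a<d k. (v a)\<^sup>2)" for k v
    proof -
      have "lin_sqnorm (d k) (R k) (g z) v \<le> s\<^sup>2 * t $ k * (\<Sum>i<d k. (v i)\<^sup>2)"
        using z unfolding E_def by (auto simp: not_less)
      then show ?thesis using s by (simp add: lin_sqnorm_scaleR power_one_over field_simps)
    qed
    then show "(1 / s) *\<^sub>R g z \<in> basic_spectratope d R T"
      unfolding basic_spectratope_altdef[OF spectratope_dataD(2)[OF sd]] using t by blast
  qed
qed

text \<open>Reflecting in the kernel of \<open>G\<close> leaves the observation \<open>G z\<close> unchanged but moves the target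
  \<open>L z\<close>, so the losses at the two points add up to at least the size of the displacement.\<close>

lemma bayes_truncated_loss_bound:
  fixes G :: "real ^ 'e::finite \<Rightarrow> real ^ 'm::finite" and l \<kappa> :: "'v::finite \<Rightarrow> real ^ 'e"
    and N :: "real ^ 'v \<Rightarrow> real" and xhat :: "real ^ 'm \<Rightarrow> real ^ 'v"
  assumes N: "is_norm N" and G: "linear G" and xhat[measurable]: "xhat \<in> borel_measurable borel"
    and ker: "\<And>b. G (\<kappa> b) = 0" and \<tau>: "0 < \<tau>" "\<tau> \<le> (\<Sum>b\<in>UNIV. \<kappa> b \<bullet> l b)"
    and c: "0 < c" and Z[measurable]: "Z \<in> sets borel" and p: "measure std_gauss Z \<le> p" "p \<le> 3/16"
    and bnd: "\<And>z u. z \<notin> Z \<Longrightarrow> (\<Sum>b\<in>UNIV. (\<kappa> b \<bullet> z) * u $ b) \<le> c * N u"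
  defines "\<delta> \<equiv> \<tau> / (2 * c)"
  shows "ennreal (\<delta> / 2 * (3/16 - p)) \<le> (\<integral>\<^sup>+z. min (ennreal (N ((\<chi> b. l b \<bullet> z) - xhat (G z)))) (ennreal \<delta>) \<partial>std_gauss)"
proof -
  interpret prob_space "std_gauss :: (real ^ 'e) measure" by (rule prob_space_std_gauss)
  have U: "subspace {z. G z = 0}" using G by (auto simp: subspace_def linear_0 linear_add linear_scale)
  obtain P :: "real ^ 'e \<Rightarrow> real ^ 'e" where P: "linear P" "\<And>v. G (P v) = 0" "\<And>v. G v = 0 \<Longrightarrow> P v = v" "\<And>v w. P v \<bullet> w = v \<bullet> P w"
  proof (rule orthogonal_projection_exists[OF U])
    fix P :: "real ^ 'e \<Rightarrow> real ^ 'e"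
    assume h: "linear P" "\<And>v. P v \<in> {z. G z = 0}" "\<And>v. v \<in> {z. G z = 0} \<Longrightarrow> P v = v" "\<And>v w. P v \<bullet> w = v \<bullet> P w"
    show thesis using h(2,3) by (intro that[OF h(1) _ _ h(4)]) simp_all
  qed
  define \<sigma> where "\<sigma> z = z - 2 *\<^sub>R P z" for z
  have \<sigma>: "orthogonal_transformation \<sigma>"
    unfolding orthogonal_transformation
  proof (intro conjI allI)
    show "linear \<sigma>" unfolding \<sigma>_def
      by (intro linear_compose_sub linear_compose_scale_right linear_ident P(1))
    have PP: "P v \<bullet> P v = v \<bullet> P v" for v using P(4)[of v "P v"] P(3)[OF P(2)] by simp
    show "norm (\<sigma> v) = norm v" for v
      unfolding norm_eq_sqrt_inner \<sigma>_def by (simp add: inner_diff_left inner_diff_right PP inner_commute)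
  qed
  have G\<sigma>: "G (\<sigma> z) = G z" for z
    unfolding \<sigma>_def by (simp add: linear_diff[OF G] linear_scale[OF G] P(2))
  \<comment> \<open>Rotating the forms \<kappa> does not lower the mean and makes the bilinear form
    nonnegative, as the lower tail estimate requires.\<close>
  obtain \<phi> :: "real ^ 'e \<Rightarrow> real ^ 'e" where \<phi>: "orthogonal_transformation \<phi>"
    and \<phi>v: "(\<Sum>i\<in>UNIV. \<kappa> i \<bullet> P (l i)) \<le> (\<Sum>i\<in>UNIV. \<phi> (\<kappa> i) \<bullet> P (l i))"
    and \<phi>pos: "\<And>v. 0 \<le> (\<Sum>i\<in>UNIV. (\<phi> (\<kappa> i) \<bullet> v) * (P (l i) \<bullet> v))"
    by (rule orthogonal_alignment[of \<kappa> "\<lambda>i. P (l i)"]) blast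
  define \<psi> where "\<psi> = inv_into UNIV \<phi>"
  have \<psi>: "orthogonal_transformation \<psi>" unfolding \<psi>_def by (rule orthogonal_transformation_inv[OF \<phi>])
  have \<phi>\<psi>: "\<phi> (\<psi> z) = z" for z unfolding \<psi>_def by (rule surj_f_inv_f[OF orthogonal_transformation_surj[OF \<phi>]])
  have \<phi>i: "\<phi> x \<bullet> z = x \<bullet> \<psi> z" for x z
  proof -
    have "\<phi> x \<bullet> \<phi> (\<psi> z) = x \<bullet> \<psi> z" using \<phi> unfolding orthogonal_transformation_def by blast
    then show ?thesis unfolding \<phi>\<psi> .
  qed
  define \<tau>' where "\<tau>' = (\<Sum>i\<in>UNIV. \<phi> (\<kappa> i) \<bullet> P (l i))"
  \<comment> \<open>The vectors \<kappa> lie in the kernel of \<open>G\<close>, so projecting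
    \<open>l\<close> onto this kernel does not change the mean.\<close>
  have "\<tau> \<le> \<tau>'" using \<phi>v \<tau>(2) P(3)[OF ker] unfolding \<tau>'_def P(4)[symmetric] by simp
  define W where "W = {v. \<tau>' / 4 \<le> (\<Sum>i\<in>UNIV. (\<phi> (\<kappa> i) \<bullet> v) * (P (l i) \<bullet> v))}"
  have W: "3/16 \<le> prob W"
    unfolding W_def \<tau>'_def by (rule std_gauss_psd_form_lower_tail[OF _ \<phi>pos]) (use \<open>\<tau> \<le> \<tau>'\<close> \<tau>(1) in \<open>simp_all add: \<tau>'_def\<close>)
  have "closed W" unfolding W_def by (intro closed_Collect_le continuous_intros)
  then have Wm[measurable]: "W \<in> sets borel" by (rule borel_closed)
  have [measurable]: "\<psi> \<in> borel_measurable borel" "\<sigma> \<in> borel_measurable borel" "G \<in> borel_measurable borel"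
    using \<psi> \<sigma> G by (auto intro!: borel_measurable_continuous_onI linear_continuous_on linear_linear[THEN iffD2] simp: orthogonal_transformation linear_conv_bounded_linear[symmetric])
  \<comment> \<open>The exceptional event for the rotated point \<psi> z, at which the forms
    \<kappa> are evaluated; rotation invariance preserves its probability.\<close>
  define Z' where "Z' = \<psi> -` Z"
  have Z'm[measurable]: "Z' \<in> sets borel" unfolding Z'_def using measurable_sets[of \<psi> borel borel Z] by simp
  have "emeasure std_gauss Z' = (\<integral>\<^sup>+z. indicator Z' z \<partial>std_gauss)" by simp
  also have "\<dots> = (\<integral>\<^sup>+z. indicator Z (\<psi> z) \<partial>std_gauss)" by (simp add: Z'_def indicator_def)
  also have "\<dots> = (\<integral>\<^sup>+z. indicator Z z \<partial>std_gauss)" by (rule nn_integral_std_gauss_orthogonal[OF \<psi>]) measurable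
  also have "\<dots> = emeasure std_gauss Z" by simp
  finally have "emeasure std_gauss Z' = emeasure std_gauss Z" .
  then have Z': "prob Z' \<le> p" using p(1) by (simp add: measure_def)
  define loss where "loss z = N ((\<chi> b. l b \<bullet> z) - xhat (G z))" for z
  have Nm[measurable]: "N \<in> borel_measurable borel"
    by (intro borel_measurable_continuous_onI is_norm_continuous[OF N])
  have lossm[measurable]: "loss \<in> borel_measurable borel"
  proof -
    have [measurable]: "(\<lambda>z. \<chi> b. l b \<bullet> z) \<in> borel_measurable borel"
      by (intro borel_measurable_continuous_onI continuous_intros)
    show ?thesis unfolding loss_def by measurable
  qed
  have \<delta>0: "0 < \<delta>" using \<tau> c by (simp add: \<delta>_def)
  have good: "\<delta> \<le> loss z + loss (\<sigma> z)" if z: "z \<in> W - Z'" for z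
  proof -
    \<comment> \<open>Half of the displacement of the target under the reflection. It is evaluated
      at \<open>z\<close>, while \<open>bnd\<close> is used at the rotated point \<psi> z.\<close>
    define e where "e = (\<chi> b. l b \<bullet> P z)"
    have "\<tau> / 4 \<le> \<tau>' / 4" using \<open>\<tau> \<le> \<tau>'\<close> by simp
    also have "\<dots> \<le> (\<Sum>i\<in>UNIV. (\<phi> (\<kappa> i) \<bullet> z) * (P (l i) \<bullet> z))" using z unfolding W_def by simp
    also have "\<dots> = (\<Sum>i\<in>UNIV. (\<kappa> i \<bullet> \<psi> z) * e $ i)" by (simp add: \<phi>i P(4) e_def)
    also have "\<dots> \<le> c * N e" using z by (intro bnd) (simp add: Z'_def)
    finally have "\<delta> \<le> 2 * N e" using c by (simp add: \<delta>_def field_simps)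
    also have "2 * N e = N (2 *\<^sub>R e)" by (simp add: is_normD[OF N])
    also have "2 *\<^sub>R e = ((\<chi> b. l b \<bullet> z) - xhat (G z)) + - ((\<chi> b. l b \<bullet> \<sigma> z) - xhat (G (\<sigma> z)))"
      unfolding G\<sigma> by (simp add: Finite_Cartesian_Product.vec_eq_iff e_def \<sigma>_def inner_diff_right)
    also have "N \<dots> \<le> N ((\<chi> b. l b \<bullet> z) - xhat (G z)) + N (- ((\<chi> b. l b \<bullet> \<sigma> z) - xhat (G (\<sigma> z))))"
      by (rule is_normD[OF N])
    also have "\<dots> = loss z + loss (\<sigma> z)" by (simp only: is_norm_minus[OF N] loss_def)
    finally show ?thesis .
  qed
  define I where "I = (\<integral>\<^sup>+z. min (ennreal (loss z)) (ennreal \<delta>) \<partial>std_gauss)"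
  have l0: "0 \<le> loss z" for z unfolding loss_def by (rule is_normD[OF N])
  have "ennreal \<delta> * ennreal (prob (W - Z')) = (\<integral>\<^sup>+z. ennreal \<delta> * indicator (W - Z') z \<partial>std_gauss)"
    by (subst nn_integral_cmult_indicator) (simp_all add: emeasure_eq_measure)
  also have "\<dots> \<le> (\<integral>\<^sup>+z. min (ennreal (loss z)) (ennreal \<delta>) + min (ennreal (loss (\<sigma> z))) (ennreal \<delta>) \<partial>std_gauss)"
  proof (intro nn_integral_mono)
    fix z
    \<comment> \<open>Two nonnegative losses with sum at least \<delta> still have sum at least
      \<delta> after truncation of each at \<delta>.\<close>
    have "ennreal \<delta> \<le> ennreal (min (loss z) \<delta> + min (loss (\<sigma> z)) \<delta>)" if "z \<in> W - Z'"
      using good[OF that] l0[of z] l0[of "\<sigma> z"] \<delta>0 by (intro ennreal_leI) linarith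
    then show "ennreal \<delta> * indicator (W - Z') z \<le> min (ennreal (loss z)) (ennreal \<delta>) + min (ennreal (loss (\<sigma> z))) (ennreal \<delta>)"
      using l0[of z] l0[of "\<sigma> z"] \<delta>0 by (auto simp: indicator_def min_ennreal ennreal_plus)
  qed
  also have "\<dots> = I + (\<integral>\<^sup>+z. min (ennreal (loss (\<sigma> z))) (ennreal \<delta>) \<partial>std_gauss)"
    unfolding I_def by (intro nn_integral_add) measurable
  \<comment> \<open>The reflection preserves the Gaussian measure, so both losses have the same
    integral, and half of the bound is left for one.\<close>
  also have "(\<integral>\<^sup>+z. min (ennreal (loss (\<sigma> z))) (ennreal \<delta>) \<partial>std_gauss) = I"
    unfolding I_def by (rule nn_integral_std_gauss_orthogonal[OF \<sigma>]) measurable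
  finally have 1: "ennreal \<delta> * ennreal (prob (W - Z')) \<le> I + I" .
  have "3/16 - p \<le> prob W - prob Z'" using W Z' by simp
  also have "\<dots> \<le> prob (W - Z')"
  proof -
    have "prob W \<le> prob ((W - Z') \<union> Z')" by (intro finite_measure_mono) auto
    also have "\<dots> \<le> prob (W - Z') + prob Z'" by (intro measure_Un_le) auto
    finally show ?thesis by simp
  qed
  finally have "ennreal (\<delta> * (3/16 - p)) \<le> ennreal (\<delta> * prob (W - Z'))" using \<delta>0 by (intro ennreal_leI) simp
  also have "\<dots> \<le> I + I" using 1 \<delta>0 by (simp add: ennreal_mult)
  finally have "ennreal (\<delta> * (3/16 - p)) \<le> 2 * I" by (simp add: mult_2)
  then have "ennreal (1/2) * ennreal (\<delta> * (3/16 - p)) \<le> ennreal (1/2) * (2 * I)" by (intro mult_left_mono) auto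
  also have "ennreal (1/2) * (2 * I) = I"
  proof -
    have "ennreal (1/2) * 2 = 1" using ennreal_mult'[of "1/2" 2] by simp
    then show ?thesis by (simp add: mult.assoc[symmetric])
  qed
  also have "ennreal (1/2) * ennreal (\<delta> * (3/16 - p)) = ennreal (\<delta> / 2 * (3/16 - p))"
    by (subst ennreal_mult'[symmetric]) simp_all
  finally show ?thesis unfolding I_def loss_def .
qed

lemma sum_Basis_vec: "(\<Sum>b\<in>(Basis :: (real ^ 'n) set). g b) = (\<Sum>i\<in>UNIV. g (axis i 1))"
proof -
  have 1: "(Basis :: (real ^ 'n) set) = (\<lambda>i. axis i 1) ` UNIV" by (auto simp: Basis_vec_def)
  have 2: "inj (\<lambda>i. axis i (1::real) :: real ^ 'n)" by (auto simp: inj_on_def axis_eq_axis)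
  show ?thesis unfolding 1 sum.reindex[OF 2] o_def ..
qed

lemma inner_vec_join: "vec_join z \<bullet> w = (\<Sum>i\<in>UNIV. fst z $ i * w $ Inl i) + (\<Sum>i\<in>UNIV. snd z $ i * w $ Inr i)"
  by (simp add: inner_vec_def sum_UNIV_Plus)

lemma invertible_if_pos_def_gram:
  fixes J :: "real ^ 'm ^ 'm"
  assumes "pos_def (J ** Finite_Cartesian_Product.transpose J)"
  shows "invertible J"
proof -
  let ?T = "Finite_Cartesian_Product.transpose J"
  have "x = 0" if "?T *v x = 0" for x
  proof (rule ccontr)
    assume "x \<noteq> 0"
    then have "0 < x \<bullet> ((J ** ?T) *v x)" using assms by (simp add: pos_def_def)
    also have "(J ** ?T) *v x = 0" unfolding matrix_vector_mul_assoc[symmetric] that by simp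
    finally show False by simp
  qed
  then obtain K where "K ** ?T = Finite_Cartesian_Product.mat 1" using matrix_left_invertible_ker[of ?T] by blast
  from arg_cong[OF this, of Finite_Cartesian_Product.transpose]
  have "J ** Finite_Cartesian_Product.transpose K = Finite_Cartesian_Product.mat 1" by (simp add: matrix_transpose_mul)
  then show ?thesis using invertible_right_inverse by blast
qed

section \<open>The Gaussian prior and the constants\<close>

context
  fixes A :: "real ^ 'n::finite ^ 'm::finite" and B :: "real ^ 'n ^ 'v::finite"
    and M :: "real ^ 'q::finite ^ 'v"
    and d :: "'k::finite \<Rightarrow> nat" and R :: "'k \<Rightarrow> 'n \<Rightarrow> real mat" and T :: "(real ^ 'k) set"
    and f :: "'l::finite \<Rightarrow> nat" and S :: "'l \<Rightarrow> 'q \<Rightarrow> real mat" and Rs :: "(real ^ 'l) set"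
    and N :: "real ^ 'v \<Rightarrow> real" and Q :: "(real ^ 'm ^ 'm) set"
  assumes sdR: "spectratope_data d R T" and N: "is_norm N" and sdS: "spectratope_data f S Rs"
    and ball: "{z. conj_norm N z \<le> 1} = (\<lambda>y. M *v y) ` basic_spectratope f S Rs"
    and Q: "Q \<noteq> {}" "convex Q" "compact Q" "\<forall>C \<in> Q. pos_def C"
begin

text \<open>The Bayes bound for the truncated loss is transferred to the worst signal. A Gaussian
  signal outside the spectratope cannot be compared with the risk, but the truncation limits its
  cost to \<delta>/128.\<close>

lemma gaussian_risk_lower_bound:
  fixes X :: "'i::finite \<Rightarrow> real ^ 'n" and Y :: "'i \<Rightarrow> real ^ 'q" and P :: "'m \<Rightarrow> real ^ 'm" and W :: "'m \<Rightarrow> real ^ 'q"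
  assumes t: "t \<in> T" "\<And>k v. (\<Sum>i\<in>UNIV. lin_sqnorm (d k) (R k) (X i) v) \<le> t $ k * (\<Sum>a<d k. (v a)\<^sup>2)"
    and r: "r \<in> Rs" "\<And>l v. (\<Sum>i\<in>UNIV. lin_sqnorm (f l) (S l) (Y i) v) \<le> r $ l * (\<Sum>a<f l. (v a)\<^sup>2)"
    and r': "r' \<in> Rs" "\<And>l v. (\<Sum>i\<in>UNIV. lin_sqnorm (f l) (S l) (W i) v) \<le> r' $ l * (\<Sum>a<f l. (v a)\<^sup>2)"
    and C: "pos_def (\<chi> a b. \<Sum>i\<in>UNIV. P i $ a * P i $ b)"
    and obs: "\<And>b. (\<Sum>i\<in>UNIV. (M *v Y i) $ b *\<^sub>R (A *v X i)) = (\<Sum>i\<in>UNIV. (M *v W i) $ b *\<^sub>R P i)"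
    and opt: "0 < opt" "opt \<le> (\<Sum>i\<in>UNIV. (M *v Y i) \<bullet> (B *v X i))"
    and xhat[measurable]: "xhat \<in> borel_measurable borel"
    and s: "1 \<le> \<alpha>" "0 < s"
    and pX: "2 * real (\<Sum>k\<in>UNIV. d k) * exp (- \<alpha>\<^sup>2 / 2) \<le> 1/128"
    and pY: "2 * real (\<Sum>l\<in>UNIV. f l) * exp (- s\<^sup>2 / 2) \<le> 1/128"
  shows "ennreal (opt / (2 * sqrt 2 * \<alpha> * s) * (21/256))
    \<le> (SUP x \<in> basic_spectratope d R T. \<integral>\<^sup>+\<xi>. ennreal (N (B *v x - xhat (A *v x + \<xi>))) \<partial>gaussian (\<chi> a b. \<Sum>i\<in>UNIV. P i $ a * P i $ b))"
    (is "_ \<le> ?risk")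
proof -
  define J where "J = (\<chi> a i. P i $ a)"
  have CJ: "(\<chi> a b. \<Sum>i\<in>UNIV. P i $ a * P i $ b) = J ** Finite_Cartesian_Product.transpose J"
    unfolding Finite_Cartesian_Product.vec_eq_iff
    by (simp add: J_def matrix_matrix_mult_def Finite_Cartesian_Product.transpose_def)
  have Ji: "invertible J" using C unfolding CJ by (rule invertible_if_pos_def_gram)
  have Jv: "J *v y = (\<Sum>i\<in>UNIV. y $ i *\<^sub>R P i)" for y
    unfolding Finite_Cartesian_Product.vec_eq_iff by (simp add: J_def matrix_vector_mult_def mult.commute)
  define gx where "gx z = (\<Sum>i\<in>UNIV. z $ i *\<^sub>R X i)" for z :: "real ^ 'i"
  \<comment> \<open>The factor \<open>1 / sqrt 2\<close> turns the sum of the variances of the two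
    families into an average, which stays in the convex set \<open>Rs\<close>. The further
    \<open>1 / \<alpha>\<close> for \<open>W\<close> does no harm since 1 \<le> \<alpha>.\<close>
  define gy where "gy z = (\<Sum>i\<in>UNIV. z $ Inl i *\<^sub>R ((1 / sqrt 2) *\<^sub>R Y i)) + (\<Sum>i\<in>UNIV. z $ Inr i *\<^sub>R ((- 1 / (sqrt 2 * \<alpha>)) *\<^sub>R W i))"
    for z :: "real ^ ('i + 'm)"
  have lin_nth: "linear (\<lambda>z :: real ^ 'a. z $ j *\<^sub>R w)" for j :: "'a::finite" and w :: "'b::real_vector"
    by (intro linearI) (simp_all add: scaleR_add_left)
  have lin_gx: "linear gx" unfolding gx_def by (intro linear_compose_sum ballI lin_nth)
  have lin_gy: "linear gy" unfolding gy_def by (intro linear_compose_add linear_compose_sum ballI lin_nth)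
  obtain Z1 :: "(real ^ 'i) set" where Z1[measurable]: "Z1 \<in> sets borel"
    and Z1p: "measure std_gauss Z1 \<le> 2 * real (\<Sum>k\<in>UNIV. d k) * exp (- \<alpha>\<^sup>2 / 2)"
    and Z1i: "\<And>z. z \<notin> Z1 \<Longrightarrow> (1 / \<alpha>) *\<^sub>R gx z \<in> basic_spectratope d R T"
  proof (rule spectratope_gauss_tail[OF sdR lin_gx t(1), of \<alpha>])
    have "gx (axis i 1) = X i" for i unfolding gx_def axis_def by (simp add: if_distrib if_distribR cong: if_cong)
    then show "(\<Sum>b\<in>Basis. lin_sqnorm (d k) (R k) (gx b) v) \<le> t $ k * (\<Sum>a<d k. (v a)\<^sup>2)" for k v
      using t(2) by (simp add: sum_Basis_vec)
    show "0 < \<alpha>" using s by simp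
  qed blast
  define rm where "rm = (1/2) *\<^sub>R r + (1/2) *\<^sub>R r'"
  have "convex Rs" using spectratope_dataD(3)[OF sdS] unfolding monotonic_set_def by (rule conjunct1)
  then have rm: "rm \<in> Rs" unfolding rm_def by (rule convexD[OF _ r(1) r'(1)]) simp_all
  obtain Z2 :: "(real ^ ('i + 'm)) set" where Z2: "Z2 \<in> sets borel"
    and Z2p: "measure std_gauss Z2 \<le> 2 * real (\<Sum>l\<in>UNIV. f l) * exp (- s\<^sup>2 / 2)"
    and Z2i: "\<And>z. z \<notin> Z2 \<Longrightarrow> (1 / s) *\<^sub>R gy z \<in> basic_spectratope f S Rs"
  proof (rule spectratope_gauss_tail[OF sdS lin_gy rm _ s(2)])
    fix l :: 'l and v :: "nat \<Rightarrow> real"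
    have gl: "gy (axis (Inl i) 1) = (1 / sqrt 2) *\<^sub>R Y i" for i
      unfolding gy_def axis_def by (simp add: if_distrib if_distribR cong: if_cong)
    have gr: "gy (axis (Inr i) 1) = (- 1 / (sqrt 2 * \<alpha>)) *\<^sub>R W i" for i
      unfolding gy_def axis_def by (simp add: if_distrib if_distribR cong: if_cong)
    have e: "(- 1 / (sqrt 2 * \<alpha>))\<^sup>2 \<le> 1/2"
      using s(1) one_le_power[OF s(1), of 2] by (simp add: power_divide power_mult_distrib field_simps)
    have "(\<Sum>b\<in>Basis. lin_sqnorm (f l) (S l) (gy b) v)
      = (\<Sum>i\<in>UNIV. (1 / sqrt 2)\<^sup>2 * lin_sqnorm (f l) (S l) (Y i) v) + (\<Sum>i\<in>UNIV. (- 1 / (sqrt 2 * \<alpha>))\<^sup>2 * lin_sqnorm (f l) (S l) (W i) v)"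
      by (simp only: sum_Basis_vec sum_UNIV_Plus gl gr lin_sqnorm_scaleR)
    also have "\<dots> \<le> (\<Sum>i\<in>UNIV. (1/2) * lin_sqnorm (f l) (S l) (Y i) v) + (\<Sum>i\<in>UNIV. (1/2) * lin_sqnorm (f l) (S l) (W i) v)"
      by (intro add_mono sum_mono mult_right_mono e lin_sqnorm_nonneg) (simp add: power_divide)
    also have "\<dots> \<le> (1/2) * (r $ l * (\<Sum>a<f l. (v a)\<^sup>2)) + (1/2) * (r' $ l * (\<Sum>a<f l. (v a)\<^sup>2))"
      unfolding sum_distrib_left[symmetric] by (intro add_mono mult_left_mono r(2) r'(2)) simp_all
    also have "\<dots> = rm $ l * (\<Sum>a<f l. (v a)\<^sup>2)" by (simp add: rm_def algebra_simps)
    finally show "(\<Sum>b\<in>Basis. lin_sqnorm (f l) (S l) (gy b) v) \<le> rm $ l * (\<Sum>a<f l. (v a)\<^sup>2)" .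
  qed blast
  define xs where "xs z = (1 / \<alpha>) *\<^sub>R gx z" for z
  have lin_xs: "linear xs" unfolding xs_def by (intro linear_compose_scale_right lin_gx)
  define p1 where "p1 z = (\<chi> i. z $ Inl i)" for z :: "real ^ ('i + 'm)"
  define p2 where "p2 z = (\<chi> i. z $ Inr i)" for z :: "real ^ ('i + 'm)"
  define G where "G z = A *v xs (p1 z) + J *v p2 z" for z
  have lin_p: "linear p1" "linear p2"
    unfolding p1_def p2_def by (intro linearI; simp add: Finite_Cartesian_Product.vec_eq_iff)+
  have lin_G: "linear G"
    unfolding G_def using linear_compose[OF linear_compose[OF lin_p(1) lin_xs] matrix_vector_mul_linear[of A]]
      linear_compose[OF lin_p(2) matrix_vector_mul_linear[of J]] by (intro linear_compose_add) (simp_all add: o_def)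
  \<comment> \<open>The coordinates of the target as linear forms in the joint Gaussian vector; the
    noise coordinates do not enter.\<close>
  define l where "l b = vec_join (\<chi> i. (1 / \<alpha>) * (B *v X i) $ b, 0 :: real ^ 'm)" for b
  \<comment> \<open>The signal is scaled by \<open>1 / \<alpha>\<close> but the noise is not.
    Scaling \<open>W\<close> by \<open>1 / \<alpha>\<close> compensates for this, so that
    \<open>obs\<close> puts these vectors into the kernel of \<open>G\<close>.\<close>
  define \<kappa> where "\<kappa> b = vec_join (\<chi> i. (M *v Y i) $ b, \<chi> i. - (1 / \<alpha>) * (M *v W i) $ b)" for b
  have Bx: "(\<chi> b. l b \<bullet> z) = B *v xs (p1 z)" for z
    unfolding Finite_Cartesian_Product.vec_eq_iff l_def inner_vec_join xs_def gx_def p1_def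
    by (simp add: matrix_vector_mult_scaleR sum_matrix_vector_mult linear_sum[OF matrix_vector_mul_linear] sum_distrib_left mult_ac)
  have G\<kappa>: "G (\<kappa> b) = 0" for b
  proof -
    have "A *v xs (p1 (\<kappa> b)) = (1 / \<alpha>) *\<^sub>R (\<Sum>i\<in>UNIV. (M *v Y i) $ b *\<^sub>R (A *v X i))"
      unfolding xs_def gx_def p1_def \<kappa>_def
      by (simp add: matrix_vector_mult_scaleR linear_sum[OF matrix_vector_mul_linear])
    moreover have "J *v p2 (\<kappa> b) = - ((1 / \<alpha>) *\<^sub>R (\<Sum>i\<in>UNIV. (M *v W i) $ b *\<^sub>R P i))"
      unfolding Jv p2_def \<kappa>_def by (simp add: scaleR_sum_right sum_negf)
    ultimately show ?thesis unfolding G_def obs by simp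
  qed
  define \<tau> where "\<tau> = opt / \<alpha>"
  have \<alpha>0: "0 < \<alpha>" using s by simp
  have \<tau>0: "0 < \<tau>" using opt(1) \<alpha>0 by (simp add: \<tau>_def)
  have \<tau>le: "\<tau> \<le> (\<Sum>b\<in>UNIV. \<kappa> b \<bullet> l b)"
  proof -
    have "(\<Sum>b\<in>UNIV. \<kappa> b \<bullet> l b) = (\<Sum>b\<in>UNIV. \<Sum>i\<in>UNIV. (1 / \<alpha>) * ((M *v Y i) $ b * (B *v X i) $ b))"
      unfolding \<kappa>_def inner_vec_join by (simp add: l_def mult_ac)
    also have "\<dots> = (\<Sum>i\<in>UNIV. \<Sum>b\<in>UNIV. (1 / \<alpha>) * ((M *v Y i) $ b * (B *v X i) $ b))" by (rule sum.swap)
    also have "\<dots> = (1 / \<alpha>) * (\<Sum>i\<in>UNIV. (M *v Y i) \<bullet> (B *v X i))"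
      by (simp add: inner_vec_def sum_distrib_left)
    also have "\<dots> \<ge> (1 / \<alpha>) * opt" using opt(2) \<alpha>0 by (intro mult_left_mono) simp_all
    finally show ?thesis by (simp add: \<tau>_def)
  qed
  \<comment> \<open>The factor \<open>sqrt 2\<close> undoes the normalization of
    \<open>gy\<close>.\<close>
  define c where "c = sqrt 2 * s"
  have c0: "0 < c" using s(2) by (simp add: c_def)
  have bnd: "(\<Sum>b\<in>UNIV. (\<kappa> b \<bullet> z) * u $ b) \<le> c * N u" if z: "z \<notin> Z2" for z u
  proof -
    have "\<kappa> b \<bullet> z = (sqrt 2 *\<^sub>R (M *v gy z)) $ b" for b
      unfolding \<kappa>_def inner_vec_join gy_def
      by (simp add: matrix_vector_right_distrib linear_sum[OF matrix_vector_mul_linear] matrix_vector_mult_scaleR matrix_vector_mult_minus distrib_left sum_distrib_left field_simps)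
    then have "(\<Sum>b\<in>UNIV. (\<kappa> b \<bullet> z) * u $ b) = (sqrt 2 *\<^sub>R (M *v gy z)) \<bullet> u" by (simp add: inner_vec_def)
    also have "\<dots> = c * ((M *v ((1 / s) *\<^sub>R gy z)) \<bullet> u)" using s(2) by (simp add: c_def matrix_vector_mult_scaleR)
    also have "\<dots> \<le> c * N u" using c0 by (intro mult_left_mono spectratope_inner_le[OF sdR N sdS ball Q(1,3,4) Z2i[OF z]]) simp
    finally show ?thesis .
  qed
  define \<delta> where "\<delta> = \<tau> / (2 * c)"
  have \<delta>0: "0 < \<delta>" using \<tau>0 c0 by (simp add: \<delta>_def)
  have Nm[measurable]: "N \<in> borel_measurable borel"
    by (intro borel_measurable_continuous_onI is_norm_continuous[OF N])
  have [measurable]: "xs \<in> borel_measurable borel" "p1 \<in> borel_measurable borel" "p2 \<in> borel_measurable borel" "G \<in> borel_measurable borel"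
    using lin_xs lin_p lin_G
    by (auto intro!: borel_measurable_continuous_onI linear_continuous_on simp: linear_conv_bounded_linear[symmetric])
  have mv[measurable]: "(\<lambda>x. D *v x) \<in> borel_measurable borel" for D :: "real ^ 'b::finite ^ 'c::finite"
    by (intro borel_measurable_continuous_onI matrix_vector_mult_linear_continuous_on)
  let ?min = "\<lambda>x \<xi>. min (ennreal (N (B *v x - xhat (A *v x + \<xi>)))) (ennreal \<delta>)"
  have lower: "ennreal (\<delta> / 2 * (3/16 - 1/128)) \<le> (\<integral>\<^sup>+z. ?min (xs (p1 z)) (J *v p2 z) \<partial>std_gauss)"
    using bayes_truncated_loss_bound[OF N lin_G xhat G\<kappa> \<tau>0 \<tau>le c0 Z2 order_trans[OF Z2p pY] _ bnd]
    unfolding \<delta>_def Bx G_def by simp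
  have inner: "(\<integral>\<^sup>+y. ?min x (J *v y) \<partial>std_gauss) \<le> ?risk" if x: "x \<in> basic_spectratope d R T" for x
  proof -
    have "(\<integral>\<^sup>+y. ?min x (J *v y) \<partial>std_gauss) \<le> (\<integral>\<^sup>+y. ennreal (N (B *v x - xhat (A *v x + J *v y))) \<partial>std_gauss)"
      by (intro nn_integral_mono) simp
    also have "\<dots> = (\<integral>\<^sup>+\<xi>. ennreal (N (B *v x - xhat (A *v x + \<xi>))) \<partial>gaussian (J ** Finite_Cartesian_Product.transpose J))"
      by (rule nn_integral_gaussian[OF Ji, symmetric]) measurable
    also have "\<dots> \<le> ?risk" unfolding CJ by (rule SUP_upper[OF x])
    finally show ?thesis .
  qed
  interpret G1: prob_space "std_gauss :: (real ^ 'i) measure" by (rule prob_space_std_gauss)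
  interpret G2: prob_space "std_gauss :: (real ^ 'm) measure" by (rule prob_space_std_gauss)
  have "(\<integral>\<^sup>+z. ?min (xs (p1 z)) (J *v p2 z) \<partial>std_gauss) = (\<integral>\<^sup>+x. \<integral>\<^sup>+y. ?min (xs x) (J *v y) \<partial>std_gauss \<partial>std_gauss)"
    by (subst nn_integral_std_gauss_split) (measurable, simp add: p1_def p2_def)
  also have "\<dots> \<le> (\<integral>\<^sup>+x. ?risk + ennreal \<delta> * indicator Z1 x \<partial>std_gauss)"
  proof (intro nn_integral_mono)
    fix x :: "real ^ 'i"
    show "(\<integral>\<^sup>+y. ?min (xs x) (J *v y) \<partial>std_gauss) \<le> ?risk + ennreal \<delta> * indicator Z1 x"
    proof (cases "x \<in> Z1")
      case True
      \<comment> \<open>Here the signal may be outside the spectratope, and only the truncation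
        bounds the inner integral.\<close>
      have "(\<integral>\<^sup>+y. ?min (xs x) (J *v y) \<partial>std_gauss) \<le> (\<integral>\<^sup>+y. ennreal \<delta> \<partial>(std_gauss :: (real ^ 'm) measure))"
        by (intro nn_integral_mono) simp
      also have "\<dots> = ennreal \<delta>" using G2.emeasure_space_1 by simp
      also have "\<dots> \<le> ?risk + ennreal \<delta>" by (rule add_increasing) simp_all
      finally show ?thesis using True by simp
    next
      case False
      then show ?thesis using inner[of "xs x"] Z1i[OF False] by (simp add: xs_def)
    qed
  qed
  also have "\<dots> = ?risk + ennreal \<delta> * emeasure std_gauss Z1"
    using G1.emeasure_space_1 by (subst nn_integral_add) (simp_all add: nn_integral_cmult_indicator)
  also have "\<dots> \<le> ?risk + ennreal \<delta> * ennreal (1/128)"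
    unfolding G1.emeasure_eq_measure using order_trans[OF Z1p pX] by (intro add_left_mono mult_left_mono ennreal_leI) simp_all
  also have "ennreal \<delta> * ennreal (1/128) = ennreal (\<delta> / 128)" using \<delta>0 by (subst ennreal_mult'[symmetric]) simp_all
  finally have "ennreal (\<delta> / 2 * (3/16 - 1/128)) \<le> ?risk + ennreal (\<delta> / 128)" using lower by (rule order_trans[rotated])
  \<comment> \<open>Half of 3/16 - 1/128 is 23/256, and the exceptional signals take away
    2/256.\<close>
  then have "ennreal (\<delta> * (21/256)) \<le> ?risk"
  proof (cases "?risk" rule: ennreal_cases)
    case (real a)
    then show ?thesis using \<open>ennreal (\<delta> / 2 * (3/16 - 1/128)) \<le> ?risk + ennreal (\<delta> / 128)\<close> \<delta>0
      by (simp add: ennreal_plus[symmetric] ennreal_le_iff del: ennreal_plus)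
  next
    case top
    show ?thesis unfolding top by (rule top_greatest)
  qed
  moreover have "\<delta> = opt / (2 * sqrt 2 * \<alpha> * s)" using s by (simp add: \<delta>_def \<tau>_def c_def field_simps)
  ultimately show ?thesis by simp
qed

lemma Opt_le_RiskOpt:
  "ennreal (Opt A B M d R T f S Rs Q)
      \<le> ennreal (64 * sqrt ((2 * ln (real (\<Sum>l \<in> UNIV. f l)) + 10 * ln 2) * (2 * ln (real (\<Sum>k \<in> UNIV. d k)) + 10 * ln 2)))
          * RiskOpt A B Q N (basic_spectratope d R T)"
proof (cases "Opt A B M d R T f S Rs Q \<le> 0")
  case True
  \<comment> \<open>A nonpositive real is sent to 0 by \<open>ennreal\<close>.\<close>
  then show ?thesis by (simp add: ennreal_neg)
next
  case False
  define opt where "opt = Opt A B M d R T f S Rs Q"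
  have opt0: "0 < opt" using False by (simp add: opt_def)
  obtain X :: "'n + 'q \<Rightarrow> real ^ 'n" and Y :: "'n + 'q \<Rightarrow> real ^ 'q" and P :: "'m \<Rightarrow> real ^ 'm" and W :: "'m \<Rightarrow> real ^ 'q"
    and t r r'
  where t: "t \<in> T" "\<And>k v. (\<Sum>i\<in>UNIV. lin_sqnorm (d k) (R k) (X i) v) \<le> t $ k * (\<Sum>a<d k. (v a)\<^sup>2)"
    and r: "r \<in> Rs" "\<And>l v. (\<Sum>i\<in>UNIV. lin_sqnorm (f l) (S l) (Y i) v) \<le> r $ l * (\<Sum>a<f l. (v a)\<^sup>2)"
    and r': "r' \<in> Rs" "\<And>l v. (\<Sum>i\<in>UNIV. lin_sqnorm (f l) (S l) (W i) v) \<le> r' $ l * (\<Sum>a<f l. (v a)\<^sup>2)"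
    and C: "(\<chi> a b. \<Sum>i\<in>UNIV. P i $ a * P i $ b) \<in> Q"
    and obs: "\<And>b. (\<Sum>i\<in>UNIV. (M *v Y i) $ b *\<^sub>R (A *v X i)) = (\<Sum>i\<in>UNIV. (M *v W i) $ b *\<^sub>R P i)"
    and opt: "opt \<le> (\<Sum>i\<in>UNIV. (M *v Y i) \<bullet> (B *v X i))"
    unfolding opt_def by (rule dual_certificate[OF sdR N sdS ball Q, where A = A and B = B]) blast
  define D F where "D = real (\<Sum>k\<in>UNIV. d k)" and "F = real (\<Sum>l\<in>UNIV. f l)"
  have D1: "1 \<le> D"
    using sum_mono[of UNIV "\<lambda>_. 1" d] spectratope_dataD(1)[OF sdR] unfolding D_def
    by (metis One_nat_def Suc_leI card_gt_0_iff finite_class.finite_UNIV UNIV_not_empty card_eq_sum le_trans of_nat_1 of_nat_le_iff)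
  have F1: "1 \<le> F"
    using sum_mono[of UNIV "\<lambda>_. 1" f] spectratope_dataD(1)[OF sdS] unfolding F_def
    by (metis One_nat_def Suc_leI card_gt_0_iff finite_class.finite_UNIV UNIV_not_empty card_eq_sum le_trans of_nat_1 of_nat_le_iff)
  have l2: "2/3 \<le> ln (2::real)" by (rule ln2_ge_two_thirds)
  \<comment> \<open>Half of \<open>16 * ln 2\<close> contributes the factor 2^(-8), and the leading
    2 leaves 1/128 whatever the dimension \<open>x\<close>.\<close>
  have tail: "2 * x * exp (- (sqrt (2 * ln x + 16 * ln 2))\<^sup>2 / 2) = 1/128" if x: "1 \<le> x" for x :: real
  proof -
    have "- (sqrt (2 * ln x + 16 * ln 2))\<^sup>2 / 2 = - ln x - 8 * ln (2::real)" using x by simp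
    also have "exp \<dots> = inverse x * inverse (2 ^ 8)"
      using x exp_of_nat_mult[of 8 "ln (2::real)"] by (simp add: exp_diff exp_minus field_simps)
    finally have e: "exp (- (sqrt (2 * ln x + 16 * ln 2))\<^sup>2 / 2) = inverse x * inverse (2 ^ 8)" .
    show ?thesis unfolding e using x by simp
  qed
  define \<alpha> s where "\<alpha> = sqrt (2 * ln D + 16 * ln 2)" and "s = sqrt (2 * ln F + 16 * ln 2)"
  have "1 \<le> \<alpha>" "1 \<le> s" unfolding \<alpha>_def s_def using ln_ge_zero[OF D1] ln_ge_zero[OF F1] l2 by simp_all
  define K where "K = 64 * sqrt ((2 * ln F + 10 * ln 2) * (2 * ln D + 10 * ln 2))"
  define c where "c = opt / (2 * sqrt 2 * \<alpha> * s) * (21/256)"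
  have K0: "0 \<le> K" unfolding K_def using D1 F1 by simp
  have optc: "opt \<le> K * c"
  proof -
    have "\<alpha> * s = sqrt ((2 * ln F + 16 * ln 2) * (2 * ln D + 16 * ln 2))" by (simp add: \<alpha>_def s_def real_sqrt_mult mult.commute)
    \<comment> \<open>As 16 is 8/5 of 10 and the logarithms of the dimensions are nonnegative, each
      factor grows by at most 8/5.\<close>
    also have "\<dots> \<le> sqrt ((8/5 * (2 * ln F + 10 * ln 2)) * (8/5 * (2 * ln D + 10 * ln 2)))"
      using D1 F1 l2 by (intro real_sqrt_le_mono mult_mono) simp_all
    also have "\<dots> = sqrt ((8/5)\<^sup>2 * ((2 * ln F + 10 * ln 2) * (2 * ln D + 10 * ln 2)))" by (simp add: power2_eq_square algebra_simps)
    also have "\<dots> = 8/5 * (K / 64)" unfolding real_sqrt_mult K_def by simp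
    finally have as: "\<alpha> * s \<le> K / 40" by simp
    have s2: "sqrt 2 \<le> 3/2" by (rule real_le_lsqrt) (simp_all add: power2_eq_square)
    \<comment> \<open>Twice this bound is 3/40 of \<open>K\<close>, slightly less than the 21/256
      available; this is where the constant 64 suffices.\<close>
    have "sqrt 2 * (\<alpha> * s) \<le> 3/2 * (K / 40)" using as s2 K0 \<open>1 \<le> \<alpha>\<close> \<open>1 \<le> s\<close> by (intro mult_mono) simp_all
    then have "2 * sqrt 2 * \<alpha> * s \<le> K * (21/256)" using K0 by simp
    then have "opt * (2 * sqrt 2 * \<alpha> * s) \<le> opt * (K * (21/256))" using opt0 by (intro mult_left_mono) simp_all
    moreover have "0 < 2 * sqrt 2 * \<alpha> * s" using \<open>1 \<le> \<alpha>\<close> \<open>1 \<le> s\<close> by simp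
    ultimately show ?thesis unfolding c_def by (simp add: field_simps)
  qed
  have "ennreal c \<le> (SUP x \<in> basic_spectratope d R T. \<integral>\<^sup>+\<xi>. ennreal (N (B *v x - xhat (A *v x + \<xi>))) \<partial>gaussian (\<chi> a b. \<Sum>i\<in>UNIV. P i $ a * P i $ b))"
    if xhat: "xhat \<in> borel_measurable borel" for xhat
    unfolding c_def
  proof (rule gaussian_risk_lower_bound[OF t r r' _ obs opt0 opt xhat])
    show "pos_def (\<chi> a b. \<Sum>i\<in>UNIV. P i $ a * P i $ b)" using Q(4) C by blast
    show "1 \<le> \<alpha>" "0 < s" using \<open>1 \<le> \<alpha>\<close> \<open>1 \<le> s\<close> by simp_all
    show "2 * real (\<Sum>k\<in>UNIV. d k) * exp (- \<alpha>\<^sup>2 / 2) \<le> 1/128" using tail[OF D1] unfolding D_def[symmetric] \<alpha>_def by simp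
    show "2 * real (\<Sum>l\<in>UNIV. f l) * exp (- s\<^sup>2 / 2) \<le> 1/128" using tail[OF F1] unfolding F_def[symmetric] s_def by simp
  qed
  then have "ennreal c \<le> (INF xhat \<in> borel_measurable borel. SUP x \<in> basic_spectratope d R T.
      \<integral>\<^sup>+\<xi>. ennreal (N (B *v x - xhat (A *v x + \<xi>))) \<partial>gaussian (\<chi> a b. \<Sum>i\<in>UNIV. P i $ a * P i $ b))"
    by (rule INF_greatest)
  also have "\<dots> \<le> RiskOpt A B Q N (basic_spectratope d R T)"
    unfolding RiskOpt_def by (rule SUP_upper[OF C])
  finally have c: "ennreal c \<le> RiskOpt A B Q N (basic_spectratope d R T)" .
  have "ennreal opt \<le> ennreal (K * c)" by (rule ennreal_leI[OF optc])
  also have "\<dots> = ennreal K * ennreal c" using K0 by (rule ennreal_mult')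
  also have "\<dots> \<le> ennreal K * RiskOpt A B Q N (basic_spectratope d R T)" using c by (rule mult_left_mono) simp
  finally show ?thesis unfolding opt_def K_def D_def F_def .
qed

end

theorem proposition3p3:
  fixes A :: "real ^ 'n::finite ^ 'm::finite" and B :: "real ^ 'n ^ 'v::finite"
    and M :: "real ^ 'q::finite ^ 'v"
    and d :: "'k::finite \<Rightarrow> nat" and R :: "'k \<Rightarrow> 'n \<Rightarrow> real mat" and T :: "(real ^ 'k) set"
    and f :: "'l::finite \<Rightarrow> nat" and S :: "'l \<Rightarrow> 'q \<Rightarrow> real mat" and Rs :: "(real ^ 'l) set"
    and N :: "real ^ 'v \<Rightarrow> real" and Q :: "(real ^ 'm ^ 'm) set"
  assumes "spectratope_data d R T"
    and "is_norm N"
    and "spectratope_data f S Rs"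
    and "{z. conj_norm N z \<le> 1} = (\<lambda>y. M *v y) ` basic_spectratope f S Rs"
    and "Q \<noteq> {}" and "convex Q" and "compact Q" and "\<forall>C \<in> Q. pos_def C"
  shows "(\<exists>s. optimal A B M d R T f S Rs Q s) \<and>
    (\<forall>H \<Lambda> \<Upsilon> \<Upsilon>' \<Theta>. optimal A B M d R T f S Rs Q (H, \<Lambda>, \<Upsilon>, \<Upsilon>', \<Theta>) \<longrightarrow>
       Risk A B Q N (basic_spectratope d R T) (linear_estimate H)
         \<le> ennreal (Opt A B M d R T f S Rs Q)) \<and>
    ennreal (Opt A B M d R T f S Rs Q)
      \<le> ennreal (64 * sqrt ((2 * ln (real (\<Sum>l \<in> UNIV. f l)) + 10 * ln 2) *
                            (2 * ln (real (\<Sum>k \<in> UNIV. d k)) + 10 * ln 2)))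
          * RiskOpt A B Q N (basic_spectratope d R T)"
proof (intro conjI allI impI)
  note h = assms(1-4) and q = assms(5,7,8)
  show "\<exists>s. optimal A B M d R T f S Rs Q s" by (rule optimal_exists[OF h q])
  show "ennreal (Opt A B M d R T f S Rs Q)
      \<le> ennreal (64 * sqrt ((2 * ln (real (\<Sum>l \<in> UNIV. f l)) + 10 * ln 2) *
                            (2 * ln (real (\<Sum>k \<in> UNIV. d k)) + 10 * ln 2)))
          * RiskOpt A B Q N (basic_spectratope d R T)"
    by (rule Opt_le_RiskOpt[OF h assms(5-8)])
  fix H \<Lambda> \<Upsilon> \<Upsilon>' \<Theta>
  assume opt: "optimal A B M d R T f S Rs Q (H, \<Lambda>, \<Upsilon>, \<Upsilon>', \<Theta>)"
  show "Risk A B Q N (basic_spectratope d R T) (linear_estimate H) \<le> ennreal (Opt A B M d R T f S Rs Q)"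
    using risk_le_objective[OF h q optimal_objective(1)[OF h q opt]]
    unfolding optimal_objective(2)[OF h q opt] .
qed

end
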